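(* Let $p$ be a fixed prime and $\mathbb{F}=\mathbb{F}_p$. There is a constant $C$ depending only on $p$ such that the following holds. Let $A \subset \mathbb{F}^n \times \mathbb{F}^n$ have density $\alpha$, let $w = \mathrm{h}\mathrm{v}\mathrm{v}\mathrm{h}\mathrm{v}\mathrm{v}\mathrm{v}\mathrm{h}\mathrm{h}$ and let $\varepsilon = \exp(-C\log^{20}\alpha^{-1})$. Then there exists a bilinear variety $B \subset \phi^{\varepsilon}_w(A)$ of codimension $r \le C\log^{80}\alpha^{-1}$.
   Context: For a word $w\in\{\mathrm{h},\mathrm{v}\}^k$ and $A\subset \mathbb{F}^n\times\mathbb{F}^n$ define the representation count $N^w_A:\mathbb{F}^n\times\mathbb{F}^n\to\mathbb{Z}_{\ge 0}$ recursively: for the empty word $N_A = 1_A$; if $w = \mathrm{h}w'$ then $N^w_A(x,y) = \sum_{x_1\in\mathbb{F}^n} N^{w'}_A(x+x_1,y)N^{w'}_A(x_1,y)$; if $w = \mathrm{v}w'$ then $N^w_A(x,y) = \sum_{y_1\in\mathbb{F}^n} N^{w'}_A(x,y+y_1)N^{w'}_A(x,y_1)$. Thus $N^w_A(x,y)$ is the number of ways $(x,y)$ is obtained by the operation $\phi_w$ from $A$, and it is at most $|\mathbb{F}^n|^{2^k-1}$. Define $\phi^{\varepsilon}_w(A) = \{(x,y) : N^w_A(x,y) \ge \varepsilon |\mathbb{F}^n|^{2^k-1}\}$. (Here $\phi_w$ for a word $w=w_1\cdots w_k$ is $\phi_{w_1}\circ\cdots\circ\phi_{w_k}$ with $\phi_{\mathrm{h}}(A)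 = \{(x_1-x_2,y) : (x_1,y),(x_2,y)\in A\}$ and $\phi_{\mathrm{v}}(A) = \{(x,y_1-y_2) : (x,y_1),(x,y_2)\in A\}$.) A bilinear variety of codimension $r = r_1+r_2+r_3$ is a set $\{(x,y)\in V\times W : b_1(x,y)=\cdots=b_{r_3}(x,y)=0\}$ with $V,W\subset\mathbb{F}^n$ subspaces of codimension $r_1,r_2$ and $b_i$ bilinear forms on $\mathbb{F}^n\times\mathbb{F}^n$.
   Formalization: The quantity log(1/α) is replaced by max(ln 2, ln(1/α)) in both bounds, and α > 0 is assumed; with the bare logarithm the claim fails for α close to 1, e.g. when A is the whole space minus one point and n is large. *)

theory Defs
  imports
    Complex_Main
    "Berlekamp_Zassenhaus.Finite_Field"
    "Jordan_Normal_Form.VS_Connect"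
begin

text \<open>
  The prime field with \<open>p\<close> elements is \<^typ>\<open>'p::prime_card mod_ring\<close>, where \<open>p = CARD('p)\<close>, and
  its \<open>n\<close>-dimensional coordinate space is \<^term>\<open>carrier_vec n\<close>, so that a bound may be uniform
  in \<open>n\<close>. Subsets of the product of two such spaces are sets of pairs of vectors.
\<close>

type_synonym 'p fvec = "'p mod_ring vec"

definition density :: "nat \<Rightarrow> ('p::prime_card fvec \<times> 'p fvec) set \<Rightarrow> real" where
  "density n A = real (card A)
     / real (card ((carrier_vec n :: 'p fvec set) \<times> (carrier_vec n :: 'p fvec set)))"

text \<open>The letters \<open>Hor\<close> and \<open>Ver\<close> stand for \<open>h\<close> and \<open>v\<close>.\<close>

datatype letter = Hor | Ver

text \<open>The head of the word is the operation applied last.\<close>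

fun rep_count ::
  "nat \<Rightarrow> letter list \<Rightarrow> ('p::prime_card fvec \<times> 'p fvec) set \<Rightarrow> 'p fvec \<Rightarrow> 'p fvec \<Rightarrow> nat"
where
  "rep_count n [] A x y = (if (x, y) \<in> A then 1 else 0)"
| "rep_count n (Hor # w) A x y =
     (\<Sum>x1\<in>carrier_vec n. rep_count n w A (x + x1) y * rep_count n w A x1 y)"
| "rep_count n (Ver # w) A x y =
     (\<Sum>y1\<in>carrier_vec n. rep_count n w A x (y + y1) * rep_count n w A x y1)"

definition popular ::
  "nat \<Rightarrow> real \<Rightarrow> letter list \<Rightarrow> ('p::prime_card fvec \<times> 'p fvec) set \<Rightarrow> ('p fvec \<times> 'p fvec) set"
where
  "popular n \<epsilon> w A = {(x, y) \<in> carrier_vec n \<times> carrier_vec n.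
     real (rep_count n w A x y)
       \<ge> \<epsilon> * real (card (carrier_vec n :: 'p fvec set)) ^ (2 ^ length w - 1)}"

text \<open>
  The addition form \<open>dim V + r = n\<close> avoids truncated subtraction.
\<close>

definition subspace_of_codim :: "nat \<Rightarrow> 'p::prime_card fvec set \<Rightarrow> nat \<Rightarrow> bool" where
  "subspace_of_codim n V r \<longleftrightarrow>
     VectorSpace.subspace class_ring V (module_vec TYPE('p mod_ring) n) \<and>
     vectorspace.dim (class_ring :: 'p mod_ring ring)
       ((module_vec TYPE('p mod_ring) n)\<lparr>carrier := V\<rparr>) + r = n"

definition bilinear_form ::
  "nat \<Rightarrow> ('p::prime_card fvec \<Rightarrow> 'p fvec \<Rightarrow> 'p mod_ring) \<Rightarrow> bool"
where
  "bilinear_form n b \<longleftrightarrow>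
     (\<forall>x\<in>carrier_vec n. \<forall>x'\<in>carrier_vec n. \<forall>y\<in>carrier_vec n. b (x + x') y = b x y + b x' y) \<and>
     (\<forall>x\<in>carrier_vec n. \<forall>y\<in>carrier_vec n. \<forall>y'\<in>carrier_vec n. b x (y + y') = b x y + b x y') \<and>
     (\<forall>c. \<forall>x\<in>carrier_vec n. \<forall>y\<in>carrier_vec n. b (c \<cdot>\<^sub>v x) y = c * b x y) \<and>
     (\<forall>c. \<forall>x\<in>carrier_vec n. \<forall>y\<in>carrier_vec n. b x (c \<cdot>\<^sub>v y) = c * b x y)"

text \<open>
  The codimension belongs to a presentation of the set, so one set may be a bilinear variety of
  several codimensions.
\<close>

definition bilinear_variety ::
  "nat \<Rightarrow> nat \<Rightarrow> ('p::prime_card fvec \<times> 'p fvec) set \<Rightarrow> bool"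
where
  "bilinear_variety n r B \<longleftrightarrow>
     (\<exists>r1 r2 r3 V W b. r = r1 + r2 + r3 \<and>
        subspace_of_codim n V r1 \<and> subspace_of_codim n W r2 \<and>
        (\<forall>i<r3. bilinear_form n (b i)) \<and>
        B = {(x, y) \<in> V \<times> W. \<forall>i<r3. b i x y = 0})"

text \<open>
  The quantity \<open>log (1 / \<alpha>)\<close> in an asymptotic bound, with the usual convention that it is bounded
  away from \<open>0\<close>: it is exactly \<open>ln (1 / \<alpha>)\<close> for \<open>0 < \<alpha> \<le> 1 / 2\<close>, and \<open>ln 2\<close> for larger \<open>\<alpha>\<close>.
  With the bare logarithm a bound \<open>codimension \<le> C * log (1 / \<alpha>) ^ 80\<close> would force codimension \<open>0\<close>
  for \<open>\<alpha>\<close> close to \<open>1\<close>, which fails if one point is removed from the whole space and \<open>n\<close> is large.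
\<close>

definition log_inv :: "real \<Rightarrow> real" where
  "log_inv \<alpha> = max (ln 2) (ln (1 / \<alpha>))"

end

theory Submission
  imports
    Defs
    "HOL-Library.FuncSet"
    "HOL-Library.Product_Plus"
    "HOL-Library.Function_Algebras"
    "Berlekamp_Zassenhaus.Berlekamp_Type_Based"
begin

text \<open>
  For a dense set \<open>Y\<close> of second coordinates \<open>u\<close> the fibre of \<open>A\<close> over \<open>u\<close> is dense, and a robust
  Bogolyubov--Ruzsa lemma (Croot--Sisask almost periodicity followed by Chang's theorem) shows that
  two horizontal operations already represent, with high multiplicity, every point over \<open>u\<close> whose
  first coordinate annihilates a subspace \<open>U u\<close> of dimension \<open>O(log\<^sup>4)\<close>. After three vertical
  operations and a horizontal one, a point \<open>(x, z)\<close> is popular as soon as \<open>x\<close> annihilates an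
  intersection of two sums of eight such subspaces, taken over two \<open>8\<close>-tuples from \<open>Y\<close> with the
  same signed sum \<open>z\<close>.

  Choose greedily a maximal family of affine maps \<open>L\<^sub>i\<close> such that \<open>L\<^sub>i u \<in> U u\<close> for many \<open>u\<close> and the
  value is not already spanned by the earlier maps. The family is small because every \<open>U u\<close> is. For
  most signed zero-sum \<open>16\<close>-tuples from \<open>Y\<close> every linear relation between elements of the
  corresponding \<open>U u\<close> is then explained by the family: otherwise some selection of elements of the
  \<open>U u\<close> would have a graph with large additive energy, and the Balog--Szemeredi--Gowers theorem
  together with the Bogolyubov--Ruzsa lemma would produce a further affine map. Hence the
  intersection above lies in the span of the values \<open>l\<^sub>i z\<close> of the linear parts and a fixed subspace \<open>H\<close>.
  Here \<open>H\<close> is enlarged until every combination of the \<open>l\<^sub>i\<close> either takes all its values in \<open>H\<close> or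
  takes few of them there, so that different sums of combinations rarely agree modulo \<open>H\<close>.

  The \<open>z\<close> obtained this way form a dense set. Two more vertical operations and a horizontal one
  turn this set into a subspace \<open>W\<close> by the Bogolyubov--Ruzsa lemma, and the remaining conditions on
  \<open>(x, y)\<close> are \<open>y \<in> W\<close>, \<open>x \<bottom> H\<close> and the bilinear equations \<open>l\<^sub>i y \<cdot> x = 0\<close>.
\<close>


text \<open>The tension is between exponentially many affine maps and a codimension that must stay
  polynomial. Write \<open>L\<close> for \<open>log_inv \<alpha>\<close>. Each \<open>U u\<close>
  has at most \<open>2 ^ D\<close> elements, \<open>D\<close> of order \<open>L ^ 4\<close>, so
  fixing one selection from sixteen of them costs a factor of about \<open>(2 ^ D) ^ 16\<close>; the
  affine map extracted from it follows the selection only on a set of density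
  \<open>exp (- O(L ^ 16))\<close>. The greedy family may thus have \<open>exp (O(L ^ 16))\<close>
  members. Only \<open>D\<close> of them matter at a given point, and a pigeonhole over the index
  sets at sixteen points leaves at most \<open>16 * D\<close> maps. It costs a density factor
  \<open>\<theta>\<close> with \<open>log (1 / \<theta>)\<close> of order
  \<open>L ^ 16 * L ^ 4\<close>, which is the exponent \<open>20\<close>; the last use of
  Bogolyubov--Ruzsa, at density \<open>\<theta> / 4\<close>, raises this to the fourth power and
  gives \<open>80\<close>. Each block of vertical operations only accumulates conditions; the
  horizontal one after it replaces two sums of subspaces by their intersection, and a common element
  of two sums is a linear relation, which is what the maps control.\<close>

definition ech :: "'p::prime_card mod_ring \<Rightarrow> complex" where
  "ech a = cis (2 * pi * real_of_int (to_int_mod_ring a) / real CARD('p))"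

lemma norm_ech [simp]: "cmod (ech a) = 1"
  by (simp add: ech_def)

lemma ech_nonzero [simp]: "ech a \<noteq> 0"
  using norm_ech[of a] by force

lemma ech_0 [simp]: "ech 0 = 1"
  by (simp add: ech_def)

lemma cis_mod_period:
  fixes m :: int
  assumes "m > 0"
  shows "cis (2 * pi * real_of_int (a mod m) / real_of_int m) = cis (2 * pi * real_of_int a / real_of_int m)"
proof -
  have "real_of_int a = real_of_int (a div m) * real_of_int m + real_of_int (a mod m)"
    by (metis of_int_add of_int_mult div_mult_mod_eq)
  hence "2 * pi * real_of_int a / real_of_int m
    = 2 * pi * real_of_int (a mod m) / real_of_int m + 2 * pi * real_of_int (a div m)"
    using assms by (simp add: field_simps)
  thus ?thesis
    by (metis cis_mult cis_multiple_2pi Ints_of_int mult.right_neutral)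
qed

lemma ech_add: "ech (a + b) = ech a * ech (b :: 'p::prime_card mod_ring)"
proof -
  have "ech (a + b) = cis (2 * pi * real_of_int (to_int_mod_ring a + to_int_mod_ring b) / real CARD('p))"
    unfolding ech_def to_int_mod_ring_add
    using cis_mod_period[of "int CARD('p)" "to_int_mod_ring a + to_int_mod_ring b"] by simp
  also have "\<dots> = ech a * ech b"
    by (simp add: ech_def cis_mult add_divide_distrib distrib_left)
  finally show ?thesis .
qed

lemma ech_minus: "ech (- a) = cnj (ech a)"
proof -
  have "ech (- a) * ech a = 1"
    by (metis ech_0 ech_add add.left_inverse)
  moreover have "cnj (ech a) * ech a = 1"
    by (metis complex_norm_square mult.commute norm_ech of_real_1 power_one)
  ultimately show ?thesis
    by (metis ech_nonzero mult_right_cancel)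
qed

lemma ech_eq_1_iff: "ech (a :: 'p::prime_card mod_ring) = 1 \<longleftrightarrow> a = 0"
proof
  assume a: "ech a = 1"
  let ?t = "to_int_mod_ring a"
  have r: "0 \<le> ?t" "?t < int CARD('p)"
    using range_to_int_mod_ring[where 'a='p] by (metis atLeastLessThan_iff rangeI)+
  from a have "cos (2 * pi * real_of_int ?t / real CARD('p)) = 1"
    by (metis cis.simps(1) ech_def one_complex.simps(1))
  then obtain k :: int where "2 * pi * real_of_int ?t / real CARD('p) = real_of_int k * 2 * pi"
    using cos_one_2pi_int by auto
  hence "2 * pi * (real_of_int ?t / real CARD('p)) = 2 * pi * real_of_int k"
    by (simp add: mult.commute mult.left_commute)
  hence "real_of_int ?t / real CARD('p) = real_of_int k"
    by (metis mult_cancel_left mult_eq_0_iff pi_neq_zero zero_neq_numeral)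
  hence "real_of_int ?t = real_of_int (k * int CARD('p))"
    by (simp add: field_simps)
  hence k: "?t = k * int CARD('p)" by linarith
  have "k * int CARD('p) < 1 * int CARD('p)" using r k by simp
  hence "k < 1" by (rule mult_right_less_imp_less) simp
  moreover have "0 \<le> k"
    using r(1) k by (simp add: zero_le_mult_iff)
  ultimately have "k = 0" by simp
  thus "a = 0" using k by simp
qed simp

text \<open>The form \<open>pr\<close> plays two roles: it labels the characters of \<open>G\<close>
  by elements of \<open>G\<close>, and it later supplies the equations of the variety. Group and
  scalar laws hold on the whole ambient type; only nondegeneracy is tied to
  \<open>G\<close>.\<close>

locale fin_space = V: vector_space scale
  for scale :: "'p::prime_card mod_ring \<Rightarrow> 'v::ab_group_add \<Rightarrow> 'v" (infixr "*s" 75) +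
  fixes G :: "'v set" and pr :: "'v \<Rightarrow> 'v \<Rightarrow> 'p mod_ring"
  assumes finite_G: "finite G"
    and subspace_G: "V.subspace G"
    and pr_add_left: "pr (x + y) z = pr x z + pr y z"
    and pr_scale_left: "pr (c *s x) z = c * pr x z"
    and pr_commute: "pr x y = pr y x"
    and pr_nondeg: "x \<in> G \<Longrightarrow> (\<And>y. y \<in> G \<Longrightarrow> pr x y = 0) \<Longrightarrow> x = 0"
begin

section \<open>Character sums and annihilators\<close>

abbreviation "q \<equiv> real (card G)"

definition perp :: "'v set \<Rightarrow> 'v set" where
  "perp H = {x \<in> G. \<forall>h\<in>H. pr h x = 0}"

lemma pr_add_right: "pr z (x + y) = pr z x + pr z y"
  by (metis pr_add_left pr_commute)

lemma pr_scale_right: "pr z (c *s x) = c * pr z x"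
  by (metis pr_scale_left pr_commute)

lemma pr_zero_left [simp]: "pr 0 z = 0"
  by (metis add_cancel_right_right add_0 pr_add_left)

lemma pr_zero_right [simp]: "pr z 0 = 0"
  by (metis pr_commute pr_zero_left)

lemma pr_minus_left: "pr (- x) z = - pr x z"
  by (metis pr_add_left add.left_inverse eq_neg_iff_add_eq_0 pr_zero_left)

lemma pr_diff_left: "pr (x - y) z = pr x z - pr y z"
  by (metis diff_conv_add_uminus pr_add_left pr_minus_left)

lemma pr_diff_right: "pr z (x - y) = pr z x - pr z y"
  by (metis pr_commute pr_diff_left)

lemma pr_sum_left: "pr (sum f I) z = (\<Sum>i\<in>I. pr (f i) z)"
  by (induction I rule: infinite_finite_induct) (auto simp: pr_add_left)

lemma G_0 [simp]: "0 \<in> G"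
  using subspace_G V.subspace_0 by blast

lemma G_add [simp, intro]: "x \<in> G \<Longrightarrow> y \<in> G \<Longrightarrow> x + y \<in> G"
  using subspace_G V.subspace_add by blast

lemma G_diff [simp, intro]: "x \<in> G \<Longrightarrow> y \<in> G \<Longrightarrow> x - y \<in> G"
  using subspace_G V.subspace_diff by blast

lemma G_minus [simp, intro]: "x \<in> G \<Longrightarrow> - x \<in> G"
  using subspace_G V.subspace_neg by blast

lemma G_scale [simp, intro]: "x \<in> G \<Longrightarrow> c *s x \<in> G"
  using subspace_G V.subspace_scale by blast

lemma G_sum [intro]: "(\<And>i. i \<in> I \<Longrightarrow> f i \<in> G) \<Longrightarrow> sum f I \<in> G"
  using subspace_G V.subspace_sum by blast

lemma q_pos: "q > 0"
  using finite_G G_0 by (metis card_gt_0_iff empty_iff of_nat_0_less_iff)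

lemma sum_translate:
  assumes "V.subspace H" "t \<in> H"
  shows "(\<Sum>x\<in>H. f (x + t)) = (\<Sum>x\<in>H. f x)"
proof (rule sum.reindex_bij_witness[where i = "\<lambda>x. x - t" and j = "\<lambda>x. x + t"])
qed (use assms V.subspace_add V.subspace_diff in auto)

lemma sum_reflect:
  assumes "t \<in> G"
  shows "(\<Sum>x\<in>G. f (t - x)) = (\<Sum>x\<in>G. f x)"
proof (rule sum.reindex_bij_witness[where i = "\<lambda>x. t - x" and j = "\<lambda>x. t - x"])
qed (use assms in auto)

lemma card_translate: "card ((\<lambda>x. x + t) ` H) = card H"
  for H :: "'v set"
  by (simp add: card_image)

text \<open>Translation by a point where the character differs from 1 multiplies the sum by that
  value, so the sum must vanish.\<close>

lemma sum_char_subspace: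
  assumes H: "V.subspace H" and f: "finite H"
  shows "(\<Sum>x\<in>H. ech (pr s x)) = (if \<forall>x\<in>H. pr s x = 0 then of_nat (card H) else 0)"
proof (cases "\<forall>x\<in>H. pr s x = 0")
  case False
  then obtain t where t: "t \<in> H" "pr s t \<noteq> 0" by blast
  have "(\<Sum>x\<in>H. ech (pr s x)) = (\<Sum>x\<in>H. ech (pr s (x + t)))"
    by (rule sum_translate[OF H t(1), symmetric])
  also have "\<dots> = ech (pr s t) * (\<Sum>x\<in>H. ech (pr s x))"
    by (simp add: pr_add_right ech_add sum_distrib_left mult.commute)
  finally have "(ech (pr s t) - 1) * (\<Sum>x\<in>H. ech (pr s x)) = 0"
    by (simp add: algebra_simps)
  moreover have "ech (pr s t) \<noteq> 1" using t by (simp add: ech_eq_1_iff)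
  ultimately have "(\<Sum>x\<in>H. ech (pr s x)) = 0" by simp
  thus ?thesis using False by auto
qed simp

lemma sum_char_G:
  assumes "s \<in> G"
  shows "(\<Sum>x\<in>G. ech (pr s x)) = (if s = 0 then of_nat (card G) else 0)"
  using sum_char_subspace[OF subspace_G finite_G, of s] pr_nondeg[OF assms] by auto

lemma perp_subset: "perp H \<subseteq> G"
  by (auto simp: perp_def)

lemma finite_perp [simp]: "finite (perp H)"
  using finite_G perp_subset finite_subset by blast

lemma subspace_perp: "V.subspace (perp H)"
  by (rule V.subspaceI) (auto simp: perp_def pr_add_right pr_scale_right)

lemma perp_antimono: "H \<subseteq> K \<Longrightarrow> perp K \<subseteq> perp H"
  by (auto simp: perp_def)

lemma finite_sub: "H \<subseteq> G \<Longrightarrow> finite H"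
  using finite_G finite_subset by blast

text \<open>The double character sum over \<open>G\<close> and \<open>H\<close> is evaluated in both
  orders of summation; no dimensions are needed.\<close>

lemma card_perp:
  assumes H: "V.subspace H" and sub: "H \<subseteq> G"
  shows "card H * card (perp H) = card G"
proof -
  have fH: "finite H" using sub finite_sub by blast
  have "(\<Sum>x\<in>G. \<Sum>h\<in>H. ech (pr x h)) = (\<Sum>x\<in>G. if x \<in> perp H then of_nat (card H) else 0)"
    by (rule sum.cong[OF refl], subst sum_char_subspace[OF H fH])
       (auto simp: perp_def pr_commute)
  also have "\<dots> = of_nat (card H * card (perp H))"
    using perp_subset[of H] by (simp add: sum.If_cases[OF finite_G] Int_absorb1 mult.commute)
  finally have 1: "(\<Sum>x\<in>G. \<Sum>h\<in>H. ech (pr x h)) = (of_nat (card H * card (perp H)) :: complex)" .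
  have "(\<Sum>x\<in>G. \<Sum>h\<in>H. ech (pr x h)) = (\<Sum>h\<in>H. \<Sum>x\<in>G. ech (pr h x))"
    by (subst sum.swap) (simp add: pr_commute)
  also have "\<dots> = (\<Sum>h\<in>H. if h = 0 then of_nat (card G) else 0)"
    using sub by (intro sum.cong[OF refl] sum_char_G) auto
  also have "\<dots> = of_nat (card G)"
    using V.subspace_0[OF H] fH by simp
  finally show ?thesis using 1 by (metis of_nat_eq_iff)
qed

lemma perp_perp:
  assumes H: "V.subspace H" and sub: "H \<subseteq> G"
  shows "perp (perp H) = H"
proof -
  have "H \<subseteq> perp (perp H)"
    using sub by (auto simp: perp_def pr_commute)
  moreover have "card (perp (perp H)) = card H"
  proof -
    have "card (perp H) * card (perp (perp H)) = card (perp H) * card H"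
      using card_perp[OF H sub] card_perp[OF subspace_perp perp_subset] by (metis mult.commute)
    moreover have "card (perp H) > 0"
      using V.subspace_0[OF subspace_perp] by (metis card_gt_0_iff empty_iff finite_perp)
    ultimately show ?thesis by (metis mult_left_cancel less_irrefl)
  qed
  ultimately show ?thesis by (metis card_subset_eq finite_perp)
qed

text \<open>The annihilator of \<open>perp H + perp K\<close> lies in \<open>H \<inter> K\<close> by
  double duality; taking annihilators once more gives the decomposition.\<close>

lemma perp_Int_decompose:
  assumes H: "V.subspace H" "H \<subseteq> G" and K: "V.subspace K" "K \<subseteq> G"
    and x: "x \<in> perp (H \<inter> K)"
  obtains a b where "a \<in> perp H" "b \<in> perp K" "x = a + b"
proof -
  define D where "D = {a + b | a b. a \<in> perp H \<and> b \<in> perp K}"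
  have D: "V.subspace D"
    unfolding D_def using V.subspace_sums[OF subspace_perp subspace_perp] by simp
  have DG: "D \<subseteq> G" using perp_subset by (auto simp: D_def)
  have "perp H \<subseteq> D" "perp K \<subseteq> D"
    unfolding D_def using V.subspace_0[OF subspace_perp] by force+
  hence "perp D \<subseteq> perp (perp H) \<inter> perp (perp K)"
    using perp_antimono by blast
  hence "perp D \<subseteq> H \<inter> K" using perp_perp H K by simp
  hence "perp (H \<inter> K) \<subseteq> D"
    using perp_antimono[of "perp D" "H \<inter> K"] perp_perp[OF D DG] by simp
  thus ?thesis using x that by (auto simp: D_def)
qed

lemma card_sums_le:
  assumes "finite H" "finite K"
  shows "card {a + b | a b. a \<in> H \<and> b \<in> K} \<le> card H * card (K :: 'v set)"
proof -
  have "{a + b | a b. a \<in> H \<and> b \<in> K} = (\<lambda>(a, b). a + b) ` (H \<times> K)" by auto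
  thus ?thesis using card_image_le[of "H \<times> K" "\<lambda>(a, b). a + b"] assms
    by (simp add: card_cartesian_product)
qed

text \<open>A pair of orthogonality conditions imposed on \<open>x + x\<^sub>1\<close> and on \<open>x\<^sub>1\<close> is consistent
  precisely when \<open>x\<close> annihilates the common part of the two subspaces.\<close>

lemma card_hor_solutions:
  assumes H: "V.subspace H" "H \<subseteq> G" and K: "V.subspace K" "K \<subseteq> G"
    and x: "x \<in> perp (H \<inter> K)"
  shows "q \<le> real (card H) * real (card K) * real (card {x1 \<in> G. x + x1 \<in> perp H \<and> x1 \<in> perp K})"
proof -
  obtain a b where ab: "a \<in> perp H" "b \<in> perp K" "x = a + b"
    using perp_Int_decompose[OF H K x] by blast
  define D where "D = {a + b | a b. a \<in> H \<and> b \<in> K}"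
  have D: "V.subspace D" unfolding D_def using V.subspace_sums[OF H(1) K(1)] by simp
  have DG: "D \<subseteq> G" using H K by (auto simp: D_def)
  have HD: "H \<subseteq> D" "K \<subseteq> D" unfolding D_def using V.subspace_0 H(1) K(1) by force+
  \<comment> \<open>The point \<open>- b\<close> is one solution, and adding anything orthogonal to
    \<open>H + K\<close> gives another. The annihilator of \<open>H + K\<close> has at least
    \<open>q / (card H * card K)\<close> elements.\<close>
  have sub: "(\<lambda>y. y + (- b)) ` perp D \<subseteq> {x1 \<in> G. x + x1 \<in> perp H \<and> x1 \<in> perp K}"
  proof clarify
    fix y assume y: "y \<in> perp D"
    have yH: "y \<in> perp H" "y \<in> perp K" using y HD perp_antimono by blast+
    have "x + (y + - b) = a + y" using ab by simp
    thus "y + - b \<in> G \<and> x + (y + - b) \<in> perp H \<and> y + - b \<in> perp K"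
      using ab yH perp_subset V.subspace_add[OF subspace_perp] V.subspace_diff[OF subspace_perp]
      by (metis diff_conv_add_uminus subsetD)
  qed
  have "card (perp D) \<le> card {x1 \<in> G. x + x1 \<in> perp H \<and> x1 \<in> perp K}"
    using card_mono[OF _ sub] finite_G by (simp add: card_translate del: diff_conv_add_uminus[symmetric] add_uminus_conv_diff)
  moreover have "card D \<le> card H * card K"
    unfolding D_def using card_sums_le finite_sub H K by blast
  moreover have "card G = card D * card (perp D)" using card_perp[OF D DG] by simp
  ultimately have "card G \<le> (card H * card K) * card {x1 \<in> G. x + x1 \<in> perp H \<and> x1 \<in> perp K}"
    by (simp add: mult_le_mono)
  thus ?thesis by (metis of_nat_le_iff of_nat_mult)
qed

end

section \<open>Concentration of sample averages\<close>

lemma exp_le_quadratic: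
  fixes x :: real
  assumes "\<bar>x\<bar> \<le> 1" shows "exp x \<le> 1 + x + x\<^sup>2"
proof (cases "x \<ge> 0")
  case True
  thus ?thesis using exp_bound[of x] assms by simp
next
  case False
  have "1 - x \<le> exp (- x)" using exp_ge_add_one_self[of "- x"] by simp
  hence "exp x * (1 - x) \<le> exp x * exp (- x)" by (intro mult_left_mono) auto
  hence 1: "exp x * (1 - x) \<le> 1" by (simp add: exp_minus)
  have "(1 + x + x\<^sup>2) * (1 - x) = 1 - x ^ 3"
    by (simp add: algebra_simps power2_eq_square power3_eq_cube)
  moreover have "x ^ 3 \<le> 0" using False by (simp add: power_le_zero_eq)
  ultimately have "exp x * (1 - x) \<le> (1 + x + x\<^sup>2) * (1 - x)" using 1 by linarith
  thus ?thesis by (rule mult_right_le_imp_le) (use False in simp)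
qed

text \<open>Exponential moments: as \<open>Z\<close> has mean zero, one coordinate contributes at
  most \<open>exp (L ^ 2)\<close> on average, and over the full product set the coordinates are
  independent.\<close>

lemma hoeffding_one_sided:
  fixes Z :: "'a \<Rightarrow> real"
  assumes fA: "finite A" and Z: "\<And>a. a \<in> A \<Longrightarrow> \<bar>Z a\<bar> \<le> 1" and Z0: "(\<Sum>a\<in>A. Z a) = 0"
    and \<epsilon>: "0 < \<epsilon>" "\<epsilon> \<le> 1"
  shows "real (card {b \<in> {..<l} \<rightarrow>\<^sub>E A. (\<Sum>i<l. Z (b i)) > \<epsilon> * l}) \<le> exp (- \<epsilon>\<^sup>2 * l / 4) * real (card A) ^ l"
proof -
  let ?\<Omega> = "{..<l} \<rightarrow>\<^sub>E A"
  let ?B = "{b \<in> ?\<Omega>. (\<Sum>i<l. Z (b i)) > \<epsilon> * l}"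
  \<comment> \<open>This value minimises \<open>L ^ 2 - L * \<epsilon>\<close>, with minimum
    \<open>- \<epsilon> ^ 2 / 4\<close>.\<close>
  define L where "L = \<epsilon> / 2"
  have f\<Omega>: "finite ?\<Omega>" using fA by (simp add: finite_PiE)
  have "(\<Sum>a\<in>A. exp (L * Z a)) \<le> (\<Sum>a\<in>A. 1 + L * Z a + L\<^sup>2)"
  proof (rule sum_mono)
    fix a assume a: "a \<in> A"
    have le: "\<bar>L * Z a\<bar> \<le> L"
      using Z[OF a] \<epsilon> by (simp add: L_def abs_mult mult_left_le)
    hence "\<bar>L * Z a\<bar> \<le> 1" using \<epsilon> by (simp add: L_def)
    hence "exp (L * Z a) \<le> 1 + L * Z a + (L * Z a)\<^sup>2" by (rule exp_le_quadratic)
    moreover have "(L * Z a)\<^sup>2 \<le> L\<^sup>2"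
      using le by (metis abs_ge_zero power2_abs power_mono)
    ultimately show "exp (L * Z a) \<le> 1 + L * Z a + L\<^sup>2" by linarith
  qed
  also have "\<dots> = real (card A) * (1 + L\<^sup>2)"
    using Z0 by (simp add: sum.distrib sum_distrib_left[symmetric] algebra_simps)
  also have "\<dots> \<le> real (card A) * exp (L\<^sup>2)"
    by (intro mult_left_mono exp_ge_add_one_self) auto
  finally have one: "(\<Sum>a\<in>A. exp (L * Z a)) \<le> real (card A) * exp (L\<^sup>2)" .
  have "real (card ?B) * exp (L * (\<epsilon> * l)) = (\<Sum>b\<in>?B. exp (L * (\<epsilon> * l)))" by simp
  also have "\<dots> \<le> (\<Sum>b\<in>?B. exp (L * (\<Sum>i<l. Z (b i))))"
    using \<epsilon> by (intro sum_mono) (auto simp: L_def)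
  also have "\<dots> \<le> (\<Sum>b\<in>?\<Omega>. exp (L * (\<Sum>i<l. Z (b i))))"
    by (rule sum_mono2[OF f\<Omega>]) auto
  also have "\<dots> = (\<Sum>b\<in>?\<Omega>. \<Prod>i<l. exp (L * Z (b i)))"
    by (simp add: sum_distrib_left exp_sum)
  also have "\<dots> = (\<Prod>i<l. \<Sum>a\<in>A. exp (L * Z a))"
    using fA by (subst prod_sum_PiE) auto
  also have "\<dots> \<le> (real (card A) * exp (L\<^sup>2)) ^ l"
    using one by (simp add: power_mono sum_nonneg)
  also have "\<dots> = real (card A) ^ l * exp (L\<^sup>2 * l)"
    by (simp add: power_mult_distrib exp_of_nat_mult[symmetric] mult.commute)
  finally have "real (card ?B) * exp (L * (\<epsilon> * l)) * exp (- (L * (\<epsilon> * l)))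
      \<le> real (card A) ^ l * exp (L\<^sup>2 * l) * exp (- (L * (\<epsilon> * l)))"
    by (rule mult_right_mono) simp
  moreover have "exp (L * (\<epsilon> * l)) * exp (- (L * (\<epsilon> * l))) = 1" by (simp add: exp_minus)
  moreover have "exp (L\<^sup>2 * l) * exp (- (L * (\<epsilon> * l))) = exp (- \<epsilon>\<^sup>2 * l / 4)"
    by (subst exp_add[symmetric], rule arg_cong[where f=exp]) (simp add: L_def power2_eq_square field_simps)
  ultimately have "real (card ?B) \<le> real (card A) ^ l * exp (- \<epsilon>\<^sup>2 * l / 4)"
    by (simp only: mult.assoc mult_1_right)
  thus ?thesis by (simp only: mult.commute)
qed

lemma hoeffding_count:
  assumes fA: "finite A" and ne: "A \<noteq> {}" and \<epsilon>: "0 < \<epsilon>" "\<epsilon> \<le> 1"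
    and mu: "\<mu> = real (card {a \<in> A. P a}) / real (card A)"
  shows "real (card {b \<in> {..<l} \<rightarrow>\<^sub>E A. \<bar>real (card {i. i < l \<and> P (b i)}) / real l - \<mu>\<bar> > \<epsilon>})
    \<le> 2 * exp (- \<epsilon>\<^sup>2 * l / 4) * real (card A) ^ l"
proof -
  let ?\<Omega> = "{..<l} \<rightarrow>\<^sub>E A"
  define Z where "Z = (\<lambda>a. of_bool (P a) - \<mu>)"
  have cA: "real (card A) > 0" using fA ne by (simp add: card_gt_0_iff)
  have m: "0 \<le> \<mu>" "\<mu> \<le> 1"
    using cA fA unfolding mu by (auto simp: divide_le_eq_1 intro: card_mono)
  have Z1: "\<bar>Z a\<bar> \<le> 1" for a using m by (auto simp: Z_def)
  have "(\<Sum>a\<in>A. Z a) = real (card {a \<in> A. P a}) - real (card A) * \<mu>"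
    using fA by (simp add: Z_def sum_subtractf sum.If_cases Int_def of_bool_def)
  hence Z0: "(\<Sum>a\<in>A. Z a) = 0" using cA by (simp add: mu)
  have f\<Omega>: "finite ?\<Omega>" using fA by (simp add: finite_PiE)
  have sumZ: "(\<Sum>i<l. Z (b i)) = real (card {i. i < l \<and> P (b i)}) - l * \<mu>" for b
    by (simp add: Z_def sum_subtractf sum.If_cases Int_def of_bool_def)
  have "{b \<in> ?\<Omega>. \<bar>real (card {i. i < l \<and> P (b i)}) / real l - \<mu>\<bar> > \<epsilon>}
     \<subseteq> {b \<in> ?\<Omega>. (\<Sum>i<l. Z (b i)) > \<epsilon> * l} \<union> {b \<in> ?\<Omega>. (\<Sum>i<l. - Z (b i)) > \<epsilon> * l}" if "l > 0"
  proof clarify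
    fix b assume b: "b \<in> ?\<Omega>" "\<epsilon> < \<bar>real (card {i. i < l \<and> P (b i)}) / real l - \<mu>\<bar>"
      "\<not> \<epsilon> * l < (\<Sum>i<l. - Z (b i))"
    have "real (card {i. i < l \<and> P (b i)}) / real l - \<mu> = (\<Sum>i<l. Z (b i)) / l"
      using that by (simp add: sumZ field_simps)
    hence "\<epsilon> < \<bar>\<Sum>i<l. Z (b i)\<bar> / l" using b(2) that by (simp add: abs_divide)
    hence "\<epsilon> * l < \<bar>\<Sum>i<l. Z (b i)\<bar>" using that by (simp add: field_simps)
    thus "\<epsilon> * l < (\<Sum>i<l. Z (b i))" using b(3) by (simp add: sum_negf)
  qed
  hence "card {b \<in> ?\<Omega>. \<bar>real (card {i. i < l \<and> P (b i)}) / real l - \<mu>\<bar> > \<epsilon>}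
     \<le> card {b \<in> ?\<Omega>. (\<Sum>i<l. Z (b i)) > \<epsilon> * l} + card {b \<in> ?\<Omega>. (\<Sum>i<l. - Z (b i)) > \<epsilon> * l}"
    if "l > 0"
    using that by (intro order_trans[OF card_mono card_Un_le]) (auto intro: finite_subset[OF _ f\<Omega>])
  moreover have "real (card {b \<in> ?\<Omega>. (\<Sum>i<l. Z (b i)) > \<epsilon> * l}) \<le> exp (- \<epsilon>\<^sup>2 * l / 4) * real (card A) ^ l"
    by (rule hoeffding_one_sided[OF fA Z1 Z0 \<epsilon>])
  moreover have "real (card {b \<in> ?\<Omega>. (\<Sum>i<l. - Z (b i)) > \<epsilon> * l}) \<le> exp (- \<epsilon>\<^sup>2 * l / 4) * real (card A) ^ l"
    by (rule hoeffding_one_sided[OF fA _ _ \<epsilon>, where Z = "\<lambda>a. - Z a"]) (use Z1 Z0 in \<open>auto simp: sum_negf\<close>)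
  \<comment> \<open>Here the sample frequency is a division by zero, but there is only one tuple and
    the right-hand side is 2.\<close>
  moreover have ?thesis if "l = 0"
  proof -
    have "card {b \<in> ?\<Omega>. \<bar>real (card {i. i < l \<and> P (b i)}) / real l - \<mu>\<bar> > \<epsilon>} \<le> card ?\<Omega>"
      by (intro card_mono f\<Omega>) auto
    also have "card ?\<Omega> = 1" using that by simp
    finally show ?thesis using that by simp
  qed
  moreover have "real m \<le> 2 * c" if "m \<le> m1 + m2" "real m1 \<le> c" "real m2 \<le> c" for m m1 m2 :: nat and c
    using that by linarith
  ultimately show ?thesis by (metis (no_types, lifting) gr0I mult.assoc)
qed

context fin_space
begin

subsection \<open>Chang's theorem\<close>

definition hatS :: "'v set \<Rightarrow> 'v \<Rightarrow> complex" where
  "hatS X s = (\<Sum>x\<in>X. ech (pr s x))"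

text \<open>The unimodular factor that rotates \<open>hatS X s\<close> onto the positive real axis;
  it is 0 if that coefficient vanishes.\<close>

definition phase :: "'v set \<Rightarrow> 'v \<Rightarrow> complex" where
  "phase X s = cnj (hatS X s) / of_real (cmod (hatS X s))"

text \<open>The factor \<open>1 / 8\<close> keeps \<open>1 + bias\<close> positive and makes the
  quadratic error of its logarithm at most \<open>2 * (1 / 8) ^ 2 = 1 / 32\<close>.\<close>

definition bias :: "'v set \<Rightarrow> 'v \<Rightarrow> 'v \<Rightarrow> real" where
  "bias X s x = Re (phase X s * ech (pr s x)) / 8"

text \<open>A Riesz product, with factors between \<open>7 / 8\<close> and
  \<open>9 / 8\<close>.\<close>

definition riesz :: "'v set \<Rightarrow> 'v list \<Rightarrow> 'v \<Rightarrow> real" where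
  "riesz X ss x = prod_list (map (\<lambda>s. 1 + bias X s x) ss)"

text \<open>A list of large frequencies, each independent of those after it. Independence is given
  by a vector orthogonal to the tail because translation by that vector is what
  \<open>sum_riesz\<close> uses.\<close>

fun chain :: "'v set \<Rightarrow> 'v list \<Rightarrow> bool" where
  "chain X [] = True"
| "chain X (s # ss) = (s \<in> G \<and> real (card X) / 2 < cmod (hatS X s)
     \<and> (\<exists>h\<in>perp (set ss). pr s h \<noteq> 0) \<and> chain X ss)"

lemma abs_bias_le: "\<bar>bias X s x\<bar> \<le> 1 / 8"
proof -
  have "cmod (phase X s * ech (pr s x)) \<le> 1"
    by (simp add: phase_def norm_mult norm_divide)
  hence "\<bar>Re (phase X s * ech (pr s x))\<bar> \<le> 1"
    using abs_Re_le_cmod order_trans by blast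
  thus ?thesis by (simp add: bias_def)
qed

lemma sum_bias: "(\<Sum>x\<in>X. bias X s x) = cmod (hatS X s) / 8"
proof -
  have "(\<Sum>x\<in>X. bias X s x) = Re (phase X s * hatS X s) / 8"
    by (simp add: bias_def hatS_def sum_divide_distrib sum_distrib_left Re_sum)
  also have "phase X s * hatS X s = of_real (cmod (hatS X s))"
  proof (cases "hatS X s = 0")
    case False
    have "cnj (hatS X s) * hatS X s = (of_real (cmod (hatS X s)))\<^sup>2"
      using complex_norm_square[of "hatS X s"] by (simp only: mult.commute of_real_power)
    thus ?thesis using False by (simp add: phase_def power2_eq_square)
  qed simp
  finally show ?thesis by simp
qed

lemma riesz_translate:
  assumes "h \<in> perp (set ss)"
  shows "riesz X ss (x + h) = riesz X ss x"
proof -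
  have "bias X s (x + h) = bias X s x" if "s \<in> set ss" for s
    using assms that by (simp add: bias_def perp_def pr_add_right)
  thus ?thesis by (simp add: riesz_def cong: map_cong)
qed

lemma riesz_nonneg: "riesz X ss x \<ge> 0"
proof -
  have "1 + bias X s x \<ge> 0" for s using abs_bias_le[of X s x] by linarith
  thus ?thesis unfolding riesz_def by (induction ss) auto
qed

text \<open>Translating by the witness \<open>h\<close> fixes the product over the tail and
  multiplies the new character by a value other than 1, so the new factor adds nothing to the total
  mass.\<close>

lemma sum_riesz:
  assumes "chain X ss"
  shows "(\<Sum>x\<in>G. riesz X ss x) = q"
  using assms
proof (induction ss)
  case (Cons s ss)
  then obtain h where h: "h \<in> perp (set ss)" "pr s h \<noteq> 0" by auto
  have hG: "h \<in> G" using h perp_subset by blast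
  define T where "T = (\<Sum>x\<in>G. ech (pr s x) * of_real (riesz X ss x))"
  have "T = (\<Sum>x\<in>G. ech (pr s (x + h)) * of_real (riesz X ss (x + h)))"
    unfolding T_def by (rule sum_translate[OF subspace_G hG, symmetric])
  also have "\<dots> = ech (pr s h) * T"
    by (simp add: T_def sum_distrib_left riesz_translate[OF h(1)] pr_add_right ech_add mult_ac)
  finally have "(ech (pr s h) - 1) * T = 0" by (simp add: algebra_simps)
  hence T0: "T = 0" using h ech_eq_1_iff by auto
  have "(\<Sum>x\<in>G. bias X s x * riesz X ss x) = Re (phase X s * T) / 8"
  proof -
    have e: "Re (c * (d * of_real a)) = Re (c * d) * a" for c d a by (simp add: algebra_simps)
    have "(\<Sum>x\<in>G. bias X s x * riesz X ss x)
        = (\<Sum>x\<in>G. Re (phase X s * (ech (pr s x) * of_real (riesz X ss x))) / 8)"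
      by (simp add: bias_def e del: times_complex.sel)
    also have "\<dots> = Re (phase X s * T) / 8"
      by (simp only: T_def sum_distrib_left sum_divide_distrib Re_sum)
    finally show ?thesis .
  qed
  hence "(\<Sum>x\<in>G. bias X s x * riesz X ss x) = 0" using T0 by simp
  thus ?case using Cons by (simp add: riesz_def algebra_simps sum.distrib)
qed (simp add: riesz_def)

text \<open>Each factor obeys \<open>ln (1 + u) \<ge> u - 2 * u ^ 2\<close>, and
  \<open>2 * u ^ 2\<close> is at most \<open>1 / 32\<close> for the values of
  \<open>bias\<close>.\<close>

lemma exp_le_riesz: "exp (\<Sum>s\<leftarrow>ss. bias X s x - 1 / 32) \<le> riesz X ss x"
proof (induction ss)
  case (Cons s ss)
  let ?u = "bias X s x"
  have u: "\<bar>?u\<bar> \<le> 1 / 8" by (rule abs_bias_le)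
  have "\<bar>ln (1 + ?u) - ?u\<bar> \<le> 2 * ?u\<^sup>2"
    using u by (intro abs_ln_one_plus_x_minus_x_bound) auto
  moreover have "?u\<^sup>2 \<le> (1 / 8)\<^sup>2" using u by (metis abs_ge_zero power2_abs power_mono)
  ultimately have "?u - 1 / 32 \<le> ln (1 + ?u)" by (simp add: power2_eq_square)
  hence "exp (?u - 1 / 32) \<le> 1 + ?u"
    using u by (subst ln_ge_iff[symmetric]) auto
  hence "exp (?u - 1 / 32) * exp (\<Sum>s\<leftarrow>ss. bias X s x - 1 / 32) \<le> (1 + ?u) * riesz X ss x"
    using Cons u by (intro mult_mono) auto
  thus ?case by (simp add: riesz_def exp_add)
qed (simp add: riesz_def)

text \<open>A large coefficient contributes more than \<open>card X / 16\<close>, of which the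
  correction \<open>1 / 32\<close> takes away half.\<close>

lemma chain_sum_bias:
  assumes "chain X ss"
  shows "(\<Sum>x\<in>X. \<Sum>s\<leftarrow>ss. bias X s x - 1 / 32) \<ge> real (card X) * (real (length ss) / 32)"
  using assms
proof (induction ss)
  case (Cons s ss)
  have "(\<Sum>x\<in>X. bias X s x - 1 / 32) = cmod (hatS X s) / 8 - real (card X) / 32"
    by (simp add: sum_subtractf sum_bias)
  also have "\<dots> \<ge> real (card X) / 32" using Cons by simp
  finally have 1: "real (card X) / 32 \<le> (\<Sum>x\<in>X. bias X s x - 1 / 32)" .
  have "(\<Sum>x\<in>X. \<Sum>s\<leftarrow>s # ss. bias X s x - 1 / 32)
      = (\<Sum>x\<in>X. bias X s x - 1 / 32) + (\<Sum>x\<in>X. \<Sum>s\<leftarrow>ss. bias X s x - 1 / 32)"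
    by (simp only: list.map sum_list.Cons sum.distrib)
  moreover have "real (card X) * (real (length (s # ss)) / 32)
      = real (card X) / 32 + real (card X) * (real (length ss) / 32)"
    by (simp add: field_simps)
  ultimately show ?case using 1 Cons by simp
qed simp

text \<open>The Riesz product has total mass \<open>q\<close>. On \<open>X\<close> its logarithm
  averages at least \<open>length ss / 32\<close>, and the tangent line of the exponential at that
  value bounds the mass on \<open>X\<close> from below. Hence chains are only logarithmically long
  in the inverse density of \<open>X\<close>.\<close>

lemma chain_bound:
  assumes "chain X ss" "X \<subseteq> G"
  shows "real (card X) * exp (real (length ss) / 32) \<le> q"
proof -
  let ?m = "real (length ss) / 32" and ?L = "\<lambda>x. \<Sum>s\<leftarrow>ss. bias X s x - 1 / 32"
  have "real (card X) * exp ?m \<le> exp ?m * (\<Sum>x\<in>X. 1 + (?L x - ?m))"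
    using chain_sum_bias[OF assms(1)] by (simp add: sum.distrib sum_subtractf mult.commute)
  also have "\<dots> \<le> exp ?m * (\<Sum>x\<in>X. exp (?L x - ?m))"
    by (intro mult_left_mono sum_mono exp_ge_add_one_self) auto
  also have "\<dots> = (\<Sum>x\<in>X. exp (?L x))"
    by (simp add: sum_distrib_left exp_diff)
  also have "\<dots> \<le> (\<Sum>x\<in>X. riesz X ss x)" by (intro sum_mono exp_le_riesz)
  also have "\<dots> \<le> (\<Sum>x\<in>G. riesz X ss x)"
    by (intro sum_mono2 finite_G assms riesz_nonneg)
  finally show ?thesis using sum_riesz[OF assms(1)] by simp
qed

lemma card_span_le:
  assumes "finite S" shows "finite (V.span S) \<and> card (V.span S) \<le> CARD('p) ^ card S"
  using assms
proof (induction S rule: finite_induct)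
  case (insert a S)
  have eq: "V.span (insert a S) = (\<lambda>(c, y). y + c *s a) ` (UNIV \<times> V.span S)"
  proof (intro equalityI subsetI)
    fix x assume "x \<in> V.span (insert a S)"
    then obtain k where "x - k *s a \<in> V.span S" by (auto simp: V.span_insert)
    thus "x \<in> (\<lambda>(c, y). y + c *s a) ` (UNIV \<times> V.span S)"
      by (intro image_eqI[of _ _ "(k, x - k *s a)"]) auto
  next
    fix x assume "x \<in> (\<lambda>(c, y). y + c *s a) ` (UNIV \<times> V.span S)"
    then obtain c y where "y \<in> V.span S" "x = y + c *s a" by auto
    hence "x - c *s a \<in> V.span S" by simp
    thus "x \<in> V.span (insert a S)" unfolding V.span_insert by blast
  qed
  have "card (V.span (insert a S)) \<le> card (UNIV \<times> V.span S :: ('p mod_ring \<times> 'v) set)"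
    unfolding eq using insert by (intro card_image_le) auto
  also have "\<dots> = CARD('p) * card (V.span S)"
    by (simp add: card_cartesian_product)
  also have "\<dots> \<le> CARD('p) * CARD('p) ^ card S" using insert by simp
  finally show ?case using insert unfolding eq by (auto intro: finite_imageI finite_cartesian_product)
qed simp

lemma perp_span:
  assumes "S \<subseteq> G" shows "perp (V.span S) = perp S"
proof
  show "perp (V.span S) \<subseteq> perp S" by (rule perp_antimono[OF V.span_superset])
  show "perp S \<subseteq> perp (V.span S)"
  proof
    fix x assume x: "x \<in> perp S"
    have "pr h x = 0" if "h \<in> V.span S" for h
      using that
    proof (induction rule: V.span_induct_alt)
      case (step c s y)
      thus ?case using x by (simp add: pr_add_left pr_scale_left perp_def)
    qed simp
    thus "x \<in> perp (V.span S)" using x by (auto simp: perp_def)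
  qed
qed

lemma card_perp_finite:
  assumes "finite S" "S \<subseteq> G"
  shows "card G \<le> CARD('p) ^ card S * card (perp S)"
proof -
  have "V.span S \<subseteq> G" using assms subspace_G V.span_minimal by blast
  hence "card G = card (V.span S) * card (perp S)"
    using card_perp[of "V.span S"] perp_span assms by simp
  thus ?thesis using card_span_le[OF assms(1)] by simp
qed

text \<open>\<open>W\<close> is the annihilator of a longest chain: a large frequency not vanishing
  on \<open>W\<close> would extend the chain.\<close>

lemma chang:
  assumes X: "X \<subseteq> G" "X \<noteq> {}"
  obtains W r where "V.subspace W" "W \<subseteq> G" "card G \<le> CARD('p) ^ r * card W"
    "real (card X) * exp (real r / 32) \<le> q"
    "\<And>s w. s \<in> G \<Longrightarrow> real (card X) / 2 < cmod (hatS X s) \<Longrightarrow> w \<in> W \<Longrightarrow> pr s w = 0"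
proof -
  have cX: "real (card X) \<ge> 1" using X finite_sub by (simp add: Suc_leI card_gt_0_iff)
  define P where "P r = (\<exists>ss. chain X ss \<and> length ss = r)" for r
  have bound: "r \<le> nat \<lceil>32 * ln q\<rceil>" if Pr: "P r" for r
  proof -
    obtain ss where ss: "chain X ss" "length ss = r" using Pr by (auto simp: P_def)
    have "1 * exp (real r / 32) \<le> real (card X) * exp (real r / 32)"
      using cX by (intro mult_right_mono) auto
    also have "\<dots> \<le> q" using chain_bound[OF ss(1) X(1)] ss by simp
    finally have "real r / 32 \<le> ln q" using ln_ge_iff[OF q_pos, of "real r / 32"] by simp
    thus ?thesis by linarith
  qed
  have "P 0" by (auto simp: P_def)
  then obtain r where r: "P r" "\<And>r'. P r' \<Longrightarrow> r' \<le> r"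
    using GreatestI_nat[of P 0] Greatest_le_nat[of P] bound by blast
  then obtain ss where ss: "chain X ss" "length ss = r" by (auto simp: P_def)
  have ssG: "set ss \<subseteq> G" using ss(1) by (induction ss) auto
  have "card (set ss) \<le> r" using ss(2) card_length by blast
  hence "CARD('p) ^ card (set ss) \<le> CARD('p) ^ r" by (intro power_increasing) auto
  hence c: "card G \<le> CARD('p) ^ r * card (perp (set ss))"
    using card_perp_finite[OF _ ssG] by (meson List.finite_set le_trans mult_le_mono1)
  have "pr s w = 0" if "s \<in> G" "real (card X) / 2 < cmod (hatS X s)" "w \<in> perp (set ss)" for s w
  proof (rule ccontr)
    assume "pr s w \<noteq> 0"
    hence "chain X (s # ss)" using that ss by auto
    hence "P (Suc r)" using ss by (auto simp: P_def intro!: exI[of _ "s # ss"])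
    thus False using r(2) by fastforce
  qed
  thus ?thesis using that[OF subspace_perp perp_subset c] chain_bound[OF ss(1) X(1)] ss(2) by blast
qed

subsection \<open>Almost periodicity\<close>

text \<open>The convolution of the indicator of \<open>S\<close> with the uniform measure on
  \<open>- A\<close>.\<close>

definition dens_at :: "'v set \<Rightarrow> 'v set \<Rightarrow> 'v \<Rightarrow> real" where
  "dens_at A S x = real (card {a \<in> A. x + a \<in> S}) / real (card A)"

lemma dens_at_bounds:
  assumes "finite A" shows "0 \<le> dens_at A S x" "dens_at A S x \<le> 1"
  using assms by (auto simp: dens_at_def divide_le_eq_1 card_gt_0_iff intro!: card_mono)

text \<open>Croot--Sisask sampling. Most \<open>l\<close>-tuples from \<open>A\<close> approximate
  the density at almost all points. Some base tuple has many diagonal shifts that are such good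
  samples, and the difference of two of these shifts is an almost period, because shifting the
  sample amounts to shifting the point.\<close>

lemma almost_periods:
  assumes A: "A \<subseteq> G" and cA: "real (card A) \<ge> \<tau> * q" and \<tau>: "0 < \<tau>"
    and \<epsilon>: "0 < \<epsilon>" "\<epsilon> \<le> 1" and l: "2 * exp (- \<epsilon>\<^sup>2 * real l / 4) \<le> \<tau> * \<epsilon> / 2"
  obtains X where "X \<subseteq> G" "X \<noteq> {}" "real (card X) \<ge> \<tau> ^ l / 2 * q"
    "\<And>t. t \<in> X \<Longrightarrow> real (card {x \<in> G. \<bar>dens_at A S (x + t) - dens_at A S x\<bar> > 2 * \<epsilon>}) \<le> 2 * \<tau> * \<epsilon> * q"
proof -
  let ?f = "dens_at A S" and ?\<Omega> = "{..<l} \<rightarrow>\<^sub>E A" and ?\<Gamma> = "{..<l} \<rightarrow>\<^sub>E G"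
  define avg where "avg b x = real (card {i. i < l \<and> x + b i \<in> S}) / real l" for b :: "nat \<Rightarrow> 'v" and x
  define bad where "bad b = {x \<in> G. \<bar>avg b x - ?f x\<bar> > \<epsilon>}" for b
  define L where "L = {b \<in> ?\<Omega>. real (card (bad b)) \<le> \<tau> * \<epsilon> * q}"
  have fA: "finite A" using A finite_sub by blast
  have cA0: "real (card A) > 0" using cA \<tau> q_pos by (meson less_le_trans mult_pos_pos)
  hence neA: "A \<noteq> {}" by auto
  have f\<Omega>: "finite ?\<Omega>" "finite ?\<Gamma>" using fA finite_G by (simp_all add: finite_PiE)
  have c\<Omega>: "card ?\<Omega> = card A ^ l" "card ?\<Gamma> = card G ^ l" by (simp_all add: card_PiE)
  have fbad: "finite (bad b)" for b using finite_G by (simp add: bad_def)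
  \<comment> \<open>Pairs of a tuple and a point where it fails are counted twice: Hoeffding bounds
    them point by point, and Markov then leaves at least half of all tuples in
    \<open>L\<close>.\<close>
  have "(\<Sum>b\<in>?\<Omega>. real (card (bad b))) = (\<Sum>b\<in>?\<Omega>. \<Sum>x\<in>G. of_bool (\<bar>avg b x - ?f x\<bar> > \<epsilon>))"
    using finite_G by (simp add: bad_def sum.If_cases of_bool_def Int_def)
  also have "\<dots> = (\<Sum>x\<in>G. real (card {b \<in> ?\<Omega>. \<bar>avg b x - ?f x\<bar> > \<epsilon>}))"
    using f\<Omega> by (subst sum.swap) (simp add: sum.If_cases of_bool_def Int_def)
  also have "\<dots> \<le> (\<Sum>x\<in>G. 2 * exp (- \<epsilon>\<^sup>2 * l / 4) * real (card A) ^ l)"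
    unfolding avg_def dens_at_def by (intro sum_mono hoeffding_count fA neA \<epsilon> refl)
  also have "\<dots> = q * real (card A) ^ l * (2 * exp (- \<epsilon>\<^sup>2 * l / 4))" by simp
  also have "\<dots> \<le> q * real (card A) ^ l * (\<tau> * \<epsilon> / 2)"
    by (intro mult_left_mono l) auto
  also have "\<dots> = (real (card A) ^ l / 2) * (\<tau> * \<epsilon> * q)" by (simp add: field_simps)
  finally have tot: "(\<Sum>b\<in>?\<Omega>. real (card (bad b))) \<le> (real (card A) ^ l / 2) * (\<tau> * \<epsilon> * q)" .
  have "real (card (?\<Omega> - L)) * (\<tau> * \<epsilon> * q) = (\<Sum>b\<in>?\<Omega> - L. \<tau> * \<epsilon> * q)" by simp
  also have "\<dots> \<le> (\<Sum>b\<in>?\<Omega> - L. real (card (bad b)))"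
  proof (rule sum_mono)
    fix b assume "b \<in> ?\<Omega> - L"
    hence "\<not> real (card (bad b)) \<le> \<tau> * \<epsilon> * q" unfolding L_def by blast
    thus "\<tau> * \<epsilon> * q \<le> real (card (bad b))" by linarith
  qed
  also have "\<dots> \<le> (\<Sum>b\<in>?\<Omega>. real (card (bad b)))"
    by (intro sum_mono2 f\<Omega>) auto
  also note tot
  finally have "real (card (?\<Omega> - L)) \<le> real (card A) ^ l / 2"
    by (rule mult_right_le_imp_le) (use \<tau> \<epsilon> q_pos in simp)
  moreover have "real (card (?\<Omega> - L)) = real (card A) ^ l - real (card L)"
  proof -
    have LO: "L \<subseteq> ?\<Omega>" unfolding L_def by blast
    have "card (?\<Omega> - L) = card ?\<Omega> - card L"
      using LO f\<Omega>(1) by (meson card_Diff_subset finite_subset)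
    thus ?thesis using card_mono[OF f\<Omega>(1) LO] by (simp only: c\<Omega> of_nat_diff of_nat_power)
  qed
  ultimately have cL: "real (card L) \<ge> real (card A) ^ l / 2" by linarith
  have "real (card L) \<ge> (\<tau> * q) ^ l / 2"
    using power_mono[OF cA, of l] \<tau> q_pos cL by fastforce
  hence cL': "real (card L) \<ge> \<tau> ^ l / 2 * q ^ l" by (simp add: power_mult_distrib)
  define shift where "shift b t = (\<lambda>i\<in>{..<l}. b i + t)" for b :: "nat \<Rightarrow> 'v" and t
  have "?\<Omega> \<subseteq> ?\<Gamma>" using A by (intro PiE_mono) auto
  hence LG: "L \<subseteq> ?\<Gamma>" unfolding L_def by blast
  have bij: "(\<Sum>b\<in>?\<Gamma>. of_bool (shift b t \<in> L)) = real (card L)" if t: "t \<in> G" for t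
  proof -
    have "(\<Sum>b\<in>?\<Gamma>. of_bool (shift b t \<in> L)) = (\<Sum>b\<in>?\<Gamma>. of_bool (b \<in> L) :: real)"
    proof (rule sum.reindex_bij_witness[where i = "\<lambda>b. shift b (- t)" and j = "\<lambda>b. shift b t"])
      fix b assume b: "b \<in> ?\<Gamma>"
      show "shift (shift b t) (- t) = b" "shift (shift b (- t)) t = b"
        using b by (auto simp: shift_def PiE_iff extensional_def fun_eq_iff)
      show "shift b t \<in> ?\<Gamma>" "shift b (- t) \<in> ?\<Gamma>"
        using b t by (auto simp: shift_def PiE_iff simp del: add_uminus_conv_diff)
    qed simp
    also have "\<dots> = real (card (?\<Gamma> \<inter> L))" using f\<Omega> by (simp add: of_bool_def sum.If_cases Int_def)
    also have "?\<Gamma> \<inter> L = L" using LG by blast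
    finally show ?thesis .
  qed
  have "(\<Sum>b\<in>?\<Gamma>. real (card {t \<in> G. shift b t \<in> L})) = (\<Sum>b\<in>?\<Gamma>. \<Sum>t\<in>G. of_bool (shift b t \<in> L))"
    using finite_G by (simp add: of_bool_def sum.If_cases Int_def)
  also have "\<dots> = q * real (card L)"
    by (subst sum.swap) (simp add: bij)
  finally have tot2: "(\<Sum>b\<in>?\<Gamma>. real (card {t \<in> G. shift b t \<in> L})) = q * real (card L)" .
  \<comment> \<open>Each shift permutes \<open>?\<Gamma>\<close>, so an average base tuple has
    \<open>card L / q ^ (l - 1)\<close> good shifts. The base tuple ranges over \<open>G\<close> and
    not over \<open>A\<close>, which is why shifting is a bijection.\<close>
  have "\<exists>b\<in>?\<Gamma>. real (card {t \<in> G. shift b t \<in> L}) \<ge> \<tau> ^ l / 2 * q"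
  proof (rule ccontr)
    assume "\<not> ?thesis"
    hence lt: "\<And>b. b \<in> ?\<Gamma> \<Longrightarrow> real (card {t \<in> G. shift b t \<in> L}) < \<tau> ^ l / 2 * q" by force
    have "?\<Gamma> \<noteq> {}" using G_0 by (metis PiE_eq_empty_iff empty_iff)
    hence "(\<Sum>b\<in>?\<Gamma>. real (card {t \<in> G. shift b t \<in> L})) < (\<Sum>b\<in>?\<Gamma>. \<tau> ^ l / 2 * q)"
      using f\<Omega> lt by (intro sum_strict_mono) auto
    also have "\<dots> = q * (\<tau> ^ l / 2 * q ^ l)" by (simp add: c\<Omega>)
    also have "\<dots> \<le> q * real (card L)" using cL' by (intro mult_left_mono) auto
    finally show False using tot2 by simp
  qed
  then obtain b where b: "b \<in> ?\<Gamma>" "real (card {t \<in> G. shift b t \<in> L}) \<ge> \<tau> ^ l / 2 * q" by blast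
  define X0 where "X0 = {t \<in> G. shift b t \<in> L}"
  have "real (card X0) > 0"
    using b(2) \<tau> q_pos unfolding X0_def
    by (smt (verit) divide_pos_pos mult_pos_pos zero_less_power)
  then obtain t0 where t0: "t0 \<in> X0" by (metis card.empty equals0I less_irrefl of_nat_0)
  \<comment> \<open>Moving one good shift to the origin makes every element of \<open>X\<close> a
    difference of two good shifts.\<close>
  define X where "X = (\<lambda>t. t + (- t0)) ` X0"
  have "X \<subseteq> G" using t0 by (auto simp: X_def X0_def simp del: add_uminus_conv_diff)
  moreover have "X \<noteq> {}" using t0 by (auto simp: X_def)
  moreover have "real (card X) \<ge> \<tau> ^ l / 2 * q"
    using b(2) unfolding X_def X0_def by (simp add: card_translate del: add_uminus_conv_diff)
  moreover have "real (card {x \<in> G. \<bar>?f (x + t) - ?f x\<bar> > 2 * \<epsilon>}) \<le> 2 * \<tau> * \<epsilon> * q" if tX: "t \<in> X" for t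
  proof -
    obtain t1 where "t = t1 + - t0" and t1_X0: "t1 \<in> X0"
      using tX unfolding X_def by blast
    hence t1: "t1 \<in> X0" "t = t1 - t0" by simp_all
    have tG: "t \<in> G" using t1 t0 by (auto simp: X0_def)
    let ?b0 = "shift b t0" and ?b1 = "shift b t1"
    have L01: "?b0 \<in> L" "?b1 \<in> L" using t0 t1 by (auto simp: X0_def)
    \<comment> \<open>Sampling at \<open>x\<close> with the tuple shifted by \<open>t1\<close> is
      sampling at \<open>x + t\<close> with the one shifted by \<open>t0\<close>; both samples are
      accurate outside small sets.\<close>
    have "{i. i < l \<and> x + ?b1 i \<in> S} = {i. i < l \<and> (x + t) + ?b0 i \<in> S}" for x
      by (auto simp: shift_def t1(2) algebra_simps)
    hence avg: "avg ?b1 x = avg ?b0 (x + t)" for x by (simp add: avg_def)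
    have "{x \<in> G. \<bar>?f (x + t) - ?f x\<bar> > 2 * \<epsilon>} \<subseteq> bad ?b1 \<union> (\<lambda>y. y + (- t)) ` bad ?b0"
    proof
      fix x assume x: "x \<in> {x \<in> G. \<bar>?f (x + t) - ?f x\<bar> > 2 * \<epsilon>}"
      show "x \<in> bad ?b1 \<union> (\<lambda>y. y + (- t)) ` bad ?b0"
      proof (cases "x + t \<in> bad ?b0")
        case True
        thus ?thesis by (intro UnI2 image_eqI[of _ _ "x + t"]) auto
      next
        case False
        hence "\<bar>avg ?b0 (x + t) - ?f (x + t)\<bar> \<le> \<epsilon>" using x tG by (auto simp: bad_def)
        hence "\<bar>avg ?b1 x - ?f x\<bar> > \<epsilon>" using x unfolding avg by auto
        thus ?thesis using x by (auto simp: bad_def)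
      qed
    qed
    hence "card {x \<in> G. \<bar>?f (x + t) - ?f x\<bar> > 2 * \<epsilon>} \<le> card (bad ?b1 \<union> (\<lambda>y. y + (- t)) ` bad ?b0)"
      by (intro card_mono) (auto simp: fbad)
    also have "\<dots> \<le> card (bad ?b1) + card (bad ?b0)"
      by (rule order_trans[OF card_Un_le]) (simp add: card_translate del: add_uminus_conv_diff)
    finally have "real (card {x \<in> G. \<bar>?f (x + t) - ?f x\<bar> > 2 * \<epsilon>}) \<le> real (card (bad ?b1)) + real (card (bad ?b0))"
      by linarith
    moreover have "real (card (bad ?b1)) \<le> \<tau> * \<epsilon> * q" "real (card (bad ?b0)) \<le> \<tau> * \<epsilon> * q"
      using L01 by (auto simp: L_def)
    ultimately show ?thesis by linarith
  qed
  ultimately show ?thesis using that by blast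
qed

subsection \<open>Fourier analysis on the finite space\<close>

definition hat :: "('v \<Rightarrow> real) \<Rightarrow> 'v \<Rightarrow> complex" where
  "hat f s = (\<Sum>x\<in>G. of_real (f x) * ech (pr s x))"

lemma hat_inversion:
  assumes "x \<in> G"
  shows "(\<Sum>s\<in>G. hat f s * ech (- pr s x)) = of_real (q * f x)"
proof -
  have "(\<Sum>s\<in>G. hat f s * ech (- pr s x)) = (\<Sum>s\<in>G. \<Sum>y\<in>G. of_real (f y) * ech (pr (y - x) s))"
    by (simp add: hat_def sum_distrib_right mult.assoc ech_add[symmetric] pr_commute[of "_ - _"] pr_diff_right)
  also have "\<dots> = (\<Sum>y\<in>G. of_real (f y) * (\<Sum>s\<in>G. ech (pr (y - x) s)))"
    by (subst sum.swap) (simp add: sum_distrib_left)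
  also have "\<dots> = (\<Sum>y\<in>G. if y = x then of_real (q * f x) else 0)"
    using assms by (intro sum.cong[OF refl]) (auto simp: sum_char_G)
  also have "\<dots> = of_real (q * f x)" using assms finite_G by simp
  finally show ?thesis .
qed

lemma parseval_set:
  assumes "A \<subseteq> G"
  shows "(\<Sum>s\<in>G. (cmod (hatS A s))\<^sup>2) = q * real (card A)"
proof -
  have fA: "finite A" using assms finite_sub by blast
  have "complex_of_real (\<Sum>s\<in>G. (cmod (hatS A s))\<^sup>2) = (\<Sum>s\<in>G. hatS A s * cnj (hatS A s))"
    by (simp only: of_real_sum complex_norm_square)
  also have "\<dots> = (\<Sum>s\<in>G. \<Sum>a\<in>A. \<Sum>b\<in>A. ech (pr (a - b) s))"
    by (simp add: hatS_def sum_product ech_minus[symmetric] ech_add[symmetric] pr_commute[of "_ - _"] pr_diff_right)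
  also have "\<dots> = (\<Sum>a\<in>A. \<Sum>b\<in>A. \<Sum>s\<in>G. ech (pr (a - b) s))"
    by (subst sum.swap, rule sum.cong[OF refl], rule sum.swap)
  also have "\<dots> = (\<Sum>a\<in>A. \<Sum>b\<in>A. if b = a then of_real q else 0)"
  proof (intro sum.cong refl)
    fix a b assume "a \<in> A" "b \<in> A"
    hence "a - b \<in> G" using assms by blast
    thus "(\<Sum>s\<in>G. ech (pr (a - b) s)) = (if b = a then of_real q else 0)"
      by (simp add: sum_char_G)
  qed
  also have "\<dots> = of_real (q * real (card A))" using fA by simp
  finally show ?thesis by (metis of_real_eq_iff)
qed

end

lemma sum_of_bool_pairs:
  assumes "finite A"
  shows "(\<Sum>a\<in>A. \<Sum>a'\<in>A. of_bool (P a a')) = real (card {z \<in> A \<times> A. P (fst z) (snd z)})"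
proof -
  have "(\<Sum>a\<in>A. \<Sum>a'\<in>A. of_bool (P a a')) = (\<Sum>z\<in>A \<times> A. of_bool (P (fst z) (snd z)) :: real)"
    by (simp only: sum.cartesian_product case_prod_unfold)
  thus ?thesis using assms by (simp add: Int_def)
qed

context fin_space
begin

subsection \<open>The robust Bogolyubov--Ruzsa lemma\<close>

definition quads :: "'v set \<Rightarrow> 'v \<Rightarrow> ('v \<times> 'v \<times> 'v \<times> 'v) set" where
  "quads A w = {(a, b, c, d). a \<in> A \<and> b \<in> A \<and> c \<in> A \<and> d \<in> A \<and> a + b - c - d = w}"

lemma finite_quads: "finite A \<Longrightarrow> finite (quads A w)"
  by (rule finite_subset[of _ "A \<times> A \<times> A \<times> A"]) (auto simp: quads_def)

text \<open>\<open>S\<close> collects the popular sums of \<open>A\<close>, and \<open>g w\<close>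
  is the proportion of pairs from \<open>A\<close> whose sum stays in \<open>S\<close> after
  subtracting \<open>w\<close>. At 0 this is at least \<open>3 / 4\<close>. Averaging
  \<open>g\<close> repeatedly over almost periods hardly changes it but damps its Fourier
  coefficients outside the large spectrum of \<open>X\<close>, so it is nearly constant on the
  subspace that Chang's theorem provides. There half of all pairs differ by \<open>w\<close> from a
  popular sum, which gives the quadruples.\<close>

lemma bogolyubov_ruzsa:
  assumes A: "A \<subseteq> G" and cA: "real (card A) \<ge> \<tau> * q" and \<tau>: "0 < \<tau>"
    and k: "k \<ge> 1" "32 / \<tau> \<le> 2 ^ k"
    and \<epsilon>: "\<epsilon> = 1 / (64 * real k)" and l: "2 * exp (- \<epsilon>\<^sup>2 * real l / 4) \<le> \<tau> * \<epsilon> / 2"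
  obtains W r where "V.subspace W" "W \<subseteq> G" "card G \<le> CARD('p) ^ r * card W"
    "\<tau> ^ l / 2 * exp (real r / 32) \<le> 1"
    "\<And>w. w \<in> W \<Longrightarrow> real (card (quads A w)) \<ge> real (card A) ^ 4 / (8 * q)"
proof -
  have fA: "finite A" using A finite_sub by blast
  have AG: "a \<in> G" if "a \<in> A" for a using A that by blast
  have cA0: "real (card A) > 0" using cA \<tau> q_pos by (meson less_le_trans mult_pos_pos)
  have \<epsilon>01: "0 < \<epsilon>" "\<epsilon> \<le> 1" using k by (auto simp: \<epsilon>)
  define R where "R x = {(c, d). c \<in> A \<and> d \<in> A \<and> c + d = x}" for x
  have fR: "finite (R x)" for x
    by (rule finite_subset[of _ "A \<times> A"]) (auto simp: R_def fA)
  \<comment> \<open>With this threshold the at most \<open>q\<close> unpopular sums account for at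
    most a quarter of all pairs.\<close>
  define S where "S = {x \<in> G. real (card (R x)) \<ge> (real (card A))\<^sup>2 / (4 * q)}"
  define g where "g w = (\<Sum>a\<in>A. dens_at A S (a - w)) / real (card A)" for w
  have dens_sum: "dens_at A S x = (\<Sum>a'\<in>A. of_bool (x + a' \<in> S)) / real (card A)" for x
    using fA by (simp add: dens_at_def of_bool_def sum.If_cases Int_def)
  have g_alt: "g w = (\<Sum>a\<in>A. \<Sum>a'\<in>A. of_bool (a + a' - w \<in> S)) / (real (card A))\<^sup>2" for w
    by (simp add: g_def dens_sum sum_divide_distrib[symmetric] power2_eq_square algebra_simps)

  have g0: "g 0 \<ge> 3 / 4"
  proof -
    have "(\<Sum>a\<in>A. \<Sum>a'\<in>A. of_bool (a + a' \<notin> S)) = real (card {z \<in> A \<times> A. fst z + snd z \<notin> S})"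
      by (rule sum_of_bool_pairs[OF fA])
    also have "{z \<in> A \<times> A. fst z + snd z \<notin> S} = (\<Union>x\<in>G - S. R x)"
      by (auto simp: R_def AG)
    also have "real (card (\<Union>x\<in>G - S. R x)) \<le> (\<Sum>x\<in>G - S. real (card (R x)))"
      using card_UN_le[of "G - S" R] finite_G by (metis finite_Diff of_nat_le_iff of_nat_sum)
    also have "\<dots> \<le> (\<Sum>x\<in>G - S. (real (card A))\<^sup>2 / (4 * q))"
      by (intro sum_mono) (auto simp: S_def)
    also have "\<dots> \<le> (\<Sum>x\<in>G. (real (card A))\<^sup>2 / (4 * q))"
      by (intro sum_mono2 finite_G) auto
    also have "\<dots> = (real (card A))\<^sup>2 / 4" using q_pos by simp
    finally have b: "(\<Sum>a\<in>A. \<Sum>a'\<in>A. of_bool (a + a' \<notin> S)) \<le> (real (card A))\<^sup>2 / 4" .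
    have "(\<Sum>a\<in>A. \<Sum>a'\<in>A. of_bool (a + a' \<in> S))
       = (\<Sum>a\<in>A. \<Sum>a'\<in>A. 1 - of_bool (a + a' \<notin> S) :: real)"
      by (intro sum.cong refl) auto
    also have "\<dots> = (real (card A))\<^sup>2 - (\<Sum>a\<in>A. \<Sum>a'\<in>A. of_bool (a + a' \<notin> S))"
      by (simp add: sum_subtractf power2_eq_square)
    finally show ?thesis using b cA0 by (simp add: g_alt field_simps)
  qed

  obtain X where X: "X \<subseteq> G" "X \<noteq> {}" "real (card X) \<ge> \<tau> ^ l / 2 * q"
    "\<And>t. t \<in> X \<Longrightarrow> real (card {x \<in> G. \<bar>dens_at A S (x + t) - dens_at A S x\<bar> > 2 * \<epsilon>}) \<le> 2 * \<tau> * \<epsilon> * q"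
    using almost_periods[OF A cA \<tau> \<epsilon>01 l] by blast
  have fX: "finite X" using X finite_sub by blast
  have cX: "real (card X) > 0" using X fX by (simp add: card_gt_0_iff)
  have g_shift: "\<bar>g (w - t) - g w\<bar> \<le> 4 * \<epsilon>" if t: "t \<in> X" and w: "w \<in> G" for t w
  proof -
    let ?B = "{x \<in> G. \<bar>dens_at A S (x + t) - dens_at A S x\<bar> > 2 * \<epsilon>}"
    have "\<bar>\<Sum>a\<in>A. dens_at A S (a - (w - t)) - dens_at A S (a - w)\<bar>
       \<le> (\<Sum>a\<in>A. \<bar>dens_at A S (a - w + t) - dens_at A S (a - w)\<bar>)"
      by (rule order_trans[OF sum_abs]) (simp add: algebra_simps)
    also have "\<dots> \<le> (\<Sum>a\<in>A. 2 * \<epsilon> + of_bool (a - w \<in> ?B))"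
    proof (rule sum_mono)
      fix a assume a: "a \<in> A"
      show "\<bar>dens_at A S (a - w + t) - dens_at A S (a - w)\<bar> \<le> 2 * \<epsilon> + of_bool (a - w \<in> ?B)"
      proof (cases "a - w \<in> ?B")
        case True
        thus ?thesis
          using dens_at_bounds[OF fA, of S "a - w + t"] dens_at_bounds[OF fA, of S "a - w"] \<epsilon>01 by auto
      next
        case False
        moreover have "a - w \<in> G" using AG[OF a] w by blast
        ultimately show ?thesis by auto
      qed
    qed
    also have "\<dots> = 2 * \<epsilon> * card A + real (card {a \<in> A. a - w \<in> ?B})"
      using fA by (simp add: sum.distrib of_bool_def sum.If_cases Int_def)
    \<comment> \<open>The exceptional points number at most
      \<open>2 * \<tau> * \<epsilon> * q\<close>, hence at most
      \<open>2 * \<epsilon> * card A\<close>; the factor \<open>\<tau>\<close> in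
      \<open>almost_periods\<close> is there for this comparison. Each costs at most 1.\<close>
    also have "card {a \<in> A. a - w \<in> ?B} \<le> card ?B"
      by (rule card_inj_on_le[where f = "\<lambda>a. a - w"]) (auto simp: inj_on_def finite_G)
    hence "2 * \<epsilon> * card A + real (card {a \<in> A. a - w \<in> ?B}) \<le> 2 * \<epsilon> * card A + 2 * \<epsilon> * (\<tau> * q)"
      using X(4)[OF t] by (simp add: mult_ac)
    also have "\<dots> \<le> 2 * \<epsilon> * card A + 2 * \<epsilon> * card A"
      using cA \<epsilon>01 by (intro add_left_mono mult_left_mono) auto
    finally have "\<bar>\<Sum>a\<in>A. dens_at A S (a - (w - t)) - dens_at A S (a - w)\<bar> \<le> 4 * \<epsilon> * card A" by simp
    moreover have "g (w - t) - g w = (\<Sum>a\<in>A. dens_at A S (a - (w - t)) - dens_at A S (a - w)) / card A"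
      by (simp add: g_def sum_subtractf diff_divide_distrib)
    ultimately show ?thesis using cA0 by (simp add: abs_divide divide_le_eq)
  qed

  \<comment> \<open>\<open>gk j\<close> is \<open>g\<close> convolved \<open>j\<close> times with
    the uniform measure on \<open>X\<close>, so its transform gains the \<open>j\<close>-th power of
    the normalised transform of \<open>X\<close>.\<close>
  define gk where "gk = rec_nat g (\<lambda>_ f w. (\<Sum>t\<in>X. f (w - t)) / real (card X))"
  have gk0: "gk 0 = g" by (simp add: gk_def)
  have gkS: "gk (Suc j) w = (\<Sum>t\<in>X. gk j (w - t)) / real (card X)" for j w by (simp add: gk_def)
  have gk_close: "\<bar>gk j w - g w\<bar> \<le> 4 * real j * \<epsilon>" if "w \<in> G" for j w
    using that
  proof (induction j arbitrary: w)
    case (Suc j)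
    have "\<bar>\<Sum>t\<in>X. gk j (w - t) - g w\<bar> \<le> (\<Sum>t\<in>X. 4 * real (Suc j) * \<epsilon>)"
    proof (rule order_trans[OF sum_abs sum_mono])
      fix t assume t: "t \<in> X"
      have "w - t \<in> G" using t X(1) Suc.prems by blast
      hence "\<bar>gk j (w - t) - g (w - t)\<bar> \<le> 4 * real j * \<epsilon>" by (rule Suc.IH)
      thus "\<bar>gk j (w - t) - g w\<bar> \<le> 4 * real (Suc j) * \<epsilon>"
        using g_shift[OF t Suc.prems] by (simp add: algebra_simps)
    qed
    moreover have "gk (Suc j) w - g w = (\<Sum>t\<in>X. gk j (w - t) - g w) / card X"
      using cX by (simp add: gkS sum_subtractf field_simps)
    ultimately show ?case using cX by (simp add: abs_divide divide_le_eq mult_ac)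
  qed (simp add: gk0)

  have hat_gk: "hat (gk j) s = (hatS X s / card X) ^ j * hat g s" for j s
  proof (induction j)
    case (Suc j)
    have inner: "(\<Sum>w\<in>G. of_real (gk j (w - t)) * ech (pr s w)) = ech (pr s t) * hat (gk j) s"
      if "t \<in> X" for t
    proof -
      have "(\<Sum>w\<in>G. of_real (gk j (w - t)) * ech (pr s w))
         = (\<Sum>w\<in>G. of_real (gk j (w + t - t)) * ech (pr s (w + t)))"
        by (rule sum_translate[OF subspace_G, symmetric]) (use that X in auto)
      thus ?thesis by (simp add: hat_def sum_distrib_left pr_add_right ech_add mult_ac)
    qed
    have "hat (gk (Suc j)) s = (\<Sum>w\<in>G. \<Sum>t\<in>X. of_real (gk j (w - t)) * ech (pr s w)) / card X"
      by (simp add: hat_def gkS sum_divide_distrib sum_distrib_right)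
    also have "\<dots> = (\<Sum>t\<in>X. ech (pr s t) * hat (gk j) s) / card X"
      by (subst sum.swap) (simp add: inner)
    also have "\<dots> = hatS X s / card X * hat (gk j) s"
      by (simp add: hatS_def sum_distrib_right)
    finally show ?case using Suc by simp
  qed (simp add: gk0)

  have hat_g: "cmod (hat g s) \<le> (cmod (hatS A s))\<^sup>2 * q / (real (card A))\<^sup>2" if s: "s \<in> G" for s
  proof -
    let ?U = "\<Sum>y\<in>G. of_bool (y \<in> S) * ech (- pr s y)"
    have inner: "(\<Sum>w\<in>G. of_bool (a + a' - w \<in> S) * ech (pr s w)) = ech (pr s a) * ech (pr s a') * ?U"
      if "a \<in> A" "a' \<in> A" for a a'
    proof -
      have G: "a + a' \<in> G" using that AG by blast
      have "(\<Sum>w\<in>G. of_bool (a + a' - w \<in> S) * ech (pr s w))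
         = (\<Sum>w\<in>G. of_bool (a + a' - (a + a' - w) \<in> S) * ech (pr s (a + a' - w)))"
        by (rule sum_reflect[OF G, symmetric])
      also have "\<dots> = (\<Sum>w\<in>G. ech (pr s a) * ech (pr s a') * (of_bool (w \<in> S) * ech (- pr s w)))"
        by (intro sum.cong refl) (simp add: pr_diff_right pr_add_right ech_add[symmetric])
      finally show ?thesis by (simp add: sum_distrib_left)
    qed
    have "hat g s = (\<Sum>w\<in>G. \<Sum>a\<in>A. \<Sum>a'\<in>A. of_bool (a + a' - w \<in> S) * ech (pr s w)) / (card A)\<^sup>2"
      by (simp add: hat_def g_alt sum_divide_distrib sum_distrib_right of_bool_def if_distrib[of of_real] cong: if_cong)
    also have "(\<Sum>w\<in>G. \<Sum>a\<in>A. \<Sum>a'\<in>A. of_bool (a + a' - w \<in> S) * ech (pr s w))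
       = (\<Sum>a\<in>A. \<Sum>a'\<in>A. \<Sum>w\<in>G. of_bool (a + a' - w \<in> S) * ech (pr s w))"
      by (subst sum.swap, rule sum.cong[OF refl], rule sum.swap)
    also have "\<dots> = (\<Sum>a\<in>A. \<Sum>a'\<in>A. ech (pr s a) * ech (pr s a') * ?U)"
      by (simp add: inner)
    also have "\<dots> = hatS A s * hatS A s * ?U"
    proof -
      have "(\<Sum>a\<in>A. \<Sum>a'\<in>A. ech (pr s a) * ech (pr s a') * U) = hatS A s * hatS A s * U" for U
      proof -
        have "hatS A s * hatS A s = (\<Sum>a\<in>A. \<Sum>a'\<in>A. ech (pr s a) * ech (pr s a'))"
          by (simp only: hatS_def sum_product)
        thus ?thesis by (simp only: sum_distrib_right)
      qed
      thus ?thesis .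
    qed
    finally have e: "hat g s = hatS A s * hatS A s * ?U / (card A)\<^sup>2" .
    have "cmod ?U \<le> (\<Sum>y\<in>G. 1)"
      by (rule order_trans[OF norm_sum sum_mono]) (simp add: norm_mult of_bool_def)
    hence "cmod ?U \<le> q" by simp
    hence "(cmod (hatS A s))\<^sup>2 * cmod ?U / (real (card A))\<^sup>2 \<le> (cmod (hatS A s))\<^sup>2 * q / (real (card A))\<^sup>2"
      by (intro divide_right_mono mult_left_mono) auto
    thus ?thesis by (simp add: e norm_mult norm_divide power2_eq_square)
  qed

  obtain W r where W: "V.subspace W" "W \<subseteq> G" "card G \<le> CARD('p) ^ r * card W"
    "real (card X) * exp (real r / 32) \<le> q"
    and ann: "\<And>s w. s \<in> G \<Longrightarrow> real (card X) / 2 < cmod (hatS X s) \<Longrightarrow> w \<in> W \<Longrightarrow> pr s w = 0"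
    using chang[OF X(1,2)] by metis

  have gk_W: "\<bar>gk k w - gk k 0\<bar> \<le> 1 / 16" if w: "w \<in> W" for w
  proof -
    have wG: "w \<in> G" using w W by auto
    have "complex_of_real (q * (gk k w - gk k 0)) = (\<Sum>s\<in>G. hat (gk k) s * (ech (- pr s w) - 1))"
      using hat_inversion[OF wG, of "gk k"] hat_inversion[OF G_0, of "gk k"]
      by (simp add: right_diff_distrib sum_subtractf)
    hence "cmod (complex_of_real (q * (gk k w - gk k 0)))
        \<le> (\<Sum>s\<in>G. cmod (hat (gk k) s * (ech (- pr s w) - 1)))"
      using norm_sum by metis
    \<comment> \<open>On the large spectrum the character is 1 at \<open>w\<close> and the term
      vanishes. Elsewhere the \<open>k\<close> averages give \<open>(1 / 2) ^ k\<close>, and since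
      \<open>g\<close> contains \<open>A\<close> twice, its transform is bounded by a square that
      Parseval can sum.\<close>
    also have "\<dots> \<le> (\<Sum>s\<in>G. (1 / 2) ^ k * (2 * q / (real (card A))\<^sup>2) * (cmod (hatS A s))\<^sup>2)"
    proof (rule sum_mono)
      fix s assume s: "s \<in> G"
      show "cmod (hat (gk k) s * (ech (- pr s w) - 1)) \<le> (1 / 2) ^ k * (2 * q / (real (card A))\<^sup>2) * (cmod (hatS A s))\<^sup>2"
      proof (cases "real (card X) / 2 < cmod (hatS X s)")
        case True
        thus ?thesis using ann[OF s True w] by simp
      next
        case False
        have "cmod (ech (- pr s w) - 1) \<le> 2"
          by (rule order_trans[OF norm_triangle_ineq4]) simp
        moreover have "cmod (hat (gk k) s) \<le> (1 / 2) ^ k * ((cmod (hatS A s))\<^sup>2 * q / (real (card A))\<^sup>2)"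
          unfolding hat_gk norm_mult norm_power norm_divide
          using False cX by (intro mult_mono power_mono hat_g s) (auto simp: divide_le_eq)
        ultimately have "cmod (hat (gk k) s) * cmod (ech (- pr s w) - 1)
           \<le> ((1 / 2) ^ k * ((cmod (hatS A s))\<^sup>2 * q / (real (card A))\<^sup>2)) * 2"
          by (intro mult_mono) auto
        thus ?thesis by (simp add: norm_mult mult_ac)
      qed
    qed
    also have "\<dots> = (1 / 2) ^ k * (2 * q / (real (card A))\<^sup>2) * (q * real (card A))"
      by (simp only: sum_distrib_left[symmetric] parseval_set[OF A])
    also have "\<dots> = q * (2 * ((1 / 2) ^ k * (q / real (card A))))"
      using cA0 by (simp add: field_simps power2_eq_square)
    finally have "q * \<bar>gk k w - gk k 0\<bar> \<le> q * (2 * ((1 / 2) ^ k * (q / real (card A))))"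
      by (simp only: norm_of_real abs_mult abs_of_nat)
    hence "\<bar>gk k w - gk k 0\<bar> \<le> 2 * ((1 / 2) ^ k * (q / real (card A)))"
      using q_pos by (simp only: mult_le_cancel_left_pos)
    also have "\<dots> \<le> 2 * ((1 / 2) ^ k * (1 / \<tau>))"
      using cA \<tau> cA0 by (intro mult_left_mono) (auto simp: field_simps)
    also have "\<dots> \<le> 1 / 16" using k(2) \<tau> by (simp add: field_simps power_one_over)
    finally show ?thesis .
  qed

  \<comment> \<open>Error budget: smoothing costs \<open>4 * k * \<epsilon> = 1 / 16\<close> at each
    of \<open>w\<close> and 0, and the Fourier estimate another \<open>1 / 16\<close>;
    \<open>3 / 4 - 3 / 16\<close> still exceeds \<open>1 / 2\<close>.\<close>
  have gW: "g w \<ge> 1 / 2" if w: "w \<in> W" for w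
  proof -
    have "4 * real k * \<epsilon> = 1 / 16" using k by (simp add: \<epsilon>)
    moreover have "w \<in> G" using w W by auto
    ultimately have "\<bar>gk k w - g w\<bar> \<le> 1 / 16" "\<bar>gk k 0 - g 0\<bar> \<le> 1 / 16"
      using gk_close[of w k] gk_close[of 0 k] by auto
    thus ?thesis using g0 gk_W[OF w] by linarith
  qed

  have count: "real (card (quads A w)) \<ge> real (card A) ^ 4 / (8 * q)" if w: "w \<in> W" for w
  proof -
    let ?P = "{z \<in> A \<times> A. fst z + snd z - w \<in> S}"
    let ?D = "SIGMA z:?P. R (fst z + snd z - w)"
    have fP: "finite ?P" using fA by simp
    have "real (card ?P) = g w * (real (card A))\<^sup>2"
      using cA0 by (simp add: g_alt sum_of_bool_pairs[OF fA] del: sum_of_bool_eq)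
    hence cP: "real (card ?P) \<ge> (real (card A))\<^sup>2 / 2"
      using mult_right_mono[OF gW[OF w], of "(real (card A))\<^sup>2"] by simp
    have "(\<lambda>((a, b), (c, d)). (a, b, c, d)) ` ?D \<subseteq> quads A w"
      by (auto simp: R_def quads_def algebra_simps)
    moreover have "inj_on (\<lambda>((a, b), (c, d)). (a, b, c, d)) ?D" by (auto simp: inj_on_def)
    ultimately have "card ?D \<le> card (quads A w)"
      using card_inj_on_le finite_quads[OF fA] by blast
    moreover have "real (card ?D) = (\<Sum>z\<in>?P. real (card (R (fst z + snd z - w))))"
      using fP fR by simp
    moreover have "\<dots> \<ge> (\<Sum>z\<in>?P. (real (card A))\<^sup>2 / (4 * q))"
      by (intro sum_mono) (auto simp: S_def)
    moreover have "(\<Sum>z\<in>?P. (real (card A))\<^sup>2 / (4 * q)) = real (card ?P) * ((real (card A))\<^sup>2 / (4 * q))"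
      by simp
    moreover have "\<dots> \<ge> (real (card A))\<^sup>2 / 2 * ((real (card A))\<^sup>2 / (4 * q))"
      using cP by (intro mult_right_mono) auto
    moreover have "(real (card A))\<^sup>2 / 2 * ((real (card A))\<^sup>2 / (4 * q)) = real (card A) ^ 4 / (8 * q)"
      by (simp add: power4_eq_xxxx power2_eq_square)
    ultimately show ?thesis by linarith
  qed
  have "\<tau> ^ l / 2 * q * exp (real r / 32) \<le> q"
    using order_trans[OF mult_right_mono[OF X(3)] W(4)] by simp
  hence "q * (\<tau> ^ l / 2 * exp (real r / 32)) \<le> q * 1" by (simp add: mult_ac)
  hence "\<tau> ^ l / 2 * exp (real r / 32) \<le> 1" using q_pos by (simp only: mult_le_cancel_left_pos)
  thus ?thesis using that W(1,2,3) count by blast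
qed

end

subsection \<open>Sumsets\<close>

definition sumset :: "'a::ab_group_add set \<Rightarrow> 'a set \<Rightarrow> 'a set" where
  "sumset A B = (\<lambda>(a, b). a + b) ` (A \<times> B)"

definition diffset :: "'a::ab_group_add set \<Rightarrow> 'a set \<Rightarrow> 'a set" where
  "diffset A B = (\<lambda>(a, b). a - b) ` (A \<times> B)"

primrec nsum :: "nat \<Rightarrow> 'a::ab_group_add set \<Rightarrow> 'a set" where
  "nsum 0 B = {0}"
| "nsum (Suc n) B = sumset (nsum n B) B"

lemma sumsetI [intro]: "a \<in> A \<Longrightarrow> b \<in> B \<Longrightarrow> a + b \<in> sumset A B"
  by (auto simp: sumset_def)

lemma sumsetE: "x \<in> sumset A B \<Longrightarrow> (\<And>a b. a \<in> A \<Longrightarrow> b \<in> B \<Longrightarrow> x = a + b \<Longrightarrow> P) \<Longrightarrow> P"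
  by (auto simp: sumset_def)

lemma diffsetI [intro]: "a \<in> A \<Longrightarrow> b \<in> B \<Longrightarrow> a - b \<in> diffset A B"
  by (auto simp: diffset_def)

lemma diffsetE: "x \<in> diffset A B \<Longrightarrow> (\<And>a b. a \<in> A \<Longrightarrow> b \<in> B \<Longrightarrow> x = a - b \<Longrightarrow> P) \<Longrightarrow> P"
  by (auto simp: diffset_def)

lemma finite_sumset [simp]: "finite A \<Longrightarrow> finite B \<Longrightarrow> finite (sumset A B)"
  by (simp add: sumset_def)

lemma finite_diffset [simp]: "finite A \<Longrightarrow> finite B \<Longrightarrow> finite (diffset A B)"
  by (simp add: diffset_def)

lemma finite_nsum [simp]: "finite B \<Longrightarrow> finite (nsum n B)"
  by (induction n) auto

lemma sumset_0 [simp]: "sumset A {0} = A"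
  by (force simp: sumset_def)

lemma sumset_assoc: "sumset (sumset A B) C = sumset A (sumset B C)"
proof (intro equalityI subsetI)
  fix x assume "x \<in> sumset (sumset A B) C"
  then obtain a b c where "a \<in> A" "b \<in> B" "c \<in> C" "x = (a + b) + c" by (auto elim!: sumsetE)
  thus "x \<in> sumset A (sumset B C)" by (simp add: add.assoc sumsetI)
next
  fix x assume "x \<in> sumset A (sumset B C)"
  then obtain a b c where "a \<in> A" "b \<in> B" "c \<in> C" "x = a + (b + c)" by (auto elim!: sumsetE)
  thus "x \<in> sumset (sumset A B) C" by (simp add: add.assoc[symmetric] sumsetI)
qed

lemma sumset_commute: "sumset A B = sumset B A"
proof -
  have "sumset A B \<subseteq> sumset B A" for A B :: "'a set"
    by (metis (no_types, opaque_lifting) add.commute subsetI sumsetE sumsetI)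
  thus ?thesis by blast
qed

lemma nsum_mono: "A \<subseteq> B \<Longrightarrow> nsum n A \<subseteq> nsum n B"
  by (induction n) (auto simp: sumset_def)

lemma nsum_add: "u \<in> nsum m A \<Longrightarrow> v \<in> nsum n A \<Longrightarrow> u + v \<in> nsum (m + n) A"
proof (induction n arbitrary: v)
  case (Suc n)
  then obtain v' a where "v' \<in> nsum n A" "a \<in> A" "v = v' + a" by (auto elim: sumsetE)
  thus ?case using Suc by (auto simp: add.assoc[symmetric])
qed simp

lemma nsum_1: "a \<in> A \<Longrightarrow> a \<in> nsum (Suc 0) A"
  by (force simp: sumset_def)

text \<open>Induction on \<open>C\<close>. When \<open>c\<close> is added, the points of
  \<open>X\<close> whose translate by \<open>c\<close> already lies in \<open>X + C\<close> form a
  set \<open>X'\<close>; they contribute no new element on the right, and on the left all of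
  \<open>X' + B + c\<close> is old. The minimality of the ratio applied to \<open>X'\<close> shows
  that enough is saved.\<close>

lemma petridis:
  assumes X: "finite X" and B: "finite B" and C: "finite C" and K: "K \<ge> 0"
    and XB: "real (card (sumset X B)) = K * real (card X)"
    and min: "\<And>X'. X' \<subseteq> X \<Longrightarrow> K * real (card X') \<le> real (card (sumset X' B))"
  shows "real (card (sumset (sumset X B) C)) \<le> K * real (card (sumset X C))"
  using C
proof (induction C rule: finite_induct)
  case (insert c C)
  let ?T = "\<lambda>S. (\<lambda>x. x + c) ` S"
  define X' where "X' = {x \<in> X. x + c \<in> sumset X C}"
  have X'X: "X' \<subseteq> X" by (auto simp: X'_def)
  have fin: "finite X'" using X X'X finite_subset by blast
  have cT: "card (?T S) = card S" for S by (simp add: card_image)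
  have "sumset (sumset X B) (insert c C)
      \<subseteq> sumset (sumset X B) C \<union> (?T (sumset X B) - ?T (sumset X' B))"
  proof
    fix z assume "z \<in> sumset (sumset X B) (insert c C)"
    then obtain y d where y: "y \<in> sumset X B" "d \<in> insert c C" "z = y + d" by (rule sumsetE)
    show "z \<in> sumset (sumset X B) C \<union> (?T (sumset X B) - ?T (sumset X' B))"
    proof (cases "z \<in> ?T (sumset X' B)")
      case True
      then obtain x b where xb: "x \<in> X'" "b \<in> B" "z = x + b + c" by (auto elim: sumsetE)
      then obtain x1 c1 where "x1 \<in> X" "c1 \<in> C" "x + c = x1 + c1" by (auto simp: X'_def elim: sumsetE)
      hence "z = (x1 + b) + c1" using xb by (metis add.assoc add.commute)
      thus ?thesis using \<open>x1 \<in> X\<close> \<open>c1 \<in> C\<close> xb(2) by (intro UnI1) (simp add: sumsetI)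
    next
      case False
      thus ?thesis using y by auto
    qed
  qed
  hence "card (sumset (sumset X B) (insert c C))
      \<le> card (sumset (sumset X B) C) + card (?T (sumset X B) - ?T (sumset X' B))"
    using X B insert.hyps by (intro order_trans[OF card_mono card_Un_le]) auto
  also have "card (?T (sumset X B) - ?T (sumset X' B)) = card (sumset X B) - card (sumset X' B)"
    using X'X fin B by (subst card_Diff_subset) (auto simp: cT sumset_def)
  finally have "real (card (sumset (sumset X B) (insert c C)))
      \<le> real (card (sumset (sumset X B) C)) + (real (card (sumset X B)) - real (card (sumset X' B)))"
    using X'X X B card_mono[of "sumset X B" "sumset X' B"] by (fastforce simp: sumset_def of_nat_diff)
  also have "\<dots> \<le> K * real (card (sumset X C)) + (K * real (card X) - K * real (card X'))"
    using insert.IH XB min[OF X'X] by linarith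
  also have "\<dots> = K * (real (card (sumset X C)) + real (card (X - X')))"
    using X'X X fin by (simp add: card_Diff_subset of_nat_diff card_mono algebra_simps)
  also have "real (card (sumset X C)) + real (card (X - X')) = real (card (sumset X C \<union> ?T (X - X')))"
    using X insert.hyps by (subst card_Un_disjoint) (auto simp: X'_def cT)
  also have "sumset X C \<union> ?T (X - X') = sumset X (insert c C)"
    by (auto simp: X'_def sumset_def)
  finally show ?case .
qed (simp add: sumset_def)

text \<open>A nonempty subset with the smallest expansion ratio satisfies \<open>petridis\<close>,
  which is then iterated with \<open>C\<close> a multiple of \<open>B\<close>. One and the same
  \<open>X\<close> serves all \<open>n\<close>.\<close>

lemma plunnecke:
  assumes A: "finite A" "A \<noteq> {}" and B: "finite B"
    and K: "real (card (sumset A B)) \<le> K * real (card A)"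
  obtains X where "X \<subseteq> A" "X \<noteq> {}" "\<And>n. real (card (sumset X (nsum n B))) \<le> K ^ n * real (card X)"
proof -
  define r where "r X = real (card (sumset X B)) / real (card X)" for X
  have fin: "finite {X. X \<subseteq> A \<and> X \<noteq> {}}" using A by simp
  have ne: "{X. X \<subseteq> A \<and> X \<noteq> {}} \<noteq> {}" using A by auto
  obtain X where am: "is_arg_min r (\<lambda>S. S \<in> {X. X \<subseteq> A \<and> X \<noteq> {}}) X"
    using ex_is_arg_min_if_finite[OF fin ne, of r] by metis
  hence X: "X \<subseteq> A" "X \<noteq> {}" and min: "\<And>X'. X' \<subseteq> A \<Longrightarrow> X' \<noteq> {} \<Longrightarrow> r X \<le> r X'"
    by (simp_all add: is_arg_min_linorder)
  have fX: "finite X" using X A finite_subset by blast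
  have cX: "real (card X) > 0" using X fX by (simp add: card_gt_0_iff)
  have cA: "real (card A) > 0" using A by (simp add: card_gt_0_iff)
  have rK: "r X \<le> K"
  proof -
    have "r X \<le> r A" by (rule min[OF subset_refl A(2)])
    also have "r A \<le> K" using K cA by (simp add: r_def divide_le_eq)
    finally show ?thesis .
  qed
  have r0: "r X \<ge> 0" by (simp add: r_def)
  have step: "real (card (sumset (sumset X B) C)) \<le> r X * real (card (sumset X C))" if "finite C" for C
  proof (rule petridis[OF fX B that r0])
    show "real (card (sumset X B)) = r X * real (card X)" using cX by (simp add: r_def)
    fix X' assume X': "X' \<subseteq> X"
    show "r X * real (card X') \<le> real (card (sumset X' B))"
    proof (cases "X' = {}")
      case False
      have "real (card X') > 0" using X' fX False by (simp add: card_gt_0_iff finite_subset)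
      moreover have "r X \<le> r X'" using min X' X False by blast
      ultimately show ?thesis by (simp add: r_def[of X'] le_divide_eq)
    qed simp
  qed
  have "real (card (sumset X (nsum n B))) \<le> K ^ n * real (card X)" for n
  proof (induction n)
    case (Suc n)
    have "sumset X (nsum (Suc n) B) = sumset (sumset X B) (nsum n B)"
      by (simp add: sumset_assoc sumset_commute[of "nsum n B" B])
    hence "real (card (sumset X (nsum (Suc n) B))) \<le> r X * real (card (sumset X (nsum n B)))"
      using step[of "nsum n B"] B by simp
    also have "\<dots> \<le> K * (K ^ n * real (card X))"
      using Suc rK r0 by (intro mult_mono) auto
    finally show ?case by simp
  qed simp
  thus ?thesis using that X by blast
qed

text \<open>Fix one representation \<open>u - v\<close> of each difference. The pair
  \<open>(x + u, x + v)\<close> returns the difference by subtraction, hence the representation,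
  hence \<open>x\<close>.\<close>

lemma ruzsa_triangle:
  assumes X: "finite X" and U: "finite U" and V: "finite V"
  shows "card X * card (diffset U V) \<le> card (sumset X U) * card (sumset X V)"
proof -
  define f where "f d = (SOME uv. uv \<in> U \<times> V \<and> d = fst uv - snd uv)" for d
  have f: "f d \<in> U \<times> V \<and> d = fst (f d) - snd (f d)" if d: "d \<in> diffset U V" for d
  proof -
    obtain u v where "u \<in> U" "v \<in> V" "d = u - v" using d by (rule diffsetE)
    hence "\<exists>uv. uv \<in> U \<times> V \<and> d = fst uv - snd uv" by (intro exI[of _ "(u, v)"]) auto
    thus ?thesis unfolding f_def by (rule someI_ex)
  qed
  have "card (X \<times> diffset U V) \<le> card (sumset X U \<times> sumset X V)"
  proof (rule card_inj_on_le[where f = "\<lambda>(x, d). (x + fst (f d), x + snd (f d))"])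
    show "inj_on (\<lambda>(x, d). (x + fst (f d), x + snd (f d))) (X \<times> diffset U V)"
    proof (rule inj_onI, clarsimp)
      fix x d x' d' assume d: "d \<in> diffset U V" "d' \<in> diffset U V"
        and e: "x + fst (f d) = x' + fst (f d')" "x + snd (f d) = x' + snd (f d')"
      have "d = (x + fst (f d)) - (x + snd (f d))" using f[OF d(1)] by simp
      also have "\<dots> = d'" using f[OF d(2)] e by simp
      finally show "x = x' \<and> d = d'" using e by auto
    qed
    show "(\<lambda>(x, d). (x + fst (f d), x + snd (f d))) ` (X \<times> diffset U V) \<subseteq> sumset X U \<times> sumset X V"
      using f by (fastforce simp: mem_Times_iff)
  qed (use X U V in auto)
  thus ?thesis by (simp add: card_cartesian_product)
qed

lemma nsum_uminus: "nsum n (uminus ` A) = uminus ` nsum n A"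
proof (induction n)
  case (Suc n)
  show ?case
    unfolding nsum.simps Suc by (force simp: sumset_def image_iff)
qed simp

text \<open>Pluennecke--Ruzsa. Since the hypothesis concerns differences, \<open>plunnecke\<close>
  is applied with \<open>- A\<close> as second summand, and the triangle inequality combines two
  multiples of \<open>- A\<close>.\<close>

lemma card_nsum_diff:
  assumes A: "finite A" "A \<noteq> {}" and K: "real (card (diffset A A)) \<le> K * real (card A)"
  shows "real (card (diffset (nsum m A) (nsum n A))) \<le> K ^ (m + n) * real (card A)"
proof -
  have "sumset A (uminus ` A) = diffset A A"
    by (force simp: sumset_def diffset_def image_iff)
  then obtain X where X: "X \<subseteq> A" "X \<noteq> {}"
    and Xn: "\<And>n. real (card (sumset X (nsum n (uminus ` A)))) \<le> K ^ n * real (card X)"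
    using plunnecke[of A "uminus ` A" K] A K by auto
  have fX: "finite X" using X A finite_subset by blast
  have cX: "real (card X) > 0" using X fX by (simp add: card_gt_0_iff)
  have "diffset (nsum n (uminus ` A)) (nsum m (uminus ` A)) = diffset (nsum m A) (nsum n A)"
    unfolding nsum_uminus by (force simp: diffset_def image_iff)
  hence "real (card X) * real (card (diffset (nsum m A) (nsum n A)))
      \<le> real (card (sumset X (nsum n (uminus ` A)))) * real (card (sumset X (nsum m (uminus ` A))))"
    using ruzsa_triangle[OF fX, of "nsum n (uminus ` A)" "nsum m (uminus ` A)"] A
    by (simp flip: of_nat_mult)
  also have "\<dots> \<le> (K ^ n * real (card X)) * (K ^ m * real (card X))"
    by (intro mult_mono Xn order_trans[OF _ Xn]) auto
  also have "\<dots> = real (card X) * (K ^ (m + n) * real (card X))" by (simp add: power_add)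
  finally have "real (card (diffset (nsum m A) (nsum n A))) \<le> K ^ (m + n) * real (card X)"
    using cX by (simp only: mult_le_cancel_left_pos)
  moreover have "K ^ (m + n) \<ge> 0"
    using K A by (smt (verit) card_gt_0_iff mult_neg_pos of_nat_0_less_iff of_nat_less_0_iff zero_le_power)
  moreover have "card X \<le> card A" using X A card_mono by blast
  ultimately show ?thesis by (meson mult_left_mono of_nat_le_iff order_trans)
qed

lemma card_Sigma_ge:
  fixes m n :: real
  assumes "finite A" "\<And>a. a \<in> A \<Longrightarrow> finite (B a)" "n \<le> real (card A)" "0 \<le> m"
    and "\<And>a. a \<in> A \<Longrightarrow> m \<le> real (card (B a))"
  shows "n * m \<le> real (card (Sigma A B))"
proof -
  have "n * m \<le> real (card A) * m" using assms by (intro mult_right_mono) auto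
  also have "\<dots> = (\<Sum>a\<in>A. m)" by simp
  also have "\<dots> \<le> (\<Sum>a\<in>A. real (card (B a)))" using assms by (intro sum_mono) auto
  also have "\<dots> = real (card (Sigma A B))" using assms by simp
  finally show ?thesis .
qed

subsection \<open>The Balog--Szemeredi--Gowers theorem\<close>

definition diff_reps :: "'a::ab_group_add set \<Rightarrow> 'a \<Rightarrow> ('a \<times> 'a) set" where
  "diff_reps A d = {z \<in> A \<times> A. fst z - snd z = d}"

lemma finite_diff_reps [simp]: "finite A \<Longrightarrow> finite (diff_reps A d)"
  by (simp add: diff_reps_def)

text \<open>Four differences with alternating signs: the shape in which the edges of a path of
  length four telescope to the difference of its end points.\<close>

definition alt_reps :: "'a::ab_group_add set \<Rightarrow> 'a \<Rightarrow> (('a \<times> 'a) \<times> ('a \<times> 'a) \<times> ('a \<times> 'a) \<times> ('a \<times> 'a)) set" where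
  "alt_reps A d = {(z1, z2, z3, z4). z1 \<in> A \<times> A \<and> z2 \<in> A \<times> A \<and> z3 \<in> A \<times> A \<and> z4 \<in> A \<times> A
     \<and> (fst z1 - snd z1) - (fst z2 - snd z2) + (fst z3 - snd z3) - (fst z4 - snd z4) = d}"

lemma card_le_of_alt_reps:
  fixes M :: real
  assumes A: "finite A" and D: "finite D" and M: "\<And>d. d \<in> D \<Longrightarrow> M \<le> real (card (alt_reps A d))"
  shows "real (card D) * M \<le> real (card A) ^ 8"
proof -
  let ?P = "(A \<times> A) \<times> (A \<times> A) \<times> (A \<times> A) \<times> (A \<times> A)"
  have fin: "finite ?P" using A by simp
  have sub: "alt_reps A d \<subseteq> ?P" for d by (auto simp: alt_reps_def)
  have fa: "finite (alt_reps A d)" for d using sub fin finite_subset by blast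
  have "real (card D) * M = (\<Sum>d\<in>D. M)" by simp
  also have "\<dots> \<le> (\<Sum>d\<in>D. real (card (alt_reps A d)))" using M by (intro sum_mono) auto
  also have "\<dots> = real (card (\<Union>d\<in>D. alt_reps A d))"
    by (subst card_UN_disjoint) (use D fa in \<open>auto simp: alt_reps_def\<close>)
  also have "\<dots> \<le> real (card ?P)" using sub fin by (intro of_nat_mono card_mono) auto
  also have "\<dots> = real (card A) ^ 8" by (simp add: card_cartesian_product eval_nat_numeral)
  finally show ?thesis .
qed

text \<open>Join two elements when their difference is popular. Some neighbourhood is large and has
  few pairs with few common neighbours. Keep the vertices that form a bad pair with at most a
  quarter of it: any two of them are joined by many paths of length four, so their difference has
  many alternating representations, and there is room for few such differences.\<close>

lemma balog_szemeredi_gowers: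
  fixes A :: "'a::ab_group_add set" and N c :: real
  assumes A: "finite A" and AN: "real (card A) \<le> N" and N: "N > 0" and c: "c > 0"
    and pop: "c * N\<^sup>2 \<le> real (card {z \<in> A \<times> A. c * N \<le> real (card (diff_reps A (fst z - snd z)))})"
  obtains A' where "A' \<subseteq> A" "c * N / 4 \<le> real (card A')"
    "real (card (diffset A' A')) * (c ^ 9 / 4096) \<le> N"
proof -
  define E where "E = {z \<in> A \<times> A. c * N \<le> real (card (diff_reps A (fst z - snd z)))}"
  have fE: "finite E" using A by (simp add: E_def)
  have Esub: "E \<subseteq> A \<times> A" by (auto simp: E_def)
  define nb where "nb v = {a \<in> A. (a, v) \<in> E}" for v
  define co where "co a b = {v \<in> A. (a, v) \<in> E \<and> (b, v) \<in> E}" for a b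
  \<comment> \<open>Chosen so that sixteen times the expected number of bad pairs takes only half of
    the second moment of the degrees.\<close>
  define \<gamma> where "\<gamma> = c\<^sup>2 / 32"
  define bad where "bad a b = (real (card (co a b)) < \<gamma> * N)" for a b
  define bp where "bp v = {z \<in> nb v \<times> nb v. bad (fst z) (snd z)}" for v
  have fin: "finite (nb v)" "finite (co a b)" "finite (bp v)" for v a b
    using A by (simp_all add: nb_def co_def bp_def)
  have co_commute: "co a b = co b a" for a b by (auto simp: co_def)
  have bad_commute: "bad a b = bad b a" for a b by (simp add: bad_def co_commute)
  have "(\<Sum>v\<in>A. real (card (nb v))) = real (card (SIGMA v:A. nb v))" using A fin by simp
  also have "card (SIGMA v:A. nb v) = card E"
    by (rule bij_betw_same_card[of prod.swap])
       (use Esub in \<open>auto simp: bij_betw_def inj_on_def image_iff nb_def\<close>)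
  finally have deg: "c * N\<^sup>2 \<le> (\<Sum>v\<in>A. real (card (nb v)))" using pop by (simp add: E_def)
  \<comment> \<open>Cauchy--Schwarz as a nonnegative sum of squares about \<open>c * N\<close>,
    which copes with \<open>card A\<close> being smaller than \<open>N\<close>.\<close>
  have "0 \<le> (\<Sum>v\<in>A. (real (card (nb v)) - c * N)\<^sup>2)" by (rule sum_nonneg) simp
  also have "\<dots> = (\<Sum>v\<in>A. (real (card (nb v)))\<^sup>2) - 2 * (c * N) * (\<Sum>v\<in>A. real (card (nb v))) + real (card A) * (c * N)\<^sup>2"
    by (simp add: power2_diff sum.distrib sum_subtractf sum_distrib_left mult_ac)
  finally have "2 * (c * N) * (\<Sum>v\<in>A. real (card (nb v))) - real (card A) * (c * N)\<^sup>2 \<le> (\<Sum>v\<in>A. (real (card (nb v)))\<^sup>2)"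
    by simp
  moreover have "2 * (c * N) * (c * N\<^sup>2) \<le> 2 * (c * N) * (\<Sum>v\<in>A. real (card (nb v)))"
    using deg c N by (intro mult_left_mono) auto
  moreover have "real (card A) * (c * N)\<^sup>2 \<le> N * (c * N)\<^sup>2" using AN by (intro mult_right_mono) auto
  ultimately have sq: "c\<^sup>2 * N ^ 3 \<le> (\<Sum>v\<in>A. (real (card (nb v)))\<^sup>2)"
    by (simp add: power2_eq_square power3_eq_cube algebra_simps)
  have "(\<Sum>v\<in>A. real (card (bp v))) = real (card (SIGMA v:A. bp v))" using A fin by simp
  also have "card (SIGMA v:A. bp v) = card (SIGMA z:{z \<in> A \<times> A. bad (fst z) (snd z)}. co (fst z) (snd z))"
    by (rule bij_betw_same_card[of prod.swap])
       (auto simp: bij_betw_def inj_on_def image_iff bp_def nb_def co_def)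
  also have "real \<dots> = (\<Sum>z\<in>{z \<in> A \<times> A. bad (fst z) (snd z)}. real (card (co (fst z) (snd z))))"
    using A fin by simp
  also have "\<dots> \<le> (\<Sum>z\<in>{z \<in> A \<times> A. bad (fst z) (snd z)}. \<gamma> * N)"
    by (intro sum_mono) (auto simp: bad_def)
  also have "\<dots> \<le> (\<Sum>z\<in>A \<times> A. \<gamma> * N)"
    using A N by (intro sum_mono2) (auto simp: \<gamma>_def)
  also have "\<dots> = real (card A) * real (card A) * (\<gamma> * N)" by (simp add: card_cartesian_product)
  also have "\<dots> \<le> N * N * (\<gamma> * N)"
    using AN N by (intro mult_right_mono mult_mono) (auto simp: \<gamma>_def)
  finally have bpsum: "(\<Sum>v\<in>A. real (card (bp v))) \<le> \<gamma> * N ^ 3" by (simp add: power3_eq_cube mult_ac)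
  have "c\<^sup>2 * N ^ 3 / 2 = c\<^sup>2 * N ^ 3 - 16 * (\<gamma> * N ^ 3)" by (simp add: \<gamma>_def)
  also have "\<dots> \<le> (\<Sum>v\<in>A. (real (card (nb v)))\<^sup>2) - 16 * (\<Sum>v\<in>A. real (card (bp v)))"
    using sq bpsum by linarith
  also have "\<dots> = (\<Sum>v\<in>A. (real (card (nb v)))\<^sup>2 - 16 * real (card (bp v)))"
    by (simp add: sum_subtractf sum_distrib_left)
  finally have tot: "c\<^sup>2 * N ^ 3 / 2 \<le> (\<Sum>v\<in>A. (real (card (nb v)))\<^sup>2 - 16 * real (card (bp v)))" .
  \<comment> \<open>A single average yields both properties at once: the neighbourhood of
    \<open>v\<close> is large and at most a sixteenth of its pairs are bad.\<close>
  have "\<exists>v\<in>A. c\<^sup>2 * N\<^sup>2 / 2 \<le> (real (card (nb v)))\<^sup>2 - 16 * real (card (bp v))"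
  proof (rule ccontr)
    assume "\<not> ?thesis"
    hence lt: "\<And>v. v \<in> A \<Longrightarrow> (real (card (nb v)))\<^sup>2 - 16 * real (card (bp v)) < c\<^sup>2 * N\<^sup>2 / 2" by force
    have "c\<^sup>2 * N ^ 3 / 2 > 0" using c N by simp
    hence "A \<noteq> {}" using tot by auto
    hence "(\<Sum>v\<in>A. (real (card (nb v)))\<^sup>2 - 16 * real (card (bp v))) < (\<Sum>v\<in>A. c\<^sup>2 * N\<^sup>2 / 2)"
      using A lt by (intro sum_strict_mono) auto
    also have "\<dots> = real (card A) * (c\<^sup>2 * N\<^sup>2 / 2)" by simp
    also have "\<dots> \<le> N * (c\<^sup>2 * N\<^sup>2 / 2)" using AN by (intro mult_right_mono) auto
    finally show False using tot by (simp add: power2_eq_square power3_eq_cube mult_ac)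
  qed
  then obtain v where v: "v \<in> A" "c\<^sup>2 * N\<^sup>2 / 2 \<le> (real (card (nb v)))\<^sup>2 - 16 * real (card (bp v))" by blast
  let ?n = "real (card (nb v))"
  have "(c * N / 2)\<^sup>2 \<le> c\<^sup>2 * N\<^sup>2 / 2" using c N by (simp add: power_divide power_mult_distrib)
  also have "\<dots> \<le> ?n\<^sup>2" using v by simp
  finally have n: "c * N / 2 \<le> ?n" by (rule power2_le_imp_le) simp
  have n0: "?n > 0" using n c N by (smt (verit) divide_pos_pos mult_pos_pos)
  have "c\<^sup>2 * N\<^sup>2 / 2 \<ge> 0" by simp
  hence bpv: "16 * real (card (bp v)) \<le> ?n\<^sup>2" using v by linarith
  define A' where "A' = {a \<in> nb v. real (card {b \<in> nb v. bad a b}) \<le> ?n / 4}"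
  have "real (card (nb v - A')) * (?n / 4) = (\<Sum>a\<in>nb v - A'. ?n / 4)" by simp
  also have "\<dots> \<le> (\<Sum>a\<in>nb v - A'. real (card {b \<in> nb v. bad a b}))"
    by (intro sum_mono) (auto simp: A'_def)
  also have "\<dots> = real (card (SIGMA a:nb v - A'. {b \<in> nb v. bad a b}))" using fin by simp
  also have "\<dots> \<le> real (card (bp v))"
    using fin by (intro of_nat_mono card_mono) (auto simp: bp_def)
  also have "\<dots> \<le> ?n / 4 * (?n / 4)" using bpv by (simp add: power2_eq_square)
  finally have "real (card (nb v - A')) \<le> ?n / 4" using n0 by (simp add: mult_le_cancel_right_pos)
  moreover have A'nb: "A' \<subseteq> nb v" by (auto simp: A'_def)
  moreover have "real (card (nb v - A')) = ?n - real (card A')"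
    using A'nb fin by (simp add: card_Diff_subset finite_subset[OF A'nb] of_nat_diff card_mono)
  ultimately have cA': "real (card A') \<ge> c * N / 4" using n n0 by linarith
  have A'A: "A' \<subseteq> A" using A'nb by (auto simp: nb_def)
  have fA': "finite A'" using A'A A finite_subset by blast
  have main: "c * N / 4 * (\<gamma> * N * (\<gamma> * N * (c * N * (c * N * (c * N * (c * N)))))) \<le> real (card (alt_reps A d))"
    if d: "d \<in> diffset A' A'" for d
  proof -
    obtain a b where ab: "a \<in> A'" "b \<in> A'" "d = a - b" using d by (rule diffsetE)
    \<comment> \<open>The middle vertices of the paths. Each of \<open>a\<close> and
      \<open>b\<close> excludes at most a quarter of the neighbourhood, so half of it
      remains.\<close>
    define C where "C = {x \<in> nb v. \<not> bad a x \<and> \<not> bad b x}"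
    have "nb v \<subseteq> C \<union> ({x \<in> nb v. bad a x} \<union> {x \<in> nb v. bad b x})" by (auto simp: C_def)
    hence "card (nb v) \<le> card (C \<union> ({x \<in> nb v. bad a x} \<union> {x \<in> nb v. bad b x}))"
      using fin by (intro card_mono) (auto simp: C_def)
    also have "\<dots> \<le> card C + (card {x \<in> nb v. bad a x} + card {x \<in> nb v. bad b x})"
      by (rule order_trans[OF card_Un_le add_left_mono[OF card_Un_le]])
    finally have "?n \<le> real (card C) + (real (card {x \<in> nb v. bad a x}) + real (card {x \<in> nb v. bad b x}))"
      by linarith
    moreover have "real (card {x \<in> nb v. bad a x}) \<le> ?n / 4" "real (card {x \<in> nb v. bad b x}) \<le> ?n / 4"
      using ab by (auto simp: A'_def)
    ultimately have cC: "c * N / 4 \<le> real (card C)" using n by linarith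
    have fC: "finite C" using fin by (simp add: C_def)
    let ?R = "\<lambda>x y. diff_reps A (x - y)"
    let ?T = "SIGMA x:C. SIGMA e1:co a x. SIGMA e2:co b x. ?R a e1 \<times> ?R x e1 \<times> ?R x e2 \<times> ?R b e2"
    have R: "c * N \<le> real (card (?R x y))" if "(x, y) \<in> E" for x y using that by (simp add: E_def)
    have cN: "0 \<le> c * N" "0 \<le> \<gamma> * N" using c N by (auto simp: \<gamma>_def)
    have fR: "finite (?R x y)" for x y using A by simp
    have R4: "c * N * (c * N * (c * N * (c * N))) \<le> real (card (?R a e1 \<times> ?R x e1 \<times> ?R x e2 \<times> ?R b e2))"
      if "e1 \<in> co a x" "e2 \<in> co b x" for x e1 e2
    proof -
      have "M * (M * (M * M)) \<le> w * (x * (y * z))"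
        if "0 \<le> M" "M \<le> w" "M \<le> x" "M \<le> y" "M \<le> z" for M w x y z :: real
        using that by (intro mult_mono mult_nonneg_nonneg) auto
      thus ?thesis unfolding card_cartesian_product of_nat_mult
        using that cN R by (simp add: co_def)
    qed
    have "c * N / 4 * (\<gamma> * N * (\<gamma> * N * (c * N * (c * N * (c * N * (c * N)))))) \<le> real (card ?T)"
    proof (rule card_Sigma_ge[OF fC _ cC])
      fix x assume x: "x \<in> C"
      have cox: "\<gamma> * N \<le> real (card (co a x))" "\<gamma> * N \<le> real (card (co b x))"
        using x by (auto simp: C_def bad_def)
      show "finite (SIGMA e1:co a x. SIGMA e2:co b x. ?R a e1 \<times> ?R x e1 \<times> ?R x e2 \<times> ?R b e2)"
        by (intro finite_SigmaI fin finite_cartesian_product fR)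
      show "\<gamma> * N * (\<gamma> * N * (c * N * (c * N * (c * N * (c * N)))))
        \<le> real (card (SIGMA e1:co a x. SIGMA e2:co b x. ?R a e1 \<times> ?R x e1 \<times> ?R x e2 \<times> ?R b e2))"
      proof (rule card_Sigma_ge[OF fin(2) _ cox(1)])
        fix e1 assume e1: "e1 \<in> co a x"
        show "finite (SIGMA e2:co b x. ?R a e1 \<times> ?R x e1 \<times> ?R x e2 \<times> ?R b e2)"
          by (intro finite_SigmaI fin finite_cartesian_product fR)
        show "\<gamma> * N * (c * N * (c * N * (c * N * (c * N))))
          \<le> real (card (SIGMA e2:co b x. ?R a e1 \<times> ?R x e1 \<times> ?R x e2 \<times> ?R b e2))"
        proof (rule card_Sigma_ge[OF fin(2) _ cox(2)])
          fix e2 assume "e2 \<in> co b x"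
          thus "c * N * (c * N * (c * N * (c * N))) \<le> real (card (?R a e1 \<times> ?R x e1 \<times> ?R x e2 \<times> ?R b e2))"
            by (rule R4[OF e1])
        qed (intro finite_cartesian_product fR mult_nonneg_nonneg cN)+
      qed (intro mult_nonneg_nonneg cN)
    qed (intro mult_nonneg_nonneg cN)
    \<comment> \<open>The vertices of the path can be forgotten: \<open>a\<close> is fixed, and the
      four differences give back \<open>e1\<close>, then \<open>x\<close>, then
      \<open>e2\<close>.\<close>
    also have "card ?T \<le> card (alt_reps A d)"
    proof (rule card_inj_on_le[where f = "\<lambda>(x, e1, e2, z). z"])
      show "inj_on (\<lambda>(x, e1, e2, z). z) ?T"
      proof (rule inj_onI)
        fix s t assume st: "s \<in> ?T" "t \<in> ?T" "(\<lambda>(x, e1, e2, z). z) s = (\<lambda>(x, e1, e2, z). z) t"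
        obtain x e1 e2 z1 z2 z3 z4 where s: "s = (x, e1, e2, z1, z2, z3, z4)" by (cases s) auto
        obtain x' e1' e2' where t: "t = (x', e1', e2', z1, z2, z3, z4)" using st(3) s by (cases t) auto
        have "a - e1 = fst z1 - snd z1" "x - e1 = fst z2 - snd z2" "x - e2 = fst z3 - snd z3"
          using st(1) by (simp_all add: s diff_reps_def)
        moreover have "a - e1' = fst z1 - snd z1" "x' - e1' = fst z2 - snd z2" "x' - e2' = fst z3 - snd z3"
          using st(2) by (simp_all add: t diff_reps_def)
        ultimately have "a - e1 = a - e1'" "x - e1 = x' - e1'" "x - e2 = x' - e2'" by simp_all
        thus "s = t" by (auto simp: s t)
      qed
      show "(\<lambda>(x, e1, e2, z). z) ` ?T \<subseteq> alt_reps A d"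
        by (auto simp: alt_reps_def diff_reps_def ab(3))
      show "finite (alt_reps A d)"
        by (rule finite_subset[of _ "(A \<times> A) \<times> (A \<times> A) \<times> (A \<times> A) \<times> (A \<times> A)"])
           (use A in \<open>auto simp: alt_reps_def\<close>)
    qed
    finally show ?thesis by simp
  qed
  have "real (card (diffset A' A')) * (c * N / 4 * (\<gamma> * N * (\<gamma> * N * (c * N * (c * N * (c * N * (c * N))))))) \<le> real (card A) ^ 8"
    using card_le_of_alt_reps[OF A _ main] fA' by simp
  also have "\<dots> \<le> N ^ 8" using AN by (intro power_mono) auto
  \<comment> \<open>The constant is \<open>(1 / 4) * (1 / 32) ^ 2 = 1 / 4096\<close>, and
    \<open>c ^ 9\<close> consists of one factor from \<open>C\<close>, four from the two uses of
    \<open>\<gamma>\<close> and four from the edges.\<close>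
  finally have "N ^ 7 * (real (card (diffset A' A')) * (c ^ 9 / 4096)) \<le> N ^ 7 * N"
    by (simp add: \<gamma>_def eval_nat_numeral mult_ac)
  hence "real (card (diffset A' A')) * (c ^ 9 / 4096) \<le> N" using N by (simp add: mult_le_cancel_left_pos)
  thus ?thesis using that A'A cA' by blast
qed

text \<open>The part of the sixfold difference set above first coordinate 0. Six is what
  \<open>freiman_hom_linear\<close> needs: it compares three elements of
  \<open>2 \<Gamma> - 2 \<Gamma>\<close>.\<close>

definition zero_fibre :: "('a::ab_group_add \<times> 'a) set \<Rightarrow> 'a set" where
  "zero_fibre \<Gamma> = {snd u - snd v | u v. u \<in> nsum 6 \<Gamma> \<and> v \<in> nsum 6 \<Gamma> \<and> fst u = fst v}"

lemma zero_fibreI: "u \<in> nsum 6 \<Gamma> \<Longrightarrow> v \<in> nsum 6 \<Gamma> \<Longrightarrow> fst u = fst v \<Longrightarrow> snd u - snd v \<in> zero_fibre \<Gamma>"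
  unfolding zero_fibre_def by blast

lemma zero_fibreE:
  assumes "z \<in> zero_fibre \<Gamma>"
  obtains u v where "u \<in> nsum 6 \<Gamma>" "v \<in> nsum 6 \<Gamma>" "fst u = fst v" "z = snd u - snd v"
  using assms unfolding zero_fibre_def by blast

lemma finite_zero_fibre: "finite \<Gamma> \<Longrightarrow> finite (zero_fibre \<Gamma>)"
  by (rule finite_subset[of _ "(\<lambda>(u, v). snd u - snd v) ` (nsum 6 \<Gamma> \<times> nsum 6 \<Gamma>)"])
     (force simp: zero_fibre_def)+

text \<open>Over each point of the graph \<open>\<Gamma>\<close> lies a full translate of the zero
  fibre, inside \<open>7 \<Gamma> - 6 \<Gamma>\<close>; injectivity of \<open>fst\<close> keeps
  these translates apart.\<close>

lemma card_zero_fibre: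
  assumes f: "finite \<Gamma>" and inj: "inj_on fst \<Gamma>"
  shows "card (zero_fibre \<Gamma>) * card \<Gamma> \<le> card (diffset (nsum 7 \<Gamma>) (nsum 6 \<Gamma>))"
proof -
  let ?f = "\<lambda>(z, g). (fst g, z + snd g)"
  have "card (zero_fibre \<Gamma> \<times> \<Gamma>) \<le> card (diffset (nsum 7 \<Gamma>) (nsum 6 \<Gamma>))"
  proof (rule card_inj_on_le[where f = ?f])
    show "inj_on ?f (zero_fibre \<Gamma> \<times> \<Gamma>)"
    proof (rule inj_onI)
      fix s t assume st: "s \<in> zero_fibre \<Gamma> \<times> \<Gamma>" "t \<in> zero_fibre \<Gamma> \<times> \<Gamma>" "?f s = ?f t"
      hence "snd s = snd t" using inj by (auto simp: inj_on_def split: prod.splits)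
      thus "s = t" using st(3) by (auto split: prod.splits)
    qed
    show "?f ` (zero_fibre \<Gamma> \<times> \<Gamma>) \<subseteq> diffset (nsum 7 \<Gamma>) (nsum 6 \<Gamma>)"
    proof (clarify)
      fix z a b assume z: "z \<in> zero_fibre \<Gamma>" and g: "(a, b) \<in> \<Gamma>"
      obtain u v where uv: "u \<in> nsum 6 \<Gamma>" "v \<in> nsum 6 \<Gamma>" "fst u = fst v" "z = snd u - snd v"
        using z by (rule zero_fibreE)
      have "u + (a, b) \<in> nsum (Suc 6) \<Gamma>" unfolding nsum.simps using uv(1) g by (rule sumsetI)
      hence "(u + (a, b)) - v \<in> diffset (nsum 7 \<Gamma>) (nsum 6 \<Gamma>)" using uv(2) by (auto simp: eval_nat_numeral)
      also have "(u + (a, b)) - v = (fst (a, b), z + snd (a, b))"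
        using uv by (simp add: prod_eq_iff algebra_simps)
      finally show "(fst (a, b), z + snd (a, b)) \<in> diffset (nsum 7 \<Gamma>) (nsum 6 \<Gamma>)" .
    qed
  qed (use f in auto)
  thus ?thesis by (simp add: card_cartesian_product)
qed

context fin_space
begin

subsection \<open>From approximate homomorphisms to affine maps\<close>

lemma card_perp_singleton:
  assumes "z \<in> G" "z \<noteq> 0" shows "2 * card (perp {z}) \<le> card G"
proof -
  obtain t where t: "t \<in> G" "pr z t \<noteq> 0" using pr_nondeg[of z] assms by blast
  have d: "perp {z} \<inter> (\<lambda>x. x + t) ` perp {z} = {}"
    using t by (auto simp: perp_def pr_add_right)
  have "card (perp {z}) + card ((\<lambda>x. x + t) ` perp {z}) = card (perp {z} \<union> (\<lambda>x. x + t) ` perp {z})"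
    by (rule card_Un_disjoint[symmetric]) (use d in auto)
  also have "\<dots> \<le> card G"
    using perp_subset t by (intro card_mono finite_G) auto
  finally show ?thesis by (simp add: card_translate)
qed

text \<open>Averaging over all functionals: each nonzero \<open>z\<close> is annihilated by at most
  half of them.\<close>

lemma exists_halving_functional:
  assumes Z: "Z \<subseteq> G - {0}"
  obtains s where "s \<in> G" "2 * card {z \<in> Z. pr s z = 0} \<le> card Z"
proof -
  have fZ: "finite Z" using Z finite_sub by blast
  have "(\<Sum>s\<in>G. 2 * card {z \<in> Z. pr s z = 0}) = 2 * (\<Sum>s\<in>G. \<Sum>z\<in>Z. of_bool (pr s z = 0))"
    using fZ by (simp add: sum_distrib_left Int_def)
  also have "\<dots> = (\<Sum>z\<in>Z. 2 * card {s \<in> G. pr z s = 0})"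
    using finite_G by (subst sum.swap) (simp add: sum_distrib_left Int_def pr_commute)
  also have "\<dots> \<le> (\<Sum>z\<in>Z. card G)"
  proof (rule sum_mono)
    fix z assume "z \<in> Z"
    thus "2 * card {s \<in> G. pr z s = 0} \<le> card G"
      using card_perp_singleton[of z] Z by (auto simp: perp_def)
  qed
  finally have le: "(\<Sum>s\<in>G. 2 * card {z \<in> Z. pr s z = 0}) \<le> (\<Sum>s\<in>G. card Z)" by (simp add: mult.commute)
  have "\<exists>s\<in>G. 2 * card {z \<in> Z. pr s z = 0} \<le> card Z"
  proof (rule ccontr)
    assume "\<not> ?thesis"
    hence "\<And>s. s \<in> G \<Longrightarrow> card Z < 2 * card {z \<in> Z. pr s z = 0}" by force
    hence "(\<Sum>s\<in>G. card Z) < (\<Sum>s\<in>G. 2 * card {z \<in> Z. pr s z = 0})"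
      using finite_G G_0 by (intro sum_strict_mono) auto
    thus False using le by simp
  qed
  thus ?thesis using that by blast
qed

lemma nsum_pr:
  assumes "\<And>g. g \<in> \<Gamma> \<Longrightarrow> pr s (snd g) = c" "u \<in> nsum n \<Gamma>"
  shows "pr s (snd u) = of_nat n * c"
  using assms(2)
proof (induction n arbitrary: u)
  case (Suc n)
  then obtain v g where "v \<in> nsum n \<Gamma>" "g \<in> \<Gamma>" "u = v + g" by (auto elim: sumsetE)
  thus ?case using Suc assms(1) by (simp add: pr_add_right algebra_simps)
qed simp

lemma nsum_sub: "\<Gamma> \<subseteq> G \<times> G \<Longrightarrow> nsum n \<Gamma> \<subseteq> G \<times> G"
proof (induction n)
  case (Suc n)
  show ?case
  proof
    fix u assume "u \<in> nsum (Suc n) \<Gamma>"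
    then obtain v g where "v \<in> nsum n \<Gamma>" "g \<in> \<Gamma>" "u = v + g" by (auto elim: sumsetE)
    moreover from this have "v \<in> G \<times> G" "g \<in> G \<times> G" using Suc by blast+
    ultimately show "u \<in> G \<times> G" by (simp add: mem_Times_iff)
  qed
qed (simp add: zero_prod_def)

text \<open>Restrict \<open>\<Gamma>\<close> to a level set of a functional \<open>s\<close> on
  second coordinates. Both sixfold sums then have the same value under \<open>s\<close>, so the new
  zero fibre is annihilated by \<open>s\<close>. A halving functional thus removes at least half of
  the nonzero elements, and the best level set costs only a factor \<open>p\<close>.\<close>

lemma thin_zero_fibre:
  assumes "\<Gamma> \<subseteq> G \<times> G" "card (zero_fibre \<Gamma> - {0}) < 2 ^ m"
  shows "\<exists>\<Gamma>'\<subseteq>\<Gamma>. card \<Gamma> \<le> CARD('p) ^ m * card \<Gamma>' \<and> zero_fibre \<Gamma>' \<subseteq> {0}"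
  using assms
proof (induction m arbitrary: \<Gamma>)
  case 0
  have "finite \<Gamma>" using 0 finite_G finite_subset by blast
  hence "finite (zero_fibre \<Gamma> - {0})" by (simp add: finite_zero_fibre)
  hence "zero_fibre \<Gamma> - {0} = {}" using 0 by (metis card_0_eq less_one power_0)
  thus ?case by (intro exI[of _ \<Gamma>]) auto
next
  case (Suc m)
  have f: "finite \<Gamma>" using Suc.prems finite_G finite_subset by blast
  have fz: "finite (zero_fibre \<Gamma>)" using f by (rule finite_zero_fibre)
  have "zero_fibre \<Gamma> \<subseteq> G"
  proof
    fix z assume "z \<in> zero_fibre \<Gamma>"
    then obtain u v where "u \<in> nsum 6 \<Gamma>" "v \<in> nsum 6 \<Gamma>" "z = snd u - snd v" by (rule zero_fibreE)
    moreover from this have "u \<in> G \<times> G" "v \<in> G \<times> G" using nsum_sub[OF Suc.prems(1)] by blast+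
    ultimately show "z \<in> G" by auto
  qed
  hence "zero_fibre \<Gamma> - {0} \<subseteq> G - {0}" by blast
  then obtain s where s: "s \<in> G" "2 * card {z \<in> zero_fibre \<Gamma> - {0}. pr s z = 0} \<le> card (zero_fibre \<Gamma> - {0})"
    by (rule exists_halving_functional)
  define part where "part c = {g \<in> \<Gamma>. pr s (snd g) = c}" for c
  have "card \<Gamma> = (\<Sum>c\<in>UNIV. card (part c))"
  proof -
    have "\<Gamma> = (\<Union>c\<in>UNIV. part c)" by (auto simp: part_def)
    also have "card \<dots> = (\<Sum>c\<in>UNIV. card (part c))"
      by (rule card_UN_disjoint) (use f in \<open>auto simp: part_def\<close>)
    finally show ?thesis .
  qed
  have "\<exists>c. card \<Gamma> \<le> CARD('p) * card (part c)"
  proof (rule ccontr)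
    assume "\<not> ?thesis"
    hence lt: "\<And>c. CARD('p) * card (part c) < card \<Gamma>" by (simp add: not_le)
    have "CARD('p) * card \<Gamma> = (\<Sum>c\<in>UNIV. CARD('p) * card (part c))"
      using \<open>card \<Gamma> = _\<close> by (simp add: sum_distrib_left)
    also have "\<dots> < (\<Sum>c\<in>(UNIV :: 'p mod_ring set). card \<Gamma>)"
      using lt by (intro sum_strict_mono) auto
    finally show False by simp
  qed
  then obtain c where c: "card \<Gamma> \<le> CARD('p) * card (part c)" by blast
  have sub: "part c \<subseteq> \<Gamma>" by (auto simp: part_def)
  have "zero_fibre (part c) - {0} \<subseteq> {z \<in> zero_fibre \<Gamma> - {0}. pr s z = 0}"
  proof
    fix z assume z: "z \<in> zero_fibre (part c) - {0}"
    then obtain u v where uv: "u \<in> nsum 6 (part c)" "v \<in> nsum 6 (part c)" "fst u = fst v" "z = snd u - snd v"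
      by (meson DiffD1 zero_fibreE)
    have "pr s (snd u) = of_nat 6 * c" "pr s (snd v) = of_nat 6 * c"
      using nsum_pr[OF _ uv(1), of s c] nsum_pr[OF _ uv(2), of s c] by (simp_all add: part_def)
    hence "pr s z = 0" using uv by (simp add: pr_diff_right)
    moreover have "z \<in> zero_fibre \<Gamma>"
      using uv nsum_mono[OF sub, of 6] by (auto intro: zero_fibreI)
    ultimately show "z \<in> {z \<in> zero_fibre \<Gamma> - {0}. pr s z = 0}" using z by auto
  qed
  hence "card (zero_fibre (part c) - {0}) \<le> card {z \<in> zero_fibre \<Gamma> - {0}. pr s z = 0}"
    using fz by (intro card_mono) auto
  hence "card (zero_fibre (part c) - {0}) < 2 ^ m" using s Suc.prems by simp
  then obtain \<Gamma>' where \<Gamma>': "\<Gamma>' \<subseteq> part c" "card (part c) \<le> CARD('p) ^ m * card \<Gamma>'" "zero_fibre \<Gamma>' \<subseteq> {0}"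
    using Suc.IH[of "part c"] sub Suc.prems(1) by blast
  have "card \<Gamma> \<le> CARD('p) * (CARD('p) ^ m * card \<Gamma>')"
    using c \<Gamma>'(2) by (meson le_trans mult_le_mono2)
  thus ?case using \<Gamma>' sub by (intro exI[of _ \<Gamma>']) (auto simp: mult.assoc)
qed

abbreviation "lin \<equiv> Vector_Spaces.linear scale scale"

lemma scale_of_nat_eq: "of_nat (Suc k) *s x = of_nat k *s x + x"
  by (simp add: V.scale_left_distrib add.commute)

text \<open>Over a prime field every scalar is a repeated sum of 1, so additivity on
  \<open>W\<close> already gives linearity; an extension with range in the span of the values stays
  in \<open>G\<close>.\<close>

lemma extend_additive:
  assumes W: "V.subspace W" "W \<subseteq> G" and hG: "\<And>x. x \<in> W \<Longrightarrow> h x \<in> G"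
    and add: "\<And>x y. x \<in> W \<Longrightarrow> y \<in> W \<Longrightarrow> h (x + y) = h x + h y"
  obtains g where "lin g" "\<And>x. x \<in> W \<Longrightarrow> g x = h x" "\<And>x. g x \<in> G"
proof -
  interpret VP: vector_space_pair scale scale ..
  have h0: "h 0 = 0" using add[of 0 0] V.subspace_0[OF W(1)] by simp
  have "h (of_nat k *s x) = of_nat k *s h x" if "x \<in> W" for k x
  proof (induction k)
    case (Suc k)
    have "of_nat k *s x \<in> W" using that W V.subspace_scale by blast
    thus ?case using Suc add that by (simp only: scale_of_nat_eq)
  qed (simp add: h0)
  hence hs: "h (c *s x) = c *s h x" if "x \<in> W" for c x
    using surj_of_nat_mod_ring[of c] that by metis
  obtain B where B: "B \<subseteq> W" "V.independent B" "W \<subseteq> V.span B"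
    using V.maximal_independent_subset[of W] by blast
  obtain g where g: "lin g" "\<forall>x\<in>B. g x = h x" "range g = V.span (h ` B)"
    using VP.linear_independent_extend_subspace[OF B(2), of h] by blast
  interpret g: Vector_Spaces.linear scale scale g by fact
  have "x \<in> W \<and> g x = h x" if "x \<in> V.span B" for x
    using that
  proof (induction rule: V.span_induct_alt)
    case base
    thus ?case using h0 V.subspace_0[OF W(1)] by (simp add: g.zero)
  next
    case (step c x y)
    have x: "x \<in> W" using step B by blast
    hence "c *s x \<in> W" using W V.subspace_scale by blast
    moreover have "g (c *s x) = h (c *s x)" using g(2) step hs[OF x] by (simp add: g.scale)
    ultimately show ?case using step add W V.subspace_add by (simp add: g.add)
  qed
  moreover have "V.span (h ` B) \<subseteq> G"
    using B hG by (intro V.span_minimal subspace_G) auto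
  ultimately show ?thesis using that g B by (metis rangeI subsetD)
qed

text \<open>A trivial zero fibre makes \<open>2 \<Gamma> - 2 \<Gamma>\<close> an additive graph, and
  \<open>cov\<close> says that this graph lies over all of \<open>W\<close>. So it defines an
  additive map on \<open>W\<close>, which extends linearly.\<close>

lemma freiman_hom_linear:
  assumes \<Gamma>: "\<Gamma> \<subseteq> G \<times> G" and z: "zero_fibre \<Gamma> \<subseteq> {0}"
    and W: "V.subspace W" "W \<subseteq> G" and cov: "\<And>w. w \<in> W \<Longrightarrow> quads (fst ` \<Gamma>) w \<noteq> {}"
  obtains g where "lin g" "\<And>x. g x \<in> G"
    "\<And>a b. a \<in> \<Gamma> \<Longrightarrow> b \<in> \<Gamma> \<Longrightarrow> fst a - fst b \<in> W \<Longrightarrow> snd a - snd b = g (fst a - fst b)"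
proof -
  define Q where "Q = diffset (nsum 2 \<Gamma>) (nsum 2 \<Gamma>)"
  have two: "a + b \<in> nsum 2 \<Gamma>" if "a \<in> \<Gamma>" "b \<in> \<Gamma>" for a b
    using nsum_add[OF nsum_1[OF that(1)] nsum_1[OF that(2)]] by (simp add: eval_nat_numeral)
  have QG: "Q \<subseteq> G \<times> G"
  proof
    fix x assume "x \<in> Q"
    then obtain u v where "u \<in> nsum 2 \<Gamma>" "v \<in> nsum 2 \<Gamma>" "x = u - v" unfolding Q_def by (rule diffsetE)
    moreover from this have "u \<in> G \<times> G" "v \<in> G \<times> G" using nsum_sub[OF \<Gamma>] by blast+
    ultimately show "x \<in> G \<times> G" by (simp add: mem_Times_iff)
  qed
  have Qadd: "snd x + snd y = snd t"
    if xyt: "x \<in> Q" "y \<in> Q" "t \<in> Q" "fst x + fst y = fst t" for x y t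
  proof -
    obtain u1 v1 where 1: "u1 \<in> nsum 2 \<Gamma>" "v1 \<in> nsum 2 \<Gamma>" "x = u1 - v1"
      using xyt(1) unfolding Q_def by (rule diffsetE)
    obtain u2 v2 where 2: "u2 \<in> nsum 2 \<Gamma>" "v2 \<in> nsum 2 \<Gamma>" "y = u2 - v2"
      using xyt(2) unfolding Q_def by (rule diffsetE)
    obtain u3 v3 where 3: "u3 \<in> nsum 2 \<Gamma>" "v3 \<in> nsum 2 \<Gamma>" "t = u3 - v3"
      using xyt(3) unfolding Q_def by (rule diffsetE)
    have "u1 + u2 + v3 \<in> nsum (2 + 2 + 2) \<Gamma>" "v1 + v2 + u3 \<in> nsum (2 + 2 + 2) \<Gamma>"
      by (intro nsum_add 1(1) 1(2) 2(1) 2(2) 3(1) 3(2))+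
    hence m: "u1 + u2 + v3 \<in> nsum 6 \<Gamma>" "v1 + v2 + u3 \<in> nsum 6 \<Gamma>" by simp_all
    have "fst (u1 + u2 + v3) = fst (v1 + v2 + u3)"
      using xyt(4) 1(3) 2(3) 3(3) by (simp add: algebra_simps)
    hence e: "snd (u1 + u2 + v3) - snd (v1 + v2 + u3) = 0" using zero_fibreI[OF m] z by blast
    have "snd x = snd u1 - snd v1" "snd y = snd u2 - snd v2" "snd t = snd u3 - snd v3"
      using 1(3) 2(3) 3(3) by simp_all
    hence "snd x + snd y - snd t = snd (u1 + u2 + v3) - snd (v1 + v2 + u3)"
      by (simp add: algebra_simps)
    thus ?thesis using e by simp
  qed
  define h where "h w = snd (SOME x. x \<in> Q \<and> fst x = w)" for w
  have ex: "\<exists>x. x \<in> Q \<and> fst x = w" if w: "w \<in> W" for w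
  proof -
    obtain a b c d where abcd: "a \<in> \<Gamma>" "b \<in> \<Gamma>" "c \<in> \<Gamma>" "d \<in> \<Gamma>" "fst a + fst b - fst c - fst d = w"
      using cov[OF w] by (auto simp: quads_def)
    have "(a + b) - (c + d) \<in> Q" unfolding Q_def using abcd two by blast
    thus ?thesis using abcd(5) by (intro exI[of _ "(a + b) - (c + d)"]) (simp add: algebra_simps)
  qed
  have h: "\<exists>x\<in>Q. fst x = w \<and> snd x = h w" if w: "w \<in> W" for w
    using someI_ex[OF ex[OF w]] by (auto simp: h_def)
  have h_add: "h (x + y) = h x + h y" if xy: "x \<in> W" "y \<in> W" for x y
  proof -
    have "x + y \<in> W" using xy W V.subspace_add by blast
    thus ?thesis using h[OF xy(1)] h[OF xy(2)] h[of "x + y"] Qadd by metis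
  qed
  have h_G: "h x \<in> G" if x: "x \<in> W" for x using h[OF x] QG by force
  obtain g where g: "lin g" "\<And>x. x \<in> W \<Longrightarrow> g x = h x" "\<And>x. g x \<in> G"
    using extend_additive[OF W h_G h_add] by blast
  have "snd a - snd b = g (fst a - fst b)" if ab: "a \<in> \<Gamma>" "b \<in> \<Gamma>" "fst a - fst b \<in> W" for a b
  proof -
    \<comment> \<open>Padding with \<open>b\<close> writes a plain difference as a difference of
      twofold sums.\<close>
    have "(a + b) - (b + b) \<in> Q" "(a + a) - (a + a) \<in> Q" unfolding Q_def using ab two by blast+
    hence "a - b \<in> Q" "0 \<in> Q" by simp_all
    moreover obtain x where "x \<in> Q" "fst x = fst a - fst b" "snd x = h (fst a - fst b)"
      using h[OF ab(3)] by blast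
    ultimately have "snd (a - b) = h (fst a - fst b)" using Qadd[of "a - b" 0 x] by simp
    thus ?thesis using g(2)[OF ab(3)] by simp
  qed
  thus ?thesis using that g by blast
qed

text \<open>Balog--Szemeredi--Gowers and Pluennecke bound the zero fibre of a dense part of
  \<open>\<Gamma>\<close>; thinning trivialises it, and Bogolyubov--Ruzsa supplies a subspace on
  which the resulting homomorphism is linear. One coset of that subspace contains many points of the
  graph, and on a coset linear becomes affine.\<close>

lemma affine_agreement:
  assumes \<Gamma>: "\<Gamma> \<subseteq> G \<times> G" and inj: "inj_on fst \<Gamma>" and c: "0 < c"
    and pop: "c * q\<^sup>2 \<le> real (card {z \<in> \<Gamma> \<times> \<Gamma>. c * q \<le> real (card (diff_reps \<Gamma> (fst z - snd z)))})"
    and m: "(16384 / c ^ 10) ^ 13 < 2 ^ m" and \<tau>: "\<tau> = c / (4 * real CARD('p) ^ m)"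
    and k: "k \<ge> 1" "32 / \<tau> \<le> 2 ^ k"
    and \<epsilon>: "\<epsilon> = 1 / (64 * real k)" and l: "2 * exp (- \<epsilon>\<^sup>2 * real l / 4) \<le> \<tau> * \<epsilon> / 2"
  obtains g c0 r where "lin g" "\<And>x. g x \<in> G" "c0 \<in> G" "\<tau> ^ l / 2 * exp (real r / 32) \<le> 1"
    "\<tau> * q \<le> real CARD('p) ^ r * real (card {a \<in> \<Gamma>. snd a = g (fst a) + c0})"
proof -
  have f\<Gamma>: "finite \<Gamma>" using \<Gamma> finite_G finite_subset by blast
  have "card \<Gamma> \<le> card G"
    by (rule card_inj_on_le[OF inj]) (use \<Gamma> finite_G in auto)
  hence \<Gamma>q: "real (card \<Gamma>) \<le> q" by simp
  obtain \<Gamma>1 where \<Gamma>1: "\<Gamma>1 \<subseteq> \<Gamma>" "c * q / 4 \<le> real (card \<Gamma>1)"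
    "real (card (diffset \<Gamma>1 \<Gamma>1)) * (c ^ 9 / 4096) \<le> q"
    using balog_szemeredi_gowers[OF f\<Gamma> \<Gamma>q q_pos c pop] by blast
  have f1: "finite \<Gamma>1" using \<Gamma>1 f\<Gamma> finite_subset by blast
  have c1: "real (card \<Gamma>1) > 0" using \<Gamma>1(2) c q_pos by (smt (verit) divide_pos_pos mult_pos_pos)
  hence ne1: "\<Gamma>1 \<noteq> {}" by auto
  have inj1: "inj_on fst \<Gamma>1" using inj \<Gamma>1(1) inj_on_subset by blast
  have G1: "\<Gamma>1 \<subseteq> G \<times> G" using \<Gamma>1 \<Gamma> by blast
  \<comment> \<open>Measuring the difference set against \<open>card \<Gamma>1\<close> instead of
    \<open>q\<close> costs the further factor \<open>4 / c\<close>, whence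
    \<open>16384 / c ^ 10\<close>.\<close>
  have "real (card (diffset \<Gamma>1 \<Gamma>1)) \<le> 4096 / c ^ 9 * q"
    using \<Gamma>1(3) c by (simp add: field_simps)
  also have "\<dots> \<le> 4096 / c ^ 9 * (4 / c * real (card \<Gamma>1))"
    using \<Gamma>1(2) c by (intro mult_left_mono) (auto simp: field_simps)
  also have "\<dots> = 16384 / c ^ 10 * real (card \<Gamma>1)" by (simp add: eval_nat_numeral)
  finally have K: "real (card (diffset \<Gamma>1 \<Gamma>1)) \<le> 16384 / c ^ 10 * real (card \<Gamma>1)" .
  have "real (card (zero_fibre \<Gamma>1)) * real (card \<Gamma>1) \<le> real (card (diffset (nsum 7 \<Gamma>1) (nsum 6 \<Gamma>1)))"
    using card_zero_fibre[OF f1 inj1] by (simp flip: of_nat_mult)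
  also have "\<dots> \<le> (16384 / c ^ 10) ^ (7 + 6) * real (card \<Gamma>1)"
    by (rule card_nsum_diff[OF f1 ne1 K])
  finally have "real (card (zero_fibre \<Gamma>1)) \<le> (16384 / c ^ 10) ^ 13"
    using c1 by (simp add: mult_le_cancel_right_pos)
  hence "real (card (zero_fibre \<Gamma>1)) < 2 ^ m" using m by (rule le_less_trans)
  hence "card (zero_fibre \<Gamma>1) < 2 ^ m" by (metis of_nat_less_iff of_nat_numeral of_nat_power)
  moreover have "card (zero_fibre \<Gamma>1 - {0}) \<le> card (zero_fibre \<Gamma>1)"
    using finite_zero_fibre[OF f1] by (intro card_mono) auto
  ultimately have "card (zero_fibre \<Gamma>1 - {0}) < 2 ^ m" by simp
  then obtain \<Gamma>2 where \<Gamma>2: "\<Gamma>2 \<subseteq> \<Gamma>1" "card \<Gamma>1 \<le> CARD('p) ^ m * card \<Gamma>2" "zero_fibre \<Gamma>2 \<subseteq> {0}"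
    using thin_zero_fibre[OF G1] by blast
  have G2: "\<Gamma>2 \<subseteq> G \<times> G" using \<Gamma>2 G1 by blast
  define Y where "Y = fst ` \<Gamma>2"
  have YG: "Y \<subseteq> G" using G2 by (auto simp: Y_def)
  have fY: "finite Y" using YG finite_sub by blast
  have inj2: "inj_on fst \<Gamma>2" using inj1 \<Gamma>2(1) inj_on_subset by blast
  have p0: "real CARD('p) ^ m > 0" by simp
  have "c * q / 4 \<le> real (CARD('p) ^ m * card \<Gamma>2)" using \<Gamma>1(2) \<Gamma>2(2) by (meson of_nat_le_iff order_trans)
  hence "\<tau> * q \<le> real (card \<Gamma>2)" using p0 by (simp add: \<tau> field_simps)
  hence cY: "\<tau> * q \<le> real (card Y)" by (simp add: Y_def card_image[OF inj2])
  have \<tau>0: "0 < \<tau>" using c p0 by (simp add: \<tau>)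
  have cY0: "real (card Y) > 0" using cY \<tau>0 q_pos by (smt (verit) mult_pos_pos)
  obtain W r where W: "V.subspace W" "W \<subseteq> G" "card G \<le> CARD('p) ^ r * card W"
    "\<tau> ^ l / 2 * exp (real r / 32) \<le> 1"
    and quads: "\<And>w. w \<in> W \<Longrightarrow> real (card (quads Y w)) \<ge> real (card Y) ^ 4 / (8 * q)"
    using bogolyubov_ruzsa[OF YG cY \<tau>0 k \<epsilon> l] by blast
  have "quads (fst ` \<Gamma>2) w \<noteq> {}" if "w \<in> W" for w
  proof
    assume "quads (fst ` \<Gamma>2) w = {}"
    hence "real (card Y) ^ 4 / (8 * q) \<le> 0" using quads[OF that] by (simp add: Y_def)
    moreover have "real (card Y) ^ 4 / (8 * q) > 0" using cY0 q_pos by simp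
    ultimately show False by linarith
  qed
  then obtain g where g: "lin g" "\<And>x. g x \<in> G"
    "\<And>a b. a \<in> \<Gamma>2 \<Longrightarrow> b \<in> \<Gamma>2 \<Longrightarrow> fst a - fst b \<in> W \<Longrightarrow> snd a - snd b = g (fst a - fst b)"
    using freiman_hom_linear[OF G2 \<Gamma>2(3) W(1,2)] by blast
  interpret g: Vector_Spaces.linear scale scale g by fact
  have fW: "finite W" using W finite_sub by blast
  \<comment> \<open>Averaging over the cosets \<open>x + W\<close> finds one that meets the graph in
    at least the mean number of points.\<close>
  have "(\<Sum>x\<in>G. card {a \<in> \<Gamma>2. fst a - x \<in> W}) = (\<Sum>x\<in>G. \<Sum>a\<in>\<Gamma>2. of_bool (fst a - x \<in> W))"
    using finite_subset[OF \<Gamma>2(1) f1] by (simp add: Int_def)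
  also have "\<dots> = (\<Sum>a\<in>\<Gamma>2. \<Sum>x\<in>G. of_bool (fst a - x \<in> W))" by (rule sum.swap)
  also have "\<dots> = (\<Sum>a\<in>\<Gamma>2. card W)"
  proof (rule sum.cong[OF refl])
    fix a assume "a \<in> \<Gamma>2"
    hence a: "fst a \<in> G" using G2 by auto
    have "(\<Sum>x\<in>G. of_bool (fst a - x \<in> W)) = (\<Sum>x\<in>G. of_bool (x \<in> W) :: nat)"
      by (rule sum_reflect[OF a])
    also have "\<dots> = card W" using finite_G W(2) by (simp add: Int_absorb1)
    finally show "(\<Sum>x\<in>G. of_bool (fst a - x \<in> W)) = card W" .
  qed
  finally have tot: "(\<Sum>x\<in>G. card {a \<in> \<Gamma>2. fst a - x \<in> W}) = card \<Gamma>2 * card W" by simp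
  have "\<exists>x\<in>G. card \<Gamma>2 * card W \<le> card G * card {a \<in> \<Gamma>2. fst a - x \<in> W}"
  proof (rule ccontr)
    assume "\<not> ?thesis"
    hence "\<And>x. x \<in> G \<Longrightarrow> card G * card {a \<in> \<Gamma>2. fst a - x \<in> W} < card \<Gamma>2 * card W" by force
    hence "(\<Sum>x\<in>G. card G * card {a \<in> \<Gamma>2. fst a - x \<in> W}) < (\<Sum>x\<in>G. card \<Gamma>2 * card W)"
      using finite_G G_0 by (intro sum_strict_mono) auto
    thus False using tot by (simp add: sum_distrib_left[symmetric])
  qed
  then obtain x where x: "x \<in> G" "card \<Gamma>2 * card W \<le> card G * card {a \<in> \<Gamma>2. fst a - x \<in> W}" by blast
  let ?S = "{a \<in> \<Gamma>2. fst a - x \<in> W}"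
  have "(\<tau> * q) * q \<le> real (card \<Gamma>2) * real (CARD('p) ^ r * card W)"
  proof (rule mult_mono)
    show "\<tau> * q \<le> real (card \<Gamma>2)" using cY by (simp add: Y_def card_image[OF inj2])
    show "q \<le> real (CARD('p) ^ r * card W)" using W(3) by (simp only: of_nat_le_iff)
  qed auto
  also have "\<dots> = real (CARD('p) ^ r) * real (card \<Gamma>2 * card W)" by simp
  also have "\<dots> \<le> real (CARD('p) ^ r) * real (card G * card ?S)"
    using x by (intro mult_left_mono of_nat_mono) auto
  finally have "q * (\<tau> * q) \<le> q * (real CARD('p) ^ r * real (card ?S))" by (simp add: mult_ac)
  hence S: "\<tau> * q \<le> real CARD('p) ^ r * real (card ?S)" using q_pos by (simp only: mult_le_cancel_left_pos)
  have "\<tau> * q > 0" using \<tau>0 q_pos by simp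
  hence "card ?S \<noteq> 0" using S by (intro notI) simp
  hence "?S \<noteq> {}" by (metis card.empty)
  then obtain b where b: "b \<in> \<Gamma>2" "fst b - x \<in> W" by blast
  define c0 where "c0 = snd b - g (fst b)"
  have "?S \<subseteq> {a \<in> \<Gamma>. snd a = g (fst a) + c0}"
  proof
    fix a assume a: "a \<in> ?S"
    have "(fst a - x) - (fst b - x) \<in> W" using a b W(1) V.subspace_diff by blast
    hence "fst a - fst b \<in> W" by simp
    hence "snd a - snd b = g (fst a - fst b)" using g(3) a b by blast
    hence "snd a = g (fst a) + c0" by (simp add: g.diff c0_def algebra_simps)
    thus "a \<in> {a \<in> \<Gamma>. snd a = g (fst a) + c0}" using a \<Gamma>2(1) \<Gamma>1(1) by auto
  qed
  hence "card ?S \<le> card {a \<in> \<Gamma>. snd a = g (fst a) + c0}" using f\<Gamma> by (intro card_mono) auto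
  hence "real CARD('p) ^ r * real (card ?S) \<le> real CARD('p) ^ r * real (card {a \<in> \<Gamma>. snd a = g (fst a) + c0})"
    by (intro mult_left_mono) auto
  hence "\<tau> * q \<le> real CARD('p) ^ r * real (card {a \<in> \<Gamma>. snd a = g (fst a) + c0})" using S by linarith
  moreover have "c0 \<in> G" using b G2 g(2) by (auto simp: c0_def)
  ultimately show ?thesis using that g W(4) by blast
qed

end

lemma pigeonhole_fibre:
  assumes B: "finite B" and C: "finite C" "C \<noteq> {}" and f: "\<And>b. b \<in> B \<Longrightarrow> f b \<in> C"
  obtains c where "c \<in> C" "card B \<le> card C * card {b \<in> B. f b = c}"
proof -
  have tot: "card B = (\<Sum>c\<in>C. card {b \<in> B. f b = c})"
  proof -
    have "B = (\<Union>c\<in>C. {b \<in> B. f b = c})" using f by auto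
    also have "card \<dots> = (\<Sum>c\<in>C. card {b \<in> B. f b = c})"
      by (rule card_UN_disjoint) (use B C in auto)
    finally show ?thesis .
  qed
  have "\<exists>c\<in>C. card B \<le> card C * card {b \<in> B. f b = c}"
  proof (rule ccontr)
    assume "\<not> ?thesis"
    hence "(\<Sum>c\<in>C. card C * card {b \<in> B. f b = c}) < (\<Sum>c\<in>C. card B)"
      using C by (intro sum_strict_mono) (auto simp: not_le)
    thus False using tot by (simp add: sum_distrib_left[symmetric])
  qed
  thus ?thesis using that by blast
qed

text \<open>Signs are booleans, so that one pattern acts alike on points, on coefficients in the
  field and on pairs.\<close>

definition sg :: "bool \<Rightarrow> 'a::ab_group_add \<Rightarrow> 'a" where
  "sg b x = (if b then - x else x)"

lemma sg_simps [simp]: "sg b 0 = 0" "sg b (x + y) = sg b x + sg b y" "sg b (x - y) = sg b x - sg b y"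
  "sg b (- x) = - sg b x" "sg b (sg b x) = x" "fst (sg b z) = sg b (fst z)" "snd (sg b z) = sg b (snd z)"
  by (auto simp: sg_def)

lemma sg_inj: "sg b x = sg b y \<longleftrightarrow> x = y"
  by (auto simp: sg_def)

context fin_space
begin

subsection \<open>Additive energy from many linear relations\<close>

lemma sg_G [simp, intro]: "x \<in> G \<Longrightarrow> sg b x \<in> G"
  by (simp add: sg_def)

lemma tuples_agree:
  assumes I: "finite I" "i \<in> I" and t: "t \<in> extensional I" "s \<in> extensional I"
    and agree: "\<And>j. j \<in> I - {i} \<Longrightarrow> t j = s j"
    and sums: "(\<Sum>j\<in>I. sg (\<epsilon> j) (t j)) = (\<Sum>j\<in>I. sg (\<epsilon> j) (s j :: 'v))"
  shows "t = s"
proof -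
  have "(\<Sum>j\<in>I - {i}. sg (\<epsilon> j) (t j)) = (\<Sum>j\<in>I - {i}. sg (\<epsilon> j) (s j))"
    using agree by (intro sum.cong) auto
  hence "sg (\<epsilon> i) (t i) = sg (\<epsilon> i) (s i)"
    using sums by (simp add: sum.remove[OF I])
  hence "t i = s i" by (simp add: sg_inj)
  thus ?thesis using t agree by (intro extensionalityI[OF t]) auto
qed

text \<open>Two relations that agree outside \<open>i0\<close> and \<open>i1\<close> show a
  difference of graph points over \<open>D i0\<close> to be, up to sign, one of graph points over
  \<open>D i1\<close>. Cauchy--Schwarz produces many such coincidences, so many differences of
  \<open>\<Gamma>\<close> are attained often.\<close>

lemma relations_popular_differences:
  fixes f :: "nat \<Rightarrow> 'v \<Rightarrow> 'v" and D :: "nat \<Rightarrow> 'v set"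
  assumes I: "finite I" "card I \<ge> 3" "i0 \<in> I" and DG: "\<And>i. i \<in> I \<Longrightarrow> D i \<subseteq> G"
    and \<beta>: "\<beta> \<ge> 0"
    and many: "\<beta> * q ^ (card I - 1) \<le> real (card {t \<in> PiE I D.
       (\<Sum>i\<in>I. sg (\<epsilon> i) (t i)) = 0 \<and> (\<Sum>i\<in>I. sg (\<epsilon> i) (f i (t i))) = 0})"
    and \<Gamma>: "\<Gamma> = (\<lambda>y. (y, f i0 y)) ` D i0"
  shows "\<beta>\<^sup>2 / 2 * q\<^sup>2 \<le> real (card {z \<in> \<Gamma> \<times> \<Gamma>. \<beta>\<^sup>2 / 2 * q \<le> real (card (diff_reps \<Gamma> (fst z - snd z)))})"
proof -
  define T where "T = {t \<in> PiE I D. (\<Sum>i\<in>I. sg (\<epsilon> i) (t i)) = 0 \<and> (\<Sum>i\<in>I. sg (\<epsilon> i) (f i (t i))) = 0}"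
  have "card (I - {i0}) \<ge> 2" using I by simp
  then obtain i1 where i1: "i1 \<in> I" "i1 \<noteq> i0"
    by (metis DiffE card.empty ex_in_conv insertI1 not_numeral_le_zero)
  have "card (I - {i0} - {i1}) \<ge> 1" using I i1 by simp
  then obtain i2 where i2: "i2 \<in> I" "i2 \<noteq> i0" "i2 \<noteq> i1"
    by (metis DiffE card.empty ex_in_conv insertI1 not_one_le_zero)
  define J where "J = I - {i0, i1}"
  \<comment> \<open>The vanishing signed sum determines the coordinate \<open>i2\<close>, so it need
    not be recorded; this saves the factor \<open>q\<close> that makes \<open>Q\<close> large and is
    the reason for three indices.\<close>
  define J' where "J' = J - {i2}"
  have fJ: "finite J" "finite J'" using I by (simp_all add: J_def J'_def)
  have cJ: "card J = card I - 2" "card J' = card I - 3"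
    using I i1 i2 by (simp_all add: J_def J'_def card_Diff_subset)
  have I_eq: "I = insert i0 (insert i1 J)" using I i1 by (auto simp: J_def)
  have fD: "finite (D i)" if "i \<in> I" for i using DG[OF that] finite_sub by blast
  have fT: "finite T" using I fD by (auto simp: T_def intro!: finite_subset[OF _ finite_PiE[of I D]])
  let ?R = "PiE J (\<lambda>_. G)"
  have fR: "finite ?R" using fJ finite_G by (simp add: finite_PiE)
  have cR: "real (card ?R) = q ^ (card I - 2)" using fJ by (simp add: card_PiE cJ)
  define n where "n r = real (card {t \<in> T. restrict t J = r})" for r
  have TR: "restrict t J \<in> ?R" if "t \<in> T" for t
    using that DG by (auto simp: T_def J_def PiE_iff)
  have sumn: "(\<Sum>r\<in>?R. n r) = real (card T)"
  proof -
    have "T = (\<Union>r\<in>?R. {t \<in> T. restrict t J = r})" using TR by auto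
    also have "card \<dots> = (\<Sum>r\<in>?R. card {t \<in> T. restrict t J = r})"
      by (rule card_UN_disjoint) (use fR fT in auto)
    finally show ?thesis by (simp only: n_def of_nat_sum)
  qed
  define Pp where "Pp = {(t, t'). t \<in> T \<and> t' \<in> T \<and> restrict t J = restrict t' J}"
  have fPp: "finite Pp" by (rule finite_subset[of _ "T \<times> T"]) (auto simp: Pp_def fT)
  have cPp: "real (card Pp) = (\<Sum>r\<in>?R. (n r)\<^sup>2)"
  proof -
    have "Pp = (\<Union>r\<in>?R. {t \<in> T. restrict t J = r} \<times> {t \<in> T. restrict t J = r})"
      using TR by (auto simp: Pp_def)
    also have "card \<dots> = (\<Sum>r\<in>?R. card ({t \<in> T. restrict t J = r} \<times> {t \<in> T. restrict t J = r}))"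
      by (rule card_UN_disjoint) (use fR fT in auto)
    finally show ?thesis
      by (simp only: n_def card_cartesian_product power2_eq_square of_nat_sum of_nat_mult)
  qed
  have qI: "q ^ (card I - 1) = q * q ^ (card I - 2)"
    using I(2) by (metis One_nat_def Suc_diff_Suc numeral_2_eq_2 numeral_3_eq_3 Suc_le_eq diff_Suc_1 le_less_trans lessI less_imp_le_nat power_Suc Suc_le_lessD)
  \<comment> \<open>Cauchy--Schwarz as a nonnegative sum of squares about the fibre size
    \<open>\<beta> * q\<close>.\<close>
  have "0 \<le> (\<Sum>r\<in>?R. (n r - \<beta> * q)\<^sup>2)" by (rule sum_nonneg) simp
  also have "\<dots> = (\<Sum>r\<in>?R. (n r)\<^sup>2) - 2 * (\<beta> * q) * (\<Sum>r\<in>?R. n r) + real (card ?R) * (\<beta> * q)\<^sup>2"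
    by (simp add: power2_diff sum.distrib sum_subtractf sum_distrib_left mult_ac)
  finally have 1: "2 * (\<beta> * q) * real (card T) - q ^ (card I - 2) * (\<beta> * q)\<^sup>2 \<le> real (card Pp)"
    by (simp add: sumn cPp cR)
  have "2 * (\<beta> * q) * (\<beta> * q ^ (card I - 1)) \<le> 2 * (\<beta> * q) * real (card T)"
    using many \<beta> by (intro mult_left_mono) (auto simp: T_def)
  hence Pp_ge: "\<beta>\<^sup>2 * q\<^sup>2 * q ^ (card I - 2) \<le> real (card Pp)"
    using 1 unfolding qI by (simp add: power2_eq_square algebra_simps)
  define lift where "lift i y = (y, f i y)" for i y
  \<comment> \<open>Equal signs at \<open>i0\<close> and \<open>i1\<close> reverse the direction in
    which the second difference compensates the first.\<close>
  define h where "h b = (if \<epsilon> i0 = \<epsilon> i1 then lift i1 (snd b) - lift i1 (fst b) else lift i1 (fst b) - lift i1 (snd b))" for b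
  define Q where "Q = {(z, b). z \<in> \<Gamma> \<times> \<Gamma> \<and> b \<in> D i1 \<times> D i1 \<and> fst z - snd z = h b}"
  have f\<Gamma>: "finite \<Gamma>" using fD I by (simp add: \<Gamma>)
  have fD1: "finite (D i1)" using fD i1 by simp
  have fQ: "finite Q"
    by (rule finite_subset[of _ "(\<Gamma> \<times> \<Gamma>) \<times> (D i1 \<times> D i1)"]) (auto simp: Q_def f\<Gamma> fD1)
  define F where "F = (\<lambda>(t, t'). (((lift i0 (t i0), lift i0 (t' i0)), (t i1, t' i1)), restrict t J'))"
  have sumI: "(\<Sum>i\<in>I. g i) = g i0 + (g i1 + (\<Sum>i\<in>J. g i))" for g :: "nat \<Rightarrow> 'v"
    unfolding I_eq using fJ i1 by (simp add: J_def)
  have "card Pp \<le> card (Q \<times> PiE J' (\<lambda>_. G))"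
  proof (rule card_inj_on_le[where f = F])
    show "inj_on F Pp"
    proof (rule inj_onI)
      fix w w' assume w: "w \<in> Pp" "w' \<in> Pp" "F w = F w'"
      obtain t t' s s' where wd: "w = (t, t')" "w' = (s, s')" by (metis surj_pair)
      have T: "t \<in> T" "t' \<in> T" "s \<in> T" "s' \<in> T" and rJ: "restrict t J = restrict t' J" "restrict s J = restrict s' J"
        using w by (auto simp: wd Pp_def)
      have e: "t i0 = s i0" "t' i0 = s' i0" "t i1 = s i1" "t' i1 = s' i1" "restrict t J' = restrict s J'"
        using w(3) by (auto simp: F_def wd lift_def)
      have ext: "t \<in> extensional I" "t' \<in> extensional I" "s \<in> extensional I" "s' \<in> extensional I"
        using T by (auto simp: T_def PiE_iff)
      have "t = s"
      proof (rule tuples_agree[where \<epsilon> = \<epsilon>, OF I(1) i2(1) ext(1,3)])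
        fix j assume j: "j \<in> I - {i2}"
        show "t j = s j"
        proof (cases "j \<in> J'")
          case True thus ?thesis using e(5) by (metis restrict_apply')
        next
          case False
          hence "j = i0 \<or> j = i1" using j by (auto simp: J'_def J_def)
          thus ?thesis using e by auto
        qed
      qed (use T in \<open>simp add: T_def\<close>)
      moreover have "t' = s'"
      proof (rule extensionalityI[OF ext(2,4)])
        fix j assume j: "j \<in> I"
        show "t' j = s' j"
        proof (cases "j \<in> J")
          case True thus ?thesis using rJ \<open>t = s\<close> by (metis restrict_apply')
        next
          case False
          hence "j = i0 \<or> j = i1" using j by (auto simp: J_def)
          thus ?thesis using e by auto
        qed
      qed
      ultimately show "w = w'" by (simp add: wd)
    qed
    show "F ` Pp \<subseteq> Q \<times> PiE J' (\<lambda>_. G)"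
    proof
      fix x assume "x \<in> F ` Pp"
      then obtain t t' where tt: "(t, t') \<in> Pp" "x = F (t, t')" by auto
      have T: "t \<in> T" "t' \<in> T" and rJ: "restrict t J = restrict t' J" using tt by (auto simp: Pp_def)
      have J: "t j = t' j" if "j \<in> J" for j using rJ that by (metis restrict_apply')
      have s1: "sg (\<epsilon> i0) (t i0) + (sg (\<epsilon> i1) (t i1) + (\<Sum>i\<in>J. sg (\<epsilon> i) (t i))) = 0"
        "sg (\<epsilon> i0) (t' i0) + (sg (\<epsilon> i1) (t' i1) + (\<Sum>i\<in>J. sg (\<epsilon> i) (t i))) = 0"
        "sg (\<epsilon> i0) (f i0 (t i0)) + (sg (\<epsilon> i1) (f i1 (t i1)) + (\<Sum>i\<in>J. sg (\<epsilon> i) (f i (t i)))) = 0"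
        "sg (\<epsilon> i0) (f i0 (t' i0)) + (sg (\<epsilon> i1) (f i1 (t' i1)) + (\<Sum>i\<in>J. sg (\<epsilon> i) (f i (t i)))) = 0"
        using T sumI[of "\<lambda>i. sg (\<epsilon> i) (t i)"] sumI[of "\<lambda>i. sg (\<epsilon> i) (t' i)"]
          sumI[of "\<lambda>i. sg (\<epsilon> i) (f i (t i))"] sumI[of "\<lambda>i. sg (\<epsilon> i) (f i (t' i))"] J
        by (simp_all add: T_def)
      have cancel: "a - a' = (if b0 = b1 then c' - c else c - c')"
        if "sg b0 a + (sg b1 c + S) = 0" "sg b0 a' + (sg b1 c' + S) = 0" for a a' c c' S :: 'v and b0 b1
      proof -
        have "sg b0 a + sg b1 c = sg b0 a' + sg b1 c'"
          using that by (metis add.assoc add_right_cancel)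
        thus ?thesis by (cases b0; cases b1) (auto simp: sg_def algebra_simps)
      qed
      have "lift i0 (t i0) - lift i0 (t' i0) = h (t i1, t' i1)"
        using cancel[OF s1(1,2)] cancel[OF s1(3,4)] by (auto simp: h_def lift_def)
      moreover have "t i0 \<in> D i0" "t' i0 \<in> D i0" "t i1 \<in> D i1" "t' i1 \<in> D i1"
        using T I i1 by (auto simp: T_def)
      moreover have "restrict t J' \<in> PiE J' (\<lambda>_. G)"
        using T DG by (auto simp: T_def J'_def J_def PiE_iff)
      ultimately show "x \<in> Q \<times> PiE J' (\<lambda>_. G)"
        by (auto simp: tt F_def Q_def \<Gamma> lift_def)
    qed
    show "finite (Q \<times> PiE J' (\<lambda>_. G))" using fQ fJ finite_G by (simp add: finite_PiE)
  qed
  hence "real (card Pp) \<le> real (card Q) * q ^ (card I - 3)"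
    using fJ by (simp add: card_cartesian_product card_PiE cJ flip: of_nat_mult of_nat_power)
  moreover have "\<beta>\<^sup>2 * q\<^sup>2 * q ^ (card I - 2) = (\<beta>\<^sup>2 * q ^ 3) * q ^ (card I - 3)"
  proof -
    have "card I - 2 = Suc (card I - 3)" using I by simp
    thus ?thesis by (simp add: power2_eq_square power3_eq_cube)
  qed
  ultimately have "(\<beta>\<^sup>2 * q ^ 3) * q ^ (card I - 3) \<le> real (card Q) * q ^ (card I - 3)"
    using Pp_ge by linarith
  hence Q_ge: "\<beta>\<^sup>2 * q ^ 3 \<le> real (card Q)" using q_pos by (simp add: mult_le_cancel_right_pos)
  define c where "c = \<beta>\<^sup>2 / 2"
  define pop where "pop = {z \<in> \<Gamma> \<times> \<Gamma>. c * q \<le> real (card (diff_reps \<Gamma> (fst z - snd z)))}"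
  have fpop: "finite pop" using f\<Gamma> by (simp add: pop_def)
  \<comment> \<open>Over a popular \<open>z\<close> there are at most \<open>q\<close> pairs
    \<open>b\<close>; over each \<open>b\<close> there are at most \<open>c * q\<close> unpopular
    \<open>z\<close>. As \<open>c\<close> is half of \<open>\<beta> ^ 2\<close>, the unpopular part
    takes at most half of the lower bound for \<open>Q\<close>.\<close>
  have "Q \<subseteq> (SIGMA z:pop. {b \<in> D i1 \<times> D i1. fst z - snd z = h b})
     \<union> prod.swap ` (SIGMA b:D i1 \<times> D i1. {z \<in> \<Gamma> \<times> \<Gamma> - pop. fst z - snd z = h b})"
    by (auto simp: Q_def image_iff)
  hence "card Q \<le> card (SIGMA z:pop. {b \<in> D i1 \<times> D i1. fst z - snd z = h b})
     + card (prod.swap ` (SIGMA b:D i1 \<times> D i1. {z \<in> \<Gamma> \<times> \<Gamma> - pop. fst z - snd z = h b}))"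
    using fpop fD1 f\<Gamma> by (intro order_trans[OF card_mono card_Un_le]) auto
  also have "card (prod.swap ` (SIGMA b:D i1 \<times> D i1. {z \<in> \<Gamma> \<times> \<Gamma> - pop. fst z - snd z = h b}))
     = card (SIGMA b:D i1 \<times> D i1. {z \<in> \<Gamma> \<times> \<Gamma> - pop. fst z - snd z = h b})"
    by (intro card_image) (auto simp: inj_on_def)
  finally have Qle: "real (card Q) \<le> real (card (SIGMA z:pop. {b \<in> D i1 \<times> D i1. fst z - snd z = h b}))
     + real (card (SIGMA b:D i1 \<times> D i1. {z \<in> \<Gamma> \<times> \<Gamma> - pop. fst z - snd z = h b}))" by linarith
  have cD1: "real (card (D i1)) \<le> q" using DG[OF i1(1)] finite_G by (intro of_nat_mono card_mono)
  have "real (card (SIGMA z:pop. {b \<in> D i1 \<times> D i1. fst z - snd z = h b}))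
      = (\<Sum>z\<in>pop. real (card {b \<in> D i1 \<times> D i1. fst z - snd z = h b}))"
    using fpop fD1 by simp
  also have "\<dots> \<le> (\<Sum>z\<in>pop. q)"
  proof (rule sum_mono)
    fix z assume "z \<in> pop"
    have "card {b \<in> D i1 \<times> D i1. fst z - snd z = h b} \<le> card (D i1)"
      by (rule card_inj_on_le[where f = fst])
         (auto simp: inj_on_def h_def lift_def fD1 split: if_splits)
    thus "real (card {b \<in> D i1 \<times> D i1. fst z - snd z = h b}) \<le> q" using cD1 by linarith
  qed
  finally have p1: "real (card (SIGMA z:pop. {b \<in> D i1 \<times> D i1. fst z - snd z = h b})) \<le> real (card pop) * q" by simp
  have "real (card (SIGMA b:D i1 \<times> D i1. {z \<in> \<Gamma> \<times> \<Gamma> - pop. fst z - snd z = h b}))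
     = (\<Sum>b\<in>D i1 \<times> D i1. real (card {z \<in> \<Gamma> \<times> \<Gamma> - pop. fst z - snd z = h b}))"
    using f\<Gamma> fD1 by simp
  also have "\<dots> \<le> (\<Sum>b\<in>D i1 \<times> D i1. c * q)"
  proof (rule sum_mono)
    fix b
    let ?Z = "{z \<in> \<Gamma> \<times> \<Gamma> - pop. fst z - snd z = h b}"
    show "real (card ?Z) \<le> c * q"
    proof (cases "?Z = {}")
      case True
      have "0 \<le> c * q" by (simp add: c_def)
      thus ?thesis by (simp only: True card.empty of_nat_0)
    next
      case False
      then obtain z where z: "z \<in> ?Z" by blast
      have "?Z \<subseteq> diff_reps \<Gamma> (fst z - snd z)" using z by (auto simp: diff_reps_def)
      hence "card ?Z \<le> card (diff_reps \<Gamma> (fst z - snd z))" using f\<Gamma> by (intro card_mono) auto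
      moreover have "real (card (diff_reps \<Gamma> (fst z - snd z))) < c * q" using z by (auto simp: pop_def)
      ultimately show ?thesis by linarith
    qed
  qed
  also have "\<dots> = real (card (D i1)) * real (card (D i1)) * (c * q)" by (simp add: card_cartesian_product)
  also have "\<dots> \<le> q * q * (c * q)"
    using cD1 by (intro mult_right_mono mult_mono) (auto simp: c_def)
  finally have "\<beta>\<^sup>2 * q ^ 3 \<le> real (card pop) * q + c * q ^ 3"
    using Q_ge Qle p1 by (simp add: power3_eq_cube mult_ac)
  hence "(c * q\<^sup>2) * q \<le> real (card pop) * q" by (simp add: c_def power2_eq_square power3_eq_cube)
  hence "c * q\<^sup>2 \<le> real (card pop)" using q_pos by (simp only: mult_le_cancel_right_pos)
  thus ?thesis by (simp add: pop_def c_def)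
qed

subsection \<open>A maximal family of affine maps\<close>

definition aff :: "('v \<Rightarrow> 'v) \<times> 'v \<Rightarrow> 'v \<Rightarrow> 'v" where
  "aff L y = fst L y + snd L"

definition is_aff :: "('v \<Rightarrow> 'v) \<times> 'v \<Rightarrow> bool" where
  "is_aff L \<longleftrightarrow> lin (fst L) \<and> (\<forall>x. fst L x \<in> G) \<and> snd L \<in> G"

definition explained :: "(nat \<Rightarrow> ('v \<Rightarrow> 'v) \<times> 'v) \<Rightarrow> ('v \<Rightarrow> nat set) \<Rightarrow> 'v \<Rightarrow> 'v set" where
  "explained Ls I y = V.span ((\<lambda>i. aff (Ls i) y) ` I y)"

text \<open>The set \<open>I y\<close> lists the maps selected at \<open>y\<close>. That their
  values are independent is recorded only through the size of the span. The last conjunct is the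
  potential: on average every map has been selected at \<open>\<eta> * q\<close> points.\<close>

definition valid_state where
  "valid_state Y U \<eta> k Ls I \<longleftrightarrow> (\<forall>i<k. is_aff (Ls i))
     \<and> (\<forall>y\<in>Y. I y \<subseteq> {..<k} \<and> explained Ls I y \<subseteq> U y \<and> 2 ^ card (I y) \<le> card (explained Ls I y))
     \<and> real k * \<eta> * q \<le> (\<Sum>y\<in>Y. real (card (I y)))"

lemma card_span_insert:
  assumes f: "finite (V.span (insert v S))" and v: "v \<notin> V.span S"
  shows "2 * card (V.span S) \<le> card (V.span (insert v S))"
proof -
  have sub: "V.span S \<subseteq> V.span (insert v S)" by (rule V.span_mono) auto
  have v': "v \<in> V.span (insert v S)" by (rule V.span_base) simp
  have fS: "finite (V.span S)" using f sub finite_subset by blast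
  have "V.span S \<inter> (\<lambda>x. x + v) ` V.span S = {}"
    using v by (auto simp: V.span_add_eq)
  hence "card (V.span S) + card ((\<lambda>x. x + v) ` V.span S) = card (V.span S \<union> (\<lambda>x. x + v) ` V.span S)"
    using fS by (intro card_Un_disjoint[symmetric]) auto
  also have "\<dots> \<le> card (V.span (insert v S))"
    using sub v' V.span_add by (intro card_mono f) blast
  finally show ?thesis by (simp add: card_translate)
qed

text \<open>A map that takes new values in the \<open>U y\<close> at \<open>\<eta> * q\<close>
  points can be appended, which raises the total number of selections by that much. Each
  \<open>U y\<close> has room for at most \<open>D\<close> independent values, so the total never
  exceeds \<open>D * q\<close> and a longest family exists.\<close>

lemma greedy_maps:
  assumes Y: "Y \<subseteq> G" and U: "\<And>y. y \<in> Y \<Longrightarrow> V.subspace (U y)" "\<And>y. y \<in> Y \<Longrightarrow> U y \<subseteq> G"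
    "\<And>y. y \<in> Y \<Longrightarrow> card (U y) \<le> 2 ^ D" and \<eta>: "0 < \<eta>"
  obtains k Ls I where "\<And>i. i < k \<Longrightarrow> is_aff (Ls i)"
    "\<And>y. y \<in> Y \<Longrightarrow> I y \<subseteq> {..<k}" "\<And>y. y \<in> Y \<Longrightarrow> explained Ls I y \<subseteq> U y"
    "\<And>y. y \<in> Y \<Longrightarrow> card (I y) \<le> D" "real k * \<eta> \<le> real D"
    "\<And>L. is_aff L \<Longrightarrow> real (card {y \<in> Y. aff L y \<in> U y \<and> aff L y \<notin> explained Ls I y}) < \<eta> * q"
proof -
  have fY: "finite Y" using Y finite_sub by blast
  have cY: "real (card Y) \<le> q" using Y finite_G by (intro of_nat_mono card_mono)
  have cI: "card (I y) \<le> D" if v: "valid_state Y U \<eta> k Ls I" and y: "y \<in> Y" for k Ls I y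
  proof -
    have "2 ^ card (I y) \<le> card (explained Ls I y)" "explained Ls I y \<subseteq> U y"
      using v y by (auto simp: valid_state_def)
    moreover have "card (explained Ls I y) \<le> card (U y)"
      using calculation(2) U(2)[OF y] finite_sub by (intro card_mono) auto
    ultimately have "(2::nat) ^ card (I y) \<le> 2 ^ D" using U(3)[OF y] by linarith
    thus ?thesis by (simp add: power_le_imp_le_exp)
  qed
  have kD: "real k * \<eta> \<le> real D" if v: "valid_state Y U \<eta> k Ls I" for k Ls I
  proof -
    have "real k * \<eta> * q \<le> (\<Sum>y\<in>Y. real (card (I y)))" using v by (simp add: valid_state_def)
    also have "\<dots> \<le> (\<Sum>y\<in>Y. real D)" using cI[OF v] by (intro sum_mono) simp
    also have "\<dots> \<le> real D * q" using mult_right_mono[OF cY, of "real D"] by (simp add: mult.commute)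
    finally show ?thesis using q_pos by (simp only: mult_le_cancel_right_pos)
  qed
  define P where "P k = (\<exists>Ls I. valid_state Y U \<eta> k Ls I)" for k
  have "P 0"
    unfolding P_def
  proof (intro exI)
    show "valid_state Y U \<eta> 0 (\<lambda>_. undefined) (\<lambda>_. {})"
      using U(1) V.subspace_0 by (auto simp: valid_state_def explained_def)
  qed
  moreover have "k \<le> nat \<lceil>real D / \<eta>\<rceil>" if "P k" for k
  proof -
    have "real k \<le> real D / \<eta>" using that kD \<eta> by (auto simp: P_def field_simps)
    thus ?thesis by linarith
  qed
  ultimately obtain k where k: "P k" "\<And>k'. P k' \<Longrightarrow> k' \<le> k"
    using GreatestI_nat[of P 0] Greatest_le_nat[of P] by blast
  then obtain Ls I where v: "valid_state Y U \<eta> k Ls I" by (auto simp: P_def)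
  have "real (card {y \<in> Y. aff L y \<in> U y \<and> aff L y \<notin> explained Ls I y}) < \<eta> * q" if L: "is_aff L" for L
  proof (rule ccontr)
    let ?N = "{y \<in> Y. aff L y \<in> U y \<and> aff L y \<notin> explained Ls I y}"
    assume "\<not> ?thesis"
    hence N: "\<eta> * q \<le> real (card ?N)" by simp
    define Ls' where "Ls' = Ls(k := L)"
    define I' where "I' y = (if y \<in> ?N then insert k (I y) else I y)" for y
    have Ik: "I y \<subseteq> {..<k}" "finite (I y)" "k \<notin> I y" if "y \<in> Y" for y
    proof -
      show "I y \<subseteq> {..<k}" using v that by (simp add: valid_state_def)
      thus "finite (I y)" "k \<notin> I y" using finite_subset by auto
    qed
    have same: "(\<lambda>i. aff (Ls' i) y) ` I y = (\<lambda>i. aff (Ls i) y) ` I y" if "y \<in> Y" for y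
      using Ik(3)[OF that] by (auto simp: Ls'_def)
    have new: "explained Ls' I' y = V.span (insert (aff L y) ((\<lambda>i. aff (Ls i) y) ` I y))" if "y \<in> ?N" for y
    proof -
      have "(\<lambda>i. aff (Ls' i) y) ` I' y = insert (aff (Ls' k) y) ((\<lambda>i. aff (Ls' i) y) ` I y)"
        using that by (simp add: I'_def)
      thus ?thesis using same[of y] that by (simp add: explained_def Ls'_def)
    qed
    have old: "explained Ls' I' y = explained Ls I y" if "y \<in> Y" "y \<notin> ?N" for y
    proof -
      have "I' y = I y" unfolding I'_def using that(2) by (rule if_not_P)
      thus ?thesis using same[OF that(1)] by (simp add: explained_def)
    qed
    have "valid_state Y U \<eta> (Suc k) Ls' I'"
      unfolding valid_state_def
    proof (intro conjI allI impI ballI)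
      fix i assume "i < Suc k"
      thus "is_aff (Ls' i)" using v L by (auto simp: Ls'_def valid_state_def less_Suc_eq)
    next
      fix y assume y: "y \<in> Y"
      show "I' y \<subseteq> {..<Suc k}" using Ik(1)[OF y] by (auto simp: I'_def)
      have vy: "explained Ls I y \<subseteq> U y" "2 ^ card (I y) \<le> card (explained Ls I y)"
        using v y by (auto simp: valid_state_def)
      show "explained Ls' I' y \<subseteq> U y"
      proof (cases "y \<in> ?N")
        case True
        have "(\<lambda>i. aff (Ls i) y) ` I y \<subseteq> U y"
          using vy(1) V.span_superset unfolding explained_def by blast
        thus ?thesis using True unfolding new[OF True] by (intro V.span_minimal U(1)[OF y]) auto
      next
        case False thus ?thesis using old[OF y] vy by simp
      qed
      hence f: "finite (explained Ls' I' y)" using U(2)[OF y] finite_sub by blast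
      show "2 ^ card (I' y) \<le> card (explained Ls' I' y)"
      proof (cases "y \<in> ?N")
        case True
        have "2 * card (explained Ls I y) \<le> card (explained Ls' I' y)"
          using card_span_insert[of "aff L y" "(\<lambda>i. aff (Ls i) y) ` I y"] f True
          unfolding new[OF True] by (simp add: explained_def)
        moreover have "card (I' y) = Suc (card (I y))" using True Ik[OF y] by (simp add: I'_def)
        ultimately show ?thesis using vy(2) by simp
      next
        case False
        hence "I' y = I y" unfolding I'_def by (rule if_not_P)
        thus ?thesis using old[OF y False] vy by simp
      qed
    next
      have "(\<Sum>y\<in>Y. real (card (I' y))) = (\<Sum>y\<in>Y. real (card (I y)) + of_bool (y \<in> ?N))"
        using Ik by (intro sum.cong refl) (auto simp: I'_def)
      also have "\<dots> = (\<Sum>y\<in>Y. real (card (I y))) + real (card ?N)"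
        using fY by (simp add: sum.distrib Int_def)
      also have "\<dots> \<ge> real k * \<eta> * q + \<eta> * q" using v N unfolding valid_state_def by linarith
      finally show "real (Suc k) * \<eta> * q \<le> (\<Sum>y\<in>Y. real (card (I' y)))"
        by (simp add: algebra_simps)
    qed
    hence "P (Suc k)" by (auto simp: P_def)
    thus False using k(2) by fastforce
  qed
  thus ?thesis using that[of k Ls I] v cI[OF v] kD[OF v] by (auto simp: valid_state_def)
qed

text \<open>Otherwise a pigeonhole fixes one selection function per position and the position of an
  unexplained value, still with many relations. The energy lemma and \<open>affine_agreement\<close>
  then give an affine map following the unexplained selection at more than \<open>\<eta> * q\<close>
  points, against \<open>terminal\<close>.\<close>

lemma few_unexplained:
  fixes U E :: "'v \<Rightarrow> 'v set"
  assumes n: "n \<ge> 3" and Y: "Y \<subseteq> G" and U: "\<And>y. y \<in> Y \<Longrightarrow> U y \<subseteq> G" "\<And>y. y \<in> Y \<Longrightarrow> U y \<noteq> {}"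
    "\<And>y. y \<in> Y \<Longrightarrow> card (U y) \<le> P"
    and terminal: "\<And>L. is_aff L \<Longrightarrow> real (card {y \<in> Y. aff L y \<in> U y \<and> aff L y \<notin> E y}) < \<eta> * q"
    and \<beta>: "\<beta> > 0" and P: "P > 0" and c: "c = (\<beta> / (real n * real P ^ n))\<^sup>2 / 2"
    and m: "(16384 / c ^ 10) ^ 13 < 2 ^ m" and \<tau>: "\<tau> = c / (4 * real CARD('p) ^ m)"
    and k: "k \<ge> 1" "32 / \<tau> \<le> 2 ^ k"
    and \<epsilon>: "\<epsilon> = 1 / (64 * real k)" and l: "2 * exp (- \<epsilon>\<^sup>2 * real l / 4) \<le> \<tau> * \<epsilon> / 2"
    and \<eta>: "\<And>r::nat. \<tau> ^ l / 2 * exp (real r / 32) \<le> 1 \<Longrightarrow> \<eta> * real CARD('p) ^ r \<le> \<tau>"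
  shows "real (card {t \<in> {..<n} \<rightarrow>\<^sub>E Y. (\<Sum>i<n. sg (\<sigma> i) (t i)) = 0 \<and>
     (\<exists>u. (\<forall>i<n. u i \<in> U (t i)) \<and> (\<Sum>i<n. sg (\<sigma> i) (u i)) = 0 \<and> (\<exists>i<n. u i \<notin> E (t i)))}) < \<beta> * q ^ (n - 1)"
proof (rule ccontr)
  define B where "B = {t \<in> {..<n} \<rightarrow>\<^sub>E Y. (\<Sum>i<n. sg (\<sigma> i) (t i)) = 0 \<and>
     (\<exists>u. (\<forall>i<n. u i \<in> U (t i)) \<and> (\<Sum>i<n. sg (\<sigma> i) (u i)) = 0 \<and> (\<exists>i<n. u i \<notin> E (t i)))}"
  assume "\<not> ?thesis"
  hence B_ge: "\<beta> * q ^ (n - 1) \<le> real (card B)" by (simp add: B_def)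
  have fY: "finite Y" using Y finite_sub by blast
  have fB: "finite B"
    by (rule finite_subset[of _ "{..<n} \<rightarrow>\<^sub>E Y"]) (auto simp: B_def fY finite_PiE)
  \<comment> \<open>Enumerations of common length \<open>P\<close>, padded by a repeated value where
    \<open>U y\<close> is smaller, turn a choice of elements of varying sets into a choice of
    indices from one finite set.\<close>
  have "\<exists>e. \<forall>y\<in>Y. U y = e y ` {..<P}"
  proof -
    have "\<exists>g. U y = g ` {..<P}" if y: "y \<in> Y" for y
    proof -
      have f: "finite (U y)" using U(1)[OF y] finite_sub by blast
      obtain g where g: "bij_betw g {..<card (U y)} (U y)"
        using ex_bij_betw_nat_finite[OF f] by (auto simp: atLeast0LessThan)
      obtain a where a: "a \<in> U y" using U(2)[OF y] by blast
      have "U y = (\<lambda>i. if i < card (U y) then g i else a) ` {..<P}"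
      proof (intro equalityI subsetI)
        fix x assume "x \<in> U y"
        then obtain i where "i < card (U y)" "x = g i" using g by (auto simp: bij_betw_def)
        thus "x \<in> (\<lambda>i. if i < card (U y) then g i else a) ` {..<P}" using U(3)[OF y] by force
      qed (use g a in \<open>auto simp: bij_betw_def\<close>)
      thus ?thesis by blast
    qed
    thus ?thesis by metis
  qed
  then obtain e where e: "\<And>y. y \<in> Y \<Longrightarrow> U y = e y ` {..<P}" by blast
  have "\<exists>mu. \<forall>t\<in>B. fst (mu t) \<in> {..<n} \<rightarrow>\<^sub>E {..<P} \<and> snd (mu t) < n
     \<and> (\<Sum>i<n. sg (\<sigma> i) (e (t i) (fst (mu t) i))) = 0
     \<and> e (t (snd (mu t))) (fst (mu t) (snd (mu t))) \<notin> E (t (snd (mu t)))"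
  proof (rule bchoice, rule ballI)
    fix t assume t: "t \<in> B"
    then obtain u j where u: "\<And>i. i < n \<Longrightarrow> u i \<in> U (t i)" "(\<Sum>i<n. sg (\<sigma> i) (u i)) = 0"
      and j: "j < n" "u j \<notin> E (t j)" by (auto simp: B_def)
    have tY: "t i \<in> Y" if "i < n" for i using t that by (auto simp: B_def)
    have "\<exists>a<P. u i = e (t i) a" if "i < n" for i using u(1)[OF that] e[OF tY[OF that]] by auto
    then obtain a where a: "\<And>i. i < n \<Longrightarrow> a i < P \<and> u i = e (t i) (a i)" by metis
    have "(\<Sum>i<n. sg (\<sigma> i) (e (t i) (restrict a {..<n} i))) = (\<Sum>i<n. sg (\<sigma> i) (u i))"
      using a by (intro sum.cong) auto
    thus "\<exists>x. fst x \<in> {..<n} \<rightarrow>\<^sub>E {..<P} \<and> snd x < n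
     \<and> (\<Sum>i<n. sg (\<sigma> i) (e (t i) (fst x i))) = 0 \<and> e (t (snd x)) (fst x (snd x)) \<notin> E (t (snd x))"
      using a u j by (intro exI[of _ "(restrict a {..<n}, j)"]) (auto simp: PiE_iff)
  qed
  then obtain mu where mu: "\<And>t. t \<in> B \<Longrightarrow> fst (mu t) \<in> {..<n} \<rightarrow>\<^sub>E {..<P} \<and> snd (mu t) < n
     \<and> (\<Sum>i<n. sg (\<sigma> i) (e (t i) (fst (mu t) i))) = 0
     \<and> e (t (snd (mu t))) (fst (mu t) (snd (mu t))) \<notin> E (t (snd (mu t)))" by blast
  let ?C = "({..<n} \<rightarrow>\<^sub>E {..<P}) \<times> {..<n}"
  have fC: "finite ?C" by (simp add: finite_PiE)
  have "{..<n} \<rightarrow>\<^sub>E {..<P} \<noteq> {}" using P by (auto simp: PiE_eq_empty_iff lessThan_empty_iff)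
  hence neC: "?C \<noteq> {}" using n by (auto simp: lessThan_empty_iff)
  have "mu t \<in> ?C" if "t \<in> B" for t using mu[OF that] by (cases "mu t") auto
  then obtain w where w: "w \<in> ?C" "card B \<le> card ?C * card {t \<in> B. mu t = w}"
    using pigeonhole_fibre[OF fB fC neC, of mu] by blast
  obtain a j where wd: "w = (a, j)" by (cases w)
  have j: "j < n" using w(1) wd by simp
  have aP: "a i < P" if "i < n" for i using w(1) wd that by (auto simp: PiE_iff)
  have cC: "real (card ?C) = real n * real P ^ n" by (simp add: card_cartesian_product card_PiE mult.commute)
  have cC0: "real n * real P ^ n > 0" using n P by simp
  \<comment> \<open>Position \<open>j\<close> keeps only those points where the selected value is
    unexplained, so the affine map found on \<open>D j\<close> is itself unexplained there.\<close>
  define D where "D i = (if i = j then {y \<in> Y. e y (a j) \<notin> E y} else Y)" for i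
  define f where "f i y = e y (a i)" for i y
  define \<beta>' where "\<beta>' = \<beta> / (real n * real P ^ n)"
  have "{t \<in> B. mu t = w} \<subseteq> {t \<in> PiE {..<n} D.
       (\<Sum>i<n. sg (\<sigma> i) (t i)) = 0 \<and> (\<Sum>i<n. sg (\<sigma> i) (f i (t i))) = 0}" (is "_ \<subseteq> ?T")
  proof
    fix t assume t: "t \<in> {t \<in> B. mu t = w}"
    hence "t \<in> {..<n} \<rightarrow>\<^sub>E Y" "(\<Sum>i<n. sg (\<sigma> i) (t i)) = 0" by (auto simp: B_def)
    moreover have "(\<Sum>i<n. sg (\<sigma> i) (f i (t i))) = 0" "e (t j) (a j) \<notin> E (t j)"
      using mu[of t] t by (auto simp: wd f_def)
    ultimately show "t \<in> ?T" by (auto simp: D_def PiE_iff)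
  qed
  moreover have fT: "finite ?T"
  proof -
    have "finite (D i)" for i using fY by (simp add: D_def)
    hence "finite (PiE {..<n} D)" by (intro finite_PiE) auto
    thus ?thesis by simp
  qed
  ultimately have "card {t \<in> B. mu t = w} \<le> card ?T" by (intro card_mono)
  hence "card B \<le> card ?C * card ?T" using w(2) by (meson le_trans mult_le_mono2)
  hence "real (card B) \<le> real (card ?C * card ?T)" by (simp only: of_nat_le_iff)
  hence "real (card B) \<le> (real n * real P ^ n) * real (card ?T)" by (simp only: of_nat_mult cC)
  hence "\<beta> * q ^ (n - 1) \<le> (real n * real P ^ n) * real (card ?T)" using B_ge by linarith
  hence many: "\<beta>' * q ^ (n - 1) \<le> real (card ?T)"
    using cC0 by (simp add: \<beta>'_def field_simps)
  define \<Gamma> where "\<Gamma> = (\<lambda>y. (y, f j y)) ` D j"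
  have fin: "finite {..<n}" "card {..<n} \<ge> 3" "j \<in> {..<n}" using n j by auto
  have DY: "D i \<subseteq> Y" for i by (auto simp: D_def)
  have "\<beta>'\<^sup>2 / 2 * q\<^sup>2 \<le> real (card {z \<in> \<Gamma> \<times> \<Gamma>. \<beta>'\<^sup>2 / 2 * q \<le> real (card (diff_reps \<Gamma> (fst z - snd z)))})"
  proof (rule relations_popular_differences[OF fin, where D = D and f = f and \<epsilon> = \<sigma>])
    show "D i \<subseteq> G" for i using DY Y by blast
    show "0 \<le> \<beta>'" unfolding \<beta>'_def using \<beta> by (intro divide_nonneg_nonneg) auto
    show "\<beta>' * q ^ (card {..<n} - 1) \<le> real (card ?T)" unfolding card_lessThan by (rule many)
    show "\<Gamma> = (\<lambda>y. (y, f j y)) ` D j" by (rule \<Gamma>_def)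
  qed
  hence pop: "c * q\<^sup>2 \<le> real (card {z \<in> \<Gamma> \<times> \<Gamma>. c * q \<le> real (card (diff_reps \<Gamma> (fst z - snd z)))})"
    by (simp add: c \<beta>'_def)
  have c0: "0 < c" unfolding c using \<beta> cC0 by (intro divide_pos_pos zero_less_power) auto
  have \<Gamma>G: "\<Gamma> \<subseteq> G \<times> G"
  proof
    fix x assume "x \<in> \<Gamma>"
    then obtain y where y: "y \<in> Y" "x = (y, e y (a j))" using DY by (auto simp: \<Gamma>_def f_def)
    have "e y (a j) \<in> U y" using e[OF y(1)] aP[OF j] by auto
    thus "x \<in> G \<times> G" using y Y U(1)[OF y(1)] by auto
  qed
  have inj: "inj_on fst \<Gamma>" by (auto simp: \<Gamma>_def inj_on_def)
  obtain g c0 r where g: "lin g" "\<And>x. g x \<in> G" "c0 \<in> G" "\<tau> ^ l / 2 * exp (real r / 32) \<le> 1"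
    and big: "\<tau> * q \<le> real CARD('p) ^ r * real (card {x \<in> \<Gamma>. snd x = g (fst x) + c0})"
    using affine_agreement[OF \<Gamma>G inj c0 pop m \<tau> k \<epsilon> l] by blast
  have aff: "is_aff (g, c0)" using g by (simp add: is_aff_def)
  let ?N = "{y \<in> Y. aff (g, c0) y \<in> U y \<and> aff (g, c0) y \<notin> E y}"
  have "card {x \<in> \<Gamma>. snd x = g (fst x) + c0} \<le> card ?N"
  proof (rule card_inj_on_le[where f = fst])
    show "inj_on fst {x \<in> \<Gamma>. snd x = g (fst x) + c0}" using inj by (rule inj_on_subset) auto
    show "fst ` {x \<in> \<Gamma>. snd x = g (fst x) + c0} \<subseteq> ?N"
    proof clarify
      fix y v assume "(y, v) \<in> \<Gamma>" "snd (y, v) = g (fst (y, v)) + c0"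
      hence y: "y \<in> Y" "e y (a j) \<notin> E y" "e y (a j) = aff (g, c0) y"
        by (auto simp: \<Gamma>_def f_def D_def aff_def)
      have "e y (a j) \<in> U y" using e[OF y(1)] aP[OF j] by auto
      thus "fst (y, v) \<in> Y \<and> aff (g, c0) (fst (y, v)) \<in> U (fst (y, v)) \<and> aff (g, c0) (fst (y, v)) \<notin> E (fst (y, v))"
        using y by simp
    qed
    show "finite ?N" using fY by simp
  qed
  hence "real CARD('p) ^ r * real (card {x \<in> \<Gamma>. snd x = g (fst x) + c0}) \<le> real CARD('p) ^ r * real (card ?N)"
    by (intro mult_left_mono) auto
  also have "\<dots> < real CARD('p) ^ r * (\<eta> * q)"
    using terminal[OF aff] by (intro mult_strict_left_mono) auto
  also have "\<dots> \<le> \<tau> * q" using mult_right_mono[OF \<eta>[OF g(4)], of q] by (simp add: mult_ac)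
  finally show False using big by linarith
qed

subsection \<open>Signed tuples with a given sum\<close>

definition tuples :: "nat \<Rightarrow> (nat \<Rightarrow> bool) \<Rightarrow> 'v set \<Rightarrow> 'v \<Rightarrow> (nat \<Rightarrow> 'v) set" where
  "tuples n \<sigma> Y z = {t \<in> {..<n} \<rightarrow>\<^sub>E Y. (\<Sum>i<n. sg (\<sigma> i) (t i)) = z}"

lemma finite_tuples: "finite Y \<Longrightarrow> finite (tuples n \<sigma> Y z)"
  by (simp add: tuples_def finite_PiE)

text \<open>Coordinate 0 is determined by the sum and the other coordinates.\<close>

lemma card_tuples_le:
  assumes n: "n \<ge> 1"
  shows "card (tuples n \<sigma> G z) \<le> card G ^ (n - 1)"
proof -
  have "card (tuples n \<sigma> G z) \<le> card ({1..<n} \<rightarrow>\<^sub>E G)"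
  proof (rule card_inj_on_le[where f = "\<lambda>t. restrict t {1..<n}"])
    show "inj_on (\<lambda>t. restrict t {1..<n}) (tuples n \<sigma> G z)"
    proof (rule inj_onI)
      fix t s assume ts: "t \<in> tuples n \<sigma> G z" "s \<in> tuples n \<sigma> G z" "restrict t {1..<n} = restrict s {1..<n}"
      show "t = s"
      proof (rule tuples_agree[where \<epsilon> = \<sigma> and I = "{..<n}" and i = 0])
        fix j assume "j \<in> {..<n} - {0}"
        hence "j \<in> {1..<n}" by auto
        thus "t j = s j" using ts(3) by (metis restrict_apply')
      qed (use ts n in \<open>auto simp: tuples_def PiE_iff\<close>)
    qed
    show "(\<lambda>t. restrict t {1..<n}) ` tuples n \<sigma> G z \<subseteq> {1..<n} \<rightarrow>\<^sub>E G"
      by (auto simp: tuples_def PiE_iff)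
  qed (simp add: finite_PiE finite_G)
  thus ?thesis by (simp add: card_PiE)
qed

subsection \<open>Combinations of linear maps modulo a subspace\<close>

definition comb :: "nat set \<Rightarrow> (nat \<Rightarrow> 'v \<Rightarrow> 'v) \<Rightarrow> (nat \<Rightarrow> 'p mod_ring) \<Rightarrow> 'v \<Rightarrow> 'v" where
  "comb J ls c y = (\<Sum>i\<in>J. c i *s ls i y)"

definition mod_ker :: "('v \<Rightarrow> 'v) \<Rightarrow> 'v set \<Rightarrow> 'v set" where
  "mod_ker f H = {y \<in> G. f y \<in> H}"

definition span_at :: "nat set \<Rightarrow> (nat \<Rightarrow> 'v \<Rightarrow> 'v) \<Rightarrow> 'v set \<Rightarrow> 'v \<Rightarrow> 'v set" where
  "span_at J ls H y = {comb J ls c y + h | c h. h \<in> H}"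

lemma comb_add_coeff: "comb J ls (\<lambda>i. c i + c' i) y = comb J ls c y + comb J ls c' y"
  by (simp add: comb_def V.scale_left_distrib sum.distrib)

lemma comb_diff_coeff: "comb J ls (\<lambda>i. c i - c' i) y = comb J ls c y - comb J ls c' y"
  by (simp add: comb_def V.scale_left_diff_distrib sum_subtractf)

lemma comb_scale_coeff: "comb J ls (\<lambda>i. a * c i) y = a *s comb J ls c y"
  by (simp add: comb_def V.scale_sum_right)

lemma comb_sg_coeff: "comb J ls (\<lambda>i. sg b (c i)) y = sg b (comb J ls c y)"
  by (cases b) (simp_all add: sg_def comb_def sum_negf)

lemma comb_zero_coeff: "comb J ls (\<lambda>i. 0) y = 0"
  by (simp add: comb_def)

lemma comb_cong: "(\<And>i. i \<in> J \<Longrightarrow> c i = c' i) \<Longrightarrow> comb J ls c y = comb J ls c' y"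
  by (simp add: comb_def)

lemma comb_restrict: "comb J ls (restrict c J) y = comb J ls c y"
  by (simp add: comb_def)

text \<open>In a pair that is not irregular, sums agreeing modulo \<open>H\<close> force all
  coefficient vectors on the side of \<open>t\<close> to coincide modulo \<open>H\<close>. Such a
  sum is then a single combination evaluated at the signed sum of \<open>t\<close>.\<close>

definition irregular where
  "irregular J ls H n \<sigma> t t' \<longleftrightarrow> (\<exists>c c' :: nat \<Rightarrow> nat \<Rightarrow> 'p mod_ring.
     (\<Sum>i<n. sg (\<sigma> i) (comb J ls (c i) (t i))) - (\<Sum>i<n. sg (\<sigma> i) (comb J ls (c' i) (t' i))) \<in> H
     \<and> (\<exists>j<n. \<exists>y\<in>G. comb J ls (\<lambda>i. c j i - c 0 i) y \<notin> H))"

context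
  fixes J :: "nat set" and ls :: "nat \<Rightarrow> 'v \<Rightarrow> 'v"
  assumes fJ: "finite J" and ls: "\<And>i. i \<in> J \<Longrightarrow> lin (ls i)" and lsG: "\<And>i x. i \<in> J \<Longrightarrow> ls i x \<in> G"
begin

lemma ls_add: "i \<in> J \<Longrightarrow> ls i (x + y) = ls i x + ls i y"
  using ls by (simp add: Vector_Spaces.linear_iff)

lemma ls_scale: "i \<in> J \<Longrightarrow> ls i (a *s x) = a *s ls i x"
  using ls by (simp add: Vector_Spaces.linear_iff)

lemma comb_add: "comb J ls c (x + y) = comb J ls c x + comb J ls c y"
  by (simp add: comb_def ls_add V.scale_right_distrib sum.distrib)

lemma comb_scale: "comb J ls c (a *s x) = a *s comb J ls c x"
  by (simp add: comb_def ls_scale V.scale_sum_right mult.commute)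

lemma comb_zero: "comb J ls c 0 = 0"
  using comb_scale[of c 0 0] by simp

lemma comb_diff: "comb J ls c (x - y) = comb J ls c x - comb J ls c y"
  using comb_add[of c "x - y" y] by (simp add: algebra_simps)

lemma comb_minus: "comb J ls c (- x) = - comb J ls c x"
  using comb_diff[of c 0 x] by (simp add: comb_zero)

lemma comb_sg: "comb J ls c (sg b x) = sg b (comb J ls c x)"
  by (simp add: sg_def comb_minus)

lemma comb_sum: "comb J ls c (sum f I) = (\<Sum>i\<in>I. comb J ls c (f i))"
  by (induction I rule: infinite_finite_induct) (auto simp: comb_add comb_zero)

lemma comb_G: "comb J ls c x \<in> G"
  unfolding comb_def using lsG by (intro G_sum G_scale) auto

lemma subspace_span_at: "V.subspace H \<Longrightarrow> V.subspace (span_at J ls H y)"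
proof (rule V.subspaceI)
  assume H: "V.subspace H"
  show "0 \<in> span_at J ls H y"
    unfolding span_at_def using V.subspace_0[OF H] comb_zero_coeff[of J ls y] by force
  fix u v assume "u \<in> span_at J ls H y" "v \<in> span_at J ls H y"
  then obtain c h c' h' where "h \<in> H" "h' \<in> H" "u = comb J ls c y + h" "v = comb J ls c' y + h'"
    by (auto simp: span_at_def)
  moreover from this have "u + v = comb J ls (\<lambda>i. c i + c' i) y + (h + h')"
    by (simp add: comb_add_coeff algebra_simps)
  ultimately show "u + v \<in> span_at J ls H y"
    unfolding span_at_def using V.subspace_add[OF H] by blast
next
  assume H: "V.subspace H"
  fix a u assume "u \<in> span_at J ls H y"
  then obtain c h where "h \<in> H" "u = comb J ls c y + h" by (auto simp: span_at_def)
  moreover from this have "a *s u = comb J ls (\<lambda>i. a * c i) y + a *s h"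
    by (simp add: comb_scale_coeff V.scale_right_distrib)
  ultimately show "a *s u \<in> span_at J ls H y"
    unfolding span_at_def using V.subspace_scale[OF H] by blast
qed

text \<open>Coefficient vectors are taken extensional so that they can be counted; this count is the
  potential of \<open>low_rank_subspace\<close>.\<close>

definition absorbed :: "'v set \<Rightarrow> (nat \<Rightarrow> 'p mod_ring) set" where
  "absorbed H = {c \<in> J \<rightarrow>\<^sub>E UNIV. \<forall>y\<in>G. comb J ls c y \<in> H}"

lemma finite_absorbed: "finite (absorbed H)"
  unfolding absorbed_def by (rule finite_subset[of _ "J \<rightarrow>\<^sub>E UNIV"]) (auto simp: finite_PiE fJ)

lemma card_absorbed_le: "card (absorbed H) \<le> CARD('p) ^ card J"
proof -
  have "card (absorbed H) \<le> card (J \<rightarrow>\<^sub>E (UNIV :: 'p mod_ring set))"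
    by (intro card_mono) (auto simp: absorbed_def finite_PiE fJ)
  thus ?thesis by (simp add: card_PiE fJ)
qed

text \<open>\<open>H'\<close> is \<open>H\<close> plus the image of the combination. A large kernel
  modulo \<open>H\<close> means a small image, so the enlargement costs at most a factor
  \<open>1 / \<rho>\<close>. In exchange the translate of the absorbed vectors by \<open>c\<close>
  is absorbed too, and it is disjoint from them.\<close>

lemma absorb_low_rank:
  assumes H: "V.subspace H" "H \<subseteq> G" and big: "\<rho> * q < real (card (mod_ker (comb J ls c) H))"
    and y0: "y0 \<in> G" "comb J ls c y0 \<notin> H" and \<rho>: "0 < \<rho>"
  obtains H' where "V.subspace H'" "H \<subseteq> H'" "H' \<subseteq> G" "real (card H') * \<rho> \<le> real (card H)"
    "2 * card (absorbed H) \<le> card (absorbed H')"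
proof -
  let ?M = "comb J ls c"
  define H' where "H' = {h + m | h m. h \<in> H \<and> m \<in> ?M ` G}"
  have "V.subspace (?M ` G)"
  proof (rule V.subspaceI)
    show "0 \<in> ?M ` G" using comb_zero G_0 by (metis imageI)
    fix u v assume "u \<in> ?M ` G" "v \<in> ?M ` G"
    thus "u + v \<in> ?M ` G" by (auto simp flip: comb_add)
  next
    fix a u assume "u \<in> ?M ` G"
    thus "a *s u \<in> ?M ` G" by (auto simp flip: comb_scale)
  qed
  hence sub: "V.subspace H'" unfolding H'_def using V.subspace_sums[OF H(1)] by simp
  have HH': "H \<subseteq> H'"
  proof
    fix h assume "h \<in> H"
    moreover have "0 \<in> ?M ` G" using comb_zero G_0 by (metis imageI)
    moreover have "h = h + 0" by simp
    ultimately show "h \<in> H'" unfolding H'_def by blast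
  qed
  have MH': "?M y \<in> H'" if "y \<in> G" for y
  proof -
    have "?M y = 0 + ?M y" by simp
    thus ?thesis unfolding H'_def using that V.subspace_0[OF H(1)] by blast
  qed
  have H'G: "H' \<subseteq> G" using H comb_G by (auto simp: H'_def)
  have fin: "finite H" "finite H'" using H H'G finite_sub by auto
  let ?K = "mod_ker ?M H"
  have KG: "?K \<subseteq> G" by (auto simp: mod_ker_def)
  have "\<exists>w. \<forall>x\<in>H'. fst w x \<in> H \<and> snd w x \<in> G \<and> x = fst w x + ?M (snd w x)"
  proof -
    have "\<forall>x\<in>H'. \<exists>hy. fst hy \<in> H \<and> snd hy \<in> G \<and> x = fst hy + ?M (snd hy)"
      by (auto simp: H'_def)
    then obtain w where "\<forall>x\<in>H'. fst (w x) \<in> H \<and> snd (w x) \<in> G \<and> x = fst (w x) + ?M (snd (w x))"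
      by metis
    thus ?thesis by (intro exI[of _ "(\<lambda>x. fst (w x), \<lambda>x. snd (w x))"]) simp
  qed
  then obtain w1 w2 where w: "\<And>x. x \<in> H' \<Longrightarrow> w1 x \<in> H \<and> w2 x \<in> G \<and> x = w1 x + ?M (w2 x)" by auto
  \<comment> \<open>Rank and nullity as an injection: the contributions of \<open>k\<close> cancel
    in \<open>(w1 x - ?M k) + ?M (w2 x + k)\<close>, which equals \<open>x\<close>.\<close>
  have "card (H' \<times> ?K) \<le> card (G \<times> H)"
  proof (rule card_inj_on_le[where f = "\<lambda>(x, k). (w2 x + k, w1 x - ?M k)"])
    show "inj_on (\<lambda>(x, k). (w2 x + k, w1 x - ?M k)) (H' \<times> ?K)"
    proof (rule inj_onI, clarify)
      fix x k x' k' assume x: "x \<in> H'" "x' \<in> H'"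
        and e: "w2 x + k = w2 x' + k'" "w1 x - ?M k = w1 x' - ?M k'"
      have "x = (w1 x - ?M k) + ?M (w2 x + k)" using w[OF x(1)] by (simp add: comb_add)
      also have "\<dots> = (w1 x' - ?M k') + ?M (w2 x' + k')" using e by simp
      also have "\<dots> = x'" using w[OF x(2)] by (simp add: comb_add)
      finally show "x = x' \<and> k = k'" using e by auto
    qed
    show "(\<lambda>(x, k). (w2 x + k, w1 x - ?M k)) ` (H' \<times> ?K) \<subseteq> G \<times> H"
      using w V.subspace_diff[OF H(1)] by (auto simp: mod_ker_def)
  qed (use finite_G fin in auto)
  hence "real (card H') * real (card ?K) \<le> q * real (card H)"
    by (simp add: card_cartesian_product flip: of_nat_mult)
  moreover have "real (card H') * (\<rho> * q) \<le> real (card H') * real (card ?K)"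
    using big by (intro mult_left_mono) auto
  ultimately have "q * (real (card H') * \<rho>) \<le> q * real (card H)" by (simp add: mult_ac)
  hence size: "real (card H') * \<rho> \<le> real (card H)" using q_pos by (simp only: mult_le_cancel_left_pos)
  let ?f = "\<lambda>c'. restrict (\<lambda>i. c' i + c i) J"
  have comb_f: "comb J ls (?f c') y = comb J ls c' y + ?M y" for c' y
    by (simp only: comb_restrict comb_add_coeff)
  have "inj_on ?f (absorbed H)"
  proof (rule inj_onI)
    fix a b assume a: "a \<in> absorbed H" "b \<in> absorbed H" "?f a = ?f b"
    show "a = b"
    proof (rule extensionalityI[of _ J])
      show "a \<in> extensional J" "b \<in> extensional J" using a by (auto simp: absorbed_def PiE_iff)
      fix i assume "i \<in> J"
      hence "a i + c i = b i + c i" using fun_cong[OF a(3), of i] by simp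
      thus "a i = b i" by simp
    qed
  qed
  hence "2 * card (absorbed H) = card (absorbed H) + card (?f ` absorbed H)" by (simp add: card_image)
  also have "\<dots> = card (absorbed H \<union> ?f ` absorbed H)"
  proof (rule card_Un_disjoint[symmetric])
    show "absorbed H \<inter> ?f ` absorbed H = {}"
    proof (rule equals0I)
      fix b assume "b \<in> absorbed H \<inter> ?f ` absorbed H"
      then obtain a where a: "a \<in> absorbed H" "?f a \<in> absorbed H" by auto
      hence "comb J ls a y0 \<in> H" "comb J ls a y0 + ?M y0 \<in> H"
        using y0 by (auto simp: absorbed_def comb_f)
      hence "(comb J ls a y0 + ?M y0) - comb J ls a y0 \<in> H" using V.subspace_diff[OF H(1)] by blast
      thus False using y0 by simp
    qed
  qed (auto simp: finite_absorbed)
  also have "\<dots> \<le> card (absorbed H')"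
  proof (intro card_mono finite_absorbed Un_least subsetI)
    fix a assume "a \<in> absorbed H"
    thus "a \<in> absorbed H'" using HH' by (auto simp: absorbed_def)
  next
    fix b assume "b \<in> ?f ` absorbed H"
    then obtain a where a: "a \<in> absorbed H" "b = ?f a" by auto
    have "comb J ls b y \<in> H'" if "y \<in> G" for y
      unfolding a(2) comb_f using a(1) that HH' MH'[OF that] V.subspace_add[OF sub]
      by (auto simp: absorbed_def)
    thus "b \<in> absorbed H'" using a(2) by (auto simp: absorbed_def)
  qed
  finally show ?thesis using that[OF sub HH' H'G size] by blast
qed

text \<open>Each absorption doubles the set of absorbed vectors, so the number \<open>s\<close> of
  rounds is logarithmic in the number of all coefficient vectors and linear in
  \<open>card J\<close>.\<close>

lemma low_rank_subspace:
  assumes H0: "V.subspace H0" "H0 \<subseteq> G" and \<rho>: "0 < \<rho>"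
  obtains H s where "V.subspace H" "H0 \<subseteq> H" "H \<subseteq> G" "2 ^ s \<le> CARD('p) ^ card J"
    "real (card H) * \<rho> ^ s \<le> real (card H0)"
    "\<And>c. (\<forall>y\<in>G. comb J ls c y \<in> H) \<or> real (card (mod_ker (comb J ls c) H)) \<le> \<rho> * q"
proof -
  define P where "P s = (\<exists>H. V.subspace H \<and> H0 \<subseteq> H \<and> H \<subseteq> G \<and> 2 ^ s \<le> card (absorbed H)
     \<and> real (card H) * \<rho> ^ s \<le> real (card H0))" for s
  have "(\<lambda>i\<in>J. 0) \<in> absorbed H0"
  proof -
    have "comb J ls (\<lambda>i\<in>J. 0) y = 0" for y by (simp only: comb_restrict comb_zero_coeff)
    thus ?thesis using V.subspace_0[OF H0(1)] by (auto simp: absorbed_def)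
  qed
  hence "1 \<le> card (absorbed H0)" using finite_absorbed by (metis One_nat_def Suc_leI card_gt_0_iff empty_iff)
  hence "P 0" unfolding P_def using H0 by (intro exI[of _ H0]) auto
  moreover have "s \<le> CARD('p) ^ card J" if "P s" for s
  proof -
    have "2 ^ s \<le> CARD('p) ^ card J" using that card_absorbed_le by (auto simp: P_def intro: order_trans)
    moreover have "s < 2 ^ s" by (rule less_exp)
    ultimately show ?thesis by linarith
  qed
  ultimately obtain s where s: "P s" "\<And>s'. P s' \<Longrightarrow> s' \<le> s"
    using GreatestI_nat[of P 0] Greatest_le_nat[of P] by blast
  then obtain H where H: "V.subspace H" "H0 \<subseteq> H" "H \<subseteq> G" "2 ^ s \<le> card (absorbed H)"
    "real (card H) * \<rho> ^ s \<le> real (card H0)" by (auto simp: P_def)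
  have "(\<forall>y\<in>G. comb J ls c y \<in> H) \<or> real (card (mod_ker (comb J ls c) H)) \<le> \<rho> * q" for c
  proof (rule ccontr)
    assume neg: "\<not> ?thesis"
    then obtain y0 where y0: "y0 \<in> G" "comb J ls c y0 \<notin> H" by blast
    have big: "\<rho> * q < real (card (mod_ker (comb J ls c) H))" using neg by auto
    obtain H' where H': "V.subspace H'" "H \<subseteq> H'" "H' \<subseteq> G" "real (card H') * \<rho> \<le> real (card H)"
      "2 * card (absorbed H) \<le> card (absorbed H')"
      using absorb_low_rank[OF H(1,3) big y0 \<rho>] by blast
    have "real (card H') * \<rho> ^ Suc s \<le> real (card H) * \<rho> ^ s"
      using mult_right_mono[OF H'(4), of "\<rho> ^ s"] \<rho> by (simp add: mult_ac)
    hence "P (Suc s)"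
      unfolding P_def using H H' by (intro exI[of _ H']) auto
    thus False using s(2) by fastforce
  qed
  moreover have "2 ^ s \<le> CARD('p) ^ card J" using H(4) card_absorbed_le order_trans by blast
  ultimately show ?thesis using that H by blast
qed

text \<open>Fix the coordinates other than 0 and \<open>j\<close>. Since the signed sum is
  \<open>z\<close>, a change at \<open>j\<close> is compensated at 0, and the sum of combinations
  changes by the combination with coefficients \<open>c j - c 0\<close> of that change. The possible
  values at \<open>j\<close> thus lie in one coset of a small kernel.\<close>

lemma card_irregular_coeff:
  assumes H: "V.subspace H" and j: "0 < j" "j < n"
    and \<rho>: "real (card (mod_ker (comb J ls (\<lambda>i. c j i - c 0 i)) H)) \<le> \<rho> * q"
  shows "real (card {t \<in> tuples n \<sigma> G z. (\<Sum>i<n. sg (\<sigma> i) (comb J ls (c i) (t i))) - u \<in> H}) \<le> \<rho> * q ^ (n - 1)"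
proof -
  let ?T = "{t \<in> tuples n \<sigma> G z. (\<Sum>i<n. sg (\<sigma> i) (comb J ls (c i) (t i))) - u \<in> H}"
  let ?M = "comb J ls (\<lambda>i. c j i - c 0 i)"
  define J' where "J' = {..<n} - {0, j}"
  let ?R = "J' \<rightarrow>\<^sub>E G"
  have fT: "finite ?T" using finite_tuples[OF finite_G] by simp
  have fJ': "finite J'" by (simp add: J'_def)
  have cJ': "card J' = n - 2" using j by (simp add: J'_def card_Diff_subset)
  have fR: "finite ?R" using fJ' finite_G by (simp add: finite_PiE)
  have fib: "card {t \<in> ?T. restrict t J' = r} \<le> card (mod_ker ?M H)" for r
  proof (cases "{t \<in> ?T. restrict t J' = r} = {}")
    case True
    thus ?thesis by (metis card.empty zero_le)
  next
    case False
    then obtain t0 where t0: "t0 \<in> ?T" "restrict t0 J' = r" by blast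
    have I_eq: "{..<n} = insert 0 (insert j J')" using j by (auto simp: J'_def)
    have split: "(\<Sum>i<n. g i) = g 0 + (g j + (\<Sum>i\<in>J'. g i))" for g :: "nat \<Rightarrow> 'v"
      unfolding I_eq using fJ' j by (simp add: J'_def)
    show ?thesis
    proof (rule card_inj_on_le[where f = "\<lambda>t. t j - t0 j"])
      show "inj_on (\<lambda>t. t j - t0 j) {t \<in> ?T. restrict t J' = r}"
      proof (rule inj_onI)
        fix t s assume ts: "t \<in> {t \<in> ?T. restrict t J' = r}" "s \<in> {t \<in> ?T. restrict t J' = r}" "t j - t0 j = s j - t0 j"
        show "t = s"
        proof (rule tuples_agree[where \<epsilon> = \<sigma> and I = "{..<n}" and i = 0])
          fix i assume i: "i \<in> {..<n} - {0}"
          show "t i = s i"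
          proof (cases "i = j")
            case True thus ?thesis using ts(3) by simp
          next
            case False
            hence "i \<in> J'" using i by (simp add: J'_def)
            thus ?thesis using ts by (metis (mono_tags, lifting) mem_Collect_eq restrict_apply')
          qed
        qed (use ts j in \<open>auto simp: tuples_def PiE_iff\<close>)
      qed
      show "(\<lambda>t. t j - t0 j) ` {t \<in> ?T. restrict t J' = r} \<subseteq> mod_ker ?M H"
      proof clarify
        fix t assume t: "t \<in> tuples n \<sigma> G z" "(\<Sum>i<n. sg (\<sigma> i) (comb J ls (c i) (t i))) - u \<in> H" "r = restrict t J'"
        have agree: "t i = t0 i" if "i \<in> J'" for i using t(3) t0(2) that by (metis restrict_apply')
        have tG: "t j \<in> G" "t0 j \<in> G" using t(1) t0(1) j by (auto simp: tuples_def)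
        have "(\<Sum>i<n. sg (\<sigma> i) (t i)) = (\<Sum>i<n. sg (\<sigma> i) (t0 i))" using t t0 by (simp add: tuples_def)
        moreover have "(\<Sum>i\<in>J'. sg (\<sigma> i) (t i)) = (\<Sum>i\<in>J'. sg (\<sigma> i) (t0 i))" by (intro sum.cong) (auto simp: agree)
        \<comment> \<open>The compensation: coordinate 0 moves exactly against coordinate
          \<open>j\<close>, signs included.\<close>
        ultimately have s: "sg (\<sigma> 0) (t 0 - t0 0) = - sg (\<sigma> j) (t j - t0 j)"
          unfolding split by (simp add: algebra_simps)
        have "((\<Sum>i<n. sg (\<sigma> i) (comb J ls (c i) (t i))) - u) - ((\<Sum>i<n. sg (\<sigma> i) (comb J ls (c i) (t0 i))) - u) \<in> H"
          using t(2) t0(1) V.subspace_diff[OF H] by blast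
        moreover have "(\<Sum>i\<in>J'. sg (\<sigma> i) (comb J ls (c i) (t i))) = (\<Sum>i\<in>J'. sg (\<sigma> i) (comb J ls (c i) (t0 i)))"
          by (intro sum.cong) (auto simp: agree)
        ultimately have "sg (\<sigma> 0) (comb J ls (c 0) (t 0) - comb J ls (c 0) (t0 0))
            + sg (\<sigma> j) (comb J ls (c j) (t j) - comb J ls (c j) (t0 j)) \<in> H"
          unfolding split by (simp add: algebra_simps)
        also have "sg (\<sigma> 0) (comb J ls (c 0) (t 0) - comb J ls (c 0) (t0 0)) = comb J ls (c 0) (sg (\<sigma> 0) (t 0 - t0 0))"
          by (simp only: comb_sg comb_diff)
        also have "\<dots> = - comb J ls (c 0) (sg (\<sigma> j) (t j - t0 j))"
          unfolding s by (rule comb_minus)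
        also have "\<dots> = - sg (\<sigma> j) (comb J ls (c 0) (t j - t0 j))" by (simp only: comb_sg)
        also have "sg (\<sigma> j) (comb J ls (c j) (t j) - comb J ls (c j) (t0 j)) = sg (\<sigma> j) (comb J ls (c j) (t j - t0 j))"
          by (simp only: comb_diff)
        also have "- sg (\<sigma> j) (comb J ls (c 0) (t j - t0 j)) + sg (\<sigma> j) (comb J ls (c j) (t j - t0 j))
          = sg (\<sigma> j) (?M (t j - t0 j))"
          by (simp add: comb_diff_coeff)
        finally have "?M (t j - t0 j) \<in> H"
          using V.subspace_neg[OF H] by (fastforce simp: sg_def split: if_splits)
        thus "t j - t0 j \<in> mod_ker ?M H" using tG by (simp add: mod_ker_def)
      qed
    qed (simp add: mod_ker_def finite_G)
  qed
  have TR: "restrict t J' \<in> ?R" if "t \<in> ?T" for t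
    using that by (auto simp: tuples_def J'_def PiE_iff)
  have "?T \<subseteq> (\<Union>r\<in>?R. {t \<in> ?T. restrict t J' = r})" using TR by auto
  moreover have "finite (\<Union>r\<in>?R. {t \<in> ?T. restrict t J' = r})"
    by (rule finite_subset[OF _ fT]) blast
  ultimately have "card ?T \<le> card (\<Union>r\<in>?R. {t \<in> ?T. restrict t J' = r})"
    by (intro card_mono)
  also have "\<dots> \<le> (\<Sum>r\<in>?R. card {t \<in> ?T. restrict t J' = r})" by (rule card_UN_le[OF fR])
  also have "\<dots> \<le> (\<Sum>r\<in>?R. card (mod_ker ?M H))"
  proof (rule sum_mono)
    fix r
    show "card {t \<in> ?T. restrict t J' = r} \<le> card (mod_ker ?M H)" using fib[of r] .
  qed
  also have "\<dots> = card G ^ (n - 2) * card (mod_ker ?M H)" using fJ' by (simp add: card_PiE cJ')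
  finally have "real (card ?T) \<le> real (card G ^ (n - 2) * card (mod_ker ?M H))" by (simp only: of_nat_le_iff)
  also have "\<dots> \<le> q ^ (n - 2) * (\<rho> * q)" using \<rho> by (simp add: mult_left_mono)
  also have "\<dots> = \<rho> * q ^ (n - 1)"
  proof -
    have "n - 1 = Suc (n - 2)" using j by simp
    thus ?thesis by simp
  qed
  finally show ?thesis .
qed

text \<open>Union bound over the coefficient vectors on both sides; for given vectors and given
  \<open>t'\<close> the first tuple is counted by \<open>card_irregular_coeff\<close>.\<close>

lemma card_irregular_pairs:
  assumes H: "V.subspace H" and n: "n \<ge> 1" and \<rho>: "0 \<le> \<rho>"
    and rank: "\<And>c. (\<forall>y\<in>G. comb J ls c y \<in> H) \<or> real (card (mod_ker (comb J ls c) H)) \<le> \<rho> * q"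
  shows "real (card {(t, t'). t \<in> tuples n \<sigma> G z \<and> t' \<in> tuples n \<sigma> G z \<and> irregular J ls H n \<sigma> t t'})
    \<le> real CARD('p) ^ (2 * n * card J) * (\<rho> * q ^ (2 * (n - 1)))"
proof -
  let ?C = "{..<n} \<rightarrow>\<^sub>E (J \<rightarrow>\<^sub>E (UNIV :: 'p mod_ring set))"
  let ?T = "tuples n \<sigma> G z"
  let ?sum = "\<lambda>c t. \<Sum>i<n. sg (\<sigma> i) (comb J ls (c i) (t i))"
  define nt where "nt c = (\<exists>j<n. \<exists>y\<in>G. comb J ls (\<lambda>i. c j i - c 0 i) y \<notin> H)" for c :: "nat \<Rightarrow> nat \<Rightarrow> 'p mod_ring"
  define A where "A w = prod.swap ` (SIGMA t':?T. {t \<in> ?T. ?sum (fst w) t - ?sum (snd w) t' \<in> H})"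
    for w :: "(nat \<Rightarrow> nat \<Rightarrow> 'p mod_ring) \<times> (nat \<Rightarrow> nat \<Rightarrow> 'p mod_ring)"
  have fC: "finite ?C" by (simp add: finite_PiE fJ)
  have cC: "card ?C = CARD('p) ^ (n * card J)" by (simp add: card_PiE fJ power_mult[symmetric] mult.commute)
  have fT: "finite ?T" by (rule finite_tuples[OF finite_G])
  have fA: "finite (A w)" for w unfolding A_def using fT by (intro finite_imageI finite_SigmaI) auto
  have cA: "real (card (A w)) \<le> \<rho> * q ^ (2 * (n - 1))" if w: "nt (fst w)" for w
  proof -
    obtain j y where j: "j < n" "y \<in> G" "comb J ls (\<lambda>i. fst w j i - fst w 0 i) y \<notin> H"
      using w by (auto simp: nt_def)
    have "j \<noteq> 0"
    proof
      assume "j = 0"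
      hence "comb J ls (\<lambda>i. fst w j i - fst w 0 i) y = 0" by (simp add: comb_zero_coeff)
      thus False using j V.subspace_0[OF H] by simp
    qed
    hence j0: "0 < j" by simp
    have r: "real (card (mod_ker (comb J ls (\<lambda>i. fst w j i - fst w 0 i)) H)) \<le> \<rho> * q"
      using rank[of "\<lambda>i. fst w j i - fst w 0 i"] j by blast
    have "card (A w) = card (SIGMA t':?T. {t \<in> ?T. ?sum (fst w) t - ?sum (snd w) t' \<in> H})"
      unfolding A_def by (intro card_image) (auto simp: inj_on_def)
    hence "real (card (A w)) = (\<Sum>t'\<in>?T. real (card {t \<in> ?T. ?sum (fst w) t - ?sum (snd w) t' \<in> H}))"
      using fT by simp
    also have "\<dots> \<le> (\<Sum>t'\<in>?T. \<rho> * q ^ (n - 1))"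
      by (intro sum_mono card_irregular_coeff[OF H j0 j(1) r])
    also have "\<dots> = real (card ?T) * (\<rho> * q ^ (n - 1))" by simp
    also have "\<dots> \<le> q ^ (n - 1) * (\<rho> * q ^ (n - 1))"
      using card_tuples_le[OF n, of \<sigma> z] \<rho>
      by (intro mult_right_mono) (auto simp flip: of_nat_power)
    also have "\<dots> = \<rho> * q ^ (2 * (n - 1))" by (simp add: power_add[symmetric] mult_2)
    finally show ?thesis .
  qed
  let ?W = "{w \<in> ?C \<times> ?C. nt (fst w)}"
  have "{(t, t'). t \<in> ?T \<and> t' \<in> ?T \<and> irregular J ls H n \<sigma> t t'} \<subseteq> (\<Union>w\<in>?W. A w)"
  proof clarify
    fix t t' assume t: "t \<in> ?T" "t' \<in> ?T" and irr: "irregular J ls H n \<sigma> t t'"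
    obtain c c' where c: "?sum c t - ?sum c' t' \<in> H" "nt c"
      using irr by (auto simp: irregular_def nt_def)
    define rr where "rr c = (\<lambda>i\<in>{..<n}. restrict (c i) J)" for c :: "nat \<Rightarrow> nat \<Rightarrow> 'p mod_ring"
    have rrC: "rr c \<in> ?C" for c by (auto simp: rr_def)
    have sum_rr: "?sum (rr c) t = ?sum c t" for c t
      by (intro sum.cong) (auto simp: rr_def comb_restrict)
    have "comb J ls (\<lambda>i. rr c j i - rr c 0 i) y = comb J ls (\<lambda>i. c j i - c 0 i) y" if "j < n" for j y
      using that by (intro comb_cong) (auto simp: rr_def)
    hence "nt (rr c)" using c(2) unfolding nt_def by metis
    hence "(rr c, rr c') \<in> ?W" using rrC by simp
    moreover have "(t, t') \<in> A (rr c, rr c')"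
      using t c(1) unfolding A_def by (auto simp: sum_rr image_iff)
    ultimately show "(t, t') \<in> (\<Union>w\<in>?W. A w)" by blast
  qed
  hence "card {(t, t'). t \<in> ?T \<and> t' \<in> ?T \<and> irregular J ls H n \<sigma> t t'} \<le> card (\<Union>w\<in>?W. A w)"
    using fC fA by (intro card_mono) auto
  also have "\<dots> \<le> (\<Sum>w\<in>?W. card (A w))" using fC by (intro card_UN_le) auto
  finally have "real (card {(t, t'). t \<in> ?T \<and> t' \<in> ?T \<and> irregular J ls H n \<sigma> t t'}) \<le> (\<Sum>w\<in>?W. real (card (A w)))"
    by (simp flip: of_nat_sum)
  also have "\<dots> \<le> (\<Sum>w\<in>?W. \<rho> * q ^ (2 * (n - 1)))" using cA by (intro sum_mono) auto
  also have "\<dots> \<le> (\<Sum>w\<in>?C \<times> ?C. \<rho> * q ^ (2 * (n - 1)))" using \<rho> fC by (intro sum_mono2) auto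
  also have "\<dots> = real (card ?C) * real (card ?C) * (\<rho> * q ^ (2 * (n - 1)))" by (simp add: card_cartesian_product)
  also have "real (card ?C) * real (card ?C) = real CARD('p) ^ (2 * n * card J)"
    unfolding cC by (simp add: power_add[symmetric] mult_2 distrib_right)
  finally show ?thesis .
qed

text \<open>Regularity replaces every \<open>c i\<close> by \<open>c 0\<close> up to elements of
  \<open>H\<close>; by linearity the sum of the values of that one combination is its value at
  \<open>z\<close>.\<close>

lemma regular_intersection:
  assumes H: "V.subspace H" and n: "n \<ge> 1" and t: "t \<in> tuples n \<sigma> G z"
    and reg: "\<not> irregular J ls H n \<sigma> t t'"
    and u: "\<And>i. i < n \<Longrightarrow> u i \<in> span_at J ls H (t i)" "\<And>i. i < n \<Longrightarrow> u' i \<in> span_at J ls H (t' i)"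
    and eq: "(\<Sum>i<n. u i) = (\<Sum>i<n. u' i)"
  shows "(\<Sum>i<n. u i) \<in> span_at J ls H z"
proof -
  have ex: "\<exists>c h. \<forall>i<n. h i \<in> H \<and> u i = sg (\<sigma> i) (comb J ls (c i) (t i)) + h i"
    if u: "\<And>i. i < n \<Longrightarrow> u i \<in> span_at J ls H (t i)" for u t
  proof -
    have "\<exists>c h. h \<in> H \<and> u i = sg (\<sigma> i) (comb J ls c (t i)) + h" if i: "i < n" for i
    proof -
      obtain c h where "h \<in> H" "u i = comb J ls c (t i) + h" using u[OF i] by (auto simp: span_at_def)
      \<comment> \<open>The sign is moved into the coefficients, so that the sums take the form used
        in \<open>irregular\<close>.\<close>
      hence "h \<in> H \<and> u i = sg (\<sigma> i) (comb J ls (\<lambda>k. sg (\<sigma> i) (c k)) (t i)) + h"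
        by (simp add: comb_sg_coeff)
      thus ?thesis by blast
    qed
    thus ?thesis by metis
  qed
  obtain c h where c: "\<And>i. i < n \<Longrightarrow> h i \<in> H \<and> u i = sg (\<sigma> i) (comb J ls (c i) (t i)) + h i"
    using ex[of u t, OF u(1)] by blast
  obtain c' h' where c': "\<And>i. i < n \<Longrightarrow> h' i \<in> H \<and> u' i = sg (\<sigma> i) (comb J ls (c' i) (t' i)) + h' i"
    using ex[of u' t', OF u(2)] by blast
  let ?s = "\<Sum>i<n. sg (\<sigma> i) (comb J ls (c i) (t i))" and ?s' = "\<Sum>i<n. sg (\<sigma> i) (comb J ls (c' i) (t' i))"
  have su: "(\<Sum>i<n. u i) = ?s + (\<Sum>i<n. h i)" "(\<Sum>i<n. u' i) = ?s' + (\<Sum>i<n. h' i)"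
    using c c' by (simp_all add: sum.distrib[symmetric])
  have hH: "(\<Sum>i<n. h i) \<in> H" "(\<Sum>i<n. h' i) \<in> H"
    using c c' by (auto intro!: V.subspace_sum[OF H])
  have "?s - ?s' = (\<Sum>i<n. h' i) - (\<Sum>i<n. h i)" using eq unfolding su by (simp add: algebra_simps)
  hence "?s - ?s' \<in> H" using V.subspace_diff[OF H hH(2) hH(1)] by simp
  hence abs: "comb J ls (\<lambda>k. c j k - c 0 k) y \<in> H" if "j < n" "y \<in> G" for j y
    using reg that by (auto simp: irregular_def)
  have tG: "t i \<in> G" if "i < n" for i using t that by (auto simp: tuples_def)
  define d where "d i = sg (\<sigma> i) (comb J ls (\<lambda>k. c i k - c 0 k) (t i))" for i
  have dH: "d i \<in> H" if "i < n" for i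
    using abs[OF that tG[OF that]] V.subspace_neg[OF H] by (auto simp: d_def sg_def)
  have "?s = (\<Sum>i<n. sg (\<sigma> i) (comb J ls (c 0) (t i))) + (\<Sum>i<n. d i)"
    by (simp add: d_def comb_diff_coeff sum.distrib[symmetric])
  also have "(\<Sum>i<n. sg (\<sigma> i) (comb J ls (c 0) (t i))) = comb J ls (c 0) z"
    using t by (simp add: tuples_def comb_sum[symmetric] comb_sg[symmetric])
  finally have "(\<Sum>i<n. u i) = comb J ls (c 0) z + ((\<Sum>i<n. d i) + (\<Sum>i<n. h i))"
    unfolding su by (simp add: add.assoc)
  moreover have "(\<Sum>i<n. d i) + (\<Sum>i<n. h i) \<in> H"
    using V.subspace_add[OF H] V.subspace_sum[OF H] dH hH by (metis (no_types, lifting) lessThan_iff)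
  ultimately show ?thesis unfolding span_at_def by blast
qed

end

end

text \<open>The Thue--Morse pattern, which arises from iterated differences: the second half repeats
  the first with opposite signs.\<close>

primrec sgs :: "nat \<Rightarrow> nat \<Rightarrow> bool" where
  "sgs 0 = (\<lambda>_. False)"
| "sgs (Suc j) = (\<lambda>i. if i < 2 ^ j then sgs j i else \<not> sgs j (i - 2 ^ j))"

lemma sum_split_double:
  fixes g :: "nat \<Rightarrow> 'a::comm_monoid_add"
  shows "(\<Sum>i<m + n. g i) = (\<Sum>i<m. g i) + (\<Sum>i<n. g (i + m))"
  by (induction n) (auto simp: ac_simps)

lemma sum_sgs_Suc:
  fixes f :: "nat \<Rightarrow> 'a::ab_group_add"
  shows "(\<Sum>i<2 ^ Suc j. sg (sgs (Suc j) i) (f i))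
    = (\<Sum>i<2 ^ j. sg (sgs j i) (f i)) - (\<Sum>i<2 ^ j. sg (sgs j i) (f (i + 2 ^ j)))"
proof -
  have "(2::nat) ^ Suc j = 2 ^ j + 2 ^ j" by simp
  moreover have "sg (\<not> b) x = - sg b x" for b and x :: 'a by (simp add: sg_def)
  ultimately show ?thesis by (simp only: sum_split_double) (simp add: sum_negf)
qed

context fin_space
begin

subsection \<open>Counting configurations\<close>

text \<open>\<open>hor\<close> and \<open>ver\<close> are the two recursion steps of
  \<open>rep_count\<close>, for real-valued counts on \<open>G\<close>.\<close>

definition hor :: "('v \<Rightarrow> 'v \<Rightarrow> real) \<Rightarrow> 'v \<Rightarrow> 'v \<Rightarrow> real" where
  "hor N x u = (\<Sum>x1\<in>G. N (x + x1) u * N x1 u)"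

definition ver :: "('v \<Rightarrow> 'v \<Rightarrow> real) \<Rightarrow> 'v \<Rightarrow> 'v \<Rightarrow> real" where
  "ver N x u = (\<Sum>u1\<in>G. N x (u + u1) * N x u1)"

text \<open>\<open>\<Omega>\<close> is a family of configurations, each with a second coordinate \<open>\<pi> \<omega>\<close> and a subspace
  \<open>S \<omega>\<close> of linear conditions; every configuration contributes \<open>\<kappa>\<close> to the count \<open>N\<close> at all points
  \<open>(x, \<pi> \<omega>)\<close> for which \<open>x\<close> satisfies its conditions.\<close>

definition dominates :: "('v \<Rightarrow> 'v \<Rightarrow> real) \<Rightarrow> real \<Rightarrow> 'w set \<Rightarrow> ('w \<Rightarrow> 'v) \<Rightarrow> ('w \<Rightarrow> 'v set) \<Rightarrow> bool" where
  "dominates N \<kappa> \<Omega> \<pi> S \<longleftrightarrow>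
     (\<forall>x\<in>G. \<forall>u\<in>G. \<kappa> * real (card {\<omega> \<in> \<Omega>. \<pi> \<omega> = u \<and> x \<in> perp (S \<omega>)}) \<le> N x u)"

definition tsum :: "nat \<Rightarrow> ('w \<Rightarrow> 'v) \<Rightarrow> (nat \<Rightarrow> 'w) \<Rightarrow> 'v" where
  "tsum j \<pi> t = (\<Sum>i<2 ^ j. sg (sgs j i) (\<pi> (t i)))"

text \<open>For subspaces, being orthogonal to this sum means meeting the conditions of all
  \<open>n\<close> configurations at once.\<close>

definition SS :: "nat \<Rightarrow> ('w \<Rightarrow> 'v set) \<Rightarrow> (nat \<Rightarrow> 'w) \<Rightarrow> 'v set" where
  "SS n S t = {\<Sum>i<n. u i | u. \<forall>i<n. u i \<in> S (t i)}"

lemma dominates_subset: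
  assumes "dominates N \<kappa> \<Omega> \<pi> S" "\<Omega>' \<subseteq> \<Omega>" "finite \<Omega>" "0 \<le> \<kappa>"
  shows "dominates N \<kappa> \<Omega>' \<pi> S"
  unfolding dominates_def
proof (intro ballI)
  fix x u assume xu: "x \<in> G" "u \<in> G"
  have "card {\<omega> \<in> \<Omega>'. \<pi> \<omega> = u \<and> x \<in> perp (S \<omega>)} \<le> card {\<omega> \<in> \<Omega>. \<pi> \<omega> = u \<and> x \<in> perp (S \<omega>)}"
    using assms by (intro card_mono) auto
  hence "\<kappa> * real (card {\<omega> \<in> \<Omega>'. \<pi> \<omega> = u \<and> x \<in> perp (S \<omega>)})
    \<le> \<kappa> * real (card {\<omega> \<in> \<Omega>. \<pi> \<omega> = u \<and> x \<in> perp (S \<omega>)})"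
    using assms(4) by (intro mult_left_mono) auto
  also have "\<dots> \<le> N x u" using assms(1) xu by (simp add: dominates_def)
  finally show "\<kappa> * real (card {\<omega> \<in> \<Omega>'. \<pi> \<omega> = u \<and> x \<in> perp (S \<omega>)}) \<le> N x u" .
qed

lemma subspace_SS: "(\<And>i. i < n \<Longrightarrow> V.subspace (S (t i))) \<Longrightarrow> V.subspace (SS n S t)"
proof (rule V.subspaceI)
  assume sub: "\<And>i. i < n \<Longrightarrow> V.subspace (S (t i))"
  show "0 \<in> SS n S t"
    unfolding SS_def using V.subspace_0[OF sub] by (auto intro!: exI[of _ "\<lambda>_. 0"])
  fix x y assume "x \<in> SS n S t" "y \<in> SS n S t"
  then obtain u v where "\<forall>i<n. u i \<in> S (t i)" "\<forall>i<n. v i \<in> S (t i)" "x = (\<Sum>i<n. u i)" "y = (\<Sum>i<n. v i)"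
    by (auto simp: SS_def)
  thus "x + y \<in> SS n S t"
    unfolding SS_def using V.subspace_add[OF sub] by (auto intro!: exI[of _ "\<lambda>i. u i + v i"] simp: sum.distrib)
next
  assume sub: "\<And>i. i < n \<Longrightarrow> V.subspace (S (t i))"
  fix a x assume "x \<in> SS n S t"
  then obtain u where "\<forall>i<n. u i \<in> S (t i)" "x = (\<Sum>i<n. u i)" by (auto simp: SS_def)
  thus "a *s x \<in> SS n S t"
    unfolding SS_def using V.subspace_scale[OF sub]
    by (auto intro!: exI[of _ "\<lambda>i. a *s u i"] simp: V.scale_sum_right)
qed

lemma SS_sub: "(\<And>i. i < n \<Longrightarrow> S (t i) \<subseteq> G) \<Longrightarrow> SS n S t \<subseteq> G"
  by (auto simp: SS_def intro!: G_sum)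

lemma card_SS_le:
  assumes "\<And>i. i < n \<Longrightarrow> S (t i) \<subseteq> G" "\<And>i. i < n \<Longrightarrow> card (S (t i)) \<le> s"
  shows "card (SS n S t) \<le> s ^ n"
proof -
  have f: "finite (S (t i))" if "i < n" for i using assms(1)[OF that] finite_sub by blast
  have "SS n S t = (\<lambda>u. \<Sum>i<n. u i) ` PiE {..<n} (\<lambda>i. S (t i))"
  proof (intro equalityI subsetI)
    fix x assume "x \<in> SS n S t"
    then obtain u where u: "\<forall>i<n. u i \<in> S (t i)" "x = (\<Sum>i<n. u i)" by (auto simp: SS_def)
    have "x = (\<Sum>i<n. restrict u {..<n} i)" using u(2) by simp
    moreover have "restrict u {..<n} \<in> PiE {..<n} (\<lambda>i. S (t i))" using u(1) by auto
    ultimately show "x \<in> (\<lambda>u. \<Sum>i<n. u i) ` PiE {..<n} (\<lambda>i. S (t i))" by blast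
  qed (auto simp: SS_def)
  hence "card (SS n S t) \<le> card (PiE {..<n} (\<lambda>i. S (t i)))"
    using f by (auto intro!: card_image_le finite_PiE)
  also have "\<dots> = (\<Prod>i<n. card (S (t i)))" by (simp add: card_PiE)
  also have "\<dots> \<le> (\<Prod>i<n. s)" using assms(2) by (intro prod_mono) auto
  finally show ?thesis by simp
qed

lemma perp_SS:
  assumes sub: "\<And>i. i < n \<Longrightarrow> V.subspace (S (t i))" and x: "x \<in> perp (SS n S t)" and j: "j < n"
  shows "x \<in> perp (S (t j))"
proof -
  have "S (t j) \<subseteq> SS n S t"
  proof
    fix h assume h: "h \<in> S (t j)"
    have "h = (\<Sum>i<n. if i = j then h else 0)" using j by simp
    moreover have "\<forall>i<n. (if i = j then h else 0) \<in> S (t i)" using h V.subspace_0[OF sub] by auto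
    ultimately show "h \<in> SS n S t" unfolding SS_def by blast
  qed
  thus ?thesis using x perp_antimono by blast
qed

text \<open>A tuple of length \<open>2 ^ Suc j\<close> is cut into halves. The signed sum of the
  second half is the summation variable \<open>u1\<close> of \<open>ver\<close>, and the first half
  then sums to \<open>u + u1\<close>.\<close>

lemma ver_iterate:
  assumes dom: "dominates N \<kappa> \<Omega> \<pi> S" and \<kappa>: "0 \<le> \<kappa>" and f: "finite \<Omega>" and \<pi>: "\<And>\<omega>. \<omega> \<in> \<Omega> \<Longrightarrow> \<pi> \<omega> \<in> G"
    and x: "x \<in> G" and u: "u \<in> G"
  shows "\<kappa> ^ (2 ^ j) * real (card {t \<in> {..<2 ^ j} \<rightarrow>\<^sub>E \<Omega>. tsum j \<pi> t = u \<and> (\<forall>i<2 ^ j. x \<in> perp (S (t i)))})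
     \<le> (ver ^^ j) N x u"
  using u
proof (induction j arbitrary: u)
  case 0
  have "card {t \<in> {..<1} \<rightarrow>\<^sub>E \<Omega>. tsum 0 \<pi> t = u \<and> (\<forall>i<1. x \<in> perp (S (t i)))}
      \<le> card {\<omega> \<in> \<Omega>. \<pi> \<omega> = u \<and> x \<in> perp (S \<omega>)}"
  proof (rule card_inj_on_le[where f = "\<lambda>t. t 0"])
    show "inj_on (\<lambda>t. t 0) {t \<in> {..<1} \<rightarrow>\<^sub>E \<Omega>. tsum 0 \<pi> t = u \<and> (\<forall>i<1. x \<in> perp (S (t i)))}"
    proof (rule inj_onI)
      fix s t assume "s \<in> {t \<in> {..<1} \<rightarrow>\<^sub>E \<Omega>. tsum 0 \<pi> t = u \<and> (\<forall>i<1. x \<in> perp (S (t i)))}"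
        "t \<in> {t \<in> {..<1} \<rightarrow>\<^sub>E \<Omega>. tsum 0 \<pi> t = u \<and> (\<forall>i<1. x \<in> perp (S (t i)))}" "s 0 = t 0"
      thus "s = t" by (intro extensionalityI[of s "{..<1}" t]) (auto simp: PiE_iff)
    qed
  qed (use f in \<open>auto simp: tsum_def sg_def\<close>)
  hence "\<kappa> * real (card {t \<in> {..<1} \<rightarrow>\<^sub>E \<Omega>. tsum 0 \<pi> t = u \<and> (\<forall>i<1. x \<in> perp (S (t i)))})
     \<le> \<kappa> * real (card {\<omega> \<in> \<Omega>. \<pi> \<omega> = u \<and> x \<in> perp (S \<omega>)})"
    using \<kappa> by (intro mult_left_mono) auto
  also have "\<dots> \<le> N x u" using dom x 0 by (simp add: dominates_def)
  finally show ?case by simp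
next
  case (Suc j)
  let ?m = "2 ^ j :: nat"
  define B where "B v = {t \<in> {..<?m} \<rightarrow>\<^sub>E \<Omega>. tsum j \<pi> t = v \<and> (\<forall>i<?m. x \<in> perp (S (t i)))}" for v
  let ?B' = "{t \<in> {..<2 ^ Suc j} \<rightarrow>\<^sub>E \<Omega>. tsum (Suc j) \<pi> t = u \<and> (\<forall>i<2 ^ Suc j. x \<in> perp (S (t i)))}"
  define lo where "lo t = restrict t {..<?m}" for t :: "nat \<Rightarrow> 'a"
  define hi where "hi t = (\<lambda>i\<in>{..<?m}. t (i + ?m))" for t :: "nat \<Rightarrow> 'a"
  have fB: "finite (B v)" for v using f by (simp add: B_def finite_PiE)
  have "card ?B' \<le> card (SIGMA u1:G. B (u + u1) \<times> B u1)"
  proof (rule card_inj_on_le[where f = "\<lambda>t. (tsum j \<pi> (hi t), lo t, hi t)"])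
    show "inj_on (\<lambda>t. (tsum j \<pi> (hi t), lo t, hi t)) ?B'"
    proof (rule inj_onI)
      fix s t assume st: "s \<in> ?B'" "t \<in> ?B'" "(tsum j \<pi> (hi s), lo s, hi s) = (tsum j \<pi> (hi t), lo t, hi t)"
      show "s = t"
      proof (rule extensionalityI[of s "{..<2 ^ Suc j}" t])
        show "s \<in> extensional {..<2 ^ Suc j}" "t \<in> extensional {..<2 ^ Suc j}" using st by (auto simp: PiE_iff)
        fix i :: nat assume i: "i \<in> {..<2 ^ Suc j}"
        show "s i = t i"
        proof (cases "i < ?m")
          case True
          have "lo s i = lo t i" using st(3) by simp
          thus ?thesis using True by (simp add: lo_def)
        next
          case False
          have "hi s (i - ?m) = hi t (i - ?m)" using st(3) by simp
          moreover have "i - ?m < ?m" using i False by auto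
          ultimately show ?thesis using False by (simp add: hi_def)
        qed
      qed
    qed
    show "(\<lambda>t. (tsum j \<pi> (hi t), lo t, hi t)) ` ?B' \<subseteq> (SIGMA u1:G. B (u + u1) \<times> B u1)"
    proof clarify
      fix t assume t: "t \<in> {..<2 ^ Suc j} \<rightarrow>\<^sub>E \<Omega>" "u = tsum (Suc j) \<pi> t" "\<forall>i<2 ^ Suc j. x \<in> perp (S (t i))"
      have tO: "t i \<in> \<Omega>" if "i < ?m + ?m" for i using t(1) that by (auto simp: PiE_iff)
      have tp: "x \<in> perp (S (t i))" if "i < ?m + ?m" for i using t(3) that by simp
      have u: "tsum j \<pi> (lo t) = tsum (Suc j) \<pi> t + tsum j \<pi> (hi t)"
        unfolding tsum_def sum_sgs_Suc by (simp add: lo_def hi_def)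
      have "tsum j \<pi> (hi t) \<in> G"
        unfolding tsum_def hi_def using tO \<pi> by (intro G_sum sg_G) auto
      moreover have "lo t \<in> B (tsum (Suc j) \<pi> t + tsum j \<pi> (hi t))"
        using tO tp u by (auto simp: B_def lo_def)
      moreover have "hi t \<in> B (tsum j \<pi> (hi t))"
        using tO tp by (auto simp: B_def hi_def)
      ultimately show "tsum j \<pi> (hi t) \<in> G \<and> (lo t, hi t) \<in> B (tsum (Suc j) \<pi> t + tsum j \<pi> (hi t)) \<times> B (tsum j \<pi> (hi t))"
        by blast
    qed
    show "finite (SIGMA u1:G. B (u + u1) \<times> B u1)"
      by (intro finite_SigmaI finite_G finite_cartesian_product fB)
  qed
  hence "real (card ?B') \<le> (\<Sum>u1\<in>G. real (card (B (u + u1))) * real (card (B u1)))"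
    using finite_G fB by (simp add: card_cartesian_product flip: of_nat_mult of_nat_sum)
  hence "\<kappa> ^ (2 ^ Suc j) * real (card ?B') \<le> \<kappa> ^ (2 ^ Suc j) * (\<Sum>u1\<in>G. real (card (B (u + u1))) * real (card (B u1)))"
    using \<kappa> by (intro mult_left_mono) auto
  also have "\<dots> = (\<Sum>u1\<in>G. (\<kappa> ^ ?m * real (card (B (u + u1)))) * (\<kappa> ^ ?m * real (card (B u1))))"
    by (simp add: sum_distrib_left mult_2 power_add mult_ac)
  also have "\<dots> \<le> (\<Sum>u1\<in>G. (ver ^^ j) N x (u + u1) * (ver ^^ j) N x u1)"
  proof (rule sum_mono)
    fix u1 assume u1: "u1 \<in> G"
    have "\<kappa> ^ ?m * real (card (B (u + u1))) \<le> (ver ^^ j) N x (u + u1)" "\<kappa> ^ ?m * real (card (B u1)) \<le> (ver ^^ j) N x u1"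
      using Suc.IH[of "u + u1"] Suc.IH[of u1] u1 Suc.prems by (simp_all add: B_def)
    moreover have "0 \<le> \<kappa> ^ ?m * real (card (B v))" for v using \<kappa> by simp
    ultimately show "(\<kappa> ^ ?m * real (card (B (u + u1)))) * (\<kappa> ^ ?m * real (card (B u1)))
       \<le> (ver ^^ j) N x (u + u1) * (ver ^^ j) N x u1"
      by (intro mult_mono) (auto intro: order_trans)
  qed
  also have "\<dots> = (ver ^^ Suc j) N x u" by (simp add: ver_def)
  finally show ?case .
qed

lemma ver_dominates:
  assumes dom: "dominates N \<kappa> \<Omega> \<pi> S" and \<kappa>: "0 \<le> \<kappa>" and f: "finite \<Omega>" and \<pi>: "\<And>\<omega>. \<omega> \<in> \<Omega> \<Longrightarrow> \<pi> \<omega> \<in> G"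
    and S: "\<And>\<omega>. \<omega> \<in> \<Omega> \<Longrightarrow> V.subspace (S \<omega>)"
  shows "dominates ((ver ^^ j) N) (\<kappa> ^ (2 ^ j)) ({..<2 ^ j} \<rightarrow>\<^sub>E \<Omega>) (tsum j \<pi>) (SS (2 ^ j) S)"
  unfolding dominates_def
proof (intro ballI)
  fix x u assume xu: "x \<in> G" "u \<in> G"
  have "x \<in> perp (S (t i))" if "t \<in> {..<2 ^ j} \<rightarrow>\<^sub>E \<Omega>" "x \<in> perp (SS (2 ^ j) S t)" "i < 2 ^ j" for t i
    using that by (intro perp_SS[of "2 ^ j" S t x i] S) (auto simp: PiE_iff)
  hence "card {t \<in> {..<2 ^ j} \<rightarrow>\<^sub>E \<Omega>. tsum j \<pi> t = u \<and> x \<in> perp (SS (2 ^ j) S t)}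
    \<le> card {t \<in> {..<2 ^ j} \<rightarrow>\<^sub>E \<Omega>. tsum j \<pi> t = u \<and> (\<forall>i<2 ^ j. x \<in> perp (S (t i)))}"
    using f by (intro card_mono) (auto simp: finite_PiE)
  hence "\<kappa> ^ (2 ^ j) * real (card {t \<in> {..<2 ^ j} \<rightarrow>\<^sub>E \<Omega>. tsum j \<pi> t = u \<and> x \<in> perp (SS (2 ^ j) S t)})
    \<le> \<kappa> ^ (2 ^ j) * real (card {t \<in> {..<2 ^ j} \<rightarrow>\<^sub>E \<Omega>. tsum j \<pi> t = u \<and> (\<forall>i<2 ^ j. x \<in> perp (S (t i)))})"
    using \<kappa> by (intro mult_left_mono) auto
  also have "\<dots> \<le> (ver ^^ j) N x u" by (rule ver_iterate[OF dom \<kappa> f \<pi> xu])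
  finally show "\<kappa> ^ (2 ^ j) * real (card {t \<in> {..<2 ^ j} \<rightarrow>\<^sub>E \<Omega>. tsum j \<pi> t = u \<and> x \<in> perp (SS (2 ^ j) S t)})
    \<le> (ver ^^ j) N x u" .
qed

text \<open>Two configurations over the same \<open>u\<close> impose conditions on
  \<open>x + x1\<close> and on \<open>x1\<close>. Once \<open>x\<close> annihilates the intersection
  of the two subspaces, \<open>card_hor_solutions\<close> gives at least \<open>q / s ^ 2\<close>
  admissible \<open>x1\<close>.\<close>

lemma hor_dominates:
  assumes dom: "dominates N \<kappa> \<Omega> \<pi> S" and \<kappa>: "0 \<le> \<kappa>" and f: "finite \<Omega>"
    and S: "\<And>\<omega>. \<omega> \<in> \<Omega> \<Longrightarrow> V.subspace (S \<omega>)" "\<And>\<omega>. \<omega> \<in> \<Omega> \<Longrightarrow> S \<omega> \<subseteq> G" "\<And>\<omega>. \<omega> \<in> \<Omega> \<Longrightarrow> card (S \<omega>) \<le> s"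
    and s: "0 < s"
  shows "dominates (hor N) (\<kappa>\<^sup>2 * (q / (real s)\<^sup>2)) {w \<in> \<Omega> \<times> \<Omega>. \<pi> (fst w) = \<pi> (snd w)}
     (\<lambda>w. \<pi> (fst w)) (\<lambda>w. S (fst w) \<inter> S (snd w))"
  unfolding dominates_def
proof (intro ballI)
  fix x u assume xu: "x \<in> G" "u \<in> G"
  let ?B = "{w \<in> {w \<in> \<Omega> \<times> \<Omega>. \<pi> (fst w) = \<pi> (snd w)}. \<pi> (fst w) = u \<and> x \<in> perp (S (fst w) \<inter> S (snd w))}"
  define A where "A y = {\<omega> \<in> \<Omega>. \<pi> \<omega> = u \<and> y \<in> perp (S \<omega>)}" for y
  let ?X = "\<lambda>w. {x1 \<in> G. x + x1 \<in> perp (S (fst w)) \<and> x1 \<in> perp (S (snd w))}"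
  have fA: "finite (A y)" for y using f by (simp add: A_def)
  have fB: "finite ?B" using f by simp
  have sols: "q / (real s)\<^sup>2 \<le> real (card (?X w))" if w: "w \<in> ?B" for w
  proof -
    have wO: "fst w \<in> \<Omega>" "snd w \<in> \<Omega>" using w by auto
    have "q \<le> real (card (S (fst w))) * real (card (S (snd w))) * real (card (?X w))"
      by (rule card_hor_solutions) (use w wO S in auto)
    also have "\<dots> \<le> real s * real s * real (card (?X w))"
      using S(3)[OF wO(1)] S(3)[OF wO(2)] by (intro mult_right_mono mult_mono) auto
    finally show ?thesis using s by (simp add: divide_le_eq power2_eq_square mult.commute)
  qed
  have "real (card ?B) * (q / (real s)\<^sup>2) \<le> real (card (SIGMA w:?B. ?X w))"
    by (rule card_Sigma_ge[OF fB _ order_refl _ sols]) (auto simp: finite_G)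
  also have "card (SIGMA w:?B. ?X w) \<le> card (SIGMA x1:G. A (x + x1) \<times> A x1)"
  proof (rule card_inj_on_le[where f = prod.swap])
    show "finite (SIGMA x1:G. A (x + x1) \<times> A x1)"
      by (intro finite_SigmaI finite_G finite_cartesian_product fA)
  qed (auto simp: A_def inj_on_def)
  hence "real (card (SIGMA w:?B. ?X w)) \<le> (\<Sum>x1\<in>G. real (card (A (x + x1))) * real (card (A x1)))"
    using finite_G fA by (simp add: card_cartesian_product flip: of_nat_mult of_nat_sum)
  finally have "\<kappa>\<^sup>2 * (real (card ?B) * (q / (real s)\<^sup>2)) \<le> \<kappa>\<^sup>2 * (\<Sum>x1\<in>G. real (card (A (x + x1))) * real (card (A x1)))"
    by (intro mult_left_mono) auto
  also have "\<dots> = (\<Sum>x1\<in>G. (\<kappa> * real (card (A (x + x1)))) * (\<kappa> * real (card (A x1))))"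
    by (simp add: sum_distrib_left power2_eq_square mult_ac)
  also have "\<dots> \<le> (\<Sum>x1\<in>G. N (x + x1) u * N x1 u)"
  proof (rule sum_mono)
    fix x1 assume x1: "x1 \<in> G"
    have "\<kappa> * real (card (A (x + x1))) \<le> N (x + x1) u" "\<kappa> * real (card (A x1)) \<le> N x1 u"
      using dom x1 xu by (simp_all add: dominates_def A_def)
    moreover have "0 \<le> \<kappa> * real (card (A v))" for v using \<kappa> by simp
    ultimately show "(\<kappa> * real (card (A (x + x1)))) * (\<kappa> * real (card (A x1))) \<le> N (x + x1) u * N x1 u"
      by (intro mult_mono) (auto intro: order_trans)
  qed
  finally show "\<kappa>\<^sup>2 * (q / (real s)\<^sup>2) * real (card ?B) \<le> hor N x u"
    by (simp add: hor_def mult_ac)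
qed

text \<open>A quadruple corresponds to the outer variable \<open>d - b\<close> and the two inner
  variables \<open>c\<close> and \<open>b\<close>; the remaining entries are
  \<open>a = x + (d - b) + c\<close> and \<open>d = (d - b) + b\<close>.\<close>

lemma hor_hor_quads:
  assumes A: "A \<subseteq> G \<times> G" and x: "x \<in> G"
  shows "real (card (quads {x \<in> G. (x, u) \<in> A} x)) \<le> hor (hor (\<lambda>x u. of_bool ((x, u) \<in> A))) x u"
proof -
  define F where "F = {x \<in> G. (x, u) \<in> A}"
  define h where "h y = {x2 \<in> G. y + x2 \<in> F \<and> x2 \<in> F}" for y
  have fh: "finite (h y)" for y using finite_G by (simp add: h_def)
  have hor1: "hor (\<lambda>x u. of_bool ((x, u) \<in> A)) y u = real (card (h y))" if "y \<in> G" for y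
  proof -
    have "hor (\<lambda>x u. of_bool ((x, u) \<in> A)) y u = (\<Sum>x2\<in>G. of_bool (y + x2 \<in> F \<and> x2 \<in> F))"
      unfolding hor_def using that by (intro sum.cong) (auto simp: F_def)
    also have "\<dots> = real (card (G \<inter> {x2. y + x2 \<in> F \<and> x2 \<in> F}))" using finite_G by simp
    also have "G \<inter> {x2. y + x2 \<in> F \<and> x2 \<in> F} = h y" by (auto simp: h_def)
    finally show ?thesis .
  qed
  have "card (quads F x) \<le> card (SIGMA x1:G. h (x + x1) \<times> h x1)"
  proof (rule card_inj_on_le[where f = "\<lambda>(a, b, c, d). (d - b, c, b)"])
    show "inj_on (\<lambda>(a, b, c, d). (d - b, c, b)) (quads F x)"
    proof (rule inj_onI)
      fix s t assume st: "s \<in> quads F x" "t \<in> quads F x"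
        and e: "(\<lambda>(a, b, c, d). (d - b, c, b)) s = (\<lambda>(a, b, c, d). (d - b, c, b)) t"
      obtain a b c d where s: "s = (a, b, c, d)" by (cases s) auto
      obtain a' b' c' d' where t: "t = (a', b', c', d')" by (cases t) auto
      have "a = x + c + d - b" "a' = x + c' + d' - b'"
        using st by (auto simp: s t quads_def algebra_simps)
      thus "s = t" using e by (auto simp: s t)
    qed
    show "(\<lambda>(a, b, c, d). (d - b, c, b)) ` quads F x \<subseteq> (SIGMA x1:G. h (x + x1) \<times> h x1)"
    proof clarify
      fix a b c d assume "(a, b, c, d) \<in> quads F x"
      hence abcd: "a \<in> F" "b \<in> F" "c \<in> F" "d \<in> F" "x + (d - b) + c = a" "d - b + b = d"
        by (auto simp: quads_def algebra_simps)
      have "d - b \<in> G" using abcd(2,4) by (auto simp: F_def)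
      moreover have "c \<in> h (x + (d - b))" "b \<in> h (d - b)"
        unfolding h_def mem_Collect_eq abcd(5,6) using abcd(1-4) by (auto simp: F_def)
      ultimately show "d - b \<in> G \<and> (c, b) \<in> h (x + (d - b)) \<times> h (d - b)" by blast
    qed
    show "finite (SIGMA x1:G. h (x + x1) \<times> h x1)"
      by (intro finite_SigmaI finite_G finite_cartesian_product fh)
  qed
  hence "real (card (quads F x)) \<le> (\<Sum>x1\<in>G. real (card (h (x + x1))) * real (card (h x1)))"
    using finite_G fh by (simp add: card_cartesian_product flip: of_nat_mult of_nat_sum)
  also have "\<dots> = hor (hor (\<lambda>x u. of_bool ((x, u) \<in> A))) x u"
    unfolding hor_def[of "hor _"] using x by (intro sum.cong refl) (simp add: hor1)
  finally show ?thesis by (simp add: F_def)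
qed

section \<open>Pairs of tuples with a common signed sum\<close>

definition join :: "(nat \<Rightarrow> 'v) \<Rightarrow> (nat \<Rightarrow> 'v) \<Rightarrow> nat \<Rightarrow> 'v" where
  "join t t' = (\<lambda>i\<in>{..<16}. if i < 8 then t i else t' (i - 8))"

definition regular_pairs where
  "regular_pairs J ls H Y Good = {w \<in> ({..<8} \<rightarrow>\<^sub>E Y) \<times> ({..<8} \<rightarrow>\<^sub>E Y).
     tsum 3 (\<lambda>y. y) (fst w) = tsum 3 (\<lambda>y. y) (snd w)
     \<and> \<not> irregular J ls H 8 (sgs 3) (fst w) (snd w) \<and> join (fst w) (snd w) \<in> Good}"

lemma sum_join:
  "(\<Sum>i<16. sg (sgs 4 i) (join t t' i)) = (\<Sum>i<8. sg (sgs 3 i) (t i)) - (\<Sum>i<8. sg (sgs 3 i) (t' i))"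
proof -
  have "(\<Sum>i<2 ^ Suc 3. sg (sgs (Suc 3) i) (join t t' i))
    = (\<Sum>i<2 ^ 3. sg (sgs 3 i) (join t t' i)) - (\<Sum>i<2 ^ 3. sg (sgs 3 i) (join t t' (i + 2 ^ 3)))"
    by (rule sum_sgs_Suc)
  moreover have "(\<Sum>i<8. sg (sgs 3 i) (join t t' i)) = (\<Sum>i<8. sg (sgs 3 i) (t i))"
    by (intro sum.cong) (auto simp: join_def)
  moreover have "(\<Sum>i<8. sg (sgs 3 i) (join t t' (i + 8))) = (\<Sum>i<8. sg (sgs 3 i) (t' i))"
    by (intro sum.cong) (auto simp: join_def)
  moreover have "(2::nat) ^ 3 = 8" "(2::nat) ^ Suc 3 = 16" "Suc 3 = 4" by simp_all
  ultimately show ?thesis by (simp only:)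
qed

context
  fixes J :: "nat set" and ls :: "nat \<Rightarrow> 'v \<Rightarrow> 'v"
  assumes fJ: "finite J" and ls: "\<And>i. i \<in> J \<Longrightarrow> lin (ls i)" and lsG: "\<And>i x. i \<in> J \<Longrightarrow> ls i x \<in> G"
begin

text \<open>A common element of the two sums of subspaces is a vanishing signed sum of sixteen
  elements of the \<open>U y\<close>. For a good tuple each of them lies in the span at its own
  point, and regularity carries this over to the span at the common signed sum.\<close>

lemma regular_pairs_span:
  assumes H: "V.subspace H" and U: "\<And>y. y \<in> Y \<Longrightarrow> V.subspace (U y)" and YG: "Y \<subseteq> G"
    and good: "\<And>t u i. t \<in> Good \<Longrightarrow> (\<And>i. i < 16 \<Longrightarrow> u i \<in> U (t i)) \<Longrightarrow> (\<Sum>i<16. sg (sgs 4 i) (u i)) = 0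
      \<Longrightarrow> i < 16 \<Longrightarrow> u i \<in> span_at J ls H (t i)"
    and w: "w \<in> regular_pairs J ls H Y Good"
  shows "SS 8 U (fst w) \<inter> SS 8 U (snd w) \<subseteq> span_at J ls H (tsum 3 (\<lambda>y. y) (fst w))"
proof
  fix x assume "x \<in> SS 8 U (fst w) \<inter> SS 8 U (snd w)"
  then obtain u u' where u: "\<And>i. i < 8 \<Longrightarrow> u i \<in> U (fst w i)" "x = (\<Sum>i<8. u i)"
    and u': "\<And>i. i < 8 \<Longrightarrow> u' i \<in> U (snd w i)" "x = (\<Sum>i<8. u' i)"
    unfolding SS_def by blast
  have wY: "fst w i \<in> Y" "snd w i \<in> Y" if "i < 8" for i
    using w that by (auto simp: regular_pairs_def mem_Times_iff PiE_iff)
  have sgU: "sg b z \<in> U y" if "z \<in> U y" "y \<in> Y" for b z y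
    using that V.subspace_neg[OF U] by (auto simp: sg_def)
  define v where "v = join (\<lambda>i. sg (sgs 3 i) (u i)) (\<lambda>i. sg (sgs 3 i) (u' i))"
  have "(\<Sum>i<16. sg (sgs 4 i) (v i)) = 0"
    using u(2) u'(2) unfolding v_def sum_join by simp
  moreover have "v i \<in> U (join (fst w) (snd w) i)" if "i < 16" for i
  proof (cases "i < 8")
    case True thus ?thesis using sgU[OF u(1)] wY by (auto simp: v_def join_def)
  next
    case False
    hence "i - 8 < 8" using that by simp
    thus ?thesis using False that sgU[OF u'(1)] wY by (auto simp: v_def join_def)
  qed
  moreover have "join (fst w) (snd w) \<in> Good" using w by (simp add: regular_pairs_def)
  ultimately have v: "v i \<in> span_at J ls H (join (fst w) (snd w) i)" if "i < 16" for i
    using good that by blast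
  have sgS: "z \<in> span_at J ls H y" if "sg b z \<in> span_at J ls H y" for b z y
    using V.subspace_neg[OF subspace_span_at[OF fJ ls lsG H] that] that by (cases b) (auto simp: sg_def)
  have "u i \<in> span_at J ls H (fst w i)" if "i < 8" for i
  proof -
    have "sg (sgs 3 i) (u i) \<in> span_at J ls H (fst w i)" using v[of i] that by (simp add: v_def join_def)
    thus ?thesis by (rule sgS)
  qed
  moreover have "u' i \<in> span_at J ls H (snd w i)" if "i < 8" for i
  proof -
    have "sg (sgs 3 i) (u' i) \<in> span_at J ls H (snd w i)" using v[of "i + 8"] that by (simp add: v_def join_def)
    thus ?thesis by (rule sgS)
  qed
  moreover have "fst w \<in> tuples 8 (sgs 3) G (tsum 3 (\<lambda>y. y) (fst w))"
    using wY YG w by (auto simp: tuples_def tsum_def regular_pairs_def mem_Times_iff PiE_iff)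
  moreover have "\<not> irregular J ls H 8 (sgs 3) (fst w) (snd w)" using w by (simp add: regular_pairs_def)
  ultimately have "(\<Sum>i<8. u i) \<in> span_at J ls H (tsum 3 (\<lambda>y. y) (fst w))"
    using u(2) u'(2)
    by (intro regular_intersection[OF fJ ls lsG H, where n = 8 and t = "fst w" and \<sigma> = "sgs 3" and t' = "snd w" and u' = u']) auto
  thus "x \<in> span_at J ls H (tsum 3 (\<lambda>y. y) (fst w))" using u(2) by simp
qed

text \<open>Cutting good 16-tuples in half gives pairs of 8-tuples with equal sums. By
  \<open>\<theta>\<close>, irregular pairs account for at most half of them; the rest are
  distributed over the sums \<open>z\<close>, and those \<open>z\<close> receiving a fair share form
  \<open>T\<close>.\<close>

lemma first_layer:
  assumes H: "V.subspace H" and YG: "Y \<subseteq> G" and \<rho>: "0 \<le> \<rho>"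
    and rank: "\<And>c. (\<forall>y\<in>G. comb J ls c y \<in> H) \<or> real (card (mod_ker (comb J ls c) H)) \<le> \<rho> * q"
    and Good: "Good \<subseteq> {t \<in> {..<16} \<rightarrow>\<^sub>E Y. (\<Sum>i<16. sg (sgs 4 i) (t i)) = 0}" "\<theta> * q ^ 15 \<le> real (card Good)"
    and \<theta>: "real CARD('p) ^ (16 * card J) * \<rho> \<le> \<theta> / 2"
  obtains T where "T \<subseteq> G" "\<theta> / 4 * q \<le> real (card T)"
    "\<And>z. z \<in> T \<Longrightarrow> \<theta> / 4 * q ^ 14 \<le> real (card {w \<in> regular_pairs J ls H Y Good. tsum 3 (\<lambda>y. y) (fst w) = z})"
proof -
  let ?R = "regular_pairs J ls H Y Good"
  define n where "n z = card {w \<in> ?R. tsum 3 (\<lambda>y. y) (fst w) = z}" for z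
  define T where "T = {z \<in> G. \<theta> / 4 * q ^ 14 \<le> real (n z)}"
  define Irr where "Irr z = {(t, t'). t \<in> tuples 8 (sgs 3) G z \<and> t' \<in> tuples 8 (sgs 3) G z \<and> irregular J ls H 8 (sgs 3) t t'}" for z
  have fY: "finite Y" using YG finite_sub by blast
  have fR: "finite ?R"
    by (rule finite_subset[of _ "({..<8} \<rightarrow>\<^sub>E Y) \<times> ({..<8} \<rightarrow>\<^sub>E Y)"])
       (auto simp: regular_pairs_def fY finite_PiE)
  have fIrr: "finite (Irr z)" for z
    by (rule finite_subset[of _ "tuples 8 (sgs 3) G z \<times> tuples 8 (sgs 3) G z"])
       (auto simp: Irr_def finite_tuples finite_G)
  define lo where "lo t = restrict t {..<8}" for t :: "nat \<Rightarrow> 'v"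
  define hi where "hi t = (\<lambda>i\<in>{..<8}. t (i + 8))" for t :: "nat \<Rightarrow> 'v"
  have lohi: "join (lo t) (hi t) = t" if "t \<in> {..<16} \<rightarrow>\<^sub>E Y" for t
  proof (rule extensionalityI[of _ "{..<16}"])
    show "join (lo t) (hi t) \<in> extensional {..<16}" by (simp add: join_def)
    show "t \<in> extensional {..<16}" using that by (simp add: PiE_iff)
    fix i :: nat assume "i \<in> {..<16}"
    thus "join (lo t) (hi t) i = t i" by (auto simp: join_def lo_def hi_def)
  qed
  have "card Good \<le> card (?R \<union> (\<Union>z\<in>G. Irr z))"
  proof (rule card_inj_on_le[where f = "\<lambda>t. (lo t, hi t)"])
    show "inj_on (\<lambda>t. (lo t, hi t)) Good"
    proof (rule inj_onI)
      fix s t assume "s \<in> Good" "t \<in> Good" "(lo s, hi s) = (lo t, hi t)"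
      thus "s = t" using lohi[of s] lohi[of t] Good(1) by auto
    qed
    show "(\<lambda>t. (lo t, hi t)) ` Good \<subseteq> ?R \<union> (\<Union>z\<in>G. Irr z)"
    proof (rule image_subsetI)
      fix t assume t: "t \<in> Good"
      hence tY: "t \<in> {..<16} \<rightarrow>\<^sub>E Y" and t0: "(\<Sum>i<16. sg (sgs 4 i) (t i)) = 0" using Good(1) by auto
      have Y: "lo t \<in> {..<8} \<rightarrow>\<^sub>E Y" "hi t \<in> {..<8} \<rightarrow>\<^sub>E Y"
        using tY by (auto simp: lo_def hi_def PiE_iff)
      let ?z = "\<Sum>i<8. sg (sgs 3 i) (lo t i)"
      have "(\<Sum>i<16. sg (sgs 4 i) (join (lo t) (hi t) i)) = 0" using t0 by (simp only: lohi[OF tY])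
      hence eq: "(\<Sum>i<8. sg (sgs 3 i) (hi t i)) = ?z" unfolding sum_join by simp
      have zG: "?z \<in> G" using Y YG by (intro G_sum sg_G) (auto simp: PiE_iff)
      have tup: "lo t \<in> tuples 8 (sgs 3) G ?z" "hi t \<in> tuples 8 (sgs 3) G ?z"
        using Y YG eq by (auto simp: tuples_def PiE_iff)
      show "(lo t, hi t) \<in> ?R \<union> (\<Union>z\<in>G. Irr z)"
      proof (cases "irregular J ls H 8 (sgs 3) (lo t) (hi t)")
        case True
        hence "(lo t, hi t) \<in> Irr ?z" using tup by (simp add: Irr_def)
        thus ?thesis using zG by blast
      next
        case False
        thus ?thesis using Y eq t lohi[OF tY] by (simp add: regular_pairs_def tsum_def)
      qed
    qed
    show "finite (?R \<union> (\<Union>z\<in>G. Irr z))" using fR fIrr finite_G by simp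
  qed
  also have "\<dots> \<le> card ?R + (\<Sum>z\<in>G. card (Irr z))"
    by (rule order_trans[OF card_Un_le add_left_mono[OF card_UN_le[OF finite_G]]])
  finally have "real (card Good) \<le> real (card ?R) + (\<Sum>z\<in>G. real (card (Irr z)))"
    by (simp flip: of_nat_sum of_nat_add)
  also have "(\<Sum>z\<in>G. real (card (Irr z))) \<le> (\<Sum>z\<in>G. real CARD('p) ^ (2 * 8 * card J) * (\<rho> * q ^ (2 * (8 - 1))))"
    unfolding Irr_def by (intro sum_mono card_irregular_pairs[OF fJ ls lsG H _ \<rho> rank]) auto
  also have "\<dots> = (real CARD('p) ^ (16 * card J) * \<rho>) * q ^ 15" by (simp add: eval_nat_numeral mult_ac)
  also have "\<dots> \<le> \<theta> / 2 * q ^ 15" using \<theta> by (intro mult_right_mono) auto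
  finally have R_ge: "\<theta> / 2 * q ^ 15 \<le> real (card ?R)" using Good(2) by simp
  have sumG: "tsum 3 (\<lambda>y. y) (fst w) \<in> G" if "w \<in> ?R" for w
    using that YG unfolding tsum_def by (intro G_sum sg_G) (auto simp: regular_pairs_def mem_Times_iff PiE_iff)
  have "?R \<subseteq> (\<Union>z\<in>G. {w \<in> ?R. tsum 3 (\<lambda>y. y) (fst w) = z})" using sumG by auto
  hence "card ?R \<le> card (\<Union>z\<in>G. {w \<in> ?R. tsum 3 (\<lambda>y. y) (fst w) = z})"
    using fR by (intro card_mono finite_UN_I finite_G) auto
  also have "\<dots> \<le> (\<Sum>z\<in>G. n z)" unfolding n_def by (rule card_UN_le[OF finite_G])
  finally have "real (card ?R) \<le> (\<Sum>z\<in>G. real (n z))" by (simp flip: of_nat_sum)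
  \<comment> \<open>No \<open>z\<close> is the sum of more than \<open>q ^ 7 * q ^ 7\<close> pairs,
    so the points outside \<open>T\<close> cannot carry the total and \<open>T\<close> must be
    dense.\<close>
  also have "\<dots> \<le> (\<Sum>z\<in>G. of_bool (z \<in> T) * q ^ 14 + \<theta> / 4 * q ^ 14)"
  proof (rule sum_mono)
    fix z assume z: "z \<in> G"
    have \<theta>0: "0 \<le> \<theta> / 4 * q ^ 14"
    proof -
      have "0 \<le> real CARD('p) ^ (16 * card J) * \<rho>" using \<rho> by simp
      hence "0 \<le> \<theta>" using \<theta> by linarith
      thus ?thesis by simp
    qed
    show "real (n z) \<le> of_bool (z \<in> T) * q ^ 14 + \<theta> / 4 * q ^ 14"
    proof (cases "z \<in> T")
      case True
      have "{w \<in> ?R. tsum 3 (\<lambda>y. y) (fst w) = z} \<subseteq> tuples 8 (sgs 3) G z \<times> tuples 8 (sgs 3) G z"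
        using YG by (auto simp: regular_pairs_def tuples_def tsum_def PiE_iff)
      hence "n z \<le> card (tuples 8 (sgs 3) G z \<times> tuples 8 (sgs 3) G z)"
        unfolding n_def by (intro card_mono finite_cartesian_product finite_tuples finite_G)
      also have "\<dots> \<le> card G ^ 7 * card G ^ 7"
        unfolding card_cartesian_product using card_tuples_le[of 8 "sgs 3" z]
        by (intro mult_le_mono) simp_all
      also have "\<dots> = card G ^ 14" by (simp flip: power_add)
      finally have "real (n z) \<le> q ^ 14" by (metis of_nat_le_iff of_nat_power)
      moreover have "of_bool (z \<in> T) * q ^ 14 = q ^ 14" using True by simp
      ultimately show ?thesis using \<theta>0 by linarith
    next
      case False
      thus ?thesis using z by (auto simp: T_def)
    qed
  qed
  also have "\<dots> = real (card T) * q ^ 14 + \<theta> / 4 * q ^ 15"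
  proof -
    have "G \<inter> T = T" by (auto simp: T_def)
    thus ?thesis using finite_G by (simp add: sum.distrib sum_distrib_right[symmetric] eval_nat_numeral)
  qed
  finally have "(\<theta> / 4 * q) * q ^ 14 \<le> real (card T) * q ^ 14" using R_ge by (simp add: eval_nat_numeral)
  hence "\<theta> / 4 * q \<le> real (card T)" using q_pos by (simp add: mult_le_cancel_right_pos)
  moreover have "T \<subseteq> G" by (auto simp: T_def)
  moreover have "\<theta> / 4 * q ^ 14 \<le> real (card {w \<in> ?R. tsum 3 (\<lambda>y. y) (fst w) = z})" if "z \<in> T" for z
    using that unfolding T_def n_def by blast
  ultimately show ?thesis using that by blast
qed

text \<open>The pattern \<open>sgs 2\<close> has signs plus, minus, minus, plus, so \<open>a\<close>
  and \<open>b\<close> go to the ends and \<open>c\<close> and \<open>d\<close> to the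
  middle.\<close>

lemma card_quads_le_tuples:
  assumes "finite T" shows "card (quads T y) \<le> card (tuples 4 (sgs 2) T y)"
proof (rule card_inj_on_le[where f = "\<lambda>(a, b, c, d). (\<lambda>i\<in>{..<4}. if i = 0 then a else if i = 1 then c else if i = 2 then d else b)"])
  let ?f = "\<lambda>(a, b, c, d). (\<lambda>i\<in>{..<4::nat}. if i = 0 then a else if i = 1 then c else if i = 2 then d else b)"
  show "inj_on ?f (quads T y)"
  proof (rule inj_onI)
    fix s t assume e: "?f s = ?f t"
    obtain a b c d where s: "s = (a, b, c, d)" by (cases s) auto
    obtain a' b' c' d' where t: "t = (a', b', c', d')" by (cases t) auto
    show "s = t" using fun_cong[OF e, of 0] fun_cong[OF e, of 1] fun_cong[OF e, of 2] fun_cong[OF e, of 3]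
      by (simp add: s t)
  qed
  have s4: "(\<Sum>i<4. g i) = g 0 + g 1 + g 2 + g 3" for g :: "nat \<Rightarrow> 'v"
    by (simp add: eval_nat_numeral)
  have sg4: "sgs 2 0 = False" "sgs 2 (Suc 0) = True" "sgs 2 1 = True" "sgs 2 2 = True" "sgs 2 3 = False"
    by (simp_all add: eval_nat_numeral)
  show "?f ` quads T y \<subseteq> tuples 4 (sgs 2) T y"
  proof (rule image_subsetI)
    fix s assume "s \<in> quads T y"
    then obtain a b c d where s: "s = (a, b, c, d)" "a \<in> T" "b \<in> T" "c \<in> T" "d \<in> T" "a + b - c - d = y"
      by (cases s) (auto simp: quads_def)
    have "(\<Sum>i<4. sg (sgs 2 i) (?f s i)) = a - c - d + b"
      unfolding s4 by (simp add: s(1) sg4 sg_def)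
    also have "\<dots> = y" using s(6) by (simp add: algebra_simps)
    finally have 1: "(\<Sum>i<4. sg (sgs 2 i) (?f s i)) = y" .
    have 2: "?f s \<in> {..<4} \<rightarrow>\<^sub>E T" using s(2-5) by (auto simp: s(1))
    show "?f s \<in> tuples 4 (sgs 2) T y" unfolding tuples_def mem_Collect_eq using 1 2 by blast
  qed
qed (rule finite_tuples[OF assms])

text \<open>Each representation of \<open>y\<close> by four points of \<open>T\<close> lifts to at
  least \<open>\<nu> ^ 4\<close> quadruples of configurations. Among the \<open>M ^ 2\<close> pairs
  of representations at most half are irregular. For a regular pair the final intersection lies in
  the span at \<open>y\<close>, so a single condition on \<open>x\<close> serves all of
  them.\<close>

lemma second_layer:
  assumes dom: "dominates N \<kappa> \<Omega> \<pi> S" and \<kappa>: "0 \<le> \<kappa>" and f: "finite \<Omega>" and \<pi>: "\<And>\<omega>. \<omega> \<in> \<Omega> \<Longrightarrow> \<pi> \<omega> \<in> G"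
    and S: "\<And>\<omega>. \<omega> \<in> \<Omega> \<Longrightarrow> V.subspace (S \<omega>)" "\<And>\<omega>. \<omega> \<in> \<Omega> \<Longrightarrow> S \<omega> \<subseteq> G" "\<And>\<omega>. \<omega> \<in> \<Omega> \<Longrightarrow> card (S \<omega>) \<le> s"
    and s: "0 < s" and Sspan: "\<And>\<omega>. \<omega> \<in> \<Omega> \<Longrightarrow> S \<omega> \<subseteq> span_at J ls H (\<pi> \<omega>)"
    and H: "V.subspace H" and \<rho>: "0 \<le> \<rho>"
    and rank: "\<And>c. (\<forall>y\<in>G. comb J ls c y \<in> H) \<or> real (card (mod_ker (comb J ls c) H)) \<le> \<rho> * q"
    and T: "T \<subseteq> G" "\<And>z. z \<in> T \<Longrightarrow> \<nu> \<le> real (card {\<omega> \<in> \<Omega>. \<pi> \<omega> = z})" and \<nu>: "0 \<le> \<nu>"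
    and y: "y \<in> G" and x: "x \<in> perp (span_at J ls H y)"
    and M: "M \<le> real (card (quads T y))" "0 \<le> M"
    and irr: "real CARD('p) ^ (8 * card J) * (\<rho> * q ^ 6) \<le> M\<^sup>2 / 2"
  shows "\<kappa> ^ 8 * (q / real s ^ 8) * (M\<^sup>2 / 2 * \<nu> ^ 8) \<le> hor ((ver ^^ 2) N) x y"
proof -
  have two2: "(2::nat) ^ 2 = 4" by simp
  let ?\<Omega>4 = "{..<4::nat} \<rightarrow>\<^sub>E \<Omega>"
  have fT: "finite T" using T finite_sub by blast
  have f4: "finite ?\<Omega>4" using f by (simp add: finite_PiE)
  have dom4: "dominates ((ver ^^ 2) N) (\<kappa> ^ 4) ?\<Omega>4 (tsum 2 \<pi>) (SS 4 S)"
    using ver_dominates[OF dom \<kappa> f \<pi> S(1), of 2] by (simp only: two2)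
  have mem: "t i \<in> \<Omega>" if "t \<in> ?\<Omega>4" "i < 4" for t i using that by (auto simp: PiE_iff)
  have dom5: "dominates (hor ((ver ^^ 2) N)) ((\<kappa> ^ 4)\<^sup>2 * (q / (real (s ^ 4))\<^sup>2))
     {w \<in> ?\<Omega>4 \<times> ?\<Omega>4. tsum 2 \<pi> (fst w) = tsum 2 \<pi> (snd w)} (\<lambda>w. tsum 2 \<pi> (fst w)) (\<lambda>w. SS 4 S (fst w) \<inter> SS 4 S (snd w))"
  proof (rule hor_dominates[OF dom4 _ f4])
    fix t assume t: "t \<in> ?\<Omega>4"
    show "V.subspace (SS 4 S t)" by (intro subspace_SS S(1) mem[OF t])
    show "SS 4 S t \<subseteq> G" by (intro SS_sub S(2) mem[OF t])
    show "card (SS 4 S t) \<le> s ^ 4" by (intro card_SS_le S(2,3) mem[OF t])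
  qed (use \<kappa> s in auto)
  let ?B = "{w \<in> {w \<in> ?\<Omega>4 \<times> ?\<Omega>4. tsum 2 \<pi> (fst w) = tsum 2 \<pi> (snd w)}.
     tsum 2 \<pi> (fst w) = y \<and> x \<in> perp (SS 4 S (fst w) \<inter> SS 4 S (snd w))}"
  let ?Tu = "tuples 4 (sgs 2) T y"
  have fTu: "finite ?Tu" by (rule finite_tuples[OF fT])
  \<comment> \<open>Regularity is tested on the points of \<open>T\<close> and not on the
    configurations above them, so the irregular pairs are counted before lifting.\<close>
  define R where "R = {(t, t'). t \<in> ?Tu \<and> t' \<in> ?Tu \<and> \<not> irregular J ls H 4 (sgs 2) t t'}"
  have fR: "finite R" by (rule finite_subset[of _ "?Tu \<times> ?Tu"]) (auto simp: R_def fTu)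
  define Irr where "Irr = {(t, t'). t \<in> tuples 4 (sgs 2) G y \<and> t' \<in> tuples 4 (sgs 2) G y \<and> irregular J ls H 4 (sgs 2) t t'}"
  have fIrr: "finite Irr"
    by (rule finite_subset[of _ "tuples 4 (sgs 2) G y \<times> tuples 4 (sgs 2) G y"])
       (auto simp: Irr_def finite_tuples finite_G)
  have TuG: "?Tu \<subseteq> tuples 4 (sgs 2) G y" using T(1) by (auto simp: tuples_def PiE_iff)
  have cIrr: "real (card Irr) \<le> M\<^sup>2 / 2"
    using card_irregular_pairs[OF fJ ls lsG H _ \<rho> rank, of 4 "sgs 2" y] irr by (simp add: Irr_def)
  have "?Tu \<times> ?Tu \<subseteq> R \<union> Irr" using TuG by (auto simp: R_def Irr_def)
  hence "card (?Tu \<times> ?Tu) \<le> card R + card Irr"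
    using fR fIrr by (intro order_trans[OF card_mono card_Un_le]) auto
  hence "real (card ?Tu) * real (card ?Tu) \<le> real (card R) + real (card Irr)"
    by (simp add: card_cartesian_product flip: of_nat_mult of_nat_add)
  moreover have MTu: "M \<le> real (card ?Tu)" using M(1) card_quads_le_tuples[OF fT, of y] by linarith
  have "M * M \<le> real (card ?Tu) * real (card ?Tu)" using M(2) MTu by (intro mult_mono) auto
  ultimately have cR: "M\<^sup>2 / 2 \<le> real (card R)" using cIrr by (simp add: power2_eq_square)
  define Fb where "Fb z = {\<omega> \<in> \<Omega>. \<pi> \<omega> = z}" for z
  let ?P = "\<lambda>t. PiE {..<4::nat} (\<lambda>i. Fb (t i))"
  have fFb: "finite (Fb z)" for z using f by (simp add: Fb_def)
  have fP: "finite (?P t)" for t using fFb by (intro finite_PiE) auto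
  have cP: "\<nu> ^ 4 \<le> real (card (?P t))" if "t \<in> ?Tu" for t
  proof -
    have "(\<Prod>i<4::nat. \<nu>) \<le> (\<Prod>i<4::nat. real (card (Fb (t i))))"
      using that T(2) \<nu> by (intro prod_mono) (auto simp: tuples_def Fb_def PiE_iff)
    thus ?thesis by (simp add: card_PiE)
  qed
  have "M\<^sup>2 / 2 * (\<nu> ^ 4 * \<nu> ^ 4) \<le> real (card (SIGMA w:R. ?P (fst w) \<times> ?P (snd w)))"
  proof (rule card_Sigma_ge[OF fR _ cR])
    fix w assume w: "w \<in> R"
    show "finite (?P (fst w) \<times> ?P (snd w))" using fP by simp
    have "\<nu> ^ 4 \<le> real (card (?P (fst w)))" "\<nu> ^ 4 \<le> real (card (?P (snd w)))"
      using w cP by (auto simp: R_def)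
    thus "\<nu> ^ 4 * \<nu> ^ 4 \<le> real (card (?P (fst w) \<times> ?P (snd w)))"
      unfolding card_cartesian_product of_nat_mult using \<nu> by (intro mult_mono) auto
  qed (use \<nu> in simp)
  also have "card (SIGMA w:R. ?P (fst w) \<times> ?P (snd w)) \<le> card ?B"
  proof (rule card_inj_on_le[where f = snd])
    \<comment> \<open>The points \<open>t\<close> are the images under \<open>\<pi>\<close> of the
      chosen configurations, so dropping them from the count loses nothing.\<close>
    have ext: "t = restrict (\<lambda>i. \<pi> (\<tau> i)) {..<4}" if "t \<in> ?Tu" "\<tau> \<in> ?P t" for t \<tau>
      using that by (intro extensionalityI[of t "{..<4}"]) (auto simp: tuples_def Fb_def PiE_iff)
    show "inj_on snd (SIGMA w:R. ?P (fst w) \<times> ?P (snd w))"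
    proof (rule inj_onI)
      fix a b assume ab: "a \<in> (SIGMA w:R. ?P (fst w) \<times> ?P (snd w))" "b \<in> (SIGMA w:R. ?P (fst w) \<times> ?P (snd w))" "snd a = snd b"
      obtain t t' \<tau> \<tau>' where a: "a = ((t, t'), (\<tau>, \<tau>'))" by (metis surj_pair)
      obtain s s' where b: "b = ((s, s'), (\<tau>, \<tau>'))" using ab(3) a by (metis snd_conv surj_pair)
      have m: "t \<in> ?Tu" "t' \<in> ?Tu" "s \<in> ?Tu" "s' \<in> ?Tu" "\<tau> \<in> ?P t" "\<tau>' \<in> ?P t'" "\<tau> \<in> ?P s" "\<tau>' \<in> ?P s'"
        using ab by (auto simp: a b R_def)
      have "t = s" using ext[OF m(1,5)] ext[OF m(3,7)] by simp
      moreover have "t' = s'" using ext[OF m(2,6)] ext[OF m(4,8)] by simp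
      ultimately show "a = b" by (simp add: a b)
    qed
    show "snd ` (SIGMA w:R. ?P (fst w) \<times> ?P (snd w)) \<subseteq> ?B"
    proof (rule image_subsetI)
      fix a assume aS: "a \<in> (SIGMA w:R. ?P (fst w) \<times> ?P (snd w))"
      obtain t t' \<tau> \<tau>' where a: "a = ((t, t'), (\<tau>, \<tau>'))" by (metis surj_pair)
      have m: "t \<in> ?Tu" "t' \<in> ?Tu" "\<not> irregular J ls H 4 (sgs 2) t t'" "\<tau> \<in> ?P t" "\<tau>' \<in> ?P t'"
        using aS by (auto simp: a R_def)
      have pt: "\<tau> i \<in> \<Omega>" "\<pi> (\<tau> i) = t i" "\<tau>' i \<in> \<Omega>" "\<pi> (\<tau>' i) = t' i" if "i < 4" for i
        using m(4,5) that by (auto simp: Fb_def PiE_iff)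
      have \<Omega>4: "\<tau> \<in> ?\<Omega>4" "\<tau>' \<in> ?\<Omega>4" using m(4,5) by (auto simp: Fb_def PiE_iff)
      have "tsum 2 \<pi> \<tau> = (\<Sum>i<4. sg (sgs 2 i) (t i))" "tsum 2 \<pi> \<tau>' = (\<Sum>i<4. sg (sgs 2 i) (t' i))"
        unfolding tsum_def two2 using pt by (auto intro!: sum.cong)
      hence ts: "tsum 2 \<pi> \<tau> = y" "tsum 2 \<pi> \<tau>' = y" using m(1,2) by (auto simp: tuples_def)
      have "SS 4 S \<tau> \<inter> SS 4 S \<tau>' \<subseteq> span_at J ls H y"
      proof
        fix v assume "v \<in> SS 4 S \<tau> \<inter> SS 4 S \<tau>'"
        then obtain u u' where u: "\<And>i. i < 4 \<Longrightarrow> u i \<in> S (\<tau> i)" "v = (\<Sum>i<4. u i)"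
          and u': "\<And>i. i < 4 \<Longrightarrow> u' i \<in> S (\<tau>' i)" "v = (\<Sum>i<4. u' i)"
          unfolding SS_def by blast
        have "u i \<in> span_at J ls H (t i)" "u' i \<in> span_at J ls H (t' i)" if "i < 4" for i
          using u(1)[OF that] u'(1)[OF that] Sspan[of "\<tau> i"] Sspan[of "\<tau>' i"] pt[OF that] by auto
        hence "(\<Sum>i<4. u i) \<in> span_at J ls H y"
          using u(2) u'(2) m(1,3) TuG
          by (intro regular_intersection[OF fJ ls lsG H, where n = 4 and t = t and \<sigma> = "sgs 2" and t' = t' and u' = u']) auto
        thus "v \<in> span_at J ls H y" using u(2) by simp
      qed
      hence "x \<in> perp (SS 4 S \<tau> \<inter> SS 4 S \<tau>')" using x perp_antimono by blast
      thus "snd a \<in> ?B" using \<Omega>4 ts by (simp add: a)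
    qed
    show "finite ?B" using f4 by simp
  qed
  finally have "M\<^sup>2 / 2 * (\<nu> ^ 4 * \<nu> ^ 4) \<le> real (card ?B)" by simp
  hence "((\<kappa> ^ 4)\<^sup>2 * (q / (real (s ^ 4))\<^sup>2)) * (M\<^sup>2 / 2 * (\<nu> ^ 4 * \<nu> ^ 4))
     \<le> ((\<kappa> ^ 4)\<^sup>2 * (q / (real (s ^ 4))\<^sup>2)) * real (card ?B)"
    using \<kappa> by (intro mult_left_mono) auto
  also have "\<dots> \<le> hor ((ver ^^ 2) N) x y"
    using dom5 y x perp_subset unfolding dominates_def by blast
  finally show ?thesis by (simp add: power_mult[symmetric] power_add[symmetric])
qed

end

end

subsection \<open>Numerical parameters\<close>

lemma log_inv_ge_half: "1 / 2 \<le> log_inv x"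
proof -
  have "1 / 2 \<le> ln (2::real)" using ln_ge_iff[of "2::real" "1/2"] exp_half_le2 by simp
  thus ?thesis by (simp add: log_inv_def le_max_iff_disj)
qed

lemma ln2_le_log_inv: "ln 2 \<le> log_inv x"
  by (simp add: log_inv_def)

lemma ln_inverse_le_log_inv: "ln (1 / x) \<le> log_inv x"
  by (simp add: log_inv_def)

lemma log_inv_leI: "ln (1 / x) \<le> B \<Longrightarrow> ln 2 \<le> B \<Longrightarrow> log_inv x \<le> B"
  by (simp add: log_inv_def)

lemma inverse_le_exp_log_inv:
  assumes "0 < x" shows "1 / x \<le> exp (log_inv x)"
  using ln_inverse_le_log_inv[of x] assms by (metis exp_le_cancel_iff exp_ln zero_less_divide_1_iff)

lemma exp_minus_leI:
  fixes x y :: real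
  assumes "0 < x" "1 / x \<le> exp y" shows "exp (- y) \<le> x"
  using assms by (simp add: exp_minus field_simps)

lemma exp_minus_mult_leI:
  fixes x y z :: real
  assumes "0 < x" "z * (1 / x) \<le> exp y" shows "exp (- y) * z \<le> x"
  using assms by (simp add: exp_minus field_simps)

lemma le_two_power_nat_ceiling:
  fixes x :: real
  assumes "0 \<le> x" shows "exp x \<le> 2 ^ nat \<lceil>2 * x\<rceil>"
proof -
  let ?k = "nat \<lceil>2 * x\<rceil>"
  have "1 / 2 \<le> ln (2::real)" using ln_ge_iff[of "2::real" "1/2"] exp_half_le2 by simp
  moreover have "2 * x \<le> real ?k" by linarith
  ultimately have "x \<le> real ?k * ln 2"
    using mult_mono[of "2 * x" "real ?k" "1 / 2" "ln 2"] assms by simp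
  hence "exp x \<le> exp (real ?k * ln 2)" by simp
  also have "\<dots> = 2 ^ ?k" by (simp add: exp_of_nat_mult)
  finally show ?thesis .
qed

text \<open>The numerical hypotheses of the quantitative Bogolyubov--Ruzsa lemma, and the assertion that
  they can be met with codimension \<open>O(log\<^sup>4)\<close>.\<close>

definition br_params :: "real \<Rightarrow> nat \<Rightarrow> nat \<Rightarrow> bool" where
  "br_params \<tau> k l \<longleftrightarrow> k \<ge> 1 \<and> 32 / \<tau> \<le> 2 ^ k \<and>
     2 * exp (- (1 / (64 * real k))\<^sup>2 * real l / 4) \<le> \<tau> * (1 / (64 * real k)) / 2"

definition br_const :: "real \<Rightarrow> bool" where
  "br_const C \<longleftrightarrow> C > 0 \<and> (\<forall>\<tau>. 0 < \<tau> \<longrightarrow> \<tau> \<le> 1 \<longrightarrow> (\<exists>k l. br_params \<tau> k l \<and>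
     (\<forall>r::nat. \<tau> ^ l / 2 * exp (real r / 32) \<le> 1 \<longrightarrow> real r \<le> C * log_inv \<tau> ^ 4)))"

text \<open>With \<open>L = log_inv \<tau>\<close>, the number \<open>k\<close> of smoothing steps
  is of order \<open>L\<close>, the sample size \<open>l\<close> of order \<open>k ^ 2 * L\<close>,
  that is \<open>L ^ 3\<close>, and the codimension of order \<open>l * L\<close>.\<close>

lemma ex_br_const: "\<exists>C. br_const C"
proof -
  define C0 :: real where "C0 = 16384 * 38 * 26\<^sup>2 + 8"
  have "\<exists>k l. br_params \<tau> k l \<and>
     (\<forall>r::nat. \<tau> ^ l / 2 * exp (real r / 32) \<le> 1 \<longrightarrow> real r \<le> (32 * (C0 + 8)) * log_inv \<tau> ^ 4)"
    if \<tau>: "0 < \<tau>" "\<tau> \<le> 1" for \<tau>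
  proof -
    define L where "L = log_inv \<tau>"
    have L: "1 / 2 \<le> L" "ln 2 \<le> L" "ln (1 / \<tau>) \<le> L"
      unfolding L_def by (rule log_inv_ge_half, rule ln2_le_log_inv, rule ln_inverse_le_log_inv)
    have invt: "1 / \<tau> \<le> exp L" using inverse_le_exp_log_inv[OF \<tau>(1)] by (simp add: L_def)
    have two: "2 \<le> exp L" using L(2) by (metis exp_ln exp_le_cancel_iff zero_less_numeral)
    \<comment> \<open>The bound \<open>32 / \<tau> \<le> exp (6 * L)\<close> uses
      \<open>32 = 2 ^ 5\<close>; the factor 2 pays for passing from base e to base 2.\<close>
    define k where "k = nat \<lceil>2 * (6 * L)\<rceil>"
    have k1: "k \<ge> 1" using L(1) by (simp add: k_def) linarith
    have k_le: "real k \<le> 26 * L" using L(1) by (simp add: k_def) linarith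
    have "32 / \<tau> = 2 ^ 5 * (1 / \<tau>)" by simp
    also have "\<dots> \<le> exp L ^ 5 * exp L" using two invt \<tau> by (intro mult_mono power_mono) auto
    also have "\<dots> = exp (6 * L)" by (simp add: exp_of_nat_mult[symmetric] exp_add[symmetric])
    also have "\<dots> \<le> 2 ^ k" unfolding k_def by (rule le_two_power_nat_ceiling) (use L in simp)
    finally have k2: "32 / \<tau> \<le> 2 ^ k" .
    define \<epsilon> where "\<epsilon> = 1 / (64 * real k)"
    have \<epsilon>: "0 < \<epsilon>" using k1 by (simp add: \<epsilon>_def)
    \<comment> \<open>\<open>16384 * k ^ 2\<close> is \<open>4 / \<epsilon> ^ 2\<close>, so the
      exponent becomes at most \<open>- 38 * L\<close>; the bound below requires
      \<open>35 = 8 + 26 + 1\<close>.\<close>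
    define l where "l = nat \<lceil>16384 * real k ^ 2 * (38 * L)\<rceil>"
    have l_ge: "16384 * real k ^ 2 * (38 * L) \<le> real l" by (simp add: l_def) linarith
    have "exp (- \<epsilon>\<^sup>2 * real l / 4) \<le> exp (- (38 * L))"
    proof -
      have ek: "\<epsilon>\<^sup>2 * real k ^ 2 = 1 / 4096"
        using k1 by (simp add: \<epsilon>_def power2_eq_square)
      have "38 * L = (\<epsilon>\<^sup>2 * real k ^ 2) * (4096 * (38 * L))" unfolding ek by simp
      also have "\<dots> = \<epsilon>\<^sup>2 * (16384 * real k ^ 2 * (38 * L)) / 4" by simp
      also have "\<dots> \<le> \<epsilon>\<^sup>2 * real l / 4"
        by (intro divide_right_mono mult_left_mono l_ge) auto
      finally show ?thesis by simp
    qed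
    also have "\<dots> \<le> \<tau> * \<epsilon> / 4"
    proof -
      have "1 / (\<tau> * \<epsilon> / 4) = 2 ^ 8 * real k * (1 / \<tau>)"
        using k1 \<tau> by (simp add: \<epsilon>_def field_simps)
      also have "\<dots> \<le> exp L ^ 8 * exp (26 * L) * exp L"
      proof (intro mult_mono power_mono)
        have "real k \<le> exp (real k)" using exp_ge_add_one_self[of "real k"] by linarith
        also have "\<dots> \<le> exp (26 * L)" using k_le by simp
        finally show "real k \<le> exp (26 * L)" .
      qed (use two invt \<tau> in auto)
      also have "\<dots> = exp (35 * L)" by (simp add: exp_of_nat_mult[symmetric] exp_add[symmetric])
      also have "\<dots> \<le> exp (38 * L)" using L by simp
      finally have "1 / (\<tau> * \<epsilon> / 4) \<le> exp (38 * L)" .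
      thus ?thesis using \<tau> \<epsilon> by (intro exp_minus_leI) auto
    qed
    finally have l2: "2 * exp (- \<epsilon>\<^sup>2 * real l / 4) \<le> \<tau> * \<epsilon> / 2" by simp
    have L3: "1 \<le> 8 * L ^ 3" using power_mono[OF L(1), of 3] by (simp add: power_divide)
    have "real k ^ 2 \<le> (26 * L) ^ 2" using k_le by (intro power_mono) auto
    hence "16384 * real k ^ 2 * (38 * L) \<le> 16384 * (26 * L) ^ 2 * (38 * L)"
      using L by (intro mult_right_mono mult_left_mono) auto
    moreover have "real l \<le> 16384 * real k ^ 2 * (38 * L) + 1"
    proof -
      have "0 \<le> 16384 * real k ^ 2 * (38 * L)" using L by simp
      thus ?thesis by (simp add: l_def)
    qed
    moreover have "16384 * (26 * L) ^ 2 * (38 * L) = 16384 * 38 * 26\<^sup>2 * L ^ 3"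
      by (simp add: power2_eq_square power3_eq_cube)
    ultimately have l_le: "real l \<le> C0 * L ^ 3" using L3 unfolding C0_def by (simp add: algebra_simps)
    have "real r \<le> (32 * (C0 + 8)) * L ^ 4" if r: "\<tau> ^ l / 2 * exp (real r / 32) \<le> 1" for r :: nat
    proof -
      have "exp (real r / 32) \<le> 2 * (1 / \<tau>) ^ l" using r \<tau> by (simp add: field_simps)
      also have "\<dots> \<le> exp L * exp L ^ l" using two invt \<tau> by (intro mult_mono power_mono) auto
      also have "\<dots> = exp (L + real l * L)" by (simp add: exp_add exp_of_nat_mult)
      finally have "real r / 32 \<le> L + real l * L" by simp
      also have "\<dots> \<le> 8 * L ^ 3 * L + (C0 * L ^ 3) * L"
        using L L3 l_le by (intro add_mono mult_right_mono) (auto simp: mult_left_le)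
      also have "\<dots> = (C0 + 8) * L ^ 4" by (simp add: eval_nat_numeral algebra_simps)
      finally show ?thesis by (simp add: algebra_simps)
    qed
    moreover have "br_params \<tau> k l" using k1 k2 l2 unfolding br_params_def \<epsilon>_def by blast
    ultimately show ?thesis unfolding L_def by blast
  qed
  moreover have "0 < 32 * (C0 + 8)" by (simp add: C0_def)
  ultimately show ?thesis unfolding br_const_def by blast
qed

text \<open>The numerical hypotheses of \<open>affine_agreement\<close>, together with the resulting
  density \<open>exp (- C * log_inv c ^ 4)\<close> that serves as threshold for the greedy
  family.\<close>

definition aff_const :: "nat \<Rightarrow> real \<Rightarrow> bool" where
  "aff_const p C \<longleftrightarrow> C > 0 \<and> (\<forall>c. 0 < c \<longrightarrow> c \<le> 1 \<longrightarrow> (\<exists>m k l.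
     (16384 / c ^ 10) ^ 13 < 2 ^ m \<and> br_params (c / (4 * real p ^ m)) k l \<and>
     (\<forall>r::nat. (c / (4 * real p ^ m)) ^ l / 2 * exp (real r / 32) \<le> 1 \<longrightarrow>
        exp (- C * log_inv c ^ 4) * real p ^ r \<le> c / (4 * real p ^ m))))"

text \<open>The number \<open>m\<close> of thinning rounds is of order \<open>log_inv c\<close>. So
  is \<open>log_inv \<tau>\<close>, for a fixed prime, and the loss \<open>p ^ r\<close> with
  \<open>r\<close> of order \<open>log_inv \<tau> ^ 4\<close> dominates.\<close>

lemma ex_aff_const:
  assumes p: "p \<ge> 2" shows "\<exists>C. aff_const p C"
proof -
  obtain B where B: "br_const B" using ex_br_const by blast
  have B0: "0 < B" using B by (simp add: br_const_def)
  define a where "a = 3 + 632 * real p"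
  define C where "C = B * a ^ 4 * real p + 8 * a"
  have p0: "0 < real p" using p by simp
  have a0: "0 < a" using p0 by (simp add: a_def add_pos_pos)
  have p_exp: "real p \<le> exp (real p)" using exp_ge_add_one_self[of "real p"] by linarith
  have "\<exists>m k l. (16384 / c ^ 10) ^ 13 < 2 ^ m \<and> br_params (c / (4 * real p ^ m)) k l \<and>
     (\<forall>r::nat. (c / (4 * real p ^ m)) ^ l / 2 * exp (real r / 32) \<le> 1 \<longrightarrow>
        exp (- C * log_inv c ^ 4) * real p ^ r \<le> c / (4 * real p ^ m))"
    if c: "0 < c" "c \<le> 1" for c
  proof -
    define L where "L = log_inv c"
    have L: "1 / 2 \<le> L" "ln 2 \<le> L" "ln (1 / c) \<le> L"
      unfolding L_def by (rule log_inv_ge_half, rule ln2_le_log_inv, rule ln_inverse_le_log_inv)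
    have invc: "1 / c \<le> exp L" using inverse_le_exp_log_inv[OF c(1)] by (simp add: L_def)
    have two: "2 \<le> exp L" using L(2) by (metis exp_ln exp_le_cancel_iff zero_less_numeral)
    \<comment> \<open>\<open>312 = 13 * 24\<close>, where \<open>24 = 14 + 10\<close> comes from
      \<open>16384 = 2 ^ 14\<close> and the tenth power of \<open>c\<close>; \<open>Suc\<close>
      makes the inequality strict.\<close>
    define m where "m = Suc (nat \<lceil>2 * (312 * L)\<rceil>)"
    have m_le: "real m \<le> 632 * L" using L(1) by (simp add: m_def) linarith
    have "16384 / c ^ 10 = 2 ^ 14 * (1 / c) ^ 10" by (simp add: power_one_over)
    also have "\<dots> \<le> exp L ^ 14 * exp L ^ 10" using two invc c by (intro mult_mono power_mono) auto
    also have "\<dots> = exp (24 * L)" by (simp add: exp_of_nat_mult[symmetric] exp_add[symmetric])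
    finally have "(16384 / c ^ 10) ^ 13 \<le> exp (24 * L) ^ 13" using c by (intro power_mono) auto
    also have "\<dots> = exp (312 * L)" by (simp add: exp_of_nat_mult[symmetric])
    also have "\<dots> \<le> 2 ^ nat \<lceil>2 * (312 * L)\<rceil>" by (rule le_two_power_nat_ceiling) (use L in simp)
    also have "\<dots> < 2 ^ m" by (simp add: m_def)
    finally have m1: "(16384 / c ^ 10) ^ 13 < 2 ^ m" .
    define \<tau> where "\<tau> = c / (4 * real p ^ m)"
    have \<tau>0: "0 < \<tau>" using c p0 by (simp add: \<tau>_def)
    have "1 \<le> real p ^ m" using p by simp
    hence \<tau>1: "\<tau> \<le> 1" using c unfolding \<tau>_def by (subst divide_le_eq_1) linarith
    have "1 / \<tau> = 2 ^ 2 * real p ^ m * (1 / c)" using c by (simp add: \<tau>_def)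
    also have "\<dots> \<le> exp L ^ 2 * exp (real p) ^ m * exp L"
      using two invc c p_exp p0 by (intro mult_mono power_mono) auto
    also have "\<dots> = exp (3 * L + real m * real p)"
      by (simp add: exp_of_nat_mult[symmetric] exp_add[symmetric])
    also have "\<dots> \<le> exp (a * L)"
      using mult_right_mono[OF m_le, of "real p"] by (simp add: a_def algebra_simps)
    finally have inv\<tau>: "1 / \<tau> \<le> exp (a * L)" .
    have "log_inv \<tau> \<le> a * L"
    proof (rule log_inv_leI)
      show "ln (1 / \<tau>) \<le> a * L" using inv\<tau> \<tau>0 by (metis exp_ln exp_le_cancel_iff zero_less_divide_1_iff)
      have "1 * L \<le> a * L" using L p0 by (intro mult_right_mono) (auto simp: a_def)
      thus "ln 2 \<le> a * L" using L(2) by linarith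
    qed
    moreover have "0 \<le> log_inv \<tau>" using log_inv_ge_half[of \<tau>] by linarith
    ultimately have log4: "log_inv \<tau> ^ 4 \<le> (a * L) ^ 4" by (intro power_mono)
    obtain k l where kl: "br_params \<tau> k l"
      and r: "\<And>r::nat. \<tau> ^ l / 2 * exp (real r / 32) \<le> 1 \<Longrightarrow> real r \<le> B * log_inv \<tau> ^ 4"
      using B \<tau>0 \<tau>1 unfolding br_const_def by blast
    have L3: "1 \<le> 8 * L ^ 3" using power_mono[OF L(1), of 3] by (simp add: power_divide)
    have "exp (- C * L ^ 4) * real p ^ r \<le> \<tau>" if "\<tau> ^ l / 2 * exp (real r / 32) \<le> 1" for r :: nat
    proof -
      have rB: "real r \<le> B * a ^ 4 * L ^ 4"
      proof -
        have "real r \<le> B * (a * L) ^ 4"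
          using r[OF that] mult_left_mono[OF log4 less_imp_le[OF B0]] by linarith
        thus ?thesis by (simp add: power_mult_distrib mult.assoc)
      qed
      have "real p ^ r * (1 / \<tau>) \<le> exp (real p) ^ r * exp (a * L)"
        using p_exp inv\<tau> \<tau>0 p0 by (intro mult_mono power_mono) auto
      also have "\<dots> = exp (real r * real p + a * L)" by (simp add: exp_of_nat_mult[symmetric] exp_add)
      also have "\<dots> \<le> exp (C * L ^ 4)"
      proof -
        have "real r * real p \<le> B * a ^ 4 * L ^ 4 * real p" using rB by (intro mult_right_mono) auto
        moreover have "a * L \<le> a * (8 * L ^ 4)"
        proof (rule mult_left_mono)
          have "1 * L \<le> 8 * L ^ 3 * L" using L3 L by (intro mult_right_mono) auto
          also have "8 * L ^ 3 * L = 8 * L ^ 4" by (simp add: eval_nat_numeral)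
          finally show "L \<le> 8 * L ^ 4" by simp
        qed (use a0 in simp)
        ultimately have "real r * real p + a * L \<le> B * a ^ 4 * L ^ 4 * real p + a * (8 * L ^ 4)" by linarith
        also have "\<dots> = C * L ^ 4" by (simp add: C_def algebra_simps)
        finally show ?thesis by simp
      qed
      finally have "exp (- (C * L ^ 4)) * real p ^ r \<le> \<tau>" by (rule exp_minus_mult_leI[OF \<tau>0])
      thus ?thesis by simp
    qed
    thus ?thesis using m1 kl unfolding \<tau>_def L_def by blast
  qed
  moreover have "0 < C" using B0 a0 p0 by (simp add: C_def add_pos_pos)
  ultimately show ?thesis unfolding aff_const_def by blast
qed

text \<open>Such a set is the range of a sequence of length \<open>D\<close>; the extra value
  \<open>k\<close> is padding that the intersection with \<open>{..<k}\<close> removes.\<close>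

lemma card_bounded_subsets:
  "card {I. I \<subseteq> {..<k::nat} \<and> card I \<le> D} \<le> (k + 1) ^ D"
proof -
  let ?f = "\<lambda>f. f ` {..<D} \<inter> {..<k}"
  have "{I. I \<subseteq> {..<k} \<and> card I \<le> D} \<subseteq> ?f ` ({..<D} \<rightarrow>\<^sub>E {..<k + 1})"
  proof clarify
    fix I assume I: "I \<subseteq> {..<k}" "card I \<le> D"
    have fI: "finite I" using I(1) finite_subset by blast
    obtain g where g: "bij_betw g {..<card I} I"
      using ex_bij_betw_nat_finite[OF fI] by (auto simp: atLeast0LessThan)
    define f where "f = (\<lambda>i\<in>{..<D}. if i < card I then g i else k)"
    have gI: "g i \<in> I" if "i < card I" for i using g that by (auto simp: bij_betw_def)
    have "f \<in> {..<D} \<rightarrow>\<^sub>E {..<k + 1}"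
    proof -
      have "g i < k" if "i < card I" for i using gI[OF that] I(1) by auto
      thus ?thesis by (auto simp: f_def less_Suc_eq)
    qed
    moreover have "I = ?f f"
    proof (intro equalityI subsetI)
      fix x assume x: "x \<in> I"
      then obtain i where "i < card I" "x = g i" using g by (auto simp: bij_betw_def)
      hence "i \<in> {..<D}" "x = f i" using I(2) by (auto simp: f_def)
      thus "x \<in> ?f f" using x I(1) by blast
    next
      fix x assume "x \<in> ?f f"
      thus "x \<in> I" using gI by (auto simp: f_def split: if_splits)
    qed
    ultimately show "I \<in> ?f ` ({..<D} \<rightarrow>\<^sub>E {..<k + 1})" by blast
  qed
  hence "card {I. I \<subseteq> {..<k} \<and> card I \<le> D} \<le> card (?f ` ({..<D} \<rightarrow>\<^sub>E {..<k + 1}))"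
    by (intro card_mono finite_imageI) (auto simp: finite_PiE)
  also have "\<dots> \<le> card ({..<D} \<rightarrow>\<^sub>E {..<k + 1})" by (intro card_image_le) (simp add: finite_PiE)
  finally show ?thesis by (simp add: card_PiE)
qed

section \<open>Structural lemmas with logarithmic bounds\<close>

context fin_space
begin

lemma bogolyubov_ruzsa_log:
  assumes C: "br_const C" and A: "A \<subseteq> G" and cA: "real (card A) \<ge> \<tau> * q" and \<tau>: "0 < \<tau>" "\<tau> \<le> 1"
  obtains W r where "V.subspace W" "W \<subseteq> G" "card G \<le> CARD('p) ^ r * card W"
    "real r \<le> C * log_inv \<tau> ^ 4" "\<And>w. w \<in> W \<Longrightarrow> real (card (quads A w)) \<ge> real (card A) ^ 4 / (8 * q)"
proof -
  obtain k l where kl: "br_params \<tau> k l"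
    and r: "\<And>r::nat. \<tau> ^ l / 2 * exp (real r / 32) \<le> 1 \<Longrightarrow> real r \<le> C * log_inv \<tau> ^ 4"
    using C \<tau> unfolding br_const_def by blast
  have k: "k \<ge> 1" "32 / \<tau> \<le> 2 ^ k"
    "2 * exp (- (1 / (64 * real k))\<^sup>2 * real l / 4) \<le> \<tau> * (1 / (64 * real k)) / 2"
    using kl by (auto simp only: br_params_def)
  show ?thesis
    using bogolyubov_ruzsa[OF A cA \<tau>(1) k(1,2) refl k(3)] r that by metis
qed

lemma few_unexplained_log:
  fixes U E :: "'v \<Rightarrow> 'v set"
  assumes C: "aff_const CARD('p) C"
    and n: "n \<ge> 3" and Y: "Y \<subseteq> G" and U: "\<And>y. y \<in> Y \<Longrightarrow> U y \<subseteq> G" "\<And>y. y \<in> Y \<Longrightarrow> U y \<noteq> {}"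
    "\<And>y. y \<in> Y \<Longrightarrow> card (U y) \<le> P"
    and \<beta>: "\<beta> > 0" and P: "P > 0" and c: "c = (\<beta> / (real n * real P ^ n))\<^sup>2 / 2" "c \<le> 1"
    and terminal: "\<And>L. is_aff L \<Longrightarrow>
      real (card {y \<in> Y. aff L y \<in> U y \<and> aff L y \<notin> E y}) < exp (- C * log_inv c ^ 4) * q"
  shows "real (card {t \<in> {..<n} \<rightarrow>\<^sub>E Y. (\<Sum>i<n. sg (\<sigma> i) (t i)) = 0 \<and>
     (\<exists>u. (\<forall>i<n. u i \<in> U (t i)) \<and> (\<Sum>i<n. sg (\<sigma> i) (u i)) = 0 \<and> (\<exists>i<n. u i \<notin> E (t i)))}) < \<beta> * q ^ (n - 1)"
proof -
  have "0 < real n * real P ^ n" using n P by simp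
  hence "0 < c" unfolding c(1) using \<beta> by (intro divide_pos_pos zero_less_power) auto
  then obtain m k l where m: "(16384 / c ^ 10) ^ 13 < 2 ^ m"
    and kl: "br_params (c / (4 * real CARD('p) ^ m)) k l"
    and r: "\<And>r::nat. (c / (4 * real CARD('p) ^ m)) ^ l / 2 * exp (real r / 32) \<le> 1 \<Longrightarrow>
        exp (- C * log_inv c ^ 4) * real CARD('p) ^ r \<le> c / (4 * real CARD('p) ^ m)"
    using C c(2) unfolding aff_const_def by blast
  have k: "k \<ge> 1" "32 / (c / (4 * real CARD('p) ^ m)) \<le> 2 ^ k"
    "2 * exp (- (1 / (64 * real k))\<^sup>2 * real l / 4) \<le> (c / (4 * real CARD('p) ^ m)) * (1 / (64 * real k)) / 2"
    using kl by (auto simp only: br_params_def)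
  show ?thesis
    by (rule few_unexplained[OF n Y U terminal \<beta> P c(1) m refl k(1,2) refl k(3) r])
qed

text \<open>A zero-sum 16-tuple is a pair of 8-tuples with equal signed sums; Cauchy--Schwarz over
  the \<open>q\<close> possible sums gives the bound.\<close>

lemma many_zero_sum:
  assumes Y: "Y \<subseteq> G"
  shows "real (card Y) ^ 16 / q \<le> real (card {t \<in> {..<16} \<rightarrow>\<^sub>E Y. (\<Sum>i<16. sg (sgs 4 i) (t i)) = 0})"
proof -
  have fY: "finite Y" using Y finite_sub by blast
  let ?Tu = "tuples 8 (sgs 3) Y"
  let ?Z = "{t \<in> {..<16} \<rightarrow>\<^sub>E Y. (\<Sum>i<16. sg (sgs 4 i) (t i)) = 0}"
  have fTu: "finite (?Tu z)" for z by (rule finite_tuples[OF fY])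
  define a where "a = real (card Y) ^ 8 / q"
  have "({..<8::nat} \<rightarrow>\<^sub>E Y) = (\<Union>z\<in>G. ?Tu z)"
  proof (intro equalityI subsetI)
    fix t :: "nat \<Rightarrow> 'v" assume t: "t \<in> {..<8} \<rightarrow>\<^sub>E Y"
    hence "t i \<in> G" if "i < 8" for i using that Y by (auto simp: PiE_iff)
    hence "(\<Sum>i<8. sg (sgs 3 i) (t i)) \<in> G" by (intro G_sum sg_G) auto
    thus "t \<in> (\<Union>z\<in>G. ?Tu z)" using t by (auto simp: tuples_def)
  qed (auto simp: tuples_def)
  also have "card (\<Union>z\<in>G. ?Tu z) = (\<Sum>z\<in>G. card (?Tu z))"
  proof (rule card_UN_disjoint)
    show "\<forall>z\<in>G. finite (?Tu z)" using fTu by blast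
  qed (auto simp: finite_G tuples_def)
  finally have tot: "(\<Sum>z\<in>G. real (card (?Tu z))) = real (card Y) ^ 8"
    by (simp add: card_PiE flip: of_nat_sum of_nat_power)
  have "0 \<le> (\<Sum>z\<in>G. (real (card (?Tu z)) - a)\<^sup>2)" by (rule sum_nonneg) simp
  also have "\<dots> = (\<Sum>z\<in>G. (real (card (?Tu z)))\<^sup>2) - 2 * a * (\<Sum>z\<in>G. real (card (?Tu z))) + q * a\<^sup>2"
    by (simp add: power2_diff sum.distrib sum_subtractf sum_distrib_left mult_ac)
  finally have "2 * a * real (card Y) ^ 8 - q * a\<^sup>2 \<le> (\<Sum>z\<in>G. (real (card (?Tu z)))\<^sup>2)" by (simp add: tot)
  moreover have "2 * a * real (card Y) ^ 8 - q * a\<^sup>2 = real (card Y) ^ 16 / q"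
  proof -
    have "q * a\<^sup>2 = a * real (card Y) ^ 8" using q_pos by (simp add: a_def power2_eq_square)
    hence "2 * a * real (card Y) ^ 8 - q * a\<^sup>2 = a * real (card Y) ^ 8" by simp
    also have "\<dots> = real (card Y) ^ (8 + 8) / q" by (simp only: a_def power_add) simp
    finally show ?thesis by simp
  qed
  ultimately have 1: "real (card Y) ^ 16 / q \<le> (\<Sum>z\<in>G. (real (card (?Tu z)))\<^sup>2)" by simp
  have fZ: "finite ?Z" using fY by (simp add: finite_PiE)
  have "card (SIGMA z:G. ?Tu z \<times> ?Tu z) \<le> card ?Z"
  proof (rule card_inj_on_le[where f = "\<lambda>(z, t, t'). join t t'"])
    show "inj_on (\<lambda>(z, t, t'). join t t') (SIGMA z:G. ?Tu z \<times> ?Tu z)"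
    proof (rule inj_onI)
      fix a b assume ab: "a \<in> (SIGMA z:G. ?Tu z \<times> ?Tu z)" "b \<in> (SIGMA z:G. ?Tu z \<times> ?Tu z)"
        and e: "(\<lambda>(z, t, t'). join t t') a = (\<lambda>(z, t, t'). join t t') b"
      obtain z t t' where a: "a = (z, t, t')" by (cases a) auto
      obtain y s s' where b: "b = (y, s, s')" by (cases b) auto
      have m: "t \<in> ?Tu z" "t' \<in> ?Tu z" "s \<in> ?Tu y" "s' \<in> ?Tu y" using ab by (auto simp: a b)
      have e': "join t t' = join s s'" using e by (simp add: a b)
      have "t i = s i" if "i < 8" for i
        using fun_cong[OF e', of i] that by (simp add: join_def)
      hence ts: "t = s" using m(1,3) by (intro extensionalityI[of t "{..<8}" s]) (auto simp: tuples_def PiE_iff)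
      have "t' i = s' i" if "i < 8" for i
        using fun_cong[OF e', of "i + 8"] that by (simp add: join_def)
      hence "t' = s'" using m(2,4) by (intro extensionalityI[of t' "{..<8}" s']) (auto simp: tuples_def PiE_iff)
      moreover have "z = y" using m ts by (auto simp: tuples_def)
      ultimately show "a = b" using ts by (simp add: a b)
    qed
    show "(\<lambda>(z, t, t'). join t t') ` (SIGMA z:G. ?Tu z \<times> ?Tu z) \<subseteq> ?Z"
    proof (rule image_subsetI)
      fix a assume aS: "a \<in> (SIGMA z:G. ?Tu z \<times> ?Tu z)"
      obtain z t t' where a: "a = (z, t, t')" by (cases a) auto
      have m: "t \<in> ?Tu z" "t' \<in> ?Tu z" using aS by (auto simp: a)
      have "(\<Sum>i<16. sg (sgs 4 i) (join t t' i)) = 0"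
        unfolding sum_join using m by (simp add: tuples_def)
      moreover have "join t t' \<in> {..<16} \<rightarrow>\<^sub>E Y" using m by (auto simp: join_def tuples_def PiE_iff)
      ultimately show "(\<lambda>(z, t, t'). join t t') a \<in> ?Z" by (simp add: a)
    qed
  qed (rule fZ)
  hence "(\<Sum>z\<in>G. (real (card (?Tu z)))\<^sup>2) \<le> real (card ?Z)"
    using finite_G fTu by (simp add: card_cartesian_product power2_eq_square flip: of_nat_mult of_nat_sum)
  thus ?thesis using 1 by linarith
qed

text \<open>Fibres below half the average density carry at most half of \<open>A\<close>.\<close>

lemma dense_fibres:
  assumes A: "A \<subseteq> G \<times> G" "\<alpha> * q\<^sup>2 \<le> real (card A)" and \<alpha>: "0 < \<alpha>"
  shows "\<alpha> / 2 * q \<le> real (card {u \<in> G. \<alpha> / 2 * q \<le> real (card {x \<in> G. (x, u) \<in> A})})"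
proof -
  let ?F = "\<lambda>u. {x \<in> G. (x, u) \<in> A}"
  let ?Y = "{u \<in> G. \<alpha> / 2 * q \<le> real (card (?F u))}"
  have "card A = card (SIGMA u:G. ?F u)"
    by (rule bij_betw_same_card[of prod.swap])
       (use A(1) in \<open>force simp: bij_betw_def inj_on_def image_iff\<close>)
  hence "real (card A) = (\<Sum>u\<in>G. real (card (?F u)))" using finite_G by simp
  also have "\<dots> \<le> (\<Sum>u\<in>G. of_bool (u \<in> ?Y) * q + \<alpha> / 2 * q)"
  proof (rule sum_mono)
    fix u assume u: "u \<in> G"
    show "real (card (?F u)) \<le> of_bool (u \<in> ?Y) * q + \<alpha> / 2 * q"
    proof (cases "u \<in> ?Y")
      case True
      have "card (?F u) \<le> card G" using finite_G by (intro card_mono) auto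
      moreover have "0 \<le> \<alpha> / 2 * q" using \<alpha> by simp
      ultimately show ?thesis using True by simp
    next
      case False
      thus ?thesis using u by simp
    qed
  qed
  also have "\<dots> = real (card ?Y) * q + q * (\<alpha> / 2 * q)"
  proof -
    have "G \<inter> ?Y = ?Y" by auto
    thus ?thesis using finite_G by (simp add: sum.distrib sum_distrib_right[symmetric] Int_def)
  qed
  finally have "real (card A) \<le> real (card ?Y) * q + q * (\<alpha> / 2 * q)" .
  moreover have "(\<alpha> / 2 * q) * q = \<alpha> * q\<^sup>2 - q * (\<alpha> / 2 * q)" by (simp add: power2_eq_square)
  ultimately have "(\<alpha> / 2 * q) * q \<le> real (card ?Y) * q" using A(2) by linarith
  thus ?thesis using q_pos by (simp only: mult_le_cancel_right_pos)
qed

subsection \<open>Bilinear structure of the popular points\<close>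

text \<open>Once the constant terms of the affine maps lie in \<open>H\<close>, only their linear
  parts remain visible modulo \<open>H\<close>.\<close>

lemma explained_sub_span_at:
  assumes J: "finite J" "\<And>i. i \<in> J \<Longrightarrow> is_aff (Ls i)" and H: "V.subspace H"
    and I: "I y \<subseteq> J" and c: "\<And>i. i \<in> J \<Longrightarrow> snd (Ls i) \<in> H"
  shows "explained Ls I y \<subseteq> span_at J (\<lambda>i. fst (Ls i)) H y"
  unfolding explained_def
proof (rule V.span_minimal)
  have ls: "lin (fst (Ls i))" "fst (Ls i) x \<in> G" if "i \<in> J" for i x
    using J(2)[OF that] by (auto simp: is_aff_def)
  show "V.subspace (span_at J (\<lambda>i. fst (Ls i)) H y)"
    by (rule subspace_span_at[OF J(1)]) (use ls H in auto)
  show "(\<lambda>i. aff (Ls i) y) ` I y \<subseteq> span_at J (\<lambda>i. fst (Ls i)) H y"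
  proof (rule image_subsetI)
    fix j assume "j \<in> I y"
    hence j: "j \<in> J" using I by blast
    have "comb J (\<lambda>i. fst (Ls i)) (\<lambda>i. if i = j then 1 else 0) y
      = (\<Sum>i\<in>J. if i = j then fst (Ls j) y else 0)"
      unfolding comb_def by (intro sum.cong) auto
    hence "aff (Ls j) y = comb J (\<lambda>i. fst (Ls i)) (\<lambda>i. if i = j then 1 else 0) y + snd (Ls j)"
      using j J(1) by (simp add: aff_def)
    thus "aff (Ls j) y \<in> span_at J (\<lambda>i. fst (Ls i)) H y"
      unfolding span_at_def using c[OF j] by blast
  qed
qed

text \<open>The parameters enter as equations, and their sizes are estimated separately.
  \<open>\<beta>\<close> is half the share \<open>(\<alpha> / 2) ^ 16\<close> of zero-sum 16-tuples,
  \<open>c\<close> the energy left after the pigeonhole of \<open>few_unexplained\<close>,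
  \<open>K\<close> a bound for the greedy family, \<open>\<theta>\<close> the share surviving the
  choice of index sets, and \<open>\<rho>\<close> the rank threshold that makes irregular pairs rare
  in both layers.\<close>

lemma popular_bilinear_structure:
  assumes C1: "br_const C1" and C2: "aff_const CARD('p) C2"
    and A: "A \<subseteq> G \<times> G" and \<alpha>: "0 < \<alpha>" and cA: "\<alpha> * q\<^sup>2 \<le> real (card A)"
    and D: "\<And>r::nat. real r \<le> C1 * log_inv (\<alpha> / 2) ^ 4 \<Longrightarrow> CARD('p) ^ r \<le> 2 ^ D"
    and \<beta>: "\<beta> = (\<alpha> / 2) ^ 16 / 2" and c: "c = (\<beta> / (16 * (2 ^ D) ^ 16))\<^sup>2 / 2"
    and K: "real D / exp (- C2 * log_inv c ^ 4) \<le> real K"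
    and \<theta>: "\<theta> = \<beta> / (real K + 1) ^ (16 * D)"
    and \<rho>: "\<rho> = (\<theta> / 4) ^ 8 / (128 * real CARD('p) ^ (256 * D))"
  obtains J :: "nat set" and ls H W r where "finite J" "card J \<le> 16 * D" "\<And>i. i \<in> J \<Longrightarrow> lin (ls i)"
    "\<And>i x. i \<in> J \<Longrightarrow> ls i x \<in> G" "V.subspace H" "H \<subseteq> G"
    "real (card H) * \<rho> ^ (16 * D * CARD('p)) \<le> real CARD('p) ^ (16 * D)"
    "V.subspace W" "W \<subseteq> G" "card G \<le> CARD('p) ^ r * card W" "real r \<le> C1 * log_inv (\<theta> / 4) ^ 4"
    "\<And>x y. y \<in> W \<Longrightarrow> x \<in> perp H \<Longrightarrow> \<forall>i\<in>J. pr (ls i y) x = 0 \<Longrightarrow>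
       ((\<alpha> / 2) ^ 4 / 8) ^ 128 / (2 ^ D) ^ 192 * ((\<theta> / 4) ^ 16 / 128) * q ^ 511
       \<le> hor ((ver ^^ 2) (hor ((ver ^^ 3) (hor (hor (\<lambda>x u. of_bool ((x, u) \<in> A))))))) x y"
proof -
  define N0 where "N0 = hor (hor (\<lambda>x u. of_bool ((x, u) \<in> A)))"
  have "card A \<le> card (G \<times> G)" using A finite_G by (intro card_mono) auto
  hence "real (card A) \<le> 1 * q\<^sup>2" by (simp add: card_cartesian_product power2_eq_square flip: of_nat_mult)
  hence "\<alpha> * q\<^sup>2 \<le> 1 * q\<^sup>2" using cA by linarith
  hence \<alpha>1: "\<alpha> \<le> 1" by (rule mult_right_le_imp_le) (use q_pos in simp)
  define F where "F u = {x \<in> G. (x, u) \<in> A}" for u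
  define Y where "Y = {u \<in> G. \<alpha> / 2 * q \<le> real (card (F u))}"
  have YG: "Y \<subseteq> G" by (auto simp: Y_def)
  have fY: "finite Y" using YG finite_sub by blast
  have cY: "\<alpha> / 2 * q \<le> real (card Y)" unfolding Y_def F_def by (rule dense_fibres[OF A cA \<alpha>])
  define \<kappa>0 where "\<kappa>0 = (\<alpha> / 2) ^ 4 / 8 * q ^ 3"
  have \<kappa>0: "0 \<le> \<kappa>0" using \<alpha> by (simp add: \<kappa>0_def)
  have "\<exists>V. V.subspace V \<and> V \<subseteq> G \<and> card (perp V) \<le> 2 ^ D \<and> (\<forall>w\<in>V. \<kappa>0 \<le> real (card (quads (F u) w)))"
    if u: "u \<in> Y" for u
  proof -
    have FG: "F u \<subseteq> G" by (auto simp: F_def)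
    have cF: "\<alpha> / 2 * q \<le> real (card (F u))" using u by (simp add: Y_def)
    obtain V r where V: "V.subspace V" "V \<subseteq> G" "card G \<le> CARD('p) ^ r * card V"
      "real r \<le> C1 * log_inv (\<alpha> / 2) ^ 4" "\<And>w. w \<in> V \<Longrightarrow> real (card (F u)) ^ 4 / (8 * q) \<le> real (card (quads (F u) w))"
      using bogolyubov_ruzsa_log[OF C1 FG cF] \<alpha> \<alpha>1 by auto
    have "card V * card (perp V) \<le> CARD('p) ^ r * card V" using card_perp[OF V(1,2)] V(3) by simp
    moreover have "card V > 0"
      using V.subspace_0[OF V(1)] V(2) finite_sub by (metis card_gt_0_iff empty_iff)
    ultimately have "card (perp V) \<le> CARD('p) ^ r" by (simp add: mult.commute)
    hence "card (perp V) \<le> 2 ^ D" using D[OF V(4)] by linarith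
    moreover have "\<kappa>0 \<le> real (card (quads (F u) w))" if "w \<in> V" for w
    proof -
      have "\<kappa>0 = (\<alpha> / 2 * q) ^ 4 / (8 * q)"
        using q_pos by (simp add: \<kappa>0_def power_mult_distrib eval_nat_numeral)
      also have "\<dots> \<le> real (card (F u)) ^ 4 / (8 * q)"
        using cF \<alpha> by (intro divide_right_mono power_mono) auto
      also have "\<dots> \<le> real (card (quads (F u) w))" by (rule V(5)[OF that])
      finally show ?thesis .
    qed
    ultimately show ?thesis using V(1,2) by blast
  qed
  then obtain Vs where Vs: "\<And>u. u \<in> Y \<Longrightarrow> V.subspace (Vs u)" "\<And>u. u \<in> Y \<Longrightarrow> Vs u \<subseteq> G"
    "\<And>u. u \<in> Y \<Longrightarrow> card (perp (Vs u)) \<le> 2 ^ D"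
    "\<And>u w. u \<in> Y \<Longrightarrow> w \<in> Vs u \<Longrightarrow> \<kappa>0 \<le> real (card (quads (F u) w))" by metis
  \<comment> \<open>Conditions replace solutions here; \<open>perp_perp\<close> recovers
    \<open>Vs u\<close> as the set of points orthogonal to \<open>U u\<close>.\<close>
  define U where "U u = perp (Vs u)" for u
  have U: "V.subspace (U y)" "U y \<subseteq> G" "U y \<noteq> {}" for y
    using subspace_perp perp_subset V.subspace_0[OF subspace_perp, of "Vs y"] by (auto simp: U_def)
  have cU: "card (U y) \<le> 2 ^ D" if "y \<in> Y" for y using Vs(3)[OF that] by (simp add: U_def)
  have hh: "real (card (quads (F u) x)) \<le> N0 x u" if "x \<in> G" for x u
    using hor_hor_quads[OF A that, of u] by (simp add: N0_def F_def)
  have dom0: "dominates N0 \<kappa>0 Y (\<lambda>y. y) U"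
    unfolding dominates_def
  proof (intro ballI)
    fix x u assume xu: "x \<in> G" "u \<in> G"
    show "\<kappa>0 * real (card {\<omega> \<in> Y. \<omega> = u \<and> x \<in> perp (U \<omega>)}) \<le> N0 x u"
    proof (cases "u \<in> Y \<and> x \<in> perp (U u)")
      case True
      hence "{\<omega> \<in> Y. \<omega> = u \<and> x \<in> perp (U \<omega>)} = {u}" by auto
      moreover have "x \<in> Vs u" using True perp_perp[OF Vs(1,2), of u] unfolding U_def by blast
      ultimately show ?thesis using Vs(4)[of u x] hh[OF xu(1), of u] True by simp
    next
      case False
      hence e: "{\<omega> \<in> Y. \<omega> = u \<and> x \<in> perp (U \<omega>)} = {}" by auto
      have "0 \<le> real (card (quads (F u) x))" by simp
      thus ?thesis using hh[OF xu(1), of u] unfolding e by simp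
    qed
  qed
  define \<eta> where "\<eta> = exp (- C2 * log_inv c ^ 4)"
  have \<eta>0: "0 < \<eta>" by (simp add: \<eta>_def)
  obtain k Ls I where Ls: "\<And>i. i < k \<Longrightarrow> is_aff (Ls i)" and I: "\<And>y. y \<in> Y \<Longrightarrow> I y \<subseteq> {..<k}"
    and ex: "\<And>y. y \<in> Y \<Longrightarrow> explained Ls I y \<subseteq> U y" and cI: "\<And>y. y \<in> Y \<Longrightarrow> card (I y) \<le> D"
    and k\<eta>: "real k * \<eta> \<le> real D"
    and terminal: "\<And>L. is_aff L \<Longrightarrow> real (card {y \<in> Y. aff L y \<in> U y \<and> aff L y \<notin> explained Ls I y}) < \<eta> * q"
  proof (rule greedy_maps[of Y U D \<eta>])
    show "Y \<subseteq> G" by (rule YG)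
    show "V.subspace (U y)" if "y \<in> Y" for y by (rule U(1))
    show "U y \<subseteq> G" if "y \<in> Y" for y by (rule U(2))
    show "card (U y) \<le> 2 ^ D" if y: "y \<in> Y" for y by (rule cU[OF y])
    show "0 < \<eta>" by (rule \<eta>0)
  qed (rule that)
  have "real k \<le> real D / \<eta>" using k\<eta> \<eta>0 by (simp add: field_simps)
  hence kK: "real k \<le> real K" using K by (simp add: \<eta>_def)
  have \<beta>0: "0 < \<beta>" using \<alpha> by (simp add: \<beta>)
  have "(\<alpha> / 2) ^ 16 \<le> 1" using \<alpha> \<alpha>1 by (intro power_le_one) auto
  hence \<beta>1: "\<beta> \<le> 1" by (simp add: \<beta>)
  have c': "c = (\<beta> / (real 16 * real (2 ^ D) ^ 16))\<^sup>2 / 2" by (simp add: c)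
  have "1 \<le> (16 * (2 ^ D) ^ 16 :: real)"
  proof -
    have "(1::real) \<le> (2 ^ D) ^ 16" by simp
    thus ?thesis by linarith
  qed
  hence "\<beta> / (16 * (2 ^ D) ^ 16) \<le> 1" using \<beta>1 by (subst divide_le_eq_1) linarith
  moreover have "0 \<le> \<beta> / (16 * (2 ^ D) ^ 16)" using \<beta>0 by simp
  ultimately have "(\<beta> / (16 * (2 ^ D) ^ 16))\<^sup>2 \<le> 1" by (simp add: power_le_one)
  hence c1: "c \<le> 1" by (simp add: c)
  \<comment> \<open>There are at least \<open>2 * \<beta> * q ^ 15\<close> zero-sum tuples and fewer
    than \<open>\<beta> * q ^ 15\<close> bad ones, so half of the former remain.\<close>
  define Bad where "Bad = {t \<in> {..<16} \<rightarrow>\<^sub>E Y. (\<Sum>i<16. sg (sgs 4 i) (t i)) = 0 \<and>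
     (\<exists>u. (\<forall>i<16. u i \<in> U (t i)) \<and> (\<Sum>i<16. sg (sgs 4 i) (u i)) = 0 \<and> (\<exists>i<16. u i \<notin> explained Ls I (t i)))}"
  have "real (card Bad) < \<beta> * q ^ (16 - 1)"
    unfolding Bad_def
    by (rule few_unexplained_log[OF C2 _ YG U(2) U(3) cU \<beta>0 _ c' c1])
       (use terminal in \<open>auto simp: \<eta>_def\<close>)
  hence bad: "real (card Bad) < \<beta> * q ^ 15" by simp
  define Tup where "Tup = {t \<in> {..<16} \<rightarrow>\<^sub>E Y. (\<Sum>i<16. sg (sgs 4 i) (t i)) = 0}"
  have fTup: "finite Tup" using fY by (simp add: Tup_def finite_PiE)
  have "2 * \<beta> * q ^ 15 = (\<alpha> / 2 * q) ^ 16 / q"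
    using q_pos by (simp add: \<beta> power_mult_distrib eval_nat_numeral)
  also have "\<dots> \<le> real (card Y) ^ 16 / q"
    using cY \<alpha> by (intro divide_right_mono power_mono) auto
  also have "\<dots> \<le> real (card Tup)" unfolding Tup_def by (rule many_zero_sum[OF YG])
  finally have cTup: "2 * \<beta> * q ^ 15 \<le> real (card Tup)" .
  define Good0 where "Good0 = Tup - Bad"
  have "Tup \<subseteq> Good0 \<union> Bad" by (auto simp: Good0_def)
  moreover have fBad: "finite Bad" by (rule finite_subset[OF _ fTup]) (auto simp: Bad_def Tup_def)
  ultimately have "card Tup \<le> card Good0 + card Bad"
    using fTup by (intro order_trans[OF card_mono card_Un_le]) (auto simp: Good0_def)
  hence "real (card Tup) \<le> real (card Good0) + real (card Bad)" by linarith
  hence cGood0: "\<beta> * q ^ 15 \<le> real (card Good0)" using bad cTup by linarith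
  have fGood0: "finite Good0" using fTup by (simp add: Good0_def)
  \<comment> \<open>The type of a tuple is the list of index sets at its sixteen points. Fixing the
    most frequent type confines all later spans to the maps in \<open>J\<close>, at most
    \<open>16 * D\<close> of the possibly exponentially many.\<close>
  define Ty where "Ty = {..<16::nat} \<rightarrow>\<^sub>E {I. I \<subseteq> {..<k} \<and> card I \<le> D}"
  have fTy: "finite Ty" by (simp add: Ty_def finite_PiE)
  have neTy: "Ty \<noteq> {}" by (auto simp: Ty_def PiE_eq_empty_iff)
  define ty where "ty t = (\<lambda>i\<in>{..<16}. I (t i))" for t :: "nat \<Rightarrow> 'v"
  have "ty t \<in> Ty" if "t \<in> Good0" for t
    using that I cI by (auto simp: ty_def Ty_def Good0_def Tup_def PiE_iff)
  then obtain jj where jj: "jj \<in> Ty" "card Good0 \<le> card Ty * card {t \<in> Good0. ty t = jj}"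
    using pigeonhole_fibre[OF fGood0 fTy neTy, of ty] by blast
  define Good where "Good = {t \<in> Good0. ty t = jj}"
  have "card Ty \<le> ((k + 1) ^ D) ^ 16"
    unfolding Ty_def using card_bounded_subsets[of k D] by (simp add: card_PiE power_mono)
  hence "real (card Ty) \<le> real (((k + 1) ^ D) ^ 16)" by (simp only: of_nat_le_iff)
  also have "\<dots> = (real k + 1) ^ (16 * D)" by (simp add: power_mult[symmetric] mult.commute add.commute)
  also have "\<dots> \<le> (real K + 1) ^ (16 * D)" using kK by (intro power_mono) auto
  finally have cTy: "real (card Ty) \<le> (real K + 1) ^ (16 * D)" .
  have "\<beta> * q ^ 15 \<le> real (card Ty * card Good)" using cGood0 jj(2) unfolding Good_def by linarith
  also have "\<dots> \<le> (real K + 1) ^ (16 * D) * real (card Good)"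
    unfolding of_nat_mult using cTy by (intro mult_right_mono) auto
  finally have cGood: "\<theta> * q ^ 15 \<le> real (card Good)" by (simp add: \<theta> field_simps)
  define J where "J = (\<Union>i<16. jj i)"
  have jjk: "jj i \<subseteq> {..<k}" "card (jj i) \<le> D" if "i < 16" for i
    using jj(1) that by (auto simp: Ty_def PiE_iff)
  have Jk: "J \<subseteq> {..<k}" using jjk by (auto simp: J_def)
  have fJ: "finite J" using Jk finite_subset by blast
  have "card J \<le> (\<Sum>i<16. card (jj i))" unfolding J_def by (rule card_UN_le) simp
  also have "\<dots> \<le> (\<Sum>i<16::nat. D)" using jjk by (intro sum_mono) auto
  finally have cJ: "card J \<le> 16 * D" by simp
  have JLs: "is_aff (Ls i)" if "i \<in> J" for i using Ls Jk that by blast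
  define ls where "ls i = fst (Ls i)" for i
  have ls: "lin (ls i)" "ls i x \<in> G" "snd (Ls i) \<in> G" if "i \<in> J" for i x
    using JLs[OF that] by (auto simp: is_aff_def ls_def)
  \<comment> \<open>The span of the constant terms, which makes \<open>explained_sub_span_at\<close>
    applicable to every larger \<open>H\<close>.\<close>
  define H0 where "H0 = V.span ((\<lambda>i. snd (Ls i)) ` J)"
  have H0: "V.subspace H0" "H0 \<subseteq> G"
    unfolding H0_def by (auto intro: ls(3) dest: subsetD[OF V.span_minimal[OF _ subspace_G], rotated])
  have p1: "1 \<le> real CARD('p)" by (simp add: Suc_leI)
  have "card H0 \<le> CARD('p) ^ card ((\<lambda>i. snd (Ls i)) ` J)"
    unfolding H0_def using card_span_le fJ by blast
  also have "\<dots> \<le> CARD('p) ^ (16 * D)"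
    using card_image_le[OF fJ, of "\<lambda>i. snd (Ls i)"] cJ by (intro power_increasing) (auto simp: Suc_leI)
  finally have "real (card H0) \<le> real (CARD('p) ^ (16 * D))" by (simp only: of_nat_le_iff)
  hence cH0: "real (card H0) \<le> real CARD('p) ^ (16 * D)" by simp
  have \<theta>0: "0 < \<theta>" using \<beta>0 by (simp add: \<theta>)
  have "1 \<le> (real K + 1) ^ (16 * D)" by simp
  hence \<theta>1: "\<theta> \<le> 1" using \<beta>1 unfolding \<theta> by (subst divide_le_eq_1) linarith
  have P256: "1 \<le> real CARD('p) ^ (256 * D)" using p1 by simp
  have \<rho>0: "0 < \<rho>" using \<theta>0 by (simp add: \<rho>)
  have pow8: "(\<theta> / 4) ^ 8 \<le> \<theta> / 4"
    using power_decreasing[of 1 8 "\<theta> / 4"] \<theta>0 \<theta>1 by simp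
  have "(\<theta> / 4) ^ 8 \<le> 1" using pow8 \<theta>1 by linarith
  hence \<rho>1: "\<rho> \<le> 1" using P256 unfolding \<rho> by (subst divide_le_eq_1) linarith
  obtain H s where H: "V.subspace H" "H0 \<subseteq> H" "H \<subseteq> G" "2 ^ s \<le> CARD('p) ^ card J"
    "real (card H) * \<rho> ^ s \<le> real (card H0)"
    and rank: "\<And>c. (\<forall>y\<in>G. comb J ls c y \<in> H) \<or> real (card (mod_ker (comb J ls c) H)) \<le> \<rho> * q"
    using low_rank_subspace[where J=J and ls=ls, OF fJ ls(1,2) H0 \<rho>0] by blast
  have "(2::nat) ^ s \<le> CARD('p) ^ (16 * D)"
    using H(4) power_increasing[OF cJ, of "CARD('p)"] by (auto simp: Suc_leI)
  \<comment> \<open>The crude bound \<open>p < 2 ^ p\<close> turns the bound on \<open>2 ^ s\<close>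
    into a linear bound on the number of absorptions.\<close>
  also have "\<dots> \<le> (2 ^ CARD('p)) ^ (16 * D)" using less_exp[of "CARD('p)"] by (intro power_mono) auto
  also have "\<dots> = 2 ^ (16 * D * CARD('p))" by (simp add: power_mult[symmetric] mult.commute)
  finally have s: "s \<le> 16 * D * CARD('p)" by (simp add: power_le_imp_le_exp)
  have "real (card H) * \<rho> ^ (16 * D * CARD('p)) \<le> real (card H) * \<rho> ^ s"
    using s \<rho>0 \<rho>1 by (intro mult_left_mono power_decreasing) auto
  hence cH: "real (card H) * \<rho> ^ (16 * D * CARD('p)) \<le> real CARD('p) ^ (16 * D)"
    using H(5) cH0 by linarith
  have good: "u i \<in> span_at J ls H (t i)"
    if t: "t \<in> Good" and u: "\<And>i. i < 16 \<Longrightarrow> u i \<in> U (t i)" "(\<Sum>i<16. sg (sgs 4 i) (u i)) = 0" and i: "i < 16" for t u i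
  proof -
    have "t \<in> Tup" "t \<notin> Bad" "ty t = jj" using t by (auto simp: Good_def Good0_def)
    hence "u i \<in> explained Ls I (t i)" using u i unfolding Bad_def Tup_def by blast
    moreover have "I (t i) = jj i" using fun_cong[OF \<open>ty t = jj\<close>, of i] i by (simp add: ty_def)
    hence "I (t i) \<subseteq> J" using i by (auto simp: J_def)
    moreover have "snd (Ls i) \<in> H" if "i \<in> J" for i
      using H(2) that V.span_base unfolding H0_def by blast
    ultimately show ?thesis
      using explained_sub_span_at[where J=J and Ls=Ls and H=H and I=I and y="t i", OF fJ JLs H(1)]
      unfolding ls_def by blast
  qed
  have Good_sub: "Good \<subseteq> {t \<in> {..<16} \<rightarrow>\<^sub>E Y. (\<Sum>i<16. sg (sgs 4 i) (t i)) = 0}"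
    by (auto simp: Good_def Good0_def Tup_def)
  \<comment> \<open>One estimate for both layers: \<open>256 * D = 16 * (16 * D)\<close> covers the
    exponents \<open>16 * card J\<close> and \<open>8 * card J\<close>, and \<open>128\<close> is
    the denominator of \<open>M ^ 2 / 2\<close> in the second layer.\<close>
  have pJ: "real CARD('p) ^ (n * card J) * \<rho> \<le> (\<theta> / 4) ^ 8 / 128" if "n \<le> 16" for n
  proof -
    have "n * card J \<le> 16 * (16 * D)" using that cJ by (intro mult_le_mono)
    hence "real CARD('p) ^ (n * card J) \<le> real CARD('p) ^ (256 * D)" using p1 by (intro power_increasing) auto
    hence "real CARD('p) ^ (n * card J) * \<rho> \<le> real CARD('p) ^ (256 * D) * \<rho>"
      using \<rho>0 by (intro mult_right_mono) auto
    also have "\<dots> = (\<theta> / 4) ^ 8 / 128" by (simp add: \<rho>)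
    finally show ?thesis .
  qed
  have "real CARD('p) ^ (16 * card J) * \<rho> \<le> \<theta> / 2" using pJ[of 16] pow8 \<theta>0 by simp
  then obtain T where T: "T \<subseteq> G" "\<theta> / 4 * q \<le> real (card T)"
    "\<And>z. z \<in> T \<Longrightarrow> \<theta> / 4 * q ^ 14 \<le> real (card {w \<in> regular_pairs J ls H Y Good. tsum 3 (\<lambda>y. y) (fst w) = z})"
    using first_layer[where J=J and ls=ls, OF fJ ls(1,2) H(1) YG less_imp_le[OF \<rho>0] rank Good_sub cGood] by blast
  let ?R = "regular_pairs J ls H Y Good" and ?\<Omega>8 = "{..<8::nat} \<rightarrow>\<^sub>E Y"
  have f8: "finite ?\<Omega>8" using fY by (simp add: finite_PiE)
  have three: "(2::nat) ^ 3 = 8" by simp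
  have dom3: "dominates ((ver ^^ 3) N0) (\<kappa>0 ^ 8) ?\<Omega>8 (tsum 3 (\<lambda>y. y)) (SS 8 U)"
    using ver_dominates[OF dom0 \<kappa>0 fY _ U(1), of 3] YG unfolding three by blast
  have SS8: "V.subspace (SS 8 U t)" "SS 8 U t \<subseteq> G" for t using U by (auto intro!: subspace_SS SS_sub)
  have cSS8: "card (SS 8 U t) \<le> (2 ^ D) ^ 8" if "t \<in> ?\<Omega>8" for t
    using that by (intro card_SS_le U(2) cU) (auto simp: PiE_iff)
  define \<kappa>3 where "\<kappa>3 = (\<kappa>0 ^ 8)\<^sup>2 * (q / (real ((2 ^ D) ^ 8))\<^sup>2)"
  have \<kappa>3: "0 \<le> \<kappa>3" by (simp add: \<kappa>3_def)
  have dom4: "dominates (hor ((ver ^^ 3) N0)) \<kappa>3 {w \<in> ?\<Omega>8 \<times> ?\<Omega>8. tsum 3 (\<lambda>y. y) (fst w) = tsum 3 (\<lambda>y. y) (snd w)}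
     (\<lambda>w. tsum 3 (\<lambda>y. y) (fst w)) (\<lambda>w. SS 8 U (fst w) \<inter> SS 8 U (snd w))"
    unfolding \<kappa>3_def by (rule hor_dominates[OF dom3 _ f8 SS8 cSS8]) (use \<kappa>0 in auto)
  have Rsub: "?R \<subseteq> {w \<in> ?\<Omega>8 \<times> ?\<Omega>8. tsum 3 (\<lambda>y. y) (fst w) = tsum 3 (\<lambda>y. y) (snd w)}"
    by (auto simp: regular_pairs_def)
  have fR: "finite ?R" by (rule finite_subset[OF Rsub]) (use f8 in simp)
  have domR: "dominates (hor ((ver ^^ 3) N0)) \<kappa>3 ?R (\<lambda>w. tsum 3 (\<lambda>y. y) (fst w)) (\<lambda>w. SS 8 U (fst w) \<inter> SS 8 U (snd w))"
    by (rule dominates_subset[OF dom4 Rsub _ \<kappa>3]) (use f8 in simp)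
  have R8: "fst w \<in> ?\<Omega>8" if "w \<in> ?R" for w
    using subsetD[OF Rsub that] unfolding mem_Collect_eq mem_Times_iff by blast
  have \<pi>R: "tsum 3 (\<lambda>y. y) (fst w) \<in> G" if "w \<in> ?R" for w
    using R8[OF that] YG unfolding tsum_def by (intro G_sum sg_G) (auto simp: PiE_iff)
  have cSR: "card (SS 8 U (fst w) \<inter> SS 8 U (snd w)) \<le> (2 ^ D) ^ 8" if "w \<in> ?R" for w
  proof -
    have "card (SS 8 U (fst w) \<inter> SS 8 U (snd w)) \<le> card (SS 8 U (fst w))"
      using SS8(2) finite_sub by (intro card_mono) auto
    thus ?thesis using cSS8[OF R8[OF that]] by linarith
  qed
  have Rspan: "SS 8 U (fst w) \<inter> SS 8 U (snd w) \<subseteq> span_at J ls H (tsum 3 (\<lambda>y. y) (fst w))" if "w \<in> ?R" for w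
  proof (rule regular_pairs_span[where J=J and ls=ls and Y=Y and Good=Good])
    show "u i \<in> span_at J ls H (t i)"
      if "t \<in> Good" "\<And>i. i < 16 \<Longrightarrow> u i \<in> U (t i)" "(\<Sum>i<16. sg (sgs 4 i) (u i)) = 0" "i < 16" for t u i
      by (rule good) (fact that)+
  qed (use that in \<open>auto intro: fJ ls(1,2) H(1) U(1) subsetD[OF YG]\<close>)
  define M where "M = (\<theta> / 4) ^ 4 / 8 * q ^ 3"
  have M0: "0 \<le> M" using \<theta>0 by (simp add: M_def)
  have \<theta>4: "0 < \<theta> / 4" "\<theta> / 4 \<le> 1" using \<theta>0 \<theta>1 by auto
  obtain W r where W: "V.subspace W" "W \<subseteq> G" "card G \<le> CARD('p) ^ r * card W"
    "real r \<le> C1 * log_inv (\<theta> / 4) ^ 4" and quadsT: "\<And>w. w \<in> W \<Longrightarrow> real (card T) ^ 4 / (8 * q) \<le> real (card (quads T w))"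
    using bogolyubov_ruzsa_log[OF C1 T(1,2) \<theta>4] by blast
  have MT: "M \<le> real (card (quads T y))" if "y \<in> W" for y
  proof -
    have "M = (\<theta> / 4 * q) ^ 4 / (8 * q)"
      using q_pos by (simp add: M_def power_mult_distrib eval_nat_numeral)
    also have "\<dots> \<le> real (card T) ^ 4 / (8 * q)"
      using T(2) \<theta>0 by (intro divide_right_mono power_mono) auto
    also have "\<dots> \<le> real (card (quads T y))" by (rule quadsT[OF that])
    finally show ?thesis .
  qed
  have M2: "M\<^sup>2 / 2 = (\<theta> / 4) ^ 8 / 128 * q ^ 6"
    by (simp add: M_def power_mult_distrib power_divide flip: power_mult)
  have irr: "real CARD('p) ^ (8 * card J) * (\<rho> * q ^ 6) \<le> M\<^sup>2 / 2"
    unfolding M2 using mult_right_mono[OF pJ[of 8], of "q ^ 6"] by (simp add: mult.assoc)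
  have final: "((\<alpha> / 2) ^ 4 / 8) ^ 128 / (2 ^ D) ^ 192 * ((\<theta> / 4) ^ 16 / 128) * q ^ 511
       \<le> hor ((ver ^^ 2) (hor ((ver ^^ 3) N0))) x y"
    if y: "y \<in> W" and x: "x \<in> perp H" and xJ: "\<And>i. i \<in> J \<Longrightarrow> pr (ls i y) x = 0" for x y
  proof -
    have xs: "x \<in> perp (span_at J ls H y)"
    proof -
      have "pr (comb J ls c y + h) x = 0" if "h \<in> H" for c h
      proof -
        have "pr h x = 0" using x that by (auto simp: perp_def)
        moreover have "pr (comb J ls c y) x = 0"
          unfolding comb_def pr_sum_left using xJ by (intro sum.neutral) (auto simp: pr_scale_left)
        ultimately show ?thesis by (simp add: pr_add_left)
      qed
      thus ?thesis using x perp_subset by (auto simp: perp_def span_at_def)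
    qed
    have bound: "\<kappa>3 ^ 8 * (q / real ((2 ^ D) ^ 8) ^ 8) * (M\<^sup>2 / 2 * (\<theta> / 4 * q ^ 14) ^ 8)
       \<le> hor ((ver ^^ 2) (hor ((ver ^^ 3) N0))) x y"
    proof (rule second_layer[where J=J and ls=ls and H=H and \<rho>=\<rho> and T=T,
        OF _ _ _ domR \<kappa>3 fR])
      show "V.subspace (SS 8 U (fst w) \<inter> SS 8 U (snd w))" for w by (intro V.subspace_inter SS8(1))
      show "SS 8 U (fst w) \<inter> SS 8 U (snd w) \<subseteq> G" for w using SS8(2) by blast
      show "y \<in> G" using y W(2) by blast
      show "(0::real) \<le> \<theta> / 4 * q ^ 14" using \<theta>0 by simp
    qed (fact fJ ls(1,2) \<pi>R cSR Rspan H(1) less_imp_le[OF \<rho>0] rank T(1) T(3) xs MT[OF y] M0 irr | simp)+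
    \<comment> \<open>Bookkeeping of exponents: \<open>\<kappa>3\<close> carries
      \<open>3 * 16 + 1 = 49\<close> powers of \<open>q\<close>, and
      \<open>49 * 8 + 1 + 6 + 14 * 8 = 511\<close>; the powers of \<open>2 ^ D\<close> are
      \<open>16 * 8 + 64 = 192\<close>.\<close>
    have "\<kappa>3 ^ 8 * (q / real ((2 ^ D) ^ 8) ^ 8) * (M\<^sup>2 / 2 * (\<theta> / 4 * q ^ 14) ^ 8)
      = ((\<alpha> / 2) ^ 4 / 8) ^ 128 / (2 ^ D) ^ 192 * ((\<theta> / 4) ^ 16 / 128) * q ^ 511"
    proof -
      have alg: "((((a * Q ^ 3) ^ 8)\<^sup>2 * (Q / (P ^ 8)\<^sup>2)) ^ 8 * (Q / (P ^ 8) ^ 8)) * ((b ^ 8 / 128 * Q ^ 6) * (b * Q ^ 14) ^ 8)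
         = a ^ 128 / P ^ 192 * (b ^ 16 / 128) * Q ^ 511" if "P > 0" for a b P Q :: real
      proof -
        have "(((a * Q ^ 3) ^ 8)\<^sup>2 * (Q / (P ^ 8)\<^sup>2)) ^ 8 = a ^ 128 * Q ^ 392 / P ^ 128"
          by (simp add: power_mult_distrib power_divide flip: power_mult power_add)
        moreover have "Q / (P ^ 8) ^ 8 = Q / P ^ 64" by (simp flip: power_mult)
        moreover have "(b ^ 8 / 128 * Q ^ 6) * (b * Q ^ 14) ^ 8 = b ^ 16 / 128 * Q ^ 118"
        proof -
          have "(b ^ 8 / 128 * Q ^ 6) * (b * Q ^ 14) ^ 8 = (b ^ 8 * b ^ 8) / 128 * (Q ^ 6 * Q ^ 112)"
            by (simp add: power_mult_distrib mult_ac flip: power_mult)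
          thus ?thesis by (simp flip: power_add)
        qed
        moreover have "Q ^ 392 * Q * Q ^ 118 = Q ^ 511" by (simp flip: power_add power_Suc2)
        moreover have "P ^ 128 * P ^ 64 = P ^ 192" by (simp flip: power_add)
        moreover have "a ^ 128 * Q ^ 392 / P ^ 128 * (Q / P ^ 64) * (b ^ 16 / 128 * Q ^ 118)
          = a ^ 128 / (P ^ 128 * P ^ 64) * (b ^ 16 / 128) * (Q ^ 392 * Q * Q ^ 118)"
          by (simp add: mult_ac)
        ultimately show ?thesis by (simp only:)
      qed
      show ?thesis
        unfolding \<kappa>3_def M2 \<kappa>0_def of_nat_power of_nat_numeral by (rule alg) simp
    qed
    thus ?thesis using bound by simp
  qed
  show ?thesis
  proof (rule that[of J ls H W r])
    show "((\<alpha> / 2) ^ 4 / 8) ^ 128 / (2 ^ D) ^ 192 * ((\<theta> / 4) ^ 16 / 128) * q ^ 511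
       \<le> hor ((ver ^^ 2) (hor ((ver ^^ 3) (hor (hor (\<lambda>x u. of_bool ((x, u) \<in> A))))))) x y"
      if "y \<in> W" "x \<in> perp H" "\<forall>i\<in>J. pr (ls i y) x = 0" for x y
      using final[OF that(1,2) bspec[OF that(3)]] unfolding N0_def .
  qed (fact fJ cJ ls(1,2) H(1,3) cH W(1-4))+
qed

end

subsection \<open>Coordinate vectors\<close>

text \<open>Coordinates in a basis identify the space with functions on the basis. The argument so
  far measures subspaces by size, and this converts sizes into the dimensions of
  \<open>subspace_of_codim\<close>.\<close>

lemma card_finite_vectorspace:
  fixes V :: "('p::prime_card mod_ring, 'b, 'c) module_scheme"
  assumes V: "vectorspace (class_ring :: 'p mod_ring ring) V" and f: "finite (carrier V)"
  shows "card (carrier V) = CARD('p) ^ vectorspace.dim class_ring V"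
proof -
  interpret vectorspace "class_ring :: 'p mod_ring ring" V by fact
  have "span (carrier V) = carrier V"
    using in_own_span[of "carrier V"] span_is_subset2[of "carrier V"] by blast
  hence "fin_dim" unfolding fin_dim_def using f by blast
  then obtain B where B: "finite B" "basis B" using finite_basis_exists by blast
  hence BV: "B \<subseteq> carrier V" by (simp add: basis_def)
  have uniq: "\<exists>!a. a \<in> B \<rightarrow>\<^sub>E carrier class_ring \<and> lincomb a B = v" if "v \<in> carrier V" for v
    using basis_criterion[OF B(1) BV] B(2) that by blast
  have "bij_betw (\<lambda>a. lincomb a B) (B \<rightarrow>\<^sub>E carrier class_ring) (carrier V)"
    unfolding bij_betw_def
  proof
    have cl: "lincomb a B \<in> carrier V" if "a \<in> B \<rightarrow>\<^sub>E carrier class_ring" for a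
      using that BV by (intro lincomb_closed) (auto simp: PiE_iff)
    show "inj_on (\<lambda>a. lincomb a B) (B \<rightarrow>\<^sub>E carrier class_ring)"
      using uniq cl by (intro inj_onI) metis
    show "(\<lambda>a. lincomb a B) ` (B \<rightarrow>\<^sub>E carrier class_ring) = carrier V"
      using uniq cl by (intro equalityI subsetI) (blast, metis imageI)
  qed
  hence "card (carrier V) = card (B \<rightarrow>\<^sub>E (carrier class_ring :: 'p mod_ring set))"
    by (metis bij_betw_same_card)
  also have "\<dots> = CARD('p) ^ card B" using B(1) by (simp add: card_PiE class_ring_simps)
  also have "card B = dim" using dim_basis[OF B] by simp
  finally show ?thesis .
qed

lemma card_carrier_mod_ring_vec: "card (carrier_vec n :: 'p::prime_card fvec set) = CARD('p) ^ n"
  by (simp add: Berlekamp_Type_Based.card_carrier_vec)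

lemma subspace_of_codimI:
  fixes S :: "'p::prime_card fvec set"
  assumes sub: "S \<subseteq> carrier_vec n" and zero: "0\<^sub>v n \<in> S"
    and add: "\<And>u v. u \<in> S \<Longrightarrow> v \<in> S \<Longrightarrow> u + v \<in> S"
    and smult: "\<And>c v. v \<in> S \<Longrightarrow> c \<cdot>\<^sub>v v \<in> S"
  shows "\<exists>r. subspace_of_codim n S r \<and> card S * CARD('p) ^ r = CARD('p) ^ n"
proof -
  let ?V = "module_vec TYPE('p mod_ring) n"
  interpret V: vectorspace "class_ring :: 'p mod_ring ring" ?V by (rule vec_vs)
  have S: "VectorSpace.subspace class_ring S ?V"
    unfolding VectorSpace.subspace_def
  proof
    show "vectorspace (class_ring :: 'p mod_ring ring) ?V" by (rule vec_vs)
    show "submodule class_ring S ?V"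
      by unfold_locales (use assms in \<open>auto simp: module_vec_simps\<close>)
  qed
  have vsS: "vectorspace class_ring (?V\<lparr>carrier := S\<rparr>)" by (rule V.subspace_is_vs[OF S])
  have fS: "finite S" using sub by (rule finite_subset) simp
  define d where "d = vectorspace.dim (class_ring :: 'p mod_ring ring) (?V\<lparr>carrier := S\<rparr>)"
  have c: "card S = CARD('p) ^ d"
    using card_finite_vectorspace[OF vsS] fS by (simp add: d_def)
  have p: "1 < CARD('p)" using prime_card[where 'a='p] by (rule prime_gt_1_nat)
  have "card S \<le> card (carrier_vec n :: 'p fvec set)" using sub by (intro card_mono) auto
  hence "CARD('p) ^ d \<le> CARD('p) ^ n" by (simp only: c card_carrier_mod_ring_vec)
  hence "d \<le> n" using p by (simp add: power_increasing_iff)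
  hence "subspace_of_codim n S (n - d)" "card S * CARD('p) ^ (n - d) = CARD('p) ^ n"
    using S by (simp_all add: subspace_of_codim_def d_def[symmetric] c flip: power_add)
  thus ?thesis by blast
qed

text \<open>Coordinate vectors of length \<open>n\<close> are modelled by functions supported below \<open>n\<close>, which
  form a subset of a type that is itself an abelian group.\<close>

definition emb :: "nat \<Rightarrow> 'p::prime_card fvec \<Rightarrow> nat \<Rightarrow> 'p mod_ring" where
  "emb n v = (\<lambda>i. if i < n then v $ i else 0)"

definition supp :: "nat \<Rightarrow> (nat \<Rightarrow> 'p::prime_card mod_ring) set" where
  "supp n = {f. \<forall>i\<ge>n. f i = 0}"

definition fscale :: "'p::prime_card mod_ring \<Rightarrow> (nat \<Rightarrow> 'p mod_ring) \<Rightarrow> nat \<Rightarrow> 'p mod_ring" where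
  "fscale c f = (\<lambda>i. c * f i)"

definition fdot :: "nat \<Rightarrow> (nat \<Rightarrow> 'p::prime_card mod_ring) \<Rightarrow> (nat \<Rightarrow> 'p mod_ring) \<Rightarrow> 'p mod_ring" where
  "fdot n f g = (\<Sum>i<n. f i * g i)"

lemma emb_add: "u \<in> carrier_vec n \<Longrightarrow> v \<in> carrier_vec n \<Longrightarrow> emb n (u + v) = emb n u + emb n v"
  by (auto simp: emb_def fun_eq_iff)

lemma emb_smult: "v \<in> carrier_vec n \<Longrightarrow> emb n (c \<cdot>\<^sub>v v) = fscale c (emb n v)"
  by (auto simp: emb_def fscale_def fun_eq_iff)

lemma emb_zero: "emb n (0\<^sub>v n) = 0"
  by (auto simp: emb_def fun_eq_iff)

lemma bij_emb: "bij_betw (emb n) (carrier_vec n) (supp n :: (nat \<Rightarrow> 'p::prime_card mod_ring) set)"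
proof (rule bij_betw_byWitness[where f' = "\<lambda>f. vec n f"])
  show "\<forall>v\<in>carrier_vec n. vec n (emb n v) = (v :: 'p fvec)" by (auto simp: emb_def)
  show "\<forall>f\<in>supp n. emb n (vec n f) = (f :: nat \<Rightarrow> 'p mod_ring)" by (auto simp: emb_def supp_def fun_eq_iff)
qed (auto simp: emb_def supp_def)

lemma emb_supp: "v \<in> carrier_vec n \<Longrightarrow> emb n v \<in> supp n"
  using bij_emb by (metis bij_betw_apply)

lemma fscale_vector_space: "Vector_Spaces.vector_space (fscale :: 'p::prime_card mod_ring \<Rightarrow> _)"
  by unfold_locales (auto simp: fscale_def fun_eq_iff algebra_simps)

lemma fin_space_supp: "fin_space (fscale :: 'p::prime_card mod_ring \<Rightarrow> _) (supp n) (fdot n)"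
proof -
  interpret V: Vector_Spaces.vector_space "fscale :: 'p mod_ring \<Rightarrow> _" by (rule fscale_vector_space)
  show ?thesis
  proof
    show "finite (supp n :: (nat \<Rightarrow> 'p mod_ring) set)"
      using bij_betw_finite[OF bij_emb[of n, where 'p='p]] by simp
    show "V.subspace (supp n)"
      by (rule V.subspaceI) (auto simp: supp_def fscale_def)
    fix x y z :: "nat \<Rightarrow> 'p mod_ring" and c
    show "fdot n (x + y) z = fdot n x z + fdot n y z"
      by (simp add: fdot_def distrib_right sum.distrib)
    show "fdot n (fscale c x) z = c * fdot n x z"
      by (simp add: fdot_def fscale_def sum_distrib_left mult.assoc)
    show "fdot n x y = fdot n y x" by (simp add: fdot_def mult.commute)
    assume x: "x \<in> supp n" "\<And>y. y \<in> supp n \<Longrightarrow> fdot n x y = 0"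
    show "x = 0"
    proof
      fix i
      show "x i = 0 i"
      proof (cases "i < n")
        case True
        have "(\<lambda>j. if j = i then 1 else 0) \<in> supp n" using True by (auto simp: supp_def)
        hence "fdot n x (\<lambda>j. if j = i then 1 else 0) = 0" by (rule x(2))
        thus ?thesis using True by (simp add: fdot_def if_distrib cong: if_cong)
      next
        case False
        thus ?thesis using x(1) by (simp add: supp_def)
      qed
    qed
  qed
qed

lemma card_supp: "card (supp n :: (nat \<Rightarrow> 'p::prime_card mod_ring) set) = CARD('p) ^ n"
  using bij_betw_same_card[OF bij_emb[of n, where 'p='p]] by (simp add: card_carrier_mod_ring_vec)

lemma pullback_subspace:
  fixes H :: "(nat \<Rightarrow> 'p::prime_card mod_ring) set"
  assumes H: "module.subspace fscale H" "H \<subseteq> supp n"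
  obtains r where "subspace_of_codim n {v \<in> carrier_vec n. emb n v \<in> H} r" "card H * CARD('p) ^ r = CARD('p) ^ n"
proof -
  interpret V: Vector_Spaces.vector_space "fscale :: 'p mod_ring \<Rightarrow> _" by (rule fscale_vector_space)
  let ?S = "{v \<in> carrier_vec n. emb n v \<in> H}"
  have "bij_betw (emb n) ?S H"
  proof -
    have "inj_on (emb n) ?S" using bij_emb[of n, where 'p='p] by (auto simp: bij_betw_def inj_on_def)
    moreover have "emb n ` ?S = H"
    proof (intro equalityI subsetI)
      fix f assume f: "f \<in> H"
      hence "f \<in> emb n ` carrier_vec n" using H(2) bij_emb[of n, where 'p='p] by (auto simp: bij_betw_def)
      thus "f \<in> emb n ` ?S" using f by auto
    qed auto
    ultimately show ?thesis by (simp add: bij_betw_def)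
  qed
  hence "card ?S = card H" by (rule bij_betw_same_card)
  moreover have "\<exists>r. subspace_of_codim n ?S r \<and> card ?S * CARD('p) ^ r = CARD('p) ^ n"
  proof (rule subspace_of_codimI)
    show "?S \<subseteq> carrier_vec n" by blast
    show "0\<^sub>v n \<in> ?S" using V.subspace_0[OF H(1)] by (simp add: emb_zero)
    show "u + v \<in> ?S" if "u \<in> ?S" "v \<in> ?S" for u v
      using that V.subspace_add[OF H(1)] by (simp add: emb_add)
    show "c \<cdot>\<^sub>v v \<in> ?S" if "v \<in> ?S" for c v
      using that V.subspace_scale[OF H(1)] by (simp add: emb_smult)
  qed
  ultimately obtain r where "subspace_of_codim n ?S r" "card H * CARD('p) ^ r = CARD('p) ^ n" by auto
  thus ?thesis by (rule that)
qed

subsection \<open>Choice of the parameters\<close>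

lemma log_inv_le_expI:
  assumes "0 < x" "1 / x \<le> exp y" "1 \<le> y"
  shows "log_inv x \<le> y"
proof (rule log_inv_leI)
  have "ln (1 / x) \<le> ln (exp y)" using assms by (intro ln_mono) auto
  thus "ln (1 / x) \<le> y" by simp
  show "ln 2 \<le> y" using assms(3) ln_2_less_1 by linarith
qed

lemma le_exp_of_power: "2 ^ m \<le> exp y \<Longrightarrow> real m \<le> 2 * y"
proof -
  assume "2 ^ m \<le> exp y"
  hence "ln (2 ^ m) \<le> ln (exp y)" by (intro ln_mono) auto
  hence *: "real m * ln 2 \<le> y" by (simp add: ln_realpow)
  have "1 / 2 \<le> ln (2 :: real)" using log_inv_ge_half[of 1] by (simp add: log_inv_def)
  hence "real m * (1 / 2) \<le> real m * ln 2" by (intro mult_left_mono) auto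
  thus ?thesis using * by linarith
qed

text \<open>The doubled logarithm \<open>\<Lambda>\<close> is at least 1, so lower powers are
  bounded by higher ones and every parameter is compared with the exponential of a single power of
  \<open>\<Lambda>\<close>.\<close>

lemma parameter_bounds:
  fixes C1 C2 \<alpha> :: real and p :: nat
  assumes C1: "0 \<le> C1" and C2: "0 \<le> C2" and p: "2 \<le> p" and \<alpha>: "0 < \<alpha>"
    and \<Lambda>: "\<Lambda> = 2 * log_inv \<alpha>"
    and D: "D = nat \<lceil>real p * C1 * log_inv (\<alpha> / 2) ^ 4\<rceil>"
    and \<beta>: "\<beta> = (\<alpha> / 2) ^ 16 / 2" and c: "c = (\<beta> / (16 * (2 ^ D) ^ 16))\<^sup>2 / 2"
    and K: "K = nat \<lceil>real D / exp (- C2 * log_inv c ^ 4)\<rceil>"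
    and \<theta>: "\<theta> = \<beta> / (real K + 1) ^ (16 * D)"
    and \<rho>: "\<rho> = (\<theta> / 4) ^ 8 / (128 * real p ^ (256 * D))"
    and a1: "a1 = real p * C1 + 1" and a2: "a2 = 38 + 32 * a1" and a3: "a3 = a1 + 1 + C2 * a2 ^ 4"
    and a5: "a5 = 16 * a1 * a3 + 18" and a6: "a6 = 4 + 256 * real p * a1 + 8 * a5"
    and a7: "a7 = 16 * real p * a1 * (1 + a6)" and a8: "a8 = 708 + 192 * a1 + 16 * a5"
  shows "\<And>r::nat. real r \<le> C1 * log_inv (\<alpha> / 2) ^ 4 \<Longrightarrow> p ^ r \<le> 2 ^ D"
    and "real D / exp (- C2 * log_inv c ^ 4) \<le> real K"
    and "real D \<le> a1 * \<Lambda> ^ 4"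
    and "log_inv (\<theta> / 4) \<le> a5 * \<Lambda> ^ 20"
    and "\<And>h::nat. real h * \<rho> ^ (16 * D * p) \<le> real p ^ (16 * D) \<Longrightarrow> real h \<le> exp (a7 * \<Lambda> ^ 24)"
    and "exp (- (a8 * \<Lambda> ^ 20)) \<le> ((\<alpha> / 2) ^ 4 / 8) ^ 128 / (2 ^ D) ^ 192 * ((\<theta> / 4) ^ 16 / 128)"
proof -
  define L where "L = log_inv \<alpha>"
  have L: "\<Lambda> = 2 * L" by (simp add: \<Lambda> L_def)
  have \<Lambda>1: "1 \<le> \<Lambda>" using log_inv_ge_half[of \<alpha>] by (simp add: \<Lambda>)
  have pw: "\<Lambda> ^ i \<le> \<Lambda> ^ j" if "i \<le> j" for i j using that \<Lambda>1 by (intro power_increasing)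
  have pw1: "\<Lambda> \<le> \<Lambda> ^ j" "1 \<le> \<Lambda> ^ j" if "1 \<le> j" for j
    using pw[of 1 j] pw[of 0 j] that by auto
  have two: "2 \<le> exp L"
    using ln2_le_log_inv[of \<alpha>] exp_le_cancel_iff[of "ln 2" L] by (simp add: L_def)
  have i\<alpha>: "1 / \<alpha> \<le> exp L" unfolding L_def by (rule inverse_le_exp_log_inv[OF \<alpha>])
  have two_pow: "2 ^ j \<le> exp (real j * L)" for j
    using power_mono[OF two, of j] by (simp add: exp_of_nat_mult)
  have two_D: "2 ^ j \<le> exp (real j)" for j
    using power_mono[OF exp_ge_add_one_self[of 1], of j] by (simp flip: exp_of_nat_mult)
  have i\<alpha>2: "2 / \<alpha> \<le> exp (2 * L)"
  proof -
    have "2 * (1 / \<alpha>) \<le> exp L * exp L" using two i\<alpha> \<alpha> by (intro mult_mono) auto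
    thus ?thesis by (simp flip: exp_add)
  qed
  have a1': "1 \<le> a1" using C1 by (simp add: a1)
  have a2': "38 \<le> a2" using a1' by (simp add: a2)
  have a3': "1 \<le> a3" using a1' C2 a2' by (simp add: a3)
  have "0 \<le> a1 * a3" using a1' a3' by simp
  hence a5': "18 \<le> a5" by (simp add: a5)
  have a6': "0 \<le> a6" using a1' a5' by (simp add: a6)
  have l\<alpha>: "log_inv (\<alpha> / 2) \<le> \<Lambda>"
    by (rule log_inv_le_expI) (use \<alpha> i\<alpha>2 \<Lambda>1 L in auto)
  have l0: "0 \<le> log_inv x" for x using log_inv_ge_half[of x] by linarith
  have D_ge: "real p * C1 * log_inv (\<alpha> / 2) ^ 4 \<le> real D" unfolding D by (rule real_nat_ceiling_ge)
  show "p ^ r \<le> 2 ^ D" if r: "real r \<le> C1 * log_inv (\<alpha> / 2) ^ 4" for r :: nat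
  proof -
    have "real (p * r) \<le> real p * (C1 * log_inv (\<alpha> / 2) ^ 4)" using r by (simp add: mult_left_mono)
    hence "real (p * r) \<le> real D" using D_ge by (simp add: mult.assoc)
    hence "p * r \<le> D" by (simp only: of_nat_le_iff)
    \<comment> \<open>The bound \<open>p < 2 ^ p\<close> accounts for the factor \<open>p\<close> in
      \<open>D\<close>.\<close>
    have "p ^ r \<le> (2 ^ p) ^ r" by (intro power_mono less_imp_le[OF less_exp]) auto
    also have "\<dots> = 2 ^ (p * r)" by (simp add: power_mult)
    also have "\<dots> \<le> 2 ^ D" using \<open>p * r \<le> D\<close> by (intro power_increasing) auto
    finally show ?thesis .
  qed
  show Kge: "real D / exp (- C2 * log_inv c ^ 4) \<le> real K" unfolding K by (rule real_nat_ceiling_ge)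
  have nat_ceil: "real (nat \<lceil>x\<rceil>) \<le> x + 1" if "0 \<le> x" for x :: real
    using that by linarith
  have "real D \<le> real p * C1 * log_inv (\<alpha> / 2) ^ 4 + 1" unfolding D using C1 by (intro nat_ceil) auto
  also have "\<dots> \<le> real p * C1 * \<Lambda> ^ 4 + \<Lambda> ^ 4"
    using l\<alpha> l0 C1 pw1[of 4] by (intro add_mono mult_left_mono power_mono) auto
  finally show Dle: "real D \<le> a1 * \<Lambda> ^ 4" by (simp add: a1 algebra_simps)
  have \<beta>0: "0 < \<beta>" using \<alpha> by (simp add: \<beta>)
  have i\<beta>: "1 / \<beta> \<le> exp (33 * L)"
  proof -
    have "1 / \<beta> = 2 * (2 / \<alpha>) ^ 16" using \<alpha> by (simp add: \<beta> power_divide)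
    also have "\<dots> \<le> exp L * exp (2 * L) ^ 16" using two i\<alpha>2 \<alpha> by (intro mult_mono power_mono) auto
    also have "\<dots> = exp (33 * L)" by (simp flip: exp_of_nat_mult exp_add)
    finally show ?thesis .
  qed
  have c0: "0 < c" using \<beta>0 by (simp add: c)
  \<comment> \<open>\<open>75 = 1 + 2 * (4 + 33)\<close> and \<open>32 = 2 * 16\<close>, the
    doubling coming from the square in \<open>c\<close>.\<close>
  have ic: "1 / c \<le> exp (75 * L + 32 * real D)"
  proof -
    have "1 / c = 2 * (2 ^ 4 * (2 ^ D) ^ 16 * (1 / \<beta>))\<^sup>2" using \<beta>0 by (simp add: c power_divide)
    also have "\<dots> \<le> exp L * (exp (4 * L) * exp (real D) ^ 16 * exp (33 * L))\<^sup>2"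
      using two two_pow[of 4] two_D[of D] i\<beta> \<beta>0 by (intro mult_mono power_mono) auto
    also have "\<dots> = exp (75 * L + 32 * real D)"
      by (simp add: power2_eq_square flip: exp_of_nat_mult exp_add)
    finally show ?thesis .
  qed
  have lc: "log_inv c \<le> a2 * \<Lambda> ^ 4"
  proof (rule log_inv_le_expI[OF c0])
    have "75 * L + 32 * real D \<le> 38 * \<Lambda> ^ 4 + 32 * (a1 * \<Lambda> ^ 4)" using pw1[of 4] Dle L \<Lambda>1 by linarith
    also have "\<dots> = a2 * \<Lambda> ^ 4" by (simp add: a2 algebra_simps)
    finally show "1 / c \<le> exp (a2 * \<Lambda> ^ 4)" using ic by (meson exp_le_cancel_iff order_trans)
    have "1 * 1 \<le> a2 * \<Lambda> ^ 4" using a2' pw1[of 4] by (intro mult_mono) auto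
    thus "1 \<le> a2 * \<Lambda> ^ 4" by simp
  qed
  have K1: "real K + 1 \<le> exp (a3 * \<Lambda> ^ 16)"
  proof -
    define x where "x = C2 * log_inv c ^ 4"
    have x0: "0 \<le> x" using C2 l0 by (simp add: x_def)
    have "log_inv c ^ 4 \<le> (a2 * \<Lambda> ^ 4) ^ 4" using lc l0 by (intro power_mono) auto
    hence x: "x \<le> C2 * (a2 ^ 4 * \<Lambda> ^ 16)"
      unfolding x_def using C2 by (intro mult_left_mono) (auto simp: power_mult_distrib simp flip: power_mult)
    have "real K \<le> real D * exp x + 1"
      using nat_ceil[of "real D / exp (- C2 * log_inv c ^ 4)"] by (simp add: K x_def exp_minus divide_inverse)
    hence "real K + 1 \<le> real D * exp x + 2 * exp x" using x0 one_le_exp_iff[of x] by linarith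
    also have "\<dots> = (1 + (real D + 1)) * exp x" by (simp add: algebra_simps)
    also have "\<dots> \<le> exp (real D + 1) * exp x" by (intro mult_right_mono exp_ge_add_one_self) auto
    also have "\<dots> = exp (real D + 1 + x)" by (simp add: exp_add)
    also have "\<dots> \<le> exp (a3 * \<Lambda> ^ 16)"
    proof -
      have "a1 * \<Lambda> ^ 4 \<le> a1 * \<Lambda> ^ 16" using a1' pw[of 4 16] by (intro mult_left_mono) auto
      moreover have "a3 * \<Lambda> ^ 16 = a1 * \<Lambda> ^ 16 + \<Lambda> ^ 16 + C2 * (a2 ^ 4 * \<Lambda> ^ 16)" by (simp add: a3 algebra_simps)
      ultimately have "real D + 1 + x \<le> a3 * \<Lambda> ^ 16" using x Dle pw1(2)[of 16] by linarith
      thus ?thesis by simp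
    qed
    finally show ?thesis .
  qed
  have \<theta>0: "0 < \<theta>" using \<beta>0 by (simp add: \<theta>)
  have a20: "a1 * \<Lambda> ^ 4 \<le> a1 * \<Lambda> ^ 20" using a1' pw[of 4 20] by (intro mult_left_mono) auto
  have i\<theta>: "1 / (\<theta> / 4) \<le> exp (a5 * \<Lambda> ^ 20)"
  proof -
    have KD: "(real K + 1) ^ (16 * D) \<le> exp (16 * a1 * a3 * \<Lambda> ^ 20)"
    proof -
      have "(real K + 1) ^ (16 * D) \<le> exp (a3 * \<Lambda> ^ 16) ^ (16 * D)" using K1 by (intro power_mono) auto
      also have "\<dots> = exp (real (16 * D) * (a3 * \<Lambda> ^ 16))" by (simp only: exp_of_nat_mult)
      also have "\<dots> \<le> exp (16 * (a1 * \<Lambda> ^ 4) * (a3 * \<Lambda> ^ 16))"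
        using Dle a3' \<Lambda>1 by (subst exp_le_cancel_iff, intro mult_right_mono) auto
      \<comment> \<open>The exponent 4 of \<open>D\<close> and the exponent 16 of the logarithm of
        \<open>K\<close> add up to 20.\<close>
      also have "16 * (a1 * \<Lambda> ^ 4) * (a3 * \<Lambda> ^ 16) = 16 * a1 * a3 * \<Lambda> ^ 20"
        by (simp add: power_add[of \<Lambda> 4 16, simplified])
      finally show ?thesis .
    qed
    have "1 / (\<theta> / 4) = 2 ^ 2 * (1 / \<beta>) * (real K + 1) ^ (16 * D)" by (simp add: \<theta>)
    also have "\<dots> \<le> exp (2 * L) * exp (33 * L) * exp (16 * a1 * a3 * \<Lambda> ^ 20)"
      using two_pow[of 2] i\<beta> KD \<beta>0 by (intro mult_mono) auto
    also have "\<dots> = exp (35 * L + 16 * a1 * a3 * \<Lambda> ^ 20)" by (simp flip: exp_add)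
    also have "\<dots> \<le> exp (a5 * \<Lambda> ^ 20)"
      using pw1(1)[of 20] L \<Lambda>1 by (subst exp_le_cancel_iff) (simp add: a5 distrib_right)
    finally show ?thesis .
  qed
  show "log_inv (\<theta> / 4) \<le> a5 * \<Lambda> ^ 20"
  proof (rule log_inv_le_expI[OF _ i\<theta>])
    have "1 * 1 \<le> a5 * \<Lambda> ^ 20" using a5' pw1[of 20] by (intro mult_mono) auto
    thus "1 \<le> a5 * \<Lambda> ^ 20" by simp
  qed (use \<theta>0 in simp)
  have p_exp: "real p ^ j \<le> exp (real p * real j)" for j
  proof -
    have "real p \<le> exp (real p)" using exp_ge_add_one_self[of "real p"] by linarith
    hence "real p ^ j \<le> exp (real p) ^ j" by (intro power_mono) auto
    thus ?thesis by (simp add: mult.commute flip: exp_of_nat_mult)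
  qed
  have \<rho>0: "0 < \<rho>" using \<theta>0 p by (simp add: \<rho>)
  have i\<rho>: "1 / \<rho> \<le> exp (a6 * \<Lambda> ^ 20)"
  proof -
    have "1 / \<rho> = 2 ^ 7 * real p ^ (256 * D) * (1 / (\<theta> / 4)) ^ 8" by (simp add: \<rho> power_divide)
    also have "\<dots> \<le> exp (7 * L) * exp (real p * real (256 * D)) * exp (a5 * \<Lambda> ^ 20) ^ 8"
      using two_pow[of 7] p_exp[of "256 * D"] i\<theta> \<theta>0 by (intro mult_mono power_mono) auto
    also have "\<dots> = exp (7 * L + 256 * real p * real D + 8 * a5 * \<Lambda> ^ 20)"
      by (simp add: mult_ac flip: exp_add exp_of_nat_mult)
    also have "\<dots> \<le> exp (a6 * \<Lambda> ^ 20)"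
    proof (subst exp_le_cancel_iff)
      have "256 * real p * real D \<le> 256 * real p * (a1 * \<Lambda> ^ 20)"
        using Dle a20 by (intro mult_left_mono) auto
      moreover have "a6 * \<Lambda> ^ 20 = 4 * \<Lambda> ^ 20 + 256 * real p * (a1 * \<Lambda> ^ 20) + 8 * a5 * \<Lambda> ^ 20"
        by (simp add: a6 algebra_simps)
      ultimately show "7 * L + 256 * real p * real D + 8 * a5 * \<Lambda> ^ 20 \<le> a6 * \<Lambda> ^ 20"
        using pw1(1)[of 20] L \<Lambda>1 by linarith
    qed
    finally show ?thesis .
  qed
  show "real h \<le> exp (a7 * \<Lambda> ^ 24)" if h: "real h * \<rho> ^ (16 * D * p) \<le> real p ^ (16 * D)" for h
  proof -
    have "real h = real h * \<rho> ^ (16 * D * p) * (1 / \<rho>) ^ (16 * D * p)"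
      using \<rho>0 by (simp add: power_divide)
    also have "\<dots> \<le> real p ^ (16 * D) * exp (a6 * \<Lambda> ^ 20) ^ (16 * D * p)"
      using h i\<rho> \<rho>0 by (intro mult_mono power_mono) auto
    also have "\<dots> \<le> exp (real p * real (16 * D)) * exp (real (16 * D * p) * (a6 * \<Lambda> ^ 20))"
      using p_exp[of "16 * D"] by (simp only: exp_of_nat_mult) (intro mult_right_mono, auto)
    also have "\<dots> = exp (16 * real p * real D * (1 + a6 * \<Lambda> ^ 20))"
      by (simp add: algebra_simps flip: exp_add)
    also have "\<dots> \<le> exp (a7 * \<Lambda> ^ 24)"
    proof (subst exp_le_cancel_iff)
      have "16 * real p * real D * (1 + a6 * \<Lambda> ^ 20) \<le> 16 * real p * (a1 * \<Lambda> ^ 4) * (\<Lambda> ^ 20 + a6 * \<Lambda> ^ 20)"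
        using Dle a1' a6' pw1(2)[of 20] \<Lambda>1 by (intro mult_mono add_mono) auto
      also have "\<dots> = a7 * \<Lambda> ^ 24" by (simp add: a7 algebra_simps flip: power_add)
      finally show "16 * real p * real D * (1 + a6 * \<Lambda> ^ 20) \<le> a7 * \<Lambda> ^ 24" .
    qed
    finally show ?thesis .
  qed
  show "exp (- (a8 * \<Lambda> ^ 20)) \<le> ((\<alpha> / 2) ^ 4 / 8) ^ 128 / (2 ^ D) ^ 192 * ((\<theta> / 4) ^ 16 / 128)" (is "_ \<le> ?\<kappa>")
  proof (rule exp_minus_leI)
    show "0 < ?\<kappa>" using \<alpha> \<theta>0 by simp
    have "1 / ?\<kappa> = (2 ^ 3 * (2 / \<alpha>) ^ 4) ^ 128 * (2 ^ D) ^ 192 * ((1 / (\<theta> / 4)) ^ 16 * 2 ^ 7)"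
      using \<alpha> by (simp add: power_divide)
    also have "\<dots> \<le> (exp (3 * L) * exp (2 * L) ^ 4) ^ 128 * exp (real D) ^ 192 * (exp (a5 * \<Lambda> ^ 20) ^ 16 * exp (7 * L))"
      using two_pow[of 3] two_pow[of 7] i\<alpha>2 two_D[of D] i\<theta> \<theta>0 \<alpha> by (intro mult_mono power_mono) auto
    also have "\<dots> = exp (1415 * L + 192 * real D + 16 * a5 * \<Lambda> ^ 20)"
      by (simp add: algebra_simps flip: exp_add exp_of_nat_mult)
    also have "\<dots> \<le> exp (a8 * \<Lambda> ^ 20)"
    proof (subst exp_le_cancel_iff)
      have "a8 * \<Lambda> ^ 20 = 708 * \<Lambda> ^ 20 + 192 * (a1 * \<Lambda> ^ 20) + 16 * a5 * \<Lambda> ^ 20" by (simp add: a8 algebra_simps)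
      thus "1415 * L + 192 * real D + 16 * a5 * \<Lambda> ^ 20 \<le> a8 * \<Lambda> ^ 20"
        using pw1(1)[of 20] L \<Lambda>1 Dle a20 by linarith
    qed
    finally show "1 / ?\<kappa> \<le> exp (a8 * \<Lambda> ^ 20)" .
  qed
qed

text \<open>The constant has to be fixed before \<open>\<alpha>\<close>, so all auxiliary constants
  depend on \<open>C1\<close>, \<open>C2\<close> and \<open>p\<close> alone. The last conjunct
  bounds the codimension with \<open>h\<close> standing for the size of \<open>H\<close>, of which
  only \<open>2 ^ r1 \<le> h\<close> is used.\<close>

lemma ex_parameters:
  fixes C1 C2 :: real and p :: nat
  assumes C1: "0 \<le> C1" and C2: "0 \<le> C2" and p: "2 \<le> p"
  shows "\<exists>C>0. \<forall>\<alpha>>0. \<exists>D K \<beta> c \<theta> \<rho>. (\<forall>r::nat. real r \<le> C1 * log_inv (\<alpha> / 2) ^ 4 \<longrightarrow> p ^ r \<le> 2 ^ D) \<and>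
     \<beta> = (\<alpha> / 2) ^ 16 / 2 \<and> c = (\<beta> / (16 * (2 ^ D) ^ 16))\<^sup>2 / 2 \<and>
     real D / exp (- C2 * log_inv c ^ 4) \<le> real (K::nat) \<and>
     \<theta> = \<beta> / (real K + 1) ^ (16 * D) \<and> \<rho> = (\<theta> / 4) ^ 8 / (128 * real p ^ (256 * D)) \<and>
     exp (- C * log_inv \<alpha> ^ 20) \<le> ((\<alpha> / 2) ^ 4 / 8) ^ 128 / (2 ^ D) ^ 192 * ((\<theta> / 4) ^ 16 / 128) \<and>
     (\<forall>r1 r2 r3 h. 2 ^ r1 \<le> h \<longrightarrow> real h * \<rho> ^ (16 * D * p) \<le> real p ^ (16 * D) \<longrightarrow>
        real r2 \<le> C1 * log_inv (\<theta> / 4) ^ 4 \<longrightarrow> r3 \<le> 16 * D \<longrightarrow>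
        real (r1 + r2 + r3) \<le> C * log_inv \<alpha> ^ 80)"
proof -
  define a1 where "a1 = real p * C1 + 1"
  define a2 where "a2 = 38 + 32 * a1"
  define a3 where "a3 = a1 + 1 + C2 * a2 ^ 4"
  define a5 where "a5 = 16 * a1 * a3 + 18"
  define a6 where "a6 = 4 + 256 * real p * a1 + 8 * a5"
  define a7 where "a7 = 16 * real p * a1 * (1 + a6)"
  define a8 where "a8 = 708 + 192 * a1 + 16 * a5"
  define b where "b = 2 * a7 + C1 * a5 ^ 4 + 16 * a1"
  \<comment> \<open>The powers of 2 convert \<open>\<Lambda>\<close> back into
    \<open>log_inv \<alpha>\<close>; the sum serves both for \<open>\<epsilon>\<close> and for the
    codimension.\<close>
  define C where "C = a8 * 2 ^ 20 + b * 2 ^ 80"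
  have a1': "1 \<le> a1" using C1 by (simp add: a1_def)
  have "0 \<le> a3" using a1' C2 by (simp add: a3_def)
  hence "0 \<le> a1 * a3" using a1' by simp
  hence a5': "0 \<le> a5" by (simp add: a5_def)
  have a6': "0 \<le> a6" using a1' a5' by (simp add: a6_def)
  have a7': "0 \<le> a7" using a1' a6' by (simp add: a7_def)
  have a8': "0 < a8" using a1' a5' by (simp add: a8_def)
  have b': "0 \<le> b" using a1' a7' C1 a5' by (simp add: b_def)
  have C0: "C > 0" using a8' b' by (simp add: C_def add_pos_nonneg)
  have C8: "a8 * 2 ^ 20 \<le> C" "b * 2 ^ 80 \<le> C" using a8' b' by (auto simp: C_def)
  show ?thesis
  proof (intro exI[of _ C] conjI C0 allI impI)
    fix \<alpha> :: real assume \<alpha>: "0 < \<alpha>"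
    define \<Lambda> where "\<Lambda> = 2 * log_inv \<alpha>"
    define D where "D = nat \<lceil>real p * C1 * log_inv (\<alpha> / 2) ^ 4\<rceil>"
    define \<beta> where "\<beta> = (\<alpha> / 2) ^ 16 / 2"
    define c where "c = (\<beta> / (16 * (2 ^ D) ^ 16))\<^sup>2 / 2"
    define K where "K = nat \<lceil>real D / exp (- C2 * log_inv c ^ 4)\<rceil>"
    define \<theta> where "\<theta> = \<beta> / (real K + 1) ^ (16 * D)"
    define \<rho> where "\<rho> = (\<theta> / 4) ^ 8 / (128 * real p ^ (256 * D))"
    note bds = parameter_bounds[OF C1 C2 p \<alpha> \<Lambda>_def D_def \<beta>_def c_def K_def \<theta>_def \<rho>_def
      a1_def a2_def a3_def a5_def a6_def a7_def a8_def]
    have l0: "0 \<le> log_inv x" for x using log_inv_ge_half[of x] by linarith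
    have \<Lambda>1: "1 \<le> \<Lambda>" using log_inv_ge_half[of \<alpha>] by (simp add: \<Lambda>_def)
    have "exp (- C * log_inv \<alpha> ^ 20) \<le> exp (- (a8 * \<Lambda> ^ 20))"
      using mult_right_mono[OF C8(1), of "log_inv \<alpha> ^ 20"] l0[of \<alpha>]
      by (simp add: \<Lambda>_def power_mult_distrib mult.assoc)
    hence \<kappa>: "exp (- C * log_inv \<alpha> ^ 20) \<le> ((\<alpha> / 2) ^ 4 / 8) ^ 128 / (2 ^ D) ^ 192 * ((\<theta> / 4) ^ 16 / 128)"
      using bds(6) by linarith
    have dims: "real (r1 + r2 + r3) \<le> C * log_inv \<alpha> ^ 80"
      if r1: "2 ^ r1 \<le> h" and h: "real h * \<rho> ^ (16 * D * p) \<le> real p ^ (16 * D)"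
        and r2: "real r2 \<le> C1 * log_inv (\<theta> / 4) ^ 4" and r3: "r3 \<le> 16 * D" for r1 r2 r3 h :: nat
    proof -
      have pw: "\<Lambda> ^ i \<le> \<Lambda> ^ 80" if "i \<le> 80" for i using that \<Lambda>1 by (intro power_increasing)
      have "real (2 ^ r1) \<le> real h" using r1 by (simp only: of_nat_le_iff)
      hence "real (2 ^ r1) \<le> exp (a7 * \<Lambda> ^ 24)" using bds(5)[OF h] by linarith
      hence "2 ^ r1 \<le> exp (a7 * \<Lambda> ^ 24)" by simp
      hence "real r1 \<le> 2 * (a7 * \<Lambda> ^ 24)" by (rule le_exp_of_power)
      moreover have "a7 * \<Lambda> ^ 24 \<le> a7 * \<Lambda> ^ 80" using a7' pw[of 24] by (intro mult_left_mono) auto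
      ultimately have R1: "real r1 \<le> 2 * (a7 * \<Lambda> ^ 80)" by linarith
      \<comment> \<open>The codimension of \<open>W\<close> is what requires the exponent 80; the
        other two contributions have exponents 24 and 4.\<close>
      have "log_inv (\<theta> / 4) ^ 4 \<le> (a5 * \<Lambda> ^ 20) ^ 4" using bds(4) l0 by (intro power_mono) auto
      hence "C1 * log_inv (\<theta> / 4) ^ 4 \<le> C1 * (a5 ^ 4 * \<Lambda> ^ 80)"
        using C1 by (intro mult_left_mono) (auto simp: power_mult_distrib simp flip: power_mult)
      hence R2: "real r2 \<le> C1 * (a5 ^ 4 * \<Lambda> ^ 80)" using r2 by linarith
      have "real r3 \<le> 16 * real D" using r3 by linarith
      moreover have "a1 * \<Lambda> ^ 4 \<le> a1 * \<Lambda> ^ 80" using a1' pw[of 4] by (intro mult_left_mono) auto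
      ultimately have R3: "real r3 \<le> 16 * (a1 * \<Lambda> ^ 80)" using bds(3) by linarith
      have "real (r1 + r2 + r3) \<le> b * \<Lambda> ^ 80"
        using R1 R2 R3 by (simp add: b_def distrib_right mult.assoc)
      also have "\<dots> = b * 2 ^ 80 * log_inv \<alpha> ^ 80" by (simp add: \<Lambda>_def power_mult_distrib)
      also have "\<dots> \<le> C * log_inv \<alpha> ^ 80" using C8(2) l0 by (intro mult_right_mono) auto
      finally show ?thesis .
    qed
    show "\<exists>D K \<beta> c \<theta> \<rho>. (\<forall>r::nat. real r \<le> C1 * log_inv (\<alpha> / 2) ^ 4 \<longrightarrow> p ^ r \<le> 2 ^ D) \<and>
     \<beta> = (\<alpha> / 2) ^ 16 / 2 \<and> c = (\<beta> / (16 * (2 ^ D) ^ 16))\<^sup>2 / 2 \<and>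
     real D / exp (- C2 * log_inv c ^ 4) \<le> real (K::nat) \<and>
     \<theta> = \<beta> / (real K + 1) ^ (16 * D) \<and> \<rho> = (\<theta> / 4) ^ 8 / (128 * real p ^ (256 * D)) \<and>
     exp (- C * log_inv \<alpha> ^ 20) \<le> ((\<alpha> / 2) ^ 4 / 8) ^ 128 / (2 ^ D) ^ 192 * ((\<theta> / 4) ^ 16 / 128) \<and>
     (\<forall>r1 r2 r3 h. 2 ^ r1 \<le> h \<longrightarrow> real h * \<rho> ^ (16 * D * p) \<le> real p ^ (16 * D) \<longrightarrow>
        real r2 \<le> C1 * log_inv (\<theta> / 4) ^ 4 \<longrightarrow> r3 \<le> 16 * D \<longrightarrow>
        real (r1 + r2 + r3) \<le> C * log_inv \<alpha> ^ 80)"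
    proof (rule exI[of _ D], rule exI[of _ K], rule exI[of _ \<beta>], rule exI[of _ c], rule exI[of _ \<theta>],
        rule exI[of _ \<rho>], intro conjI allI impI)
      show "p ^ r \<le> 2 ^ D" if "real r \<le> C1 * log_inv (\<alpha> / 2) ^ 4" for r by (rule bds(1)[OF that])
      show "real (r1 + r2 + r3) \<le> C * log_inv \<alpha> ^ 80"
        if "2 ^ r1 \<le> h" "real h * \<rho> ^ (16 * D * p) \<le> real p ^ (16 * D)"
          "real r2 \<le> C1 * log_inv (\<theta> / 4) ^ 4" "r3 \<le> 16 * D" for r1 r2 r3 h :: nat
        by (rule dims[OF that])
    qed (fact \<beta>_def c_def bds(2) \<theta>_def \<rho>_def \<kappa>)+
  qed
qed

subsection \<open>Transfer to coordinate vectors\<close>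

lemma emb_eq_iff: "u \<in> carrier_vec n \<Longrightarrow> v \<in> carrier_vec n \<Longrightarrow> emb n u = emb n v \<longleftrightarrow> u = v"
  using bij_emb by (metis bij_betw_def inj_on_eq_iff)

lemma inj_on_map_prod_emb: "inj_on (map_prod (emb n) (emb n)) (carrier_vec n \<times> carrier_vec n)"
  by (intro inj_onI) (auto simp: emb_eq_iff)

text \<open>\<open>emb\<close> is additive and maps the coordinate vectors bijectively onto
  \<open>supp n\<close>, so each step of the recursion is a reindexed sum.\<close>

lemma rep_count_emb:
  fixes A :: "('p::prime_card fvec \<times> 'p fvec) set"
  assumes A: "A \<subseteq> carrier_vec n \<times> carrier_vec n"
    and "x \<in> carrier_vec n" "y \<in> carrier_vec n"
  shows "real (rep_count n w A x y)
    = foldr (\<lambda>l. case l of Hor \<Rightarrow> fin_space.hor (supp n) | Ver \<Rightarrow> fin_space.ver (supp n)) w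
        (\<lambda>x u. of_bool ((x, u) \<in> map_prod (emb n) (emb n) ` A)) (emb n x) (emb n y)"
  using assms(2,3)
proof (induction w arbitrary: x y)
  case Nil
  have "map_prod (emb n) (emb n) (x, y) \<in> map_prod (emb n) (emb n) ` A \<longleftrightarrow> (x, y) \<in> A"
    using Nil A by (intro inj_on_image_mem_iff[OF inj_on_map_prod_emb]) auto
  thus ?case by simp
next
  case (Cons l w)
  interpret F: fin_space "fscale :: 'p mod_ring \<Rightarrow> _" "supp n" "fdot n" by (rule fin_space_supp)
  define N where "N = foldr (\<lambda>l. case l of Hor \<Rightarrow> F.hor | Ver \<Rightarrow> F.ver) w
        (\<lambda>x u. of_bool ((x, u) \<in> map_prod (emb n) (emb n) ` A))"
  have IH: "real (rep_count n w A x y) = N (emb n x) (emb n y)"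
    if "x \<in> carrier_vec n" "y \<in> carrier_vec n" for x y
    using Cons.IH[OF that] by (simp add: N_def)
  show ?case
  proof (cases l)
    case Hor
    have "real (rep_count n (Hor # w) A x y)
      = (\<Sum>x1\<in>carrier_vec n. N (emb n x + emb n x1) (emb n y) * N (emb n x1) (emb n y))"
      using Cons.prems by (simp add: IH emb_add)
    also have "\<dots> = F.hor N (emb n x) (emb n y)"
      unfolding F.hor_def by (rule sum.reindex_bij_betw[OF bij_emb])
    finally show ?thesis by (simp add: Hor N_def)
  next
    case Ver
    have "real (rep_count n (Ver # w) A x y)
      = (\<Sum>y1\<in>carrier_vec n. N (emb n x) (emb n y + emb n y1) * N (emb n x) (emb n y1))"
      using Cons.prems by (simp add: IH emb_add)
    also have "\<dots> = F.ver N (emb n x) (emb n y)"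
      unfolding F.ver_def by (rule sum.reindex_bij_betw[OF bij_emb])
    finally show ?thesis by (simp add: Ver N_def)
  qed
qed

lemma bilinear_form_emb:
  fixes l :: "(nat \<Rightarrow> 'p::prime_card mod_ring) \<Rightarrow> nat \<Rightarrow> 'p mod_ring"
  assumes "Vector_Spaces.linear fscale fscale l"
  shows "bilinear_form n (\<lambda>x y. fdot n (l (emb n y)) (emb n x))"
proof -
  interpret F: fin_space "fscale :: 'p mod_ring \<Rightarrow> _" "supp n" "fdot n" by (rule fin_space_supp)
  interpret l: Vector_Spaces.linear "fscale :: 'p mod_ring \<Rightarrow> _" fscale l by fact
  show ?thesis
    by (simp add: bilinear_form_def emb_add emb_smult l.add l.scale F.pr_add_left F.pr_add_right
        F.pr_scale_left F.pr_scale_right)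
qed

theorem theorem1p5:
  shows "\<exists>C::real. C > 0 \<and>
    (\<forall>(n::nat) (A :: ('p::prime_card fvec \<times> 'p fvec) set) (\<alpha>::real) (w :: letter list) (\<epsilon>::real).
       A \<subseteq> carrier_vec n \<times> carrier_vec n \<and> density n A = \<alpha> \<and> \<alpha> > 0 \<and>
       w = [Hor, Ver, Ver, Hor, Ver, Ver, Ver, Hor, Hor] \<and>
       \<epsilon> = exp (- C * log_inv \<alpha> ^ 20) \<longrightarrow>
       (\<exists>B r. bilinear_variety n r B \<and> B \<subseteq> popular n \<epsilon> w A \<and>
          real r \<le> C * log_inv \<alpha> ^ 80))"
proof -
  have p: "2 \<le> CARD('p)" using prime_card[where 'a='p] by (rule prime_ge_2_nat)
  obtain C1 where C1: "br_const C1" using ex_br_const by blast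
  obtain C2 where C2: "aff_const CARD('p) C2" using ex_aff_const[OF p] by blast
  have "0 \<le> C1" "0 \<le> C2" using C1 C2 by (auto simp: br_const_def aff_const_def)
  then obtain C where C: "C > 0" and params: "\<And>\<alpha>. 0 < \<alpha> \<Longrightarrow>
     \<exists>D K \<beta> c \<theta> \<rho>. (\<forall>r::nat. real r \<le> C1 * log_inv (\<alpha> / 2) ^ 4 \<longrightarrow> CARD('p) ^ r \<le> 2 ^ D) \<and>
     \<beta> = (\<alpha> / 2) ^ 16 / 2 \<and> c = (\<beta> / (16 * (2 ^ D) ^ 16))\<^sup>2 / 2 \<and>
     real D / exp (- C2 * log_inv c ^ 4) \<le> real (K::nat) \<and>
     \<theta> = \<beta> / (real K + 1) ^ (16 * D) \<and> \<rho> = (\<theta> / 4) ^ 8 / (128 * real CARD('p) ^ (256 * D)) \<and>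
     exp (- C * log_inv \<alpha> ^ 20) \<le> ((\<alpha> / 2) ^ 4 / 8) ^ 128 / (2 ^ D) ^ 192 * ((\<theta> / 4) ^ 16 / 128) \<and>
     (\<forall>r1 r2 r3 h. 2 ^ r1 \<le> h \<longrightarrow> real h * \<rho> ^ (16 * D * CARD('p)) \<le> real CARD('p) ^ (16 * D) \<longrightarrow>
        real r2 \<le> C1 * log_inv (\<theta> / 4) ^ 4 \<longrightarrow> r3 \<le> 16 * D \<longrightarrow>
        real (r1 + r2 + r3) \<le> C * log_inv \<alpha> ^ 80)"
    using ex_parameters[OF _ _ p, of C1 C2] by blast
  have main: "\<exists>B r. bilinear_variety n r B \<and>
      B \<subseteq> popular n (exp (- C * log_inv \<alpha> ^ 20)) [Hor, Ver, Ver, Hor, Ver, Ver, Ver, Hor, Hor] A \<and>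
      real r \<le> C * log_inv \<alpha> ^ 80"
    if A: "A \<subseteq> carrier_vec n \<times> carrier_vec n" and dA: "density n A = \<alpha>" and \<alpha>: "\<alpha> > 0"
    for n \<alpha> and A :: "('p fvec \<times> 'p fvec) set"
  proof -
    let ?cv = "carrier_vec n :: 'p fvec set" and ?G = "supp n :: (nat \<Rightarrow> 'p mod_ring) set"
    interpret F: fin_space "fscale :: 'p mod_ring \<Rightarrow> _" ?G "fdot n" by (rule fin_space_supp)
    define A' where "A' = map_prod (emb n) (emb n) ` A"
    have A'G: "A' \<subseteq> ?G \<times> ?G"
      unfolding A'_def
    proof (rule image_subsetI)
      fix z assume "z \<in> A"
      hence "z \<in> ?cv \<times> ?cv" using A by blast
      thus "map_prod (emb n) (emb n) z \<in> ?G \<times> ?G" by (cases z) (simp add: emb_supp)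
    qed
    have "card A' = card A"
      unfolding A'_def by (rule card_image[OF inj_on_subset[OF inj_on_map_prod_emb A]])
    moreover have "real (card A) = \<alpha> * (real (card ?cv))\<^sup>2"
      using dA by (auto simp: density_def card_cartesian_product power2_eq_square card_carrier_mod_ring_vec)
    ultimately have cA': "\<alpha> * (real (card ?G))\<^sup>2 \<le> real (card A')"
      by (simp add: card_supp card_carrier_mod_ring_vec)
    obtain D K \<beta> c \<theta> \<rho> where par1: "\<forall>r::nat. real r \<le> C1 * log_inv (\<alpha> / 2) ^ 4 \<longrightarrow> CARD('p) ^ r \<le> 2 ^ D"
      and par: "\<beta> = (\<alpha> / 2) ^ 16 / 2" "c = (\<beta> / (16 * (2 ^ D) ^ 16))\<^sup>2 / 2"
      "real D / exp (- C2 * log_inv c ^ 4) \<le> real (K::nat)"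
      "\<theta> = \<beta> / (real K + 1) ^ (16 * D)" "\<rho> = (\<theta> / 4) ^ 8 / (128 * real CARD('p) ^ (256 * D))"
      and \<kappa>: "exp (- C * log_inv \<alpha> ^ 20) \<le> ((\<alpha> / 2) ^ 4 / 8) ^ 128 / (2 ^ D) ^ 192 * ((\<theta> / 4) ^ 16 / 128)"
      and dims: "\<forall>r1 r2 r3 h. 2 ^ r1 \<le> h \<longrightarrow> real h * \<rho> ^ (16 * D * CARD('p)) \<le> real CARD('p) ^ (16 * D) \<longrightarrow>
        real r2 \<le> C1 * log_inv (\<theta> / 4) ^ 4 \<longrightarrow> r3 \<le> 16 * D \<longrightarrow>
        real (r1 + r2 + r3) \<le> C * log_inv \<alpha> ^ 80"
      using params[OF \<alpha>] by (elim exE conjE) (rule that)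
    obtain J :: "nat set" and ls H W r where J: "finite J" "card J \<le> 16 * D"
      and ls: "\<And>i. i \<in> J \<Longrightarrow> F.lin (ls i)"
      and H: "F.V.subspace H" "H \<subseteq> ?G"
        "real (card H) * \<rho> ^ (16 * D * CARD('p)) \<le> real CARD('p) ^ (16 * D)"
      and cW: "card ?G \<le> CARD('p) ^ r * card W" and W: "F.V.subspace W" "W \<subseteq> ?G"
      and r: "real r \<le> C1 * log_inv (\<theta> / 4) ^ 4"
      and pop: "\<And>x y. y \<in> W \<Longrightarrow> x \<in> F.perp H \<Longrightarrow> \<forall>i\<in>J. fdot n (ls i y) x = 0 \<Longrightarrow>
         ((\<alpha> / 2) ^ 4 / 8) ^ 128 / (2 ^ D) ^ 192 * ((\<theta> / 4) ^ 16 / 128) * real (card ?G) ^ 511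
         \<le> F.hor ((F.ver ^^ 2) (F.hor ((F.ver ^^ 3) (F.hor (F.hor (\<lambda>x u. of_bool ((x, u) \<in> A'))))))) x y"
    proof (rule F.popular_bilinear_structure[OF C1 C2 A'G \<alpha> cA' _ par])
      show "CARD('p) ^ r \<le> 2 ^ D" if "real r \<le> C1 * log_inv (\<alpha> / 2) ^ 4" for r using par1 that by blast
    qed (rule that)
    obtain r1 where r1: "subspace_of_codim n {v \<in> ?cv. emb n v \<in> F.perp H} r1"
      "card (F.perp H) * CARD('p) ^ r1 = CARD('p) ^ n"
      by (rule pullback_subspace[OF F.subspace_perp F.perp_subset])
    obtain r2 where r2: "subspace_of_codim n {v \<in> ?cv. emb n v \<in> W} r2" "card W * CARD('p) ^ r2 = CARD('p) ^ n"
      by (rule pullback_subspace[OF W(1,2)])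
    have p0: "0 < CARD('p) ^ n" by simp
    \<comment> \<open>The codimension of the annihilator is the dimension of \<open>H\<close>, so
      the bound on \<open>card H\<close> becomes a bound on \<open>r1\<close>.\<close>
    have "card H * card (F.perp H) = card (F.perp H) * CARD('p) ^ r1"
      using F.card_perp[OF H(1,2)] r1(2) by (simp add: card_supp)
    moreover have "card (F.perp H) > 0" using r1(2) p0 by (cases "card (F.perp H) = 0") auto
    ultimately have "card H = CARD('p) ^ r1" by (metis mult.commute nat_mult_eq_cancel1)
    hence hr1: "2 ^ r1 \<le> card H" using p by (simp add: power_mono)
    \<comment> \<open>\<open>r\<close> only bounds the codimension of \<open>W\<close> from above;
      the exact one is \<open>r2\<close>.\<close>
    have "card W * CARD('p) ^ r2 \<le> card W * CARD('p) ^ r"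
      using cW r2(2) by (simp add: card_supp mult.commute)
    moreover have "card W > 0" using r2(2) p0 by (cases "card W = 0") auto
    ultimately have "CARD('p) ^ r2 \<le> CARD('p) ^ r" by (metis nat_mult_le_cancel1)
    hence "r2 \<le> r" using p by (simp add: power_increasing_iff)
    hence hr2: "real r2 \<le> C1 * log_inv (\<theta> / 4) ^ 4" using r by linarith
    \<comment> \<open>The forms of a bilinear variety are indexed by an initial segment, whereas
      \<open>J\<close> is an arbitrary finite set.\<close>
    obtain e where e: "bij_betw e {..<card J} J"
      using ex_bij_betw_nat_finite[OF J(1)] by (auto simp: atLeast0LessThan)
    define b where "b i = (\<lambda>x y. fdot n (ls (e i) (emb n y)) (emb n x))" for i
    let ?B = "{(x, y) \<in> {v \<in> ?cv. emb n v \<in> F.perp H} \<times> {v \<in> ?cv. emb n v \<in> W}. \<forall>i<card J. b i x y = 0}"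
    have "\<forall>i<card J. bilinear_form n (b i)"
      unfolding b_def using e by (intro allI impI bilinear_form_emb ls) (auto simp: bij_betw_def)
    hence "bilinear_variety n (r1 + r2 + card J) ?B"
      unfolding bilinear_variety_def using r1(1) r2(1) by blast
    moreover have "?B \<subseteq> popular n (exp (- C * log_inv \<alpha> ^ 20)) [Hor, Ver, Ver, Hor, Ver, Ver, Ver, Hor, Hor] A"
    proof clarify
      fix x y assume x: "x \<in> ?cv" "emb n x \<in> F.perp H" and y: "y \<in> ?cv" "emb n y \<in> W"
        and xy: "\<forall>i<card J. b i x y = 0"
      have z: "fdot n (ls i (emb n y)) (emb n x) = 0" if "i \<in> J" for i
        using that e xy by (force simp: bij_betw_def b_def)
      \<comment> \<open>For the nine letters of the word the normalising exponent is
        \<open>2 ^ 9 - 1 = 511\<close>.\<close>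
      have "exp (- C * log_inv \<alpha> ^ 20) * real (card ?cv) ^ 511
        \<le> ((\<alpha> / 2) ^ 4 / 8) ^ 128 / (2 ^ D) ^ 192 * ((\<theta> / 4) ^ 16 / 128) * real (card ?G) ^ 511"
        using mult_right_mono[OF \<kappa>, of "real (card ?G) ^ 511"] by (simp add: card_supp card_carrier_mod_ring_vec)
      also have "\<dots> \<le> F.hor ((F.ver ^^ 2) (F.hor ((F.ver ^^ 3) (F.hor (F.hor (\<lambda>x u. of_bool ((x, u) \<in> A'))))))) (emb n x) (emb n y)"
        using pop[OF y(2) x(2)] z by blast
      also have "\<dots> = real (rep_count n [Hor, Ver, Ver, Hor, Ver, Ver, Ver, Hor, Hor] A x y)"
        unfolding rep_count_emb[OF A x(1) y(1)] A'_def by (simp add: eval_nat_numeral)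
      finally show "(x, y) \<in> popular n (exp (- C * log_inv \<alpha> ^ 20)) [Hor, Ver, Ver, Hor, Ver, Ver, Ver, Hor, Hor] A"
        using x(1) y(1) by (simp add: popular_def del: rep_count.simps)
    qed
    moreover have "real (r1 + r2 + card J) \<le> C * log_inv \<alpha> ^ 80"
      by (rule dims[rule_format, OF hr1 H(3) hr2 J(2)])
    ultimately show ?thesis by blast
  qed
  show ?thesis using C main by blast
qed

end
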